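(* Let $n$ be a positive integer and let $\mu,g,f$ satisfy the structural assumptions $(S)$. Let $u$ be $C^2_{\rm loc}$ in the interior of $\mathbb{R}^{n+1}_+$, and assume that $u$ is a bounded and stable weak solution of $$\begin{cases} -{\rm div}\,(\mu(x)\nabla u)+g(x,u)=0 & \text{on } \mathbb{R}^{n+1}_+,\\ -\mu(x)u_x=f(u) & \text{on } \partial\mathbb{R}^{n+1}_+,\end{cases}$$ with $|\nabla_y u|\in L^\infty(\overline{B_r^+})$ for all $r>0$. Assume furthermore that there exists $C_o\ge 1$ such that $$\int_{B_R^+}\mu(x)|\nabla u|^2\le C_o\,R^2\qquad\text{for any }R\ge C_o .$$ Then there exist $\omega\in{\rm S}^{n-1}$ and $u_o:\mathbb{R}\times(0,+\infty)\to\mathbb{R}$ such that $$u(y,x)=u_o(\omega\cdot y,x)\qquad\text{for any }(y,x)\in\mathbb{R}^{n+1}_+ .$$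
   Context: Notation. Points of $\mathbb{R}^{n+1}_+:=\mathbb{R}^n\times(0,+\infty)$ are written $(y,x)$ with $y\in\mathbb{R}^n$, $x>0$; $\partial\mathbb{R}^{n+1}_+=\mathbb{R}^n\times\{0\}$. $\nabla$ is the full gradient in $(y,x)$, $\nabla_y$ the gradient in $y$, $u_x=\partial_x u$. $B_R$ is the ball of radius $R$ centered at $0$ in $\mathbb{R}^{n+1}$ and $B_R^+:=B_R\cap\mathbb{R}^{n+1}_+$. ${\rm S}^{n-1}$ is the unit sphere of $\mathbb{R}^n$. Structural assumptions $(S)$ on $\mu:(0,+\infty)\to\mathbb{R}$, $g:(0,+\infty)\times\mathbb{R}\to\mathbb{R}$, $f:\mathbb{R}\to\mathbb{R}$: (i) $\mu\in L^1((0,r))$ for any $r>0$, and for every $K\Subset\mathbb{R}^{n+1}_+$ there are $\mu_1,\mu_2>0$, possibly depending on $K$, with $\mu_1\le\mu(x)\le\mu_2$ for all $(y,x)\in K$. (ii) $\mu$ is an $A_2$-Muckenhoupt weight: there exists $\kappa>0$ such that $\int_a^b\mu(x)\,dx\int_a^b\frac{1}{\mu(x)}\,dx\le\kappa(b-a)^2$ for any $b\ge a\ge 0$. (iii) The map $x\mapsto g(x,0)$ belongs to $L^\infty((0,r))$ for any $r>0$; for any $x>0$ the map $u\mapsto g(x,u)$ is locally Lipschitz; and for any $R,M>0$ there exists $C>0$, possibly depending on $R$ and $M$, such that $\sup_{0<x<R,\,|u|<M}|g_u(x,u)|\le C$. (iv) $f$ is locally Lipschitz in $\mathbb{R}$.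 Here $g_u=\partial g/\partial u$ and $f'$ are the derivatives of these locally Lipschitz functions (existing almost everywhere). Admissible test functions: for some $R>0$, $\xi$ is a real function on $\mathbb{R}^{n+1}_+$ that is bounded, locally Lipschitz in the interior of $\mathbb{R}^{n+1}_+$, vanishes on $\mathbb{R}^{n+1}_+\setminus B_R$, and satisfies $\mu(x)|\nabla\xi|^2\in L^1(B_R^+)$. Weak solution: $u\in L^\infty_{\rm loc}(\overline{\mathbb{R}^{n+1}_+})$, $\mu(x)|\nabla u|^2\in L^1(B_R^+)$ for any $R>0$, and $$\int_{\mathbb{R}^{n+1}_+}\mu(x)\nabla u\cdot\nabla\xi+\int_{\mathbb{R}^{n+1}_+}g(x,u)\,\xi=\int_{\partial\mathbb{R}^{n+1}_+}f(u)\,\xi$$ for every admissible $\xi$. Stable: for every admissible $\xi$ (vanishing outside $B_R$), $$\int_{B_R^+}\mu(x)|\nabla\xi|^2+\int_{B_R^+}g_u(x,u)\xi^2-\int_{B_R\cap\partial\mathbb{R}^{n+1}_+}f'(u)\xi^2\ge 0 .$$ *)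

theory Defs
  imports "HOL-Analysis.Analysis"
begin

text \<open>
  A point \<open>(y, x)\<close> of the half-space has \<open>y\<close> in \<^typ>\<open>real ^ 'n\<close> and \<open>x > 0\<close>; the norm of the product
  type is the Euclidean one. All integrals are Lebesgue integrals with respect to
  \<^const>\<open>lebesgue\<close>. Since the Bochner integral of a non-integrable function is \<open>0\<close>, every
  relation between integrals below is accompanied by the integrability of its integrands, so that
  the integrals have their usual meaning.
\<close>

definition upper_half :: "((real ^ 'n) \<times> real) set" where
  "upper_half = {p. snd p > 0}"

definition half_ball :: "real \<Rightarrow> ((real ^ 'n) \<times> real) set" where
  "half_ball R = ball 0 R \<inter> upper_half"

text \<open>
  The classical gradient; its value where the function is not differentiable is irrelevant, because
  it is applied only to functions that are locally Lipschitz on an open set, hence differentiable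
  almost everywhere there (and whose weak gradient is the classical one).
\<close>

definition grad :: "('a::real_inner \<Rightarrow> real) \<Rightarrow> 'a \<Rightarrow> 'a" where
  "grad v p = (THE D. GDERIV v p :> D)"

lemma grad_eq:
  assumes "GDERIV v p :> D"
  shows "grad v p = D"
  unfolding grad_def
proof (rule the_equality)
  fix D' assume "GDERIV v p :> D'"
  then have "(\<lambda>h. h \<bullet> D') = (\<lambda>h. h \<bullet> D)"
    using assms has_derivative_unique unfolding gderiv_def by blast
  then have "\<And>h. h \<bullet> (D' - D) = 0"
    by (metis inner_diff_right right_minus_eq)
  then show "D' = D"
    by (metis inner_eq_zero_iff right_minus_eq)
qed (rule assms)

definition grad_y :: "((real ^ 'n) \<times> real \<Rightarrow> real) \<Rightarrow> (real ^ 'n) \<times> real \<Rightarrow> real ^ 'n" where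
  "grad_y v p = fst (grad v p)"

definition C2_on :: "('a::euclidean_space) set \<Rightarrow> ('a \<Rightarrow> real) \<Rightarrow> bool" where
  "C2_on S v \<longleftrightarrow>
    (\<exists>(D1 :: 'a \<Rightarrow> 'a) (D2 :: 'a \<Rightarrow> 'a \<Rightarrow>\<^sub>L 'a).
      (\<forall>p\<in>S. (GDERIV v p :> D1 p) \<and> (D1 has_derivative blinfun_apply (D2 p)) (at p)) \<and>
      continuous_on S D2)"

definition locally_lipschitz_on :: "('a::metric_space) set \<Rightarrow> ('a \<Rightarrow> real) \<Rightarrow> bool" where
  "locally_lipschitz_on S h \<longleftrightarrow>
    (\<forall>p\<in>S. \<exists>r>0. \<exists>L. L-lipschitz_on (cball p r \<inter> S) h)"

definition Linfty_on :: "('a::euclidean_space) set \<Rightarrow> ('a \<Rightarrow> real) \<Rightarrow> bool" where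
  "Linfty_on S h \<longleftrightarrow>
    h \<in> borel_measurable (lebesgue_on S) \<and> (\<exists>C. AE p in lebesgue_on S. \<bar>h p\<bar> \<le> C)"

text \<open>
  The boundary value on \<open>x = 0\<close>, taken as the limit along the normal. If \<open>\<mu>\<close> is a Muckenhoupt weight
  and \<open>\<mu> |\<nabla>v|\<^sup>2\<close> is integrable on half-balls, then \<open>1/\<mu>\<close> is integrable near \<open>0\<close>, so \<open>v\<^sub>x(y, \<cdot>)\<close> is
  integrable near \<open>0\<close> for almost every \<open>y\<close> by the Cauchy--Schwarz inequality, and the limit exists
  for these \<open>y\<close>.
\<close>

definition bdry :: "((real ^ 'n) \<times> real \<Rightarrow> real) \<Rightarrow> real ^ 'n \<Rightarrow> real" where
  "bdry v y = Lim (at_right 0) (\<lambda>x. v (y, x))"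

text \<open>
  The type argument supplies the dimension of the half-space containing the sets \<open>K\<close>. The integrals
  in the Muckenhoupt condition are extended-real integrals of the positive functions \<open>\<mu>\<close> and \<open>1/\<mu>\<close>.
  As \<open>g\<^sub>u\<close> exists only almost everywhere, its bound is imposed wherever the derivative exists.
\<close>

definition structural ::
    "'n::finite itself \<Rightarrow> (real \<Rightarrow> real) \<Rightarrow> (real \<Rightarrow> real \<Rightarrow> real) \<Rightarrow> (real \<Rightarrow> real) \<Rightarrow> bool" where
  "structural TYPE('n) \<mu> g f \<longleftrightarrow>
    (\<forall>r>0. \<mu> absolutely_integrable_on {0<..<r}) \<and>
    (\<forall>K :: ((real ^ 'n) \<times> real) set. compact (closure K) \<and> closure K \<subseteq> upper_half \<longrightarrow>
      (\<exists>\<mu>1>0. \<exists>\<mu>2>0. \<forall>(y, x)\<in>K. \<mu>1 \<le> \<mu> x \<and> \<mu> x \<le> \<mu>2)) \<and>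
    (\<exists>\<kappa>>0. \<forall>a b. 0 \<le> a \<and> a \<le> b \<longrightarrow>
      (\<integral>\<^sup>+x\<in>{a<..<b}. ennreal (\<mu> x) \<partial>lebesgue) * (\<integral>\<^sup>+x\<in>{a<..<b}. ennreal (1 / \<mu> x) \<partial>lebesgue)
        \<le> ennreal (\<kappa> * (b - a)\<^sup>2)) \<and>
    (\<forall>r>0. Linfty_on {0<..<r} (\<lambda>x. g x 0)) \<and>
    (\<forall>x>0. locally_lipschitz_on UNIV (g x)) \<and>
    (\<forall>R>0. \<forall>M>0. \<exists>C>0. \<forall>x t D. 0 < x \<and> x < R \<and> \<bar>t\<bar> < M \<and>
      (g x has_real_derivative D) (at t) \<longrightarrow> \<bar>D\<bar> \<le> C) \<and>
    locally_lipschitz_on UNIV f"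

definition admissible :: "(real \<Rightarrow> real) \<Rightarrow> real \<Rightarrow> ((real ^ 'n) \<times> real \<Rightarrow> real) \<Rightarrow> bool" where
  "admissible \<mu> R \<xi> \<longleftrightarrow>
    R > 0 \<and>
    bounded (\<xi> ` upper_half) \<and>
    locally_lipschitz_on upper_half \<xi> \<and>
    (\<forall>p \<in> upper_half - ball 0 R. \<xi> p = 0) \<and>
    (\<lambda>p. \<mu> (snd p) * (norm (grad \<xi> p))\<^sup>2) absolutely_integrable_on half_ball R"

text \<open>To be used for \<open>u\<close> differentiable in the half-space, as \<open>\<nabla>u\<close> is the classical gradient.\<close>

definition weak_solution ::
    "(real \<Rightarrow> real) \<Rightarrow> (real \<Rightarrow> real \<Rightarrow> real) \<Rightarrow> (real \<Rightarrow> real)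
      \<Rightarrow> ((real ^ 'n) \<times> real \<Rightarrow> real) \<Rightarrow> bool" where
  "weak_solution \<mu> g f u \<longleftrightarrow>
    (\<forall>R>0. Linfty_on (half_ball R) u) \<and>
    (\<forall>R>0. (\<lambda>p. \<mu> (snd p) * (norm (grad u p))\<^sup>2) absolutely_integrable_on half_ball R) \<and>
    (\<forall>R \<xi>. admissible \<mu> R \<xi> \<longrightarrow>
      (\<lambda>p. \<mu> (snd p) * (grad u p \<bullet> grad \<xi> p)) absolutely_integrable_on upper_half \<and>
      (\<lambda>p. g (snd p) (u p) * \<xi> p) absolutely_integrable_on upper_half \<and>
      (\<lambda>y. f (bdry u y) * bdry \<xi> y) absolutely_integrable_on UNIV \<and>
      (LINT p:upper_half|lebesgue. \<mu> (snd p) * (grad u p \<bullet> grad \<xi> p))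
        + (LINT p:upper_half|lebesgue. g (snd p) (u p) * \<xi> p)
        = (LINT y|lebesgue. f (bdry u y) * bdry \<xi> y))"

text \<open>Here \<open>g\<^sub>u\<close> and \<open>f'\<close> are functions representing the almost everywhere defined derivatives.\<close>

definition stable_solution ::
    "(real \<Rightarrow> real) \<Rightarrow> (real \<Rightarrow> real \<Rightarrow> real) \<Rightarrow> (real \<Rightarrow> real)
      \<Rightarrow> ((real ^ 'n) \<times> real \<Rightarrow> real) \<Rightarrow> bool" where
  "stable_solution \<mu> g\<^sub>u f' u \<longleftrightarrow>
    (\<forall>R \<xi>. admissible \<mu> R \<xi> \<longrightarrow>
      (\<lambda>p. g\<^sub>u (snd p) (u p) * (\<xi> p)\<^sup>2) absolutely_integrable_on half_ball R \<and>
      (\<lambda>y. f' (bdry u y) * (bdry \<xi> y)\<^sup>2) absolutely_integrable_on ball 0 R \<and>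
      (LINT p:half_ball R|lebesgue. \<mu> (snd p) * (norm (grad \<xi> p))\<^sup>2)
        + (LINT p:half_ball R|lebesgue. g\<^sub>u (snd p) (u p) * (\<xi> p)\<^sup>2)
        - (LINT y:ball 0 R|lebesgue. f' (bdry u y) * (bdry \<xi> y)\<^sup>2) \<ge> 0)"

end

theory Submission
  imports Defs
begin

text \<open>
  Put \<open>F = \<nabla>\<^sub>y u\<close>. Test the equation with the difference quotients \<open>v\<^sub>b\<close> of \<open>u\<close> in the directions \<open>y\<^sub>b\<close>,
  multiplied by \<open>\<phi>\<^sup>2\<close>, and the stability inequality with \<open>\<phi> |v| + \<tau> \<psi>\<close>, where \<open>\<phi> = 1\<close> on the support
  of \<open>\<psi>\<close>. In the limit the difference of the two bounds \<open>\<integral> \<mu> \<phi>\<^sup>2 (\<Sum>\<^sub>b |\<nabla>F\<^sub>b|\<^sup>2 - |\<nabla>|F||\<^sup>2)\<close> by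
  \<open>\<integral> \<mu> |F|\<^sup>2 |\<nabla>\<phi>|\<^sup>2\<close> plus a quadratic polynomial in \<open>\<tau>\<close> that vanishes at \<open>\<tau> = 0\<close>; the first integral tends
  to \<open>0\<close> along logarithmic cutoffs because the energy grows at most quadratically.

  The choice \<open>\<psi> = 0\<close> shows that \<open>\<nabla>F\<^sub>b\<close> is \<open>F\<^sub>b\<close> times a common vector wherever \<open>F \<noteq> 0\<close>, so that the direction
  of \<open>F\<close> is locally constant there. It is constant in the half-space unless \<open>F\<close> vanishes on a slice \<open>x = x\<^sub>0\<close>.
  The linear term in \<open>\<tau>\<close> shows that \<open>|F|\<close> is a weak supersolution of the linearised equation. Averaging \<open>|F|\<close>
  over slices with a weight \<open>\<rho>\<close> such that \<open>\<Delta>\<rho> \<ge> - C \<rho>\<close>, and testing with a tent in \<open>x\<close> that is piecewise affine in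
  \<open>\<integral> 1/\<mu>\<close>, turns this into a one-dimensional strong maximum principle: if \<open>F\<close> vanishes on one slice, it
  vanishes everywhere.
\<close>

section \<open>Difference quotients of Lipschitz functions\<close>

text \<open>The equation cannot be differentiated: \<open>f\<close> and \<open>g x\<close> are only
  Lipschitz and \<open>\<mu>\<close> need not be continuous. Hence the difference quotients, with
  |v| replaced by sqrt(|v|^2 + h^2). The delicate terms are those of order zero:
  \<open>g\<^sub>u\<close> and \<open>f'\<close> are arbitrary on a null set of values, and u may
  take such values on a set of positive measure. There, however, the difference quotients tend to 0
  almost everywhere, so that the terms of stability and of the equation still cancel in the limit.
  No weak gradient of |F| is constructed. Derivatives are moved onto the test function while |v| is
  still regularized: \<open>\<rho>\<close> is C^2 in y, and the tent is affine in the integral of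
  1/\<open>\<mu>\<close> because \<open>\<mu>\<close> times its slope is then piecewise constant, so
  that integration by parts in x leaves only the averages at three heights. The geometric argument
  loses the direction of F only at a height where F vanishes identically. Therefore a maximum
  principle for slice averages is enough, and no Harnack inequality or unique continuation for the
  weighted operator enters.\<close>

lemma lmeasurable_outer_open':
  fixes S :: "'a::euclidean_space set"
  assumes S: "S \<in> lmeasurable" and e: "0 < e"
  obtains U where "open U" "S \<subseteq> U" "U \<in> lmeasurable" "measure lebesgue U < measure lebesgue S + e"
proof -
  obtain U where U: "open U" "S \<subseteq> U" "U - S \<in> lmeasurable" "emeasure lebesgue (U - S) < ennreal e"
    using sets_lebesgue_outer_open[OF fmeasurableD[OF S] e] by blast
  have eq: "U = S \<union> (U - S)" using U(2) by auto
  have "U \<in> lmeasurable" by (subst eq) (rule fmeasurable.Un[OF S U(3)])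
  moreover have "measure lebesgue U = measure lebesgue S + measure lebesgue (U - S)"
    using measure_Un3[OF S U(3)] eq by simp
  moreover have "measure lebesgue (U - S) < e"
    using U(3,4) e by (simp add: emeasure_eq_measure2 ennreal_less_iff)
  ultimately show ?thesis using U that by auto
qed

lemma AE_lebesgue_iff_negligible: "(AE x in lebesgue. P x) \<longleftrightarrow> negligible {x. \<not> P x}"
proof
  assume "AE x in lebesgue. P x"
  then obtain N where "N \<in> null_sets lebesgue" "{x. \<not> P x} \<subseteq> N"
    by (auto simp: eventually_ae_filter)
  then show "negligible {x. \<not> P x}"
    by (metis negligible_iff_null_sets negligible_subset)
next
  assume "negligible {x. \<not> P x}"
  then show "AE x in lebesgue. P x"
    by (auto simp: eventually_ae_filter negligible_iff_null_sets)
qed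

text \<open>A Lipschitz function is controlled by its slopes without being written as the integral
  of its derivative. Cover S by an open set U of almost the same measure: a short interval around a
  point of S lies in U and is charged to |U| at rate L, a short interval around any other point has
  slope at most C + e, and bisection adds up these local bounds.\<close>

lemma lipschitz_increment_le:
  fixes f :: "real \<Rightarrow> real"
  assumes ab: "a \<le> b" and L: "0 \<le> L" and C: "0 \<le> C"
    and lip: "\<And>s t. s \<in> {a..b} \<Longrightarrow> t \<in> {a..b} \<Longrightarrow> \<bar>f s - f t\<bar> \<le> L * \<bar>s - t\<bar>"
    and S: "S \<in> lmeasurable"
    and slope: "\<And>t e. t \<in> {a..b} - S \<Longrightarrow> 0 < e \<Longrightarrow>
      \<exists>d>0. \<forall>s\<in>{a..b}. \<bar>s - t\<bar> < d \<longrightarrow> \<bar>f s - f t\<bar> \<le> (C + e) * \<bar>s - t\<bar>"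
  shows "\<bar>f b - f a\<bar> \<le> C * (b - a) + L * measure lebesgue S"
proof (rule field_le_epsilon)
  fix e0 :: real assume e0: "0 < e0"
  define e where "e = e0 / (b - a + L + 1)"
  have e: "0 < e" using e0 ab L by (simp add: e_def)
  have e_e0: "e * (b - a) + L * e \<le> e0"
  proof -
    have "e * (b - a) + L * e \<le> e * (b - a + L + 1)" using e by (simp add: algebra_simps)
    also have "\<dots> = e0" using ab L by (simp add: e_def)
    finally show ?thesis .
  qed
  obtain U where U: "open U" "S \<subseteq> U" "U \<in> lmeasurable" "measure lebesgue U < measure lebesgue S + e"
    using lmeasurable_outer_open'[OF S e] by blast
  define \<Omega> where "\<Omega> t = measure lebesgue (U \<inter> {a..t})" for t
  have meas: "U \<inter> {u..v} \<in> lmeasurable" "U \<inter> {u<..v} \<in> lmeasurable" for u v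
    using U(3) by (auto intro: fmeasurable_Int_fmeasurable)
  have \<Omega>_add: "\<Omega> v = \<Omega> u + measure lebesgue (U \<inter> {u<..v})" if "a \<le> u" "u \<le> v" for u v
  proof -
    have "U \<inter> {a..v} = (U \<inter> {a..u}) \<union> (U \<inter> {u<..v})" using that by auto
    moreover have "(U \<inter> {a..u}) \<inter> (U \<inter> {u<..v}) = {}" by auto
    ultimately show ?thesis using measure_Un3[OF meas(1)[of a u] meas(2)[of u v]] by (simp add: \<Omega>_def)
  qed
  \<comment> \<open>The bound is additive over adjacent intervals, which is the form that
    \<open>Bolzano\<close> needs. The implication makes it vacuous for intervals that leave
    \<open>{a..b}\<close>.\<close>
  define P where "P u v \<longleftrightarrow> (a \<le> u \<and> v \<le> b \<longrightarrow> \<bar>f v - f u\<bar> \<le> (C + e) * (v - u) + L * (\<Omega> v - \<Omega> u))" for u v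
  have "P a b"
  proof (rule Bolzano[OF ab])
    fix u v w assume "P u v" "P v w" "u \<le> v" "v \<le> w"
    then show "P u w" unfolding P_def by (auto simp: algebra_simps)
  next
    fix x assume x: "a \<le> x" "x \<le> b"
    show "\<exists>d>0. \<forall>u v. u \<le> x \<and> x \<le> v \<and> v - u < d \<longrightarrow> P u v"
    proof (cases "x \<in> S")
      case True
      then obtain d where d: "d > 0" "ball x d \<subseteq> U" using U(1,2) open_contains_ball by blast
      show ?thesis
      proof (intro exI[of _ d] conjI allI impI d(1))
        fix u v assume uv: "u \<le> x \<and> x \<le> v \<and> v - u < d"
        show "P u v" unfolding P_def
        proof
          assume b: "a \<le> u \<and> v \<le> b"
          have "U \<inter> {u<..v} = {u<..v}"
            using d(2) uv by (auto simp: subset_eq dist_real_def)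
          then have "\<Omega> v - \<Omega> u = v - u" using \<Omega>_add[of u v] b uv by simp
          moreover have "\<bar>f v - f u\<bar> \<le> L * (v - u)" using lip[of v u] b uv by simp
          moreover have "0 \<le> (C + e) * (v - u)" using C e uv by simp
          ultimately show "\<bar>f v - f u\<bar> \<le> (C + e) * (v - u) + L * (\<Omega> v - \<Omega> u)" by simp
        qed
      qed
    next
      case False
      then obtain d where d: "d > 0" "\<forall>s\<in>{a..b}. \<bar>s - x\<bar> < d \<longrightarrow> \<bar>f s - f x\<bar> \<le> (C + e) * \<bar>s - x\<bar>"
        using slope[of x e] x e by auto
      show ?thesis
      proof (intro exI[of _ d] conjI allI impI d(1))
        fix u v assume uv: "u \<le> x \<and> x \<le> v \<and> v - u < d"
        show "P u v" unfolding P_def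
        proof
          assume b: "a \<le> u \<and> v \<le> b"
          have "\<bar>f u - f x\<bar> \<le> (C + e) * (x - u)" "\<bar>f v - f x\<bar> \<le> (C + e) * (v - x)"
            using d(2)[rule_format, of u] d(2)[rule_format, of v] b uv by auto
          moreover have "0 \<le> L * (\<Omega> v - \<Omega> u)" using \<Omega>_add[of u v] b uv L by simp
          ultimately show "\<bar>f v - f u\<bar> \<le> (C + e) * (v - u) + L * (\<Omega> v - \<Omega> u)"
            by (auto simp: algebra_simps)
        qed
      qed
    qed
  qed
  then have "\<bar>f b - f a\<bar> \<le> (C + e) * (b - a) + L * (\<Omega> b - \<Omega> a)" by (simp add: P_def)
  moreover have "\<Omega> b - \<Omega> a \<le> measure lebesgue S + e"
  proof -
    have "\<Omega> b \<le> measure lebesgue U" unfolding \<Omega>_def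
      by (rule measure_mono_fmeasurable) (use U meas in \<open>auto simp: fmeasurableD\<close>)
    moreover have "0 \<le> \<Omega> a" by (simp add: \<Omega>_def)
    ultimately show ?thesis using U(4) by linarith
  qed
  ultimately have "\<bar>f b - f a\<bar> \<le> (C + e) * (b - a) + L * (measure lebesgue S + e)"
    using L by (smt (verit) mult_left_mono)
  then show "\<bar>f b - f a\<bar> \<le> C * (b - a) + L * measure lebesgue S + e0"
    using e_e0 by (simp add: algebra_simps)
qed

text \<open>Outside S only values in a null set are taken, so that part of the interval cannot
  contribute to the increment. To see this, compose with a map that flattens an open set G
  containing N: the composition has slope 0 off S, and flattening loses at most |G| < e.\<close>

lemma lipschitz_increment_le_of_null_values:
  fixes \<alpha> :: "real \<Rightarrow> real"
  assumes ab: "a \<le> b" and L: "0 \<le> L"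
    and lip: "\<And>s t. s \<in> {a..b} \<Longrightarrow> t \<in> {a..b} \<Longrightarrow> \<bar>\<alpha> s - \<alpha> t\<bar> \<le> L * \<bar>s - t\<bar>"
    and S: "S \<in> lmeasurable" and N: "negligible N"
    and val: "\<And>t. t \<in> {a..b} - S \<Longrightarrow> \<alpha> t \<in> N"
  shows "\<bar>\<alpha> b - \<alpha> a\<bar> \<le> L * measure lebesgue S"
proof (rule field_le_epsilon)
  fix e :: real assume e: "0 < e"
  have "N \<in> lmeasurable" "measure lebesgue N = 0" using N by (auto simp: negligible_iff_measure)
  then obtain G where G: "open G" "N \<subseteq> G" "G \<in> lmeasurable" "measure lebesgue G < e"
    using lmeasurable_outer_open'[of N e] e by auto
  \<comment> \<open>A lower bound of \<open>\<alpha>\<close> on \<open>{a..b}\<close>, so that the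
    base point of \<open>\<kappa>\<close> lies to the left of all values that occur.\<close>
  define c where "c = - (\<bar>\<alpha> a\<bar> + L * (b - a))"
  \<comment> \<open>\<open>\<kappa>\<close> collapses \<open>G\<close>: it is monotone, 1-Lipschitz, locally constant on \<open>G\<close>, and loses at most \<open>|G|\<close>.\<close>
  define \<kappa> where "\<kappa> t = measure lebesgue ({c..t} - G)" for t
  have meas: "{u..v} - G \<in> lmeasurable" "{u<..v} - G \<in> lmeasurable" "{u<..v} \<inter> G \<in> lmeasurable" for u v
    using G(3) bounded_set_imp_lmeasurable[of "{u<..v}"]
    by (auto intro: fmeasurable.Diff fmeasurable_Int_fmeasurable simp: fmeasurableD)
  have \<kappa>_add: "\<kappa> v = \<kappa> u + measure lebesgue ({u<..v} - G)" if "c \<le> u" "u \<le> v" for u v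
  proof -
    have "{c..v} - G = ({c..u} - G) \<union> ({u<..v} - G)" using that by auto
    moreover have "({c..u} - G) \<inter> ({u<..v} - G) = {}" by auto
    ultimately show ?thesis using measure_Un3[OF meas(1)[of c u] meas(2)[of u v]] by (simp add: \<kappa>_def)
  qed
  have \<kappa>_le: "\<kappa> v - \<kappa> u \<le> v - u" "0 \<le> \<kappa> v - \<kappa> u" "v - u - e \<le> \<kappa> v - \<kappa> u" if "c \<le> u" "u \<le> v" for u v
  proof -
    have sub: "measure lebesgue ({u<..v} - G) \<le> measure lebesgue {u<..v}"
      by (rule measure_mono_fmeasurable)
        (use meas in \<open>auto simp: fmeasurableD intro: bounded_set_imp_lmeasurable\<close>)
    then show "\<kappa> v - \<kappa> u \<le> v - u" "0 \<le> \<kappa> v - \<kappa> u" using \<kappa>_add[OF that] that by auto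
    have "measure lebesgue {u<..v} = measure lebesgue (({u<..v} - G) \<union> ({u<..v} \<inter> G))"
      by (rule arg_cong[where f="measure lebesgue"]) auto
    also have "\<dots> \<le> measure lebesgue ({u<..v} - G) + measure lebesgue ({u<..v} \<inter> G)"
      by (rule measure_Un_le) (use meas in \<open>auto simp: fmeasurableD\<close>)
    also have "measure lebesgue ({u<..v} \<inter> G) \<le> measure lebesgue G"
      by (rule measure_mono_fmeasurable) (use meas G in \<open>auto simp: fmeasurableD\<close>)
    finally show "v - u - e \<le> \<kappa> v - \<kappa> u" using \<kappa>_add[OF that] that G(4) by simp
  qed
  have \<kappa>_lip: "\<bar>\<kappa> v - \<kappa> u\<bar> \<le> \<bar>v - u\<bar>" "\<bar>v - u\<bar> - e \<le> \<bar>\<kappa> v - \<kappa> u\<bar>" if "c \<le> u" "c \<le> v" for u v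
  proof -
    have "\<bar>\<kappa> v - \<kappa> u\<bar> \<le> \<bar>v - u\<bar> \<and> \<bar>v - u\<bar> - e \<le> \<bar>\<kappa> v - \<kappa> u\<bar>"
    proof (cases "u \<le> v")
      case True
      then show ?thesis using \<kappa>_le[OF that(1) True] by simp
    next
      case False
      then have vu: "v \<le> u" by simp
      then show ?thesis using \<kappa>_le[OF that(2) vu] by simp
    qed
    then show "\<bar>\<kappa> v - \<kappa> u\<bar> \<le> \<bar>v - u\<bar>" "\<bar>v - u\<bar> - e \<le> \<bar>\<kappa> v - \<kappa> u\<bar>" by auto
  qed
  have range: "c \<le> \<alpha> s" if "s \<in> {a..b}" for s
  proof -
    have "\<bar>\<alpha> s - \<alpha> a\<bar> \<le> L * (b - a)"
      using lip[of s a] that ab L mult_left_mono[of "\<bar>s - a\<bar>" "b - a" L] by auto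
    then show ?thesis by (simp add: c_def)
  qed
  have "\<bar>\<kappa> (\<alpha> b) - \<kappa> (\<alpha> a)\<bar> \<le> 0 * (b - a) + L * measure lebesgue S"
  proof (rule lipschitz_increment_le[OF ab L order_refl _ S])
    fix s t assume st: "s \<in> {a..b}" "t \<in> {a..b}"
    show "\<bar>\<kappa> (\<alpha> s) - \<kappa> (\<alpha> t)\<bar> \<le> L * \<bar>s - t\<bar>"
      using \<kappa>_lip(1)[OF range[OF st(2)] range[OF st(1)]] lip[OF st] by linarith
  next
    fix t e' :: real assume t: "t \<in> {a..b} - S" and e': "0 < e'"
    then have "\<alpha> t \<in> G" using val G(2) by blast
    then obtain r where r: "r > 0" "ball (\<alpha> t) r \<subseteq> G" using G(1) open_contains_ball by blast
    define d where "d = r / (L + 1)"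
    have d: "d > 0" using r L by (simp add: d_def)
    have "\<bar>\<kappa> (\<alpha> s) - \<kappa> (\<alpha> t)\<bar> \<le> (0 + e') * \<bar>s - t\<bar>" if s: "s \<in> {a..b}" "\<bar>s - t\<bar> < d" for s
    proof -
      have "L * \<bar>s - t\<bar> \<le> L * d" using s L by (simp add: mult_left_mono)
      also have "\<dots> < r" using r L by (simp add: d_def field_simps)
      finally have "\<bar>\<alpha> s - \<alpha> t\<bar> < r" using lip[of s t] s t by auto
      then have sub: "{\<alpha> s<..\<alpha> t} \<subseteq> G" "{\<alpha> t<..\<alpha> s} \<subseteq> G"
        using r(2) by (auto simp: subset_eq dist_real_def)
      have "\<kappa> (\<alpha> s) = \<kappa> (\<alpha> t)"
        using \<kappa>_add[of "\<alpha> s" "\<alpha> t"] \<kappa>_add[of "\<alpha> t" "\<alpha> s"] range[of s] range[of t] s t sub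
        by (cases "\<alpha> s \<le> \<alpha> t") (auto simp: Diff_eq_empty_iff[THEN iffD2])
      then show ?thesis using e' by simp
    qed
    then show "\<exists>d>0. \<forall>s\<in>{a..b}. \<bar>s - t\<bar> < d \<longrightarrow> \<bar>\<kappa> (\<alpha> s) - \<kappa> (\<alpha> t)\<bar> \<le> (0 + e') * \<bar>s - t\<bar>"
      using d by blast
  qed
  then show "\<bar>\<alpha> b - \<alpha> a\<bar> \<le> L * measure lebesgue S + e"
    using \<kappa>_lip(2)[of "\<alpha> a" "\<alpha> b"] range[of a] range[of b] ab by auto
qed


text \<open>At a density point s of the preimage E of N, the part of [s, s + h] outside E has
  measure o(h), and the previous estimate makes the increment o(h) as well. Almost every point of E
  is a density point. N is taken in \<open>null_sets lborel\<close> so that E is Borel.\<close>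

lemma difference_quotient_tendsto_zero_on_preimage:
  fixes \<alpha> :: "real \<Rightarrow> real" and h :: "nat \<Rightarrow> real"
  assumes lip: "\<And>r. \<exists>L\<ge>0. \<forall>s t. \<bar>s\<bar> \<le> r \<longrightarrow> \<bar>t\<bar> \<le> r \<longrightarrow> \<bar>\<alpha> s - \<alpha> t\<bar> \<le> L * \<bar>s - t\<bar>"
    and cont: "continuous_on UNIV \<alpha>"
    and N: "N \<in> null_sets lborel" and h: "\<And>k. 0 < h k" "h \<longlonglongrightarrow> 0"
  shows "negligible {s. \<alpha> s \<in> N \<and> \<not> (\<lambda>k. (\<alpha> (s + h k) - \<alpha> s) / h k) \<longlonglongrightarrow> 0}"
proof -
  define E where "E = \<alpha> -` N"
  have \<alpha>: "\<alpha> \<in> borel_measurable borel" using cont by (rule borel_measurable_continuous_onI)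
  have Nb: "N \<in> sets borel" using N by auto
  have E: "E \<in> sets borel"
    using measurable_sets[OF \<alpha> Nb] by (simp add: E_def)
  have negN: "negligible N" using N by (simp add: negligible_iff_null_sets null_sets_completionI)
  have Eab: "E \<inter> {a..b} \<in> lmeasurable" for a b
    using E by (intro bounded_set_imp_lmeasurable) auto
  have int: "(indicator E :: real \<Rightarrow> real) integrable_on cbox a b" for a b :: real
    by (simp add: Eab integrable_on_indicator)
  \<comment> \<open>Lebesgue differentiation of the indicator of E in one-sided form: off K the
    averages over [s, s + h] converge to the value at s.\<close>
  obtain K where K: "negligible K" "\<And>x e. x \<notin> K \<Longrightarrow> 0 < e \<Longrightarrow>
      \<exists>d>0. \<forall>h. 0 < h \<and> h < d \<longrightarrow>
        norm (integral (cbox x (x + h *\<^sub>R One)) (indicator E :: real \<Rightarrow> real) /\<^sub>R h ^ DIM(real) - indicator E x) < e"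
    using integrable_ccontinuous_explicit[OF int] by metis
  have "(\<lambda>k. (\<alpha> (s + h k) - \<alpha> s) / h k) \<longlonglongrightarrow> 0" if s: "s \<notin> K" "s \<in> E" for s
  proof (rule LIMSEQ_I)
    fix e :: real assume e: "0 < e"
    obtain L where L: "L \<ge> 0" "\<And>u t. \<bar>u\<bar> \<le> \<bar>s\<bar> + 1 \<Longrightarrow> \<bar>t\<bar> \<le> \<bar>s\<bar> + 1 \<Longrightarrow> \<bar>\<alpha> u - \<alpha> t\<bar> \<le> L * \<bar>u - t\<bar>"
      using lip[of "\<bar>s\<bar> + 1"] by blast
    define e' where "e' = e / (L + 1)"
    have e': "e' > 0" using e L by (simp add: e'_def)
    obtain d where d: "d > 0" "\<And>h. 0 < h \<Longrightarrow> h < d \<Longrightarrow>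
        norm (integral (cbox s (s + h *\<^sub>R One)) (indicator E :: real \<Rightarrow> real) /\<^sub>R h ^ DIM(real) - indicator E s) < e'"
      using K(2)[OF s(1) e'] by blast
    have "\<forall>\<^sub>F k in sequentially. h k < min d 1"
      using order_tendstoD(2)[OF h(2), of "min d 1"] d by simp
    then obtain n where n: "\<And>k. k \<ge> n \<Longrightarrow> h k < min d 1"
      by (auto simp: eventually_sequentially)
    have "norm ((\<alpha> (s + h k) - \<alpha> s) / h k - 0) < e" if k: "k \<ge> n" for k
    proof -
      have hk: "0 < h k" "h k < d" "h k < 1" using h(1) n[OF k] by auto
      have "integral {s..s + h k} (indicator E :: real \<Rightarrow> real) = measure lebesgue (E \<inter> {s..s + h k})"
        using Eab by (rule Equivalence_Lebesgue_Henstock_Integration.integral_indicator)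
      then have "norm (measure lebesgue (E \<inter> {s..s + h k}) / h k - 1) < e'"
        using d(2)[OF hk(1,2)] s(2) by (simp add: inverse_eq_divide)
      then have "1 - e' < measure lebesgue (E \<inter> {s..s + h k}) / h k"
        unfolding real_norm_def by linarith
      then have "(1 - e') * h k < measure lebesgue (E \<inter> {s..s + h k})"
        using hk(1) by (simp only: pos_less_divide_eq)
      then have "h k - measure lebesgue (E \<inter> {s..s + h k}) < e' * h k"
        by (simp add: left_diff_distrib)
      moreover have "measure lebesgue ({s..s + h k} - E) = h k - measure lebesgue (E \<inter> {s..s + h k})"
      proof -
        have "measure lebesgue ({s..s + h k} - E \<inter> {s..s + h k})
            = measure lebesgue {s..s + h k} - measure lebesgue (E \<inter> {s..s + h k})"
          by (rule measurable_measure_Diff) (use Eab fmeasurableD in auto)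
        moreover have "{s..s + h k} - E \<inter> {s..s + h k} = {s..s + h k} - E" by auto
        ultimately show ?thesis using hk by simp
      qed
      moreover have "\<bar>\<alpha> (s + h k) - \<alpha> s\<bar> \<le> L * measure lebesgue ({s..s + h k} - E)"
      proof (rule lipschitz_increment_le_of_null_values[where \<alpha>=\<alpha>, OF _ L(1) _ _ negN])
        show "\<bar>\<alpha> u - \<alpha> t\<bar> \<le> L * \<bar>u - t\<bar>" if "u \<in> {s..s + h k}" "t \<in> {s..s + h k}" for u t
          using that hk by (intro L(2)) auto
        show "{s..s + h k} - E \<in> lmeasurable"
          using E by (intro bounded_set_imp_lmeasurable) auto
        show "\<alpha> t \<in> N" if "t \<in> {s..s + h k} - ({s..s + h k} - E)" for t
          using that by (auto simp: E_def)
      qed (use hk in auto)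
      ultimately have "\<bar>\<alpha> (s + h k) - \<alpha> s\<bar> \<le> L * (e' * h k)"
        using L(1) by (smt (verit) mult_left_mono)
      also have "\<dots> = (L * e') * h k" by simp
      also have "\<dots> < e * h k"
      proof (rule mult_strict_right_mono[OF _ hk(1)])
        have "L * e' < (L + 1) * e'" using e' by simp
        also have "\<dots> = e" using L(1) by (simp add: e'_def)
        finally show "L * e' < e" .
      qed
      finally show ?thesis using hk(1) by (simp add: abs_divide pos_divide_less_eq)
    qed
    then show "\<exists>no. \<forall>n\<ge>no. norm ((\<alpha> (s + h n) - \<alpha> s) / h n - 0) < e" by blast
  qed
  then have "{s. \<alpha> s \<in> N \<and> \<not> (\<lambda>k. (\<alpha> (s + h k) - \<alpha> s) / h k) \<longlonglongrightarrow> 0} \<subseteq> K"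
    by (auto simp: E_def)
  then show ?thesis using K(1) negligible_subset by blast
qed

text \<open>By translation invariance the measure of B is the average over s in [0, 1] of the
  measure of B shifted by -s v. Exchanging the integrals turns it into an integral of line measures,
  all of which vanish. This avoids coordinates adapted to v.\<close>

lemma null_sets_if_null_on_lines:
  fixes B :: "'a::euclidean_space set"
  assumes B: "B \<in> sets borel" and lines: "\<And>y. negligible {s. y + s *\<^sub>R v \<in> B}"
  shows "B \<in> null_sets lborel"
proof -
  have [measurable]: "B \<in> sets borel" by (rule B)
  let ?f = "\<lambda>(y, s). indicator B (y + s *\<^sub>R v) * indicator {0..1::real} s :: ennreal"
  have meas: "?f \<in> borel_measurable (lborel \<Otimes>\<^sub>M lborel)" by measurable
  have inner: "(\<integral>\<^sup>+ y. indicator B (y + s *\<^sub>R v) \<partial>lborel) = emeasure lborel B" for s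
  proof -
    have "(\<integral>\<^sup>+ y. indicator B y \<partial>lborel) = (\<integral>\<^sup>+ y. indicator B y \<partial>(distr lborel borel ((+) (s *\<^sub>R v))))"
      by (simp add: lborel_distr_plus)
    also have "\<dots> = (\<integral>\<^sup>+ y. indicator B (s *\<^sub>R v + y) \<partial>lborel)"
      by (rule nn_integral_distr) measurable
    finally show ?thesis by (simp add: add.commute)
  qed
  have "emeasure lborel B = (\<integral>\<^sup>+ s. emeasure lborel B * indicator {0..1::real} s \<partial>lborel)"
    by (simp add: nn_integral_cmult_indicator)
  also have "\<dots> = (\<integral>\<^sup>+ s. (\<integral>\<^sup>+ y. ?f (y, s) \<partial>lborel) \<partial>lborel)"
    by (simp add: nn_integral_multc inner)
  also have "\<dots> = (\<integral>\<^sup>+ y. (\<integral>\<^sup>+ s. ?f (y, s) \<partial>lborel) \<partial>lborel)"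
    by (rule lborel_pair.Fubini[OF meas])
  also have "\<dots> = integral\<^sup>N lborel (\<lambda>_ :: 'a. 0)"
  proof (rule nn_integral_cong)
    fix y :: 'a
    have S: "{s. y + s *\<^sub>R v \<in> B} \<in> sets borel" by measurable
    then have "{s. y + s *\<^sub>R v \<in> B} \<in> null_sets lborel"
      using lines[of y] by (simp add: negligible_iff_null_sets null_sets_completion_iff)
    then have "AE s in lborel. s \<notin> {s. y + s *\<^sub>R v \<in> B}" by (rule AE_not_in)
    then have "AE s in lborel. ?f (y, s) = 0" by eventually_elim auto
    then show "(\<integral>\<^sup>+ s. ?f (y, s) \<partial>lborel) = 0" by (subst nn_integral_0_iff_AE) auto
  qed
  finally have "emeasure lborel B = 0" by simp
  then show ?thesis using B by auto
qed

text \<open>The one-dimensional statement on every line parallel to v, combined by Fubini. Enlarging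
  N to a Borel null set makes the exceptional set Borel.\<close>

lemma AE_difference_quotient_tendsto_zero_on_preimage:
  fixes a :: "'a::euclidean_space \<Rightarrow> real" and h :: "nat \<Rightarrow> real"
  assumes lip: "\<And>r. \<exists>L. L-lipschitz_on (cball 0 r) a"
    and N: "negligible N" and h: "\<And>k. 0 < h k" "h \<longlonglongrightarrow> 0"
  shows "AE y in lebesgue. a y \<in> N \<longrightarrow> (\<lambda>k. (a (y + h k *\<^sub>R v) - a y) / h k) \<longlonglongrightarrow> 0"
proof -
  obtain N' where N': "N' \<in> null_sets lborel" "N \<subseteq> N'"
    using N by (auto simp: negligible_iff_null_sets null_sets_completion_iff2)
  have "continuous (at y) a" for y
  proof -
    obtain L where "L-lipschitz_on (cball 0 (norm y + 1)) a" using lip by blast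
    then have "continuous_on (cball 0 (norm y + 1)) a" by (rule lipschitz_on_continuous_on)
    then show ?thesis by (rule continuous_on_interior) (auto simp: interior_cball)
  qed
  then have cont: "continuous_on UNIV a" by (simp add: continuous_on_eq_continuous_at)
  have [measurable]: "a \<in> borel_measurable borel" using cont by (rule borel_measurable_continuous_onI)
  have [measurable]: "N' \<in> sets borel" using N' by auto
  define B where "B = {y. a y \<in> N' \<and> \<not> (\<lambda>k. (a (y + h k *\<^sub>R v) - a y) / h k) \<longlonglongrightarrow> 0}"
  have "B \<in> sets borel" unfolding B_def by measurable
  moreover have "negligible {s. y + s *\<^sub>R v \<in> B}" for y
  proof -
    let ?\<alpha> = "\<lambda>s. a (y + s *\<^sub>R v)"
    have "negligible {s. ?\<alpha> s \<in> N' \<and> \<not> (\<lambda>k. (?\<alpha> (s + h k) - ?\<alpha> s) / h k) \<longlonglongrightarrow> 0}"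
    proof (rule difference_quotient_tendsto_zero_on_preimage[OF _ _ N'(1) h])
      fix r :: real
      obtain L where L: "L-lipschitz_on (cball 0 (norm y + r * norm v)) a" using lip by blast
      have "\<bar>?\<alpha> s - ?\<alpha> t\<bar> \<le> (L * norm v) * \<bar>s - t\<bar>" if "\<bar>s\<bar> \<le> r" "\<bar>t\<bar> \<le> r" for s t
      proof -
        have in_ball: "y + q *\<^sub>R v \<in> cball 0 (norm y + r * norm v)" if "\<bar>q\<bar> \<le> r" for q
        proof -
          have "norm (y + q *\<^sub>R v) \<le> norm y + \<bar>q\<bar> * norm v" by (metis norm_scaleR norm_triangle_ineq)
          also have "\<dots> \<le> norm y + r * norm v" using that by (simp add: mult_right_mono)
          finally show ?thesis by simp
        qed
        have "dist (?\<alpha> s) (?\<alpha> t) \<le> L * dist (y + s *\<^sub>R v) (y + t *\<^sub>R v)"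
          using that by (intro lipschitz_onD[OF L] in_ball)
        then show ?thesis by (simp add: dist_real_def dist_norm mult.commute mult.left_commute flip: scaleR_left_diff_distrib)
      qed
      moreover have "0 \<le> L * norm v" using lipschitz_on_nonneg[OF L] by simp
      ultimately show "\<exists>L\<ge>0. \<forall>s t. \<bar>s\<bar> \<le> r \<longrightarrow> \<bar>t\<bar> \<le> r \<longrightarrow> \<bar>?\<alpha> s - ?\<alpha> t\<bar> \<le> L * \<bar>s - t\<bar>" by blast
    next
      show "continuous_on UNIV ?\<alpha>"
        by (intro continuous_on_compose2[OF cont] continuous_intros) auto
    qed
    then show ?thesis by (simp add: B_def scaleR_left_distrib add.assoc)
  qed
  ultimately have "B \<in> null_sets lborel" by (rule null_sets_if_null_on_lines)
  then have "AE y in lebesgue. y \<notin> B" by (intro AE_completion AE_not_in)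
  then show ?thesis by eventually_elim (use N'(2) in \<open>auto simp: B_def\<close>)
qed

text \<open>The first product will come from stability, which contains f', the second from the
  equation, which contains differences of f. Where f has derivative f' at \<open>a y\<close>, the
  claim is the chain rule with bounded quotients. Elsewhere \<open>f' (a y)\<close> is an arbitrary
  number, but the quotients of a tend to 0 and both products are quadratic in them. Only the
  difference is claimed to converge, so that no limit of the quotients of a has to be known.\<close>

lemma AE_chain_rule_difference_quotient:
  fixes a :: "'a::euclidean_space \<Rightarrow> real" and f f' :: "real \<Rightarrow> real" and h :: "nat \<Rightarrow> real"
  assumes lip: "\<And>r. \<exists>L. L-lipschitz_on (cball 0 r) a"
    and f_lip: "\<And>M. \<exists>L. L-lipschitz_on (cball 0 M) f"
    and deriv: "AE t in lebesgue. (f has_real_derivative f' t) (at t)"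
    and h: "\<And>k. 0 < h k" "h \<longlonglongrightarrow> 0"
  shows "AE y in lebesgue. (\<lambda>k. f' (a y) * ((a (y + h k *\<^sub>R v) - a y) / h k)\<^sup>2
      - ((f (a (y + h k *\<^sub>R v)) - f (a y)) / h k) * ((a (y + h k *\<^sub>R v) - a y) / h k)) \<longlonglongrightarrow> 0"
proof -
  define N where "N = {t. \<not> (f has_real_derivative f' t) (at t)}"
  have N: "negligible N"
    using deriv by (simp add: N_def AE_lebesgue_iff_negligible)
  show ?thesis
    using AE_difference_quotient_tendsto_zero_on_preimage[OF lip N h, of v]
  proof eventually_elim
    fix y assume *: "a y \<in> N \<longrightarrow> (\<lambda>k. (a (y + h k *\<^sub>R v) - a y) / h k) \<longlonglongrightarrow> 0"
    define q where "q k = (a (y + h k *\<^sub>R v) - a y) / h k" for k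
    define Q where "Q k = (f (a (y + h k *\<^sub>R v)) - f (a y)) / h k" for k
    obtain L where L: "L-lipschitz_on (cball 0 (norm y + norm v)) a" using lip by blast
    have "\<forall>\<^sub>F k in sequentially. h k < 1" using order_tendstoD(2)[OF h(2)] by simp
    then have inb: "\<forall>\<^sub>F k in sequentially. norm (y + h k *\<^sub>R v) \<le> norm y + norm v"
    proof eventually_elim
      case (elim k)
      have "norm (y + h k *\<^sub>R v) \<le> norm y + h k * norm v" using h(1)[of k] by (metis norm_scaleR norm_triangle_ineq abs_of_pos)
      also have "h k * norm v \<le> 1 * norm v" using elim by (intro mult_right_mono) auto
      finally show ?case by simp
    qed
    have inc: "\<forall>\<^sub>F k in sequentially. \<bar>a (y + h k *\<^sub>R v) - a y\<bar> \<le> L * norm v * h k"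
      using inb
    proof eventually_elim
      case (elim k)
      have "dist (a (y + h k *\<^sub>R v)) (a y) \<le> L * dist (y + h k *\<^sub>R v) y"
        using elim by (intro lipschitz_onD[OF L]) auto
      then show ?case using h(1)[of k] by (simp add: dist_real_def dist_norm mult.commute mult.left_commute)
    qed
    then have qb: "\<forall>\<^sub>F k in sequentially. \<bar>q k\<bar> \<le> L * norm v"
    proof eventually_elim
      case (elim k)
      then show ?case using h(1)[of k] by (simp add: q_def field_simps)
    qed
    have L0: "0 \<le> L" using L by (rule lipschitz_on_nonneg)
    have "(\<lambda>k. f' (a y) * (q k)\<^sup>2 - Q k * q k) \<longlonglongrightarrow> 0"
    proof (cases "a y \<in> N")
      case True
      then have q0: "q \<longlonglongrightarrow> 0" using * by (simp add: q_def[abs_def])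
      obtain Lf where Lf: "Lf-lipschitz_on (cball 0 (\<bar>a y\<bar> + L * norm v)) f" using f_lip by blast
      have Lf0: "0 \<le> Lf" using Lf by (rule lipschitz_on_nonneg)
      have "\<forall>\<^sub>F k in sequentially. norm (f' (a y) * (q k)\<^sup>2 - Q k * q k) \<le> (\<bar>f' (a y)\<bar> + Lf) * (q k)\<^sup>2"
        using inc \<open>\<forall>\<^sub>F k in sequentially. h k < 1\<close>
      proof eventually_elim
        case (elim k)
        have "L * norm v * h k \<le> L * norm v * 1" using elim L0 by (intro mult_left_mono) auto
        then have "dist (f (a (y + h k *\<^sub>R v))) (f (a y)) \<le> Lf * dist (a (y + h k *\<^sub>R v)) (a y)"
          using elim L0 by (intro lipschitz_onD[OF Lf]) auto
        then have "\<bar>Q k\<bar> \<le> Lf * \<bar>q k\<bar>"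
          using h(1)[of k] by (simp add: Q_def q_def dist_real_def field_simps)
        then have "\<bar>Q k * q k\<bar> \<le> Lf * (q k)\<^sup>2"
          using mult_right_mono[of "\<bar>Q k\<bar>" "Lf * \<bar>q k\<bar>" "\<bar>q k\<bar>"] by (simp add: abs_mult power2_eq_square mult.assoc)
        moreover have "\<bar>f' (a y) * (q k)\<^sup>2\<bar> = \<bar>f' (a y)\<bar> * (q k)\<^sup>2" by (simp add: abs_mult)
        ultimately show ?case by (simp add: algebra_simps)
      qed
      moreover have "(\<lambda>k. (\<bar>f' (a y)\<bar> + Lf) * (q k)\<^sup>2) \<longlonglongrightarrow> 0"
        using tendsto_mult_right_zero[OF tendsto_mult_zero[OF q0 q0]] by (simp add: power2_eq_square)
      ultimately show ?thesis by (rule Lim_null_comparison)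
    next
      case False
      then have D: "(f has_real_derivative f' (a y)) (at (a y))" by (simp add: N_def)
      show ?thesis
      proof (rule LIMSEQ_I)
        fix e :: real assume e: "0 < e"
        define e' where "e' = e / ((L * norm v)\<^sup>2 + 1)"
        have e': "e' > 0" using e by (simp add: e'_def add_nonneg_pos)
        have "(f has_derivative (*) (f' (a y))) (at (a y))" using D by (simp add: has_field_derivative_def)
        then obtain d where d: "d > 0" "\<And>t. \<bar>t - a y\<bar> < d \<Longrightarrow> \<bar>f t - f (a y) - f' (a y) * (t - a y)\<bar> \<le> e' * \<bar>t - a y\<bar>"
          using e' unfolding has_derivative_at_alt by (metis real_norm_def)
        have "(\<lambda>k. L * norm v * h k) \<longlonglongrightarrow> L * norm v * 0" by (intro tendsto_intros h(2))
        then have "\<forall>\<^sub>F k in sequentially. L * norm v * h k < d" using order_tendstoD(2) d(1) by fastforce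
        with inc qb have "\<forall>\<^sub>F k in sequentially. norm (f' (a y) * (q k)\<^sup>2 - Q k * q k - 0) < e"
        proof eventually_elim
          case (elim k)
          have "\<bar>f (a (y + h k *\<^sub>R v)) - f (a y) - f' (a y) * (a (y + h k *\<^sub>R v) - a y)\<bar> \<le> e' * \<bar>a (y + h k *\<^sub>R v) - a y\<bar>"
            using elim by (intro d(2)) auto
          then have "\<bar>f (a (y + h k *\<^sub>R v)) - f (a y) - f' (a y) * (a (y + h k *\<^sub>R v) - a y)\<bar> / h k
              \<le> e' * \<bar>a (y + h k *\<^sub>R v) - a y\<bar> / h k"
            using h(1)[of k] by (simp add: divide_right_mono)
          moreover have "Q k - f' (a y) * q k
              = (f (a (y + h k *\<^sub>R v)) - f (a y) - f' (a y) * (a (y + h k *\<^sub>R v) - a y)) / h k"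
            by (simp add: Q_def q_def diff_divide_distrib right_diff_distrib)
          ultimately have b: "\<bar>Q k - f' (a y) * q k\<bar> \<le> e' * \<bar>q k\<bar>"
            using h(1)[of k] by (simp add: q_def abs_divide)
          have "\<bar>f' (a y) * (q k)\<^sup>2 - Q k * q k\<bar> = \<bar>Q k - f' (a y) * q k\<bar> * \<bar>q k\<bar>"
            by (simp add: power2_eq_square algebra_simps flip: abs_mult)
          also have "\<dots> \<le> e' * \<bar>q k\<bar> * \<bar>q k\<bar>" using b by (simp add: mult_right_mono)
          also have "\<dots> = e' * (\<bar>q k\<bar>)\<^sup>2" by (simp add: power2_eq_square)
          also have "\<dots> \<le> e' * (L * norm v)\<^sup>2" using e' elim by (intro mult_left_mono power_mono) auto
          also have "\<dots> < e' * ((L * norm v)\<^sup>2 + 1)" using e' by simp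
          also have "\<dots> = e" by (simp add: e'_def add_nonneg_eq_0_iff)
          finally show ?case by simp
        qed
        then show "\<exists>no. \<forall>k\<ge>no. norm (f' (a y) * (q k)\<^sup>2 - Q k * q k - 0) < e"
          by (simp add: eventually_sequentially)
      qed
    qed
    then show "(\<lambda>k. f' (a y) * ((a (y + h k *\<^sub>R v) - a y) / h k)\<^sup>2
      - ((f (a (y + h k *\<^sub>R v)) - f (a y)) / h k) * ((a (y + h k *\<^sub>R v) - a y) / h k)) \<longlonglongrightarrow> 0"
      by (simp add: q_def Q_def)
  qed
qed

section \<open>Gradients of constant direction\<close>

text \<open>Differentiability of D1 at the single point p suffices. The mean value theorem in the
  direction v turns the second difference into a difference of two values of D1 near p, and each is
  expanded at p with remainder o(s). The quotient is symmetric in v and w, which yields the symmetry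
  of the second derivative.\<close>

lemma gradient_second_difference:
  fixes f :: "'a::real_inner \<Rightarrow> real"
  assumes S: "open S" "p \<in> S" and grad: "\<And>q. q \<in> S \<Longrightarrow> GDERIV f q :> D1 q"
    and D2: "(D1 has_derivative D2) (at p)"
  shows "((\<lambda>s. (f (p + s *\<^sub>R v + s *\<^sub>R w) - f (p + s *\<^sub>R w) - f (p + s *\<^sub>R v) + f p) / s\<^sup>2)
    \<longlongrightarrow> D2 w \<bullet> v) (at_right 0)"
proof (rule tendstoI)
  interpret D2: bounded_linear D2 using D2 by (rule has_derivative_bounded_linear)
  fix e :: real assume e: "0 < e"
  \<comment> \<open>The two remainders below are at most e' s (|v| + |w|) and e' s |v|; paired with
    v they account for the first summand. The rest is slack that keeps c positive.\<close>
  define c where "c = (2 * norm v + norm w) * norm v + norm v * norm w + 1"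
  have c: "c > 0" unfolding c_def by (intro add_nonneg_pos add_nonneg_nonneg mult_nonneg_nonneg) auto
  define e' where "e' = e / (2 * c)"
  have e': "e' > 0" using e c by (simp add: e'_def)
  obtain r where r: "r > 0" "ball p r \<subseteq> S" using S open_contains_ball by blast
  obtain d where d: "d > 0" "\<And>q. norm (q - p) < d \<Longrightarrow> norm (D1 q - D1 p - D2 (q - p)) \<le> e' * norm (q - p)"
    using D2 e' unfolding has_derivative_at_alt by blast
  define \<delta> where "\<delta> = min r d / (norm v + norm w + 1)"
  have nn: "norm v + norm w + 1 > 0" by (simp add: add_nonneg_pos)
  have \<delta>: "\<delta> > 0" using r(1) d(1) nn by (simp add: \<delta>_def)
  have "dist ((f (p + s *\<^sub>R v + s *\<^sub>R w) - f (p + s *\<^sub>R w) - f (p + s *\<^sub>R v) + f p) / s\<^sup>2) (D2 w \<bullet> v) < e"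
    if s: "0 < s" "s < \<delta>" for s
  proof -
    have near: "norm (t *\<^sub>R v + q *\<^sub>R w) < min r d" if "0 \<le> t" "t \<le> s" "0 \<le> q" "q \<le> s" for t q
    proof -
      have "norm (t *\<^sub>R v + q *\<^sub>R w) \<le> t * norm v + q * norm w"
        using that by (metis abs_of_nonneg norm_scaleR norm_triangle_ineq)
      also have "\<dots> \<le> s * norm v + s * norm w" using that by (intro add_mono mult_right_mono) auto
      also have "\<dots> \<le> s * (norm v + norm w + 1)" using s by (simp add: algebra_simps)
      also have "\<dots> < \<delta> * (norm v + norm w + 1)" using s nn by (intro mult_strict_right_mono) auto
      also have "\<dots> = min r d" using nn by (simp add: \<delta>_def)
      finally show ?thesis .
    qed
    have inS: "p + z \<in> S" if "norm z < min r d" for z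
    proof -
      have "dist p (p + z) = norm z" by (simp add: dist_norm)
      then have "p + z \<in> ball p r" using that by simp
      then show ?thesis using r(2) by blast
    qed
    define \<phi> where "\<phi> t = f (p + t *\<^sub>R v + s *\<^sub>R w) - f (p + t *\<^sub>R v)" for t
    have der: "(\<phi> has_real_derivative (D1 (p + t *\<^sub>R v + s *\<^sub>R w) - D1 (p + t *\<^sub>R v)) \<bullet> v) (at t)"
      if "0 \<le> t" "t \<le> s" for t
    proof -
      have chain: "((\<lambda>t. f (p + t *\<^sub>R v + z)) has_real_derivative D1 (p + t *\<^sub>R v + z) \<bullet> v) (at t)"
        if "p + t *\<^sub>R v + z \<in> S" for z
      proof -
        have "(f has_derivative (\<lambda>h. h \<bullet> D1 (p + t *\<^sub>R v + z))) (at (p + t *\<^sub>R v + z))"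
          using grad[OF that] by (simp add: gderiv_def)
        moreover have "((\<lambda>t. p + t *\<^sub>R v + z) has_derivative (\<lambda>h. h *\<^sub>R v)) (at t)"
          by (auto intro!: derivative_eq_intros)
        ultimately have "((\<lambda>t. f (p + t *\<^sub>R v + z)) has_derivative (\<lambda>h. (h *\<^sub>R v) \<bullet> D1 (p + t *\<^sub>R v + z))) (at t)"
          by (rule has_derivative_compose[rotated])
        then show ?thesis by (simp add: has_field_derivative_def inner_commute mult_commute_abs)
      qed
      have "p + t *\<^sub>R v + s *\<^sub>R w \<in> S" "p + t *\<^sub>R v + 0 \<in> S"
        using inS[OF near[of t s]] inS[OF near[of t 0]] that s by (auto simp: add.assoc)
      from chain[OF this(1)] chain[OF this(2)] show ?thesis
        unfolding \<phi>_def by (auto intro!: derivative_eq_intros simp: inner_diff_left)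
    qed
    obtain t where t: "0 < t" "t < s" "\<phi> s - \<phi> 0 = (s - 0) * ((D1 (p + t *\<^sub>R v + s *\<^sub>R w) - D1 (p + t *\<^sub>R v)) \<bullet> v)"
      using MVT2[of 0 s \<phi>, OF s(1) der] by auto
    let ?R = "\<lambda>q. D1 q - D1 p - D2 (q - p)"
    \<comment> \<open>The unknown intermediate point t drops out of the linear part, where only the
      increment s w survives.\<close>
    have eq: "D1 (p + t *\<^sub>R v + s *\<^sub>R w) - D1 (p + t *\<^sub>R v)
        = s *\<^sub>R D2 w + (?R (p + t *\<^sub>R v + s *\<^sub>R w) - ?R (p + t *\<^sub>R v))"
      by (simp add: D2.add D2.scaleR algebra_simps)
    have "norm (?R (p + t *\<^sub>R v + s *\<^sub>R w)) \<le> e' * norm (t *\<^sub>R v + s *\<^sub>R w)"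
      using d(2)[of "p + t *\<^sub>R v + s *\<^sub>R w"] near[of t s] t s by (simp add: add.assoc)
    moreover have "norm (?R (p + t *\<^sub>R v)) \<le> e' * norm (t *\<^sub>R v)"
      using d(2)[of "p + t *\<^sub>R v"] near[of t 0] t s by simp
    moreover have "norm (t *\<^sub>R v + s *\<^sub>R w) \<le> s * norm v + s * norm w"
    proof -
      have "norm (t *\<^sub>R v + s *\<^sub>R w) \<le> t * norm v + s * norm w"
        using t s by (metis abs_of_nonneg less_imp_le norm_scaleR norm_triangle_ineq)
      then show ?thesis using t mult_right_mono[of t s "norm v"] by simp
    qed
    moreover have "norm (t *\<^sub>R v) \<le> s * norm v" using t by (simp add: mult_right_mono)
    ultimately have "norm (?R (p + t *\<^sub>R v + s *\<^sub>R w) - ?R (p + t *\<^sub>R v)) \<le> e' * (s * norm v + s * norm w) + e' * (s * norm v)"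
      using e' norm_triangle_ineq4[of "?R (p + t *\<^sub>R v + s *\<^sub>R w)" "?R (p + t *\<^sub>R v)"]
      by (smt (verit) mult_left_mono)
    then have b: "norm (?R (p + t *\<^sub>R v + s *\<^sub>R w) - ?R (p + t *\<^sub>R v)) * norm v \<le> (e' * (s * norm v + s * norm w) + e' * (s * norm v)) * norm v"
      by (rule mult_right_mono) simp
    have "f (p + s *\<^sub>R v + s *\<^sub>R w) - f (p + s *\<^sub>R w) - f (p + s *\<^sub>R v) + f p = \<phi> s - \<phi> 0"
      by (simp add: \<phi>_def)
    also have "\<dots> = s\<^sup>2 * (D2 w \<bullet> v) + s * ((?R (p + t *\<^sub>R v + s *\<^sub>R w) - ?R (p + t *\<^sub>R v)) \<bullet> v)"
      unfolding t(3) eq by (simp only: inner_add_left inner_scaleR_left power2_eq_square) (simp add: algebra_simps)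
    finally have "(f (p + s *\<^sub>R v + s *\<^sub>R w) - f (p + s *\<^sub>R w) - f (p + s *\<^sub>R v) + f p) / s\<^sup>2 - D2 w \<bullet> v
        = ((?R (p + t *\<^sub>R v + s *\<^sub>R w) - ?R (p + t *\<^sub>R v)) \<bullet> v) / s"
      using s by (simp add: field_simps power2_eq_square)
    moreover have "\<bar>((?R (p + t *\<^sub>R v + s *\<^sub>R w) - ?R (p + t *\<^sub>R v)) \<bullet> v) / s\<bar> < e"
    proof -
      have "\<bar>(?R (p + t *\<^sub>R v + s *\<^sub>R w) - ?R (p + t *\<^sub>R v)) \<bullet> v\<bar>
          \<le> (e' * (s * norm v + s * norm w) + e' * (s * norm v)) * norm v"
        using Cauchy_Schwarz_ineq2[of "?R (p + t *\<^sub>R v + s *\<^sub>R w) - ?R (p + t *\<^sub>R v)" v] b by linarith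
      also have "\<dots> = s * (e' * ((2 * norm v + norm w) * norm v))" by (simp add: algebra_simps)
      also have "\<dots> \<le> s * (e' * c)" using s e' by (intro mult_left_mono) (auto simp: c_def)
      also have "\<dots> < s * e" using s e c by (simp add: e'_def)
      finally show ?thesis using s by (simp add: abs_divide pos_divide_less_eq mult.commute)
    qed
    ultimately show ?thesis by (simp add: dist_real_def)
  qed
  then show "\<forall>\<^sub>F s in at_right 0. dist ((f (p + s *\<^sub>R v + s *\<^sub>R w) - f (p + s *\<^sub>R w) - f (p + s *\<^sub>R v) + f p) / s\<^sup>2) (D2 w \<bullet> v) < e"
    unfolding eventually_at_right_field using \<delta> by blast
qed

lemma gradient_derivative_symmetric:
  fixes f :: "'a::real_inner \<Rightarrow> real"
  assumes S: "open S" "p \<in> S" and grad: "\<And>q. q \<in> S \<Longrightarrow> GDERIV f q :> D1 q"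
    and D2: "(D1 has_derivative D2) (at p)"
  shows "D2 w \<bullet> v = D2 v \<bullet> w"
proof -
  have "((\<lambda>s. (f (p + s *\<^sub>R v + s *\<^sub>R w) - f (p + s *\<^sub>R w) - f (p + s *\<^sub>R v) + f p) / s\<^sup>2) \<longlongrightarrow> D2 v \<bullet> w) (at_right 0)"
  proof (rule Lim_transform_eventually[OF gradient_second_difference[OF assms, of w v]])
    show "\<forall>\<^sub>F s in at_right 0. (f (p + s *\<^sub>R w + s *\<^sub>R v) - f (p + s *\<^sub>R v) - f (p + s *\<^sub>R w) + f p) / s\<^sup>2
      = (f (p + s *\<^sub>R v + s *\<^sub>R w) - f (p + s *\<^sub>R w) - f (p + s *\<^sub>R v) + f p) / s\<^sup>2"
      by (intro always_eventually allI) (simp add: ac_simps)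
  qed
  with gradient_second_difference[OF assms, of v w] show ?thesis
    by (intro tendsto_unique[of "at_right (0::real)"]) auto
qed


lemma open_upper_half: "open (upper_half :: ((real ^ 'n) \<times> real) set)"
proof -
  have "(upper_half :: ((real ^ 'n) \<times> real) set) = snd -` {0::real<..}" by (auto simp: upper_half_def)
  then show ?thesis by (metis open_greaterThan open_vimage_snd)
qed

lemma mem_upper_half [simp]: "(y, x) \<in> upper_half \<longleftrightarrow> 0 < x"
  by (simp add: upper_half_def)

text \<open>If the derivative of \<open>F = \<nabla>\<^sub>y u\<close> is a multiple of \<open>F\<close>, then the direction of \<open>F\<close> is locally constant
  and, by symmetry of second derivatives, \<open>F\<close> is constant on the hyperplane orthogonal to it. Two
  such hyperplanes at the same height meet unless they are parallel.\<close>

locale rank_one_gradient =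
  fixes u :: "(real ^ 'n::finite) \<times> real \<Rightarrow> real"
    and D1 :: "(real ^ 'n) \<times> real \<Rightarrow> (real ^ 'n) \<times> real"
    and D2 :: "(real ^ 'n) \<times> real \<Rightarrow> ((real ^ 'n) \<times> real) \<Rightarrow>\<^sub>L ((real ^ 'n) \<times> real)"
  assumes grad_u: "p \<in> upper_half \<Longrightarrow> GDERIV u p :> D1 p"
    and deriv_D1: "p \<in> upper_half \<Longrightarrow> (D1 has_derivative blinfun_apply (D2 p)) (at p)"
    and rank_one: "p \<in> upper_half \<Longrightarrow> fst (D1 p) \<noteq> 0 \<Longrightarrow>
      \<exists>G. \<forall>v. fst (blinfun_apply (D2 p) v) = (G \<bullet> v) *\<^sub>R fst (D1 p)"
begin

abbreviation F where "F p \<equiv> fst (D1 p)"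

lemma deriv_F: "p \<in> upper_half \<Longrightarrow> (F has_derivative (\<lambda>v. fst (blinfun_apply (D2 p) v))) (at p)"
  using has_derivative_fst[OF deriv_D1] .

lemma cont_F: "p \<in> upper_half \<Longrightarrow> isCont F p"
  using deriv_F has_derivative_continuous by blast

text \<open>Near p the product \<open>F q \<bullet> F p\<close> is positive, and the quotient of
  \<open>F q \<bullet> c\<close> by it has derivative 0, because differentiation multiplies
  numerator and denominator by the same factor \<open>G \<bullet> v\<close>.\<close>

lemma direction_locally_constant:
  assumes p: "p \<in> upper_half" and Fp: "F p \<noteq> 0"
  obtains r where "r > 0" "ball p r \<subseteq> upper_half"
    "\<And>q. q \<in> ball p r \<Longrightarrow> F q \<noteq> 0" "\<And>q c. q \<in> ball p r \<Longrightarrow> c \<bullet> F p = 0 \<Longrightarrow> c \<bullet> F q = 0"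
proof -
  have "isCont (\<lambda>q. F q \<bullet> F p) p" by (intro continuous_inner cont_F p continuous_const)
  then have "\<forall>\<^sub>F q in at p. 0 < F q \<bullet> F p"
    unfolding isCont_def by (rule order_tendstoD(1)) (use Fp in simp)
  then obtain d where d: "d > 0" "\<And>q. q \<noteq> p \<Longrightarrow> dist q p < d \<Longrightarrow> 0 < F q \<bullet> F p"
    by (auto simp: eventually_at)
  obtain r0 where r0: "r0 > 0" "ball p r0 \<subseteq> upper_half"
    using p open_upper_half open_contains_ball by blast
  define r where "r = min d r0"
  have r: "r > 0" "ball p r \<subseteq> upper_half" using d r0 by (auto simp: r_def)
  have pos: "0 < F q \<bullet> F p" if "q \<in> ball p r" for q
    using d(2)[of q] that Fp by (cases "q = p") (auto simp: r_def dist_commute)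
  have "c \<bullet> F q = 0" if q: "q \<in> ball p r" and c: "c \<bullet> F p = 0" for q c
  proof -
    let ?z = "\<lambda>q. (F q \<bullet> c) / (F q \<bullet> F p)"
    have "?z p = ?z q"
    proof (rule has_derivative_zero_unique[of "ball p r" ?z])
      fix q assume q: "q \<in> ball p r"
      then have qH: "q \<in> upper_half" using r by auto
      have "F q \<noteq> 0" using pos[OF q] by auto
      then obtain G where G: "\<And>v. fst (blinfun_apply (D2 q) v) = (G \<bullet> v) *\<^sub>R F q"
        using rank_one[OF qH] by blast
      have "(?z has_derivative (\<lambda>v. - (F q \<bullet> c) * (inverse (F q \<bullet> F p) * (fst (blinfun_apply (D2 q) v) \<bullet> F p) * inverse (F q \<bullet> F p))
          + (fst (blinfun_apply (D2 q) v) \<bullet> c) / (F q \<bullet> F p))) (at q within ball p r)"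
        using pos[OF q] by (intro has_derivative_divide has_derivative_inner_left has_derivative_at_withinI[OF deriv_F[OF qH]]) auto
      moreover have "(\<lambda>v. - (F q \<bullet> c) * (inverse (F q \<bullet> F p) * (fst (blinfun_apply (D2 q) v) \<bullet> F p) * inverse (F q \<bullet> F p))
          + (fst (blinfun_apply (D2 q) v) \<bullet> c) / (F q \<bullet> F p)) = (\<lambda>v. 0)"
        using pos[OF q] by (auto simp: G fun_eq_iff field_simps)
      ultimately show "(?z has_derivative (\<lambda>v. 0)) (at q within ball p r)" by simp
    qed (use q r in auto)
    then have "F q \<bullet> c = 0" using c pos[OF q] by (simp add: inner_commute)
    then show ?thesis by (simp add: inner_commute)
  qed
  note orth = this
  show ?thesis
  proof (rule that[OF r])
    show "F q \<noteq> 0" if "q \<in> ball p r" for q using pos[OF that] by auto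
  qed (rule orth)
qed

text \<open>Symmetry equates the derivative of F in the direction k, paired with F, with the
  derivative in the direction F, paired with k. The latter is a multiple of
  \<open>F p \<bullet> k\<close>, hence 0, so the factor \<open>G \<bullet> (k, 0)\<close>
  vanishes.\<close>

lemma deriv_F_orthogonal:
  assumes p: "p \<in> upper_half" and k: "k \<bullet> F p = 0" and Fp: "F p \<noteq> 0"
  shows "fst (blinfun_apply (D2 p) (k, 0)) = 0"
proof -
  obtain G where G: "\<And>v. fst (blinfun_apply (D2 p) v) = (G \<bullet> v) *\<^sub>R F p"
    using rank_one[OF p Fp] by blast
  have "blinfun_apply (D2 p) (k, 0) \<bullet> (F p, 0) = blinfun_apply (D2 p) (F p, 0) \<bullet> (k, 0)"
    by (rule gradient_derivative_symmetric[OF open_upper_half p grad_u deriv_D1[OF p]])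
  then have "fst (blinfun_apply (D2 p) (k, 0)) \<bullet> F p = fst (blinfun_apply (D2 p) (F p, 0)) \<bullet> k"
    by (simp add: inner_prod_def)
  then have "(G \<bullet> (k, 0)) * (F p \<bullet> F p) = 0"
    using k by (simp add: G inner_commute)
  then show ?thesis using Fp by (simp add: G)
qed

text \<open>Along the line, the parameters at which F has its initial value form a closed and open
  set: near such a parameter the direction of F is unchanged, k stays orthogonal to it, and F has
  derivative 0 along k.\<close>

lemma F_constant_on_orthogonal_hyperplane:
  assumes x: "0 < x" and Fp: "F (y, x) \<noteq> 0" and k: "k \<bullet> F (y, x) = 0"
  shows "F (y + k, x) = F (y, x)"
proof -
  let ?\<gamma> = "\<lambda>s. (y + s *\<^sub>R k, x)"
  have \<gamma>H: "?\<gamma> s \<in> upper_half" for s using x by simp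
  have \<gamma>d: "(?\<gamma> has_derivative (\<lambda>h. (h *\<^sub>R k, 0))) (at s within S)" for s S
    by (auto intro!: derivative_eq_intros)
  have Fd: "((\<lambda>s. F (?\<gamma> s)) has_derivative (\<lambda>h. fst (blinfun_apply (D2 (?\<gamma> s)) (h *\<^sub>R k, 0)))) (at s within S)" for s S
    using has_derivative_compose[OF \<gamma>d deriv_F[OF \<gamma>H]] by simp
  define T where "T = {s. F (?\<gamma> s) = F (y, x)}"
  have "closed T" unfolding T_def
  proof (rule closed_Collect_eq)
    show "continuous_on UNIV (\<lambda>s. F (?\<gamma> s))"
      using Fd by (auto intro!: has_derivative_continuous_on)
  qed auto
  moreover have "open T"
    unfolding open_contains_ball
  proof
    fix s0 assume s0: "s0 \<in> T"
    then have F0: "F (?\<gamma> s0) = F (y, x)" by (simp add: T_def)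
    obtain r where r: "r > 0" "\<And>q. q \<in> ball (?\<gamma> s0) r \<Longrightarrow> F q \<noteq> 0"
        "\<And>q c. q \<in> ball (?\<gamma> s0) r \<Longrightarrow> c \<bullet> F (?\<gamma> s0) = 0 \<Longrightarrow> c \<bullet> F q = 0"
      using direction_locally_constant[OF \<gamma>H, of s0] F0 Fp by metis
    define d where "d = r / (norm k + 1)"
    have d: "d > 0" using r by (simp add: d_def add_nonneg_pos)
    have inb: "?\<gamma> s \<in> ball (?\<gamma> s0) r" if "s \<in> ball s0 d" for s
    proof -
      have "dist (?\<gamma> s0) (?\<gamma> s) = \<bar>s0 - s\<bar> * norm k"
        by (simp add: dist_Pair_Pair dist_norm flip: scaleR_left_diff_distrib)
      also have "\<dots> \<le> \<bar>s0 - s\<bar> * (norm k + 1)" by (intro mult_left_mono) auto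
      also have "\<dots> < d * (norm k + 1)"
        using that by (intro mult_strict_right_mono) (auto simp: dist_real_def add_nonneg_pos)
      also have "\<dots> = r" by (simp add: d_def add_nonneg_eq_0_iff)
      finally show ?thesis by simp
    qed
    have "F (?\<gamma> s) = F (?\<gamma> s0)" if s: "s \<in> ball s0 d" for s
    proof (rule has_derivative_zero_unique[of "ball s0 d" "\<lambda>s. F (?\<gamma> s)"])
      fix q assume q: "q \<in> ball s0 d"
      have "k \<bullet> F (?\<gamma> q) = 0" using r(3)[OF inb[OF q]] k F0 by simp
      then have "fst (blinfun_apply (D2 (?\<gamma> q)) (k, 0)) = 0"
        using deriv_F_orthogonal[OF \<gamma>H] r(2)[OF inb[OF q]] by blast
      then have "fst (blinfun_apply (D2 (?\<gamma> q)) (h *\<^sub>R k, 0)) = 0" for h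
        using blinfun.scaleR_right[of "D2 (?\<gamma> q)" h "(k, 0)"] by simp
      then show "((\<lambda>s. F (?\<gamma> s)) has_derivative (\<lambda>h. 0)) (at q within ball s0 d)"
        using Fd[of q "ball s0 d"] by simp
    qed (use s d in auto)
    then show "\<exists>e>0. ball s0 e \<subseteq> T" using d F0 by (auto simp: T_def)
  qed
  moreover have "0 \<in> T" by (simp add: T_def)
  ultimately have "T = UNIV" using clopen[of T] by blast
  then have "1 \<in> T" by simp
  then show ?thesis by (simp add: T_def)
qed

lemma F_parallel_at_same_height:
  assumes x: "0 < x" and F1: "F (y1, x) \<noteq> 0" and c: "c \<bullet> F (y1, x) = 0"
  shows "c \<bullet> F (y2, x) = 0"
proof (rule ccontr)
  assume nz: "c \<bullet> F (y2, x) \<noteq> 0"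
  then have F2: "F (y2, x) \<noteq> 0" by auto
  \<comment> \<open>With this t the point y1 + t c lies in the hyperplane through y2 orthogonal to
    \<open>F (y2, x)\<close>. It also lies in the hyperplane of y1, as c is orthogonal to
    \<open>F (y1, x)\<close>, so the two values of F would agree.\<close>
  define t where "t = ((y2 - y1) \<bullet> F (y2, x)) / (c \<bullet> F (y2, x))"
  have "F (y1 + t *\<^sub>R c, x) = F (y1, x)"
    by (rule F_constant_on_orthogonal_hyperplane[OF x F1]) (simp add: c)
  moreover have "F (y2 + (y1 + t *\<^sub>R c - y2), x) = F (y2, x)"
    by (rule F_constant_on_orthogonal_hyperplane[OF x F2])
      (use nz in \<open>simp add: t_def inner_diff_left inner_add_left\<close>)
  ultimately show False using c nz by simp
qed

text \<open>\<open>dich\<close> provides a point with F \<noteq> 0 on every slice unless F vanishes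
  identically. Such a point carries the direction of F to neighbouring heights, and connectedness of
  the half-line does the rest. Once F is everywhere a multiple of one vector F0, u is constant along
  horizontal segments orthogonal to F0.\<close>

lemma one_dimensional:
  assumes dich: "\<And>x. 0 < x \<Longrightarrow> (\<And>y. F (y, x) = 0) \<Longrightarrow> (\<forall>p\<in>upper_half. F p = 0)"
  shows "\<exists>\<omega>::real ^ 'n. \<omega> \<in> sphere 0 1 \<and>
    (\<exists>u\<^sub>o :: real \<Rightarrow> real \<Rightarrow> real. \<forall>y x. x > 0 \<longrightarrow> u (y, x) = u\<^sub>o (\<omega> \<bullet> y) x)"
proof -
  have "\<exists>F0. F0 \<noteq> 0 \<and> (\<forall>p\<in>upper_half. \<forall>c. c \<bullet> F0 = 0 \<longrightarrow> c \<bullet> F p = 0)"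
  proof (cases "\<forall>p\<in>upper_half. F p = 0")
    case True
    \<comment> \<open>If F vanishes everywhere, any nonzero vector serves as the direction.\<close>
    have "axis undefined 1 \<noteq> (0 :: real ^ 'n)" by (simp add: axis_eq_0_iff)
    then show ?thesis using True by fastforce
  next
    case False
    then obtain y0 x0 where x0: "0 < x0" "F (y0, x0) \<noteq> 0" by (metis mem_upper_half surj_pair)
    have ex: "\<exists>y. F (y, x) \<noteq> 0" if "0 < x" for x using dich[OF that] False by blast
    \<comment> \<open>Heights where F is everywhere a multiple of its value at (y0, x0), expressed
      through orthogonal vectors so that F = 0 is allowed, and the complementary heights. Both sets
      are open.\<close>
    define A where "A = {x. 0 < x \<and> (\<forall>y c. c \<bullet> F (y0, x0) = 0 \<longrightarrow> c \<bullet> F (y, x) = 0)}"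
    define B where "B = {x. 0 < x \<and> (\<exists>y c. c \<bullet> F (y0, x0) = 0 \<and> c \<bullet> F (y, x) \<noteq> 0)}"
    have "open A" unfolding open_contains_ball
    proof
      fix x assume "x \<in> A"
      then have x: "0 < x" "\<And>y c. c \<bullet> F (y0, x0) = 0 \<Longrightarrow> c \<bullet> F (y, x) = 0" by (auto simp: A_def)
      obtain y where y: "F (y, x) \<noteq> 0" using ex[OF x(1)] by blast
      obtain r where r: "r > 0" "ball (y, x) r \<subseteq> upper_half" "\<And>q. q \<in> ball (y, x) r \<Longrightarrow> F q \<noteq> 0"
          "\<And>q c. q \<in> ball (y, x) r \<Longrightarrow> c \<bullet> F (y, x) = 0 \<Longrightarrow> c \<bullet> F q = 0"
        using direction_locally_constant[OF _ y] x(1) by (metis mem_upper_half)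
      have "x' \<in> A" if "x' \<in> ball x r" for x'
      proof -
        have q: "(y, x') \<in> ball (y, x) r" using that by (simp add: dist_Pair_Pair)
        then have "(y, x') \<in> upper_half" using r(2) by blast
        then have x': "0 < x'" by simp
        have "c \<bullet> F (y', x') = 0" if "c \<bullet> F (y0, x0) = 0" for y' c
          by (rule F_parallel_at_same_height[OF x' r(3)[OF q] r(4)[OF q x(2)[OF that]]])
        then show ?thesis using x' by (simp add: A_def)
      qed
      then show "\<exists>e>0. ball x e \<subseteq> A" using r(1) by blast
    qed
    moreover have "open B" unfolding open_contains_ball
    proof
      fix x assume "x \<in> B"
      then obtain y c where x: "0 < x" "c \<bullet> F (y0, x0) = 0" "c \<bullet> F (y, x) \<noteq> 0" by (auto simp: B_def)
      have "isCont (\<lambda>q. c \<bullet> F q) (y, x)" using x(1) by (intro continuous_inner cont_F continuous_const) auto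
      moreover have "isCont (\<lambda>x'. (y, x')) x" by (intro continuous_intros)
      ultimately have "isCont (\<lambda>x'. c \<bullet> F (y, x')) x" using isCont_o2[of x "\<lambda>x'. (y, x')"] by blast
      then have "\<forall>\<^sub>F x' in nhds x. c \<bullet> F (y, x') \<noteq> 0"
        using x(3) by (simp add: continuous_at_imp_continuous_at_within isCont_def tendsto_imp_eventually_ne eventually_nhds_conv_at)
      then obtain d where d: "d > 0" "\<And>x'. dist x' x < d \<Longrightarrow> c \<bullet> F (y, x') \<noteq> 0"
        by (auto simp: eventually_nhds_metric)
      have "x' \<in> B" if "x' \<in> ball x (min d x)" for x'
      proof -
        have "c \<bullet> F (y, x') \<noteq> 0" using d(2)[of x'] that by (simp add: dist_commute)
        moreover have "0 < x'" using that by (auto simp: dist_real_def)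
        ultimately show ?thesis using x(2) by (auto simp: B_def)
      qed
      then show "\<exists>e>0. ball x e \<subseteq> B" using d(1) x(1) by (intro exI[of _ "min d x"] conjI subsetI) auto
    qed
    moreover have "A \<inter> B \<inter> {0<..} = {}" "{0<..} \<subseteq> A \<union> B" by (auto simp: A_def B_def)
    ultimately have "A \<inter> {0<..} = {} \<or> B \<inter> {0<..} = {}"
      using connectedD[OF connected_Ioi] by blast
    moreover have "x0 \<in> A \<inter> {0<..}" using x0 F_parallel_at_same_height by (auto simp: A_def)
    ultimately have "B \<inter> {0<..} = {}" by blast
    then have "F p \<bullet> c = 0" if "p \<in> upper_half" "c \<bullet> F (y0, x0) = 0" for p c
      using that by (cases p) (force simp: B_def inner_commute)
    then show ?thesis using x0(2) by (metis inner_commute)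
  qed
  then obtain F0 where F0: "F0 \<noteq> 0" "\<And>p c. p \<in> upper_half \<Longrightarrow> c \<bullet> F0 = 0 \<Longrightarrow> c \<bullet> F p = 0" by blast
  have const: "u (y, x) = u (y', x)" if x: "0 < x" and c: "(y' - y) \<bullet> F0 = 0" for y y' x
  proof -
    let ?\<gamma> = "\<lambda>s. (y + s *\<^sub>R (y' - y), x)"
    have "u (?\<gamma> 0) = u (?\<gamma> 1)"
    proof (rule has_derivative_zero_unique[of "UNIV :: real set" "\<lambda>s. u (?\<gamma> s)"])
      fix s :: real
      have "(?\<gamma> has_derivative (\<lambda>h. (h *\<^sub>R (y' - y), 0))) (at s)"
        by (auto intro!: derivative_eq_intros)
      moreover have "(u has_derivative (\<lambda>h. h \<bullet> D1 (?\<gamma> s))) (at (?\<gamma> s))"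
        using grad_u[of "?\<gamma> s"] x by (simp add: gderiv_def)
      ultimately have "((\<lambda>s. u (?\<gamma> s)) has_derivative (\<lambda>h. (h *\<^sub>R (y' - y), 0) \<bullet> D1 (?\<gamma> s))) (at s)"
        by (rule has_derivative_compose)
      moreover have "(h *\<^sub>R (y' - y), 0) \<bullet> D1 (?\<gamma> s) = 0" for h
        using F0(2)[of "?\<gamma> s" "y' - y"] x c by (simp add: inner_prod_def)
      ultimately show "((\<lambda>s. u (?\<gamma> s)) has_derivative (\<lambda>h. 0)) (at s)" by simp
    qed auto
    then show ?thesis by simp
  qed
  define \<omega> where "\<omega> = F0 /\<^sub>R norm F0"
  \<comment> \<open>y and its projection to the line spanned by \<open>\<omega>\<close> differ by a
    vector orthogonal to F0.\<close>
  have eq: "u (y, x) = u ((\<omega> \<bullet> y) *\<^sub>R \<omega>, x)" if "0 < x" for y x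
  proof (rule const[OF that])
    have "\<omega> \<bullet> F0 = norm F0" using F0(1) by (simp add: \<omega>_def dot_square_norm power2_eq_square)
    moreover have "(\<omega> \<bullet> y) * norm F0 = y \<bullet> F0" using F0(1) by (simp add: \<omega>_def inner_commute)
    ultimately show "((\<omega> \<bullet> y) *\<^sub>R \<omega> - y) \<bullet> F0 = 0"
      by (simp add: inner_diff_left)
  qed
  show ?thesis
  proof (rule exI[of _ \<omega>], rule conjI)
    show "\<omega> \<in> sphere 0 1" using F0(1) by (simp add: \<omega>_def)
    show "\<exists>u\<^sub>o. \<forall>y x. 0 < x \<longrightarrow> u (y, x) = u\<^sub>o (\<omega> \<bullet> y) x"
      by (rule exI[of _ "\<lambda>s x. u (s *\<^sub>R \<omega>, x)"]) (intro allI impI eq)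
  qed
qed

end

section \<open>Cutoff functions\<close>

lemma measurable_plus_lebesgue: "(+) c \<in> lebesgue \<rightarrow>\<^sub>M (lebesgue :: 'a::euclidean_space measure)"
proof (rule measurableI)
  fix A :: "'a set" assume "A \<in> sets lebesgue"
  moreover have "(+) c -` A = (+) (- c) ` A"
    by (auto simp: image_iff) (metis add.commute diff_add_cancel uminus_add_conv_diff)
  ultimately show "(+) c -` A \<inter> space lebesgue \<in> sets lebesgue"
    using lebesgue_sets_translation[of A "- c"] by (simp add: add.commute)
qed auto

lemma distr_lebesgue_plus: "distr lebesgue lebesgue ((+) c) = (lebesgue :: 'a::euclidean_space measure)"
proof (rule measure_eqI)
  fix A :: "'a set" assume "A \<in> sets (distr lebesgue lebesgue ((+) c))"
  then have A: "A \<in> sets lebesgue" by simp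
  have eq: "(+) c -` A = (\<lambda>x. 1 *\<^sub>R x + - c) ` A"
    by (auto simp: image_iff) (metis add.commute diff_add_cancel uminus_add_conv_diff)
  have "emeasure (distr lebesgue lebesgue ((+) c)) A = emeasure lebesgue ((+) c -` A)"
    using A by (subst emeasure_distr[OF measurable_plus_lebesgue]) auto
  also have "\<dots> = emeasure lebesgue A"
    unfolding eq by (subst emeasure_lebesgue_affine) simp
  finally show "emeasure (distr lebesgue lebesgue ((+) c)) A = emeasure lebesgue A" .
qed simp

lemma null_sets_snd_vimage:
  assumes "N \<in> null_sets (lborel :: 'b::euclidean_space measure)"
  shows "(snd :: 'a::euclidean_space \<times> 'b \<Rightarrow> 'b) -` N \<in> null_sets lborel"
proof -
  have N: "N \<in> sets borel" "emeasure lborel N = 0" using assms by auto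
  have eq: "(snd :: 'a \<times> 'b \<Rightarrow> 'b) -` N = UNIV \<times> N" by auto
  have "emeasure (lborel :: ('a \<times> 'b) measure) (UNIV \<times> N) = emeasure (lborel :: 'a measure) UNIV * emeasure lborel N"
    unfolding lborel_prod[symmetric] using N by (intro lborel.emeasure_pair_measure_Times) auto
  then show ?thesis using N by (auto simp: eq null_sets_def borel_Times)
qed

text \<open>Preimages of Borel sets are Borel, and the preimage of a null set lies in a Borel null
  cylinder. The weight \<open>\<mu>\<close> is only Lebesgue measurable, so Borel measurability of
  \<open>snd\<close> would not allow composition with it.\<close>

lemma measurable_snd_lebesgue:
  "(snd :: 'a::euclidean_space \<times> 'b::euclidean_space \<Rightarrow> 'b) \<in> lebesgue \<rightarrow>\<^sub>M lebesgue"
proof (rule measurableI)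
  fix A :: "'b set" assume "A \<in> sets lebesgue"
  then obtain S N N' where A: "A = S \<union> N" "N \<subseteq> N'" "N' \<in> null_sets lborel" "S \<in> sets lborel"
    by (rule sets_completionE)
  have "(snd :: 'a \<times> 'b \<Rightarrow> 'b) -` S \<in> sets borel"
    using A(4) measurable_sets[of "snd :: 'a \<times> 'b \<Rightarrow> 'b" borel borel S]
    by (simp add: borel_measurable_continuous_onI continuous_on_snd)
  then have "(snd :: 'a \<times> 'b \<Rightarrow> 'b) -` A \<in> sets (completion lborel)"
    using A by (intro sets_completionI[OF _ _ null_sets_snd_vimage[OF A(3)]]) auto
  then show "(snd :: 'a \<times> 'b \<Rightarrow> 'b) -` A \<inter> space lebesgue \<in> sets lebesgue" by simp
qed auto

lemma AE_lebesgue_snd: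
  assumes "AE x in lebesgue. P (x :: 'b::euclidean_space)"
  shows "AE p in (lebesgue :: ('a::euclidean_space \<times> 'b) measure). P (snd p)"
proof -
  obtain N where "N \<in> null_sets lborel" "{x. \<not> P x} \<subseteq> N"
    using assms by (auto simp: AE_lebesgue_iff_negligible negligible_iff_null_sets null_sets_completion_iff2)
  then have "{p :: 'a \<times> 'b. \<not> P (snd p)} \<subseteq> snd -` N" "(snd :: 'a \<times> 'b \<Rightarrow> 'b) -` N \<in> null_sets lborel"
    using null_sets_snd_vimage by auto
  then show ?thesis
    unfolding AE_lebesgue_iff_negligible negligible_iff_null_sets null_sets_completion_iff2 by blast
qed

text \<open>The exceptional set must be jointly measurable, since its slices alone do not determine
  its measure. Its Borel part is handled by Tonelli, and the rest is covered by a Borel null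
  set.\<close>

lemma AE_lebesgue_prodI:
  fixes P :: "'a::euclidean_space \<times> 'b::euclidean_space \<Rightarrow> bool"
  assumes meas: "{p. \<not> P p} \<in> sets lebesgue"
    and slices: "\<And>x. AE y in lebesgue. P (y, x)"
  shows "AE p in lebesgue. P p"
proof -
  obtain S N N' where B: "{p. \<not> P p} = S \<union> N" "N \<subseteq> N'" "N' \<in> null_sets lborel" "S \<in> sets lborel"
    using meas by (rule sets_completionE)
  have S: "S \<in> sets (lborel \<Otimes>\<^sub>M lborel)" using B(4) by (simp only: lborel_prod)
  have "emeasure lborel ((\<lambda>y. (y, x)) -` S) = 0" for x
  proof -
    have "(\<lambda>y. (y, x)) -` S \<in> sets lborel" using S by (rule sets_Pair2)
    moreover have "negligible ((\<lambda>y. (y, x)) -` S)"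
      using slices[of x] B(1) unfolding AE_lebesgue_iff_negligible by (elim negligible_subset) auto
    ultimately show ?thesis
      by (simp add: negligible_iff_null_sets null_sets_completion_iff null_setsD1)
  qed
  then have "emeasure (lborel \<Otimes>\<^sub>M lborel) S = 0"
    using lborel_pair.emeasure_pair_measure_alt2[OF S] by simp
  then have "S \<in> null_sets lborel" using B(4) by (simp add: lborel_prod null_sets_def)
  then have "S \<union> N' \<in> null_sets lborel" using B(3) by (rule null_sets.Un)
  then show ?thesis
    unfolding AE_lebesgue_iff_negligible negligible_iff_null_sets null_sets_completion_iff2 B(1)
    using B(2) by blast
qed

text \<open>One-sided Lebesgue differentiation is applied to the integrand extended by 0 and to its
  reflection; together they give the two-sided derivative.\<close>

lemma AE_has_real_derivative_integral:
  fixes k :: "real \<Rightarrow> real"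
  assumes int: "k integrable_on {a..b}"
  shows "AE x in lebesgue. a < x \<and> x < b \<longrightarrow> ((\<lambda>x. integral {a..x} k) has_real_derivative k x) (at x)"
proof -
  define K where "K x = (if x \<in> {a..b} then k x else 0)" for x
  have K: "K integrable_on UNIV" unfolding K_def using int integrable_restrict_UNIV[of "{a..b}" k] by simp
  have Kc: "K integrable_on cbox c d" for c d
    using integrable_on_subcbox[OF K, of c d] by simp
  have Kr: "(\<lambda>x. K (- x)) integrable_on cbox c d" for c d
    using Kc[of "- d" "- c"] Henstock_Kurzweil_Integration.integrable_reflect_real[where f=K and a="- d" and b="- c"] by simp
  obtain N where N: "negligible N" "\<And>x e. x \<notin> N \<Longrightarrow> 0 < e \<Longrightarrow>
      \<exists>d>0. \<forall>h. 0 < h \<and> h < d \<longrightarrow> norm (integral (cbox x (x + h *\<^sub>R One)) K /\<^sub>R h ^ DIM(real) - K x) < e"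
    using integrable_ccontinuous_explicit[of K, OF Kc] by metis
  obtain N' where N': "negligible N'" "\<And>x e. x \<notin> N' \<Longrightarrow> 0 < e \<Longrightarrow>
      \<exists>d>0. \<forall>h. 0 < h \<and> h < d \<longrightarrow> norm (integral (cbox x (x + h *\<^sub>R One)) (\<lambda>x. K (- x)) /\<^sub>R h ^ DIM(real) - K (- x)) < e"
    using integrable_ccontinuous_explicit[of "\<lambda>x. K (- x)", OF Kr] by metis
  have "negligible (N \<union> uminus ` N')"
    using N(1) negligible_differentiable_image_negligible[OF order_refl N'(1), of uminus]
    by (auto intro: derivative_intros)
  moreover have "((\<lambda>x. integral {a..x} k) has_real_derivative k x) (at x)"
    if x: "x \<notin> N \<union> uminus ` N'" "a < x" "x < b" for x
  proof -
    have xN: "x \<notin> N" "- x \<notin> N'" using x(1) by (auto simp: image_iff)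
    have T: "integral {a..d} k - integral {a..c} k = integral {c..d} K" if "a \<le> c" "c \<le> d" "d \<le> b" for c d
    proof -
      have "k integrable_on {a..d}" using that by (intro integrable_on_subinterval[OF int]) auto
      then have "integral {a..c} k + integral {c..d} k = integral {a..d} k"
        using that by (intro Henstock_Kurzweil_Integration.integral_combine) auto
      moreover have "integral {c..d} k = integral {c..d} K"
        using that by (intro Henstock_Kurzweil_Integration.integral_cong) (auto simp: K_def)
      ultimately show ?thesis by simp
    qed
    have Kx: "K x = k x" using x by (simp add: K_def)
    have "\<exists>d>0. \<forall>y. norm (y - x) < d \<longrightarrow>
      norm (integral {a..y} k - integral {a..x} k - k x * (y - x)) \<le> e * norm (y - x)" if e: "e > 0" for e
    proof -
      obtain d1 where d1: "d1 > 0" "\<And>h. 0 < h \<Longrightarrow> h < d1 \<Longrightarrow> norm (integral {x..x + h} K / h - k x) < e"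
        using N(2)[OF xN(1) e] by (auto simp: Kx divide_inverse mult.commute)
      obtain d2 where d2: "d2 > 0" "\<And>h. 0 < h \<Longrightarrow> h < d2 \<Longrightarrow> norm (integral {- x..- x + h} (\<lambda>x. K (- x)) / h - k x) < e"
        using N'(2)[OF xN(2) e] by (auto simp: Kx divide_inverse mult.commute)
      define d where "d = min (min d1 d2) (min (x - a) (b - x))"
      have d: "d > 0" using d1 d2 x by (simp add: d_def)
      have scale: "norm (I - k x * h) \<le> e * h" if "norm (I / h - k x) < e" "0 < h" for I h :: real
      proof -
        have "I - k x * h = (I / h - k x) * h" using that(2) by (simp add: left_diff_distrib)
        then have "norm (I - k x * h) = norm (I / h - k x) * h"
          using that(2) by (simp only: norm_mult) simp
        then show ?thesis using that by (simp add: mult_right_mono)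
      qed
      have "norm (integral {a..y} k - integral {a..x} k - k x * (y - x)) \<le> e * norm (y - x)"
        if y: "norm (y - x) < d" for y
      proof (cases y x rule: linorder_cases)
        case greater
        have "integral {a..y} k - integral {a..x} k = integral {x..y} K"
          using T[of x y] greater y x by (auto simp: d_def)
        then show ?thesis using scale[OF d1(2)[of "y - x"]] greater y by (simp add: d_def)
      next
        case less
        have "integral {a..x} k - integral {a..y} k = integral {y..x} K"
          using T[of y x] less y x by (auto simp: d_def)
        also have "\<dots> = integral {- x..- y} (\<lambda>x. K (- x))"
          by (simp add: integral_reflect_real)
        finally have "norm ((integral {a..x} k - integral {a..y} k) - k x * (x - y)) \<le> e * (x - y)"
          using scale[OF d2(2)[of "x - y"]] less y by (simp add: d_def)
        moreover have "integral {a..y} k - integral {a..x} k - k x * (y - x)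
            = - ((integral {a..x} k - integral {a..y} k) - k x * (x - y))" by (simp add: algebra_simps)
        ultimately show ?thesis using less by (simp only: norm_minus_cancel) simp
      qed simp
      then show ?thesis using d by blast
    qed
    then show ?thesis
      unfolding has_field_derivative_def has_derivative_at_alt by (simp add: bounded_linear_mult_right)
  qed
  ultimately show ?thesis
    unfolding AE_lebesgue_iff_negligible by (elim negligible_subset) auto
qed

section \<open>Calculus of gradients and locally Lipschitz functions\<close>

lemma locally_lipschitz_on_C1:
  fixes f :: "'a::euclidean_space \<Rightarrow> real"
  assumes S: "open S" and grad: "\<And>p. p \<in> S \<Longrightarrow> GDERIV f p :> G p" and G: "continuous_on S G"
  shows "locally_lipschitz_on S f"
  unfolding locally_lipschitz_on_def
proof
  fix p assume "p \<in> S"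
  then obtain r where r: "r > 0" "cball p r \<subseteq> S" using S open_contains_cball by blast
  have "bounded (G ` cball p r)"
    using continuous_on_subset[OF G r(2)] by (intro compact_imp_bounded compact_continuous_image) auto
  then obtain B where "\<forall>x\<in>G ` cball p r. norm x \<le> B"
    unfolding bounded_iff ..
  then have B: "norm (G q) \<le> B" if "q \<in> cball p r" for q using that by blast
  have "B-lipschitz_on (cball p r) f"
  proof (rule bounded_derivative_imp_lipschitz[where f'="\<lambda>q h. h \<bullet> G q"])
    fix q assume q: "q \<in> cball p r"
    have "q \<in> S" using q r(2) by blast
    then show "(f has_derivative (\<lambda>h. h \<bullet> G q)) (at q within cball p r)"
      using grad[unfolded gderiv_def] by (blast intro: has_derivative_at_withinI)
    show "onorm (\<lambda>h. h \<bullet> G q) \<le> B"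
    proof (rule onorm_le)
      fix h show "norm (h \<bullet> G q) \<le> B * norm h"
        using Cauchy_Schwarz_ineq2[of h "G q"] mult_right_mono[OF B[OF q], of "norm h"] by (simp add: mult.commute)
    qed
  next
    have "norm (G p) \<le> B" using r(1) by (intro B) simp
    then show "0 \<le> B" using norm_ge_zero order_trans by blast
  qed auto
  then show "\<exists>r>0. \<exists>L. L-lipschitz_on (cball p r \<inter> S) f"
    using r by (intro exI[of _ r] exI[of _ B] conjI) (simp_all add: Int_absorb2)
qed

lemma locally_lipschitz_on_add:
  assumes "locally_lipschitz_on S f" "locally_lipschitz_on S g"
  shows "locally_lipschitz_on S (\<lambda>p. f p + g p)"
  unfolding locally_lipschitz_on_def
proof
  fix p assume p: "p \<in> S"
  obtain r1 L1 r2 L2 where *: "r1 > 0" "L1-lipschitz_on (cball p r1 \<inter> S) f" "r2 > 0" "L2-lipschitz_on (cball p r2 \<inter> S) g"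
    using assms p unfolding locally_lipschitz_on_def by metis
  have "(L1 + L2)-lipschitz_on (cball p (min r1 r2) \<inter> S) (\<lambda>p. f p + g p)"
    by (rule lipschitz_on_add) (rule lipschitz_on_subset[OF *(2)] lipschitz_on_subset[OF *(4)]; auto)+
  then show "\<exists>r>0. \<exists>L. L-lipschitz_on (cball p r \<inter> S) (\<lambda>p. f p + g p)"
    using *(1,3) by (metis min_less_iff_conj)
qed

lemma locally_lipschitz_on_mult:
  assumes "locally_lipschitz_on S f" "locally_lipschitz_on S g"
  shows "locally_lipschitz_on S (\<lambda>p. f p * g p)"
  unfolding locally_lipschitz_on_def
proof
  fix p assume p: "p \<in> S"
  obtain r1 L1 r2 L2 where *: "r1 > 0" "L1-lipschitz_on (cball p r1 \<inter> S) f" "r2 > 0" "L2-lipschitz_on (cball p r2 \<inter> S) g"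
    using assms p unfolding locally_lipschitz_on_def by metis
  define r where "r = min r1 r2"
  have L: "0 \<le> L1" "0 \<le> L2" using *(2,4) lipschitz_on_nonneg by auto
  have f: "L1-lipschitz_on (cball p r \<inter> S) f" and g: "L2-lipschitz_on (cball p r \<inter> S) g"
    by (rule lipschitz_on_subset[OF *(2)] lipschitz_on_subset[OF *(4)]; auto simp: r_def)+
  define A where "A = \<bar>f p\<bar> + L1 * r"
  define B where "B = \<bar>g p\<bar> + L2 * r"
  have r: "r > 0" using * by (simp add: r_def)
  have AB: "0 \<le> A" "0 \<le> B" using L r by (auto simp: A_def B_def)
  have fA: "\<bar>f q\<bar> \<le> A" if "q \<in> cball p r \<inter> S" for q
  proof -
    have "dist (f q) (f p) \<le> L1 * dist q p" using that p r by (intro lipschitz_onD[OF f]) auto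
    also have "\<dots> \<le> L1 * r" using that L by (intro mult_left_mono) (auto simp: dist_commute)
    finally show ?thesis by (simp add: A_def dist_real_def)
  qed
  have gB: "\<bar>g q\<bar> \<le> B" if "q \<in> cball p r \<inter> S" for q
  proof -
    have "dist (g q) (g p) \<le> L2 * dist q p" using that p r by (intro lipschitz_onD[OF g]) auto
    also have "\<dots> \<le> L2 * r" using that L by (intro mult_left_mono) (auto simp: dist_commute)
    finally show ?thesis by (simp add: B_def dist_real_def)
  qed
  have "(A * L2 + B * L1)-lipschitz_on (cball p r \<inter> S) (\<lambda>p. f p * g p)"
  proof (rule lipschitz_onI)
    fix x y assume x: "x \<in> cball p r \<inter> S" and y: "y \<in> cball p r \<inter> S"
    have "\<bar>f x * g x - f y * g y\<bar> = \<bar>f x * (g x - g y) + g y * (f x - f y)\<bar>" by (simp add: algebra_simps)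
    also have "\<dots> \<le> \<bar>f x\<bar> * \<bar>g x - g y\<bar> + \<bar>g y\<bar> * \<bar>f x - f y\<bar>" by (metis abs_mult abs_triangle_ineq)
    also have "\<dots> \<le> A * (L2 * dist x y) + B * (L1 * dist x y)"
      using fA[OF x] gB[OF y] lipschitz_onD[OF f x y] lipschitz_onD[OF g x y] AB
      by (intro add_mono mult_mono) (auto simp: dist_real_def)
    finally show "dist (f x * g x) (f y * g y) \<le> (A * L2 + B * L1) * dist x y"
      by (simp add: dist_real_def algebra_simps)
  qed (use AB L in auto)
  then show "\<exists>r>0. \<exists>L. L-lipschitz_on (cball p r \<inter> S) (\<lambda>p. f p * g p)"
    using r by blast
qed

lemma GDERIV_sum: "(\<And>i. i \<in> I \<Longrightarrow> GDERIV (f i) x :> D i) \<Longrightarrow> GDERIV (\<lambda>x. \<Sum>i\<in>I. f i x) x :> (\<Sum>i\<in>I. D i)"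
  unfolding gderiv_def inner_sum_right by (rule has_derivative_sum)

lemma GDERIV_norm_power2: "GDERIV (\<lambda>x. (norm x)\<^sup>2) x :> 2 *\<^sub>R x"
  unfolding gderiv_def power2_norm_eq_inner
  by (auto intro!: derivative_eq_intros simp: inner_commute)

lemma GDERIV_translate: "GDERIV (\<lambda>x. f (x + c)) p :> D \<longleftrightarrow> GDERIV f (p + c) :> D"
proof
  assume "GDERIV f (p + c) :> D"
  moreover have "((\<lambda>x. x + c) has_derivative (\<lambda>h. h)) (at p)" by (auto intro!: derivative_eq_intros)
  ultimately show "GDERIV (\<lambda>x. f (x + c)) p :> D" unfolding gderiv_def
    using has_derivative_compose[of "\<lambda>x. x + c" "\<lambda>h. h" p UNIV f "\<lambda>h. h \<bullet> D"] by simp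
next
  assume "GDERIV (\<lambda>x. f (x + c)) p :> D"
  moreover have "((\<lambda>x. x - c) has_derivative (\<lambda>h. h)) (at (p + c))" by (auto intro!: derivative_eq_intros)
  ultimately show "GDERIV f (p + c) :> D" unfolding gderiv_def
    using has_derivative_compose[of "\<lambda>x. x - c" "\<lambda>h. h" "p + c" UNIV "\<lambda>x. f (x + c)" "\<lambda>h. h \<bullet> D"] by simp
qed

lemma DERIV_max_zero_power2: "((\<lambda>t::real. (max 0 t)\<^sup>2) has_real_derivative 2 * max 0 t) (at t)"
proof (cases t "0 :: real" rule: linorder_cases)
  case less
  then have "((\<lambda>t::real. 0) has_real_derivative 2 * max 0 t) (at t)" by simp
  then show ?thesis
    by (rule has_field_derivative_transform_within_open[of _ _ _ "{..<0}"]) (use less in auto)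
next
  case greater
  then have "((\<lambda>t::real. t\<^sup>2) has_real_derivative 2 * max 0 t) (at t)" by (auto intro!: derivative_eq_intros)
  then show ?thesis
    by (rule has_field_derivative_transform_within_open[of _ _ _ "{0<..}"]) (use greater in auto)
next
  case equal
  have "norm ((max 0 y)\<^sup>2) \<le> e * norm y" if "norm y < e" for e y :: real
  proof -
    have "\<bar>y\<bar> * \<bar>y\<bar> \<le> e * \<bar>y\<bar>" using that by (intro mult_right_mono) auto
    moreover have "0 \<le> e * \<bar>y\<bar>" using that by (intro mult_nonneg_nonneg) (auto intro: order_trans[OF abs_ge_zero])
    ultimately show ?thesis by (cases "y \<ge> 0") (auto simp: power2_eq_square max_def)
  qed
  then have "\<forall>e>0. \<exists>d>0. \<forall>y. norm (y - 0) < d \<longrightarrow> norm ((max 0 y)\<^sup>2 - (max 0 0)\<^sup>2 - 0 * (y - 0)) \<le> e * norm (y - (0::real))"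
    by (intro allI impI) (metis diff_zero mult_zero_left max.idem power_zero_numeral)
  then have "((\<lambda>t::real. (max 0 t)\<^sup>2) has_derivative (*) 0) (at 0)"
    unfolding has_derivative_at_alt by (auto simp: bounded_linear_mult_right)
  then show ?thesis using equal by (simp add: has_field_derivative_def)
qed



text \<open>A C^1 profile that is 1 for t \<le> 1 and 0 for t \<ge> 2: squaring both positive parts
  removes the kinks and leaves an explicit bounded derivative.\<close>

definition bump :: "real \<Rightarrow> real" where
  "bump t = (max 0 (1 - (max 0 (t - 1))\<^sup>2))\<^sup>2"

definition bump' :: "real \<Rightarrow> real" where
  "bump' t = 2 * max 0 (1 - (max 0 (t - 1))\<^sup>2) * - (2 * max 0 (t - 1))"

lemma DERIV_bump: "(bump has_real_derivative bump' t) (at t)"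
proof -
  have "((\<lambda>t. t - 1) has_real_derivative 1) (at t)" by (auto intro!: derivative_eq_intros)
  from DERIV_chain2[OF DERIV_max_zero_power2 this]
  have "((\<lambda>t. 1 - (max 0 (t - 1))\<^sup>2) has_real_derivative - (2 * max 0 (t - 1))) (at t)"
    by (intro DERIV_cong[OF DERIV_diff[OF DERIV_const]]) auto
  from DERIV_chain2[OF DERIV_max_zero_power2 this] show ?thesis
    unfolding bump_def[abs_def] bump'_def .
qed

lemma continuous_on_bump': "continuous_on UNIV bump'"
  unfolding bump'_def by (intro continuous_intros)

lemma bump_nonneg: "0 \<le> bump t" by (simp add: bump_def)

lemma bump_le_1: "bump t \<le> 1"
  unfolding bump_def by (intro power_le_one) auto

lemma bump_eq_1: "t \<le> 1 \<Longrightarrow> bump t = 1"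
  by (simp add: bump_def max_absorb1)

lemma max_zero_bump: "2 \<le> t \<Longrightarrow> max 0 (1 - (max 0 (t - 1))\<^sup>2) = (0::real)"
  using power_mono[of 1 "t - 1" 2] by (intro max_absorb1) simp

lemma bump_eq_0: "2 \<le> t \<Longrightarrow> bump t = 0"
  by (simp add: bump_def max_zero_bump)

lemma bump'_eq_0: "t \<le> 1 \<or> 2 \<le> t \<Longrightarrow> bump' t = 0"
  by (auto simp: bump'_def max_zero_bump)

lemma bump'_bound: "\<bar>bump' t\<bar> \<le> 4"
proof (cases "t \<le> 1 \<or> 2 \<le> t")
  case False
  then have "max 0 (t - 1) \<le> 1" "max 0 (1 - (max 0 (t - 1))\<^sup>2) \<le> 1" by auto
  then have "2 * max 0 (1 - (max 0 (t - 1))\<^sup>2) * (2 * max 0 (t - 1)) \<le> 2 * 1 * (2 * 1)"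
    by (intro mult_mono) auto
  then show ?thesis by (simp add: bump'_def abs_mult)
qed (simp add: bump'_eq_0)

text \<open>A logarithmic cutoff: an average of dyadic bumps whose gradients have disjoint supports, so
  that quadratic energy growth makes its weighted Dirichlet energy of order \<open>1/N\<close>.\<close>

definition cutoff :: "nat \<Rightarrow> 'a::real_inner \<Rightarrow> real" where
  "cutoff N p = (\<Sum>k\<in>{N..<2 * N}. bump ((norm p)\<^sup>2 / 4 ^ k)) / real N"

definition cutoff_grad :: "nat \<Rightarrow> 'a::real_inner \<Rightarrow> 'a" where
  "cutoff_grad N p = ((\<Sum>k\<in>{N..<2 * N}. bump' ((norm p)\<^sup>2 / 4 ^ k) * (2 / 4 ^ k)) / real N) *\<^sub>R p"

lemma GDERIV_cutoff: "GDERIV (cutoff N) p :> cutoff_grad N p"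
proof -
  have "GDERIV (\<lambda>p. bump ((norm p)\<^sup>2 / 4 ^ k)) p :> (bump' ((norm p)\<^sup>2 / 4 ^ k) * (2 / 4 ^ k)) *\<^sub>R p" for k
  proof -
    have "((\<lambda>t. t / 4 ^ k) has_real_derivative 1 / 4 ^ k) (at ((norm p)\<^sup>2))"
      by (rule DERIV_cdivide[OF DERIV_ident])
    from DERIV_chain2[OF DERIV_bump this]
    have "((\<lambda>t. bump (t / 4 ^ k)) has_real_derivative bump' ((norm p)\<^sup>2 / 4 ^ k) * (1 / 4 ^ k)) (at ((norm p)\<^sup>2))" .
    from GDERIV_DERIV_compose[OF GDERIV_norm_power2 this] show ?thesis by (simp add: mult.commute)
  qed
  then have "GDERIV (\<lambda>p. \<Sum>k\<in>{N..<2 * N}. bump ((norm p)\<^sup>2 / 4 ^ k)) p :>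
      (\<Sum>k\<in>{N..<2 * N}. (bump' ((norm p)\<^sup>2 / 4 ^ k) * (2 / 4 ^ k)) *\<^sub>R p)" by (rule GDERIV_sum)
  moreover have "((\<lambda>t. t / real N) has_real_derivative 1 / real N) (at t)" for t
    by (rule DERIV_cdivide[OF DERIV_ident])
  ultimately have "GDERIV (\<lambda>p. (\<Sum>k\<in>{N..<2 * N}. bump ((norm p)\<^sup>2 / 4 ^ k)) / real N) p :>
      (1 / real N) *\<^sub>R (\<Sum>k\<in>{N..<2 * N}. (bump' ((norm p)\<^sup>2 / 4 ^ k) * (2 / 4 ^ k)) *\<^sub>R p)"
    by (rule GDERIV_DERIV_compose)
  moreover have "(1 / real N) *\<^sub>R (\<Sum>k\<in>{N..<2 * N}. (bump' ((norm p)\<^sup>2 / 4 ^ k) * (2 / 4 ^ k)) *\<^sub>R p) = cutoff_grad N p"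
    unfolding cutoff_grad_def scaleR_left.sum[symmetric]
    unfolding scaleR_scaleR times_divide_eq_left mult_1_left ..
  ultimately show ?thesis unfolding cutoff_def[abs_def] by simp
qed

lemma continuous_on_cutoff_grad: "continuous_on UNIV (cutoff_grad N)"
  unfolding cutoff_grad_def divide_inverse
  by (intro continuous_on_scaleR continuous_on_mult continuous_on_sum continuous_on_const continuous_on_id
      continuous_on_power continuous_on_norm continuous_on_compose2[OF continuous_on_bump']) auto

lemma cutoff_nonneg: "0 \<le> cutoff N p"
  unfolding cutoff_def by (intro divide_nonneg_nonneg sum_nonneg bump_nonneg) auto

lemma cutoff_le_1: "cutoff N p \<le> 1"
proof (cases "N = 0")
  case False
  have "(\<Sum>k\<in>{N..<2 * N}. bump ((norm p)\<^sup>2 / 4 ^ k)) \<le> (\<Sum>k\<in>{N..<2 * N}. 1)"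
    by (intro sum_mono bump_le_1)
  then show ?thesis using False by (simp add: cutoff_def divide_le_eq)
qed (simp add: cutoff_def)

lemma power2_le_iff_norm_le: "(norm p)\<^sup>2 \<le> 4 ^ k \<longleftrightarrow> norm p \<le> 2 ^ k"
proof -
  have "(4::real) ^ k = (2 ^ k)\<^sup>2" by (simp add: power_mult[symmetric] mult.commute[of _ 2] power_mult)
  then show ?thesis by (simp add: abs_le_square_iff[symmetric])
qed

lemma cutoff_eq_1:
  assumes "norm p \<le> 2 ^ N" "0 < N"
  shows "cutoff N p = 1"
proof -
  have "bump ((norm p)\<^sup>2 / 4 ^ k) = 1" if "k \<in> {N..<2 * N}" for k
  proof (rule bump_eq_1)
    have "norm p \<le> 2 ^ k" using assms(1) that power_increasing[of N k "2::real"]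
      by (intro order_trans[OF assms(1)]) auto
    then show "(norm p)\<^sup>2 / 4 ^ k \<le> 1" by (simp add: divide_le_eq power2_le_iff_norm_le)
  qed
  then show ?thesis using assms(2) by (simp add: cutoff_def)
qed

lemma cutoff_large:
  assumes "2 ^ (2 * N) \<le> norm p"
  shows "cutoff N p = 0" "cutoff_grad N p = 0"
proof -
  have "2 \<le> (norm p)\<^sup>2 / 4 ^ k" if "k \<in> {N..<2 * N}" for k
  proof -
    have "2 ^ (Suc k) \<le> norm p" using that power_increasing[of "Suc k" "2 * N" "2::real"]
      by (intro order_trans[OF _ assms]) auto
    then have "(2 ^ (Suc k))\<^sup>2 \<le> (norm p)\<^sup>2" by (intro power_mono) auto
    moreover have "((2::real) ^ (Suc k))\<^sup>2 = 4 * 4 ^ k"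
      by (simp add: power2_eq_square power_mult_distrib[symmetric])
    ultimately have "2 * 4 ^ k \<le> (norm p)\<^sup>2" using zero_le_power[of "4::real" k] by linarith
    then show ?thesis by (simp add: le_divide_eq)
  qed
  then show "cutoff N p = 0" "cutoff_grad N p = 0"
    by (auto simp: cutoff_def cutoff_grad_def bump_eq_0 bump'_eq_0)
qed

lemma norm_cutoff_grad:
  "(norm (cutoff_grad N p))\<^sup>2 \<le> (\<Sum>k\<in>{N..<2 * N}. 128 / 4 ^ k * indicator (ball 0 (2 ^ (Suc k))) p) / (real N)\<^sup>2"
proof -
  define c where "c k = bump' ((norm p)\<^sup>2 / 4 ^ k) * (2 / 4 ^ k)" for k :: nat
  have c_nz: "4 ^ k < (norm p)\<^sup>2 \<and> (norm p)\<^sup>2 < 2 * 4 ^ k" if "c k \<noteq> 0" for k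
  proof -
    have "\<not> ((norm p)\<^sup>2 / 4 ^ k \<le> 1 \<or> 2 \<le> (norm p)\<^sup>2 / 4 ^ k)"
      using that bump'_eq_0 by (auto simp: c_def)
    then show ?thesis by (auto simp: divide_le_eq le_divide_eq not_le)
  qed
  \<comment> \<open>\<open>c k\<close> lives on the annulus 4^k < |p|^2 < 2 * 4^k, and passing to
    the next k multiplies the radii squared by 4. Without cross terms, the square of a sum of N
    terms costs no factor N.\<close>
  have zero: "c j * c k = 0" if "j < k" for j k
  proof (rule ccontr)
    assume "c j * c k \<noteq> 0"
    then have "4 ^ k < (norm p)\<^sup>2" "(norm p)\<^sup>2 < 2 * 4 ^ j" using c_nz by auto
    moreover have "(4::real) * 4 ^ j \<le> 4 ^ k" using that power_increasing[of "Suc j" k "4::real"] by simp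
    ultimately show False using zero_le_power[of "4::real" j] by linarith
  qed
  have orth: "c j * c k = (if j = k then (c j)\<^sup>2 else 0)" for j k
    using zero[of j k] zero[of k j] by (cases j k rule: linorder_cases) (auto simp: power2_eq_square)
  have "(\<Sum>k\<in>{N..<2 * N}. c k)\<^sup>2 = (\<Sum>k\<in>{N..<2 * N}. (c k)\<^sup>2)"
    unfolding power2_eq_square[of "sum c _"] sum_product orth by (simp add: sum.delta)
  then have "(norm (cutoff_grad N p))\<^sup>2 = (\<Sum>k\<in>{N..<2 * N}. (c k)\<^sup>2 * (norm p)\<^sup>2) / (real N)\<^sup>2"
    unfolding cutoff_grad_def c_def[symmetric] by (simp add: power_mult_distrib power_divide sum_distrib_right)
  also have "\<dots> \<le> (\<Sum>k\<in>{N..<2 * N}. 128 / 4 ^ k * indicator (ball 0 (2 ^ (Suc k))) p) / (real N)\<^sup>2"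
  proof (intro divide_right_mono sum_mono)
    fix k
    show "(c k)\<^sup>2 * (norm p)\<^sup>2 \<le> 128 / 4 ^ k * indicator (ball 0 (2 ^ (Suc k))) p"
    proof (cases "c k = 0")
      case False
      then have p: "(norm p)\<^sup>2 < 2 * 4 ^ k" using c_nz by blast
      then have "(norm p)\<^sup>2 < (2 ^ Suc k)\<^sup>2"
      proof -
        have "((2::real) ^ (Suc k))\<^sup>2 = 4 * 4 ^ k" by (simp add: power2_eq_square power_mult_distrib[symmetric])
        then show ?thesis using p zero_less_power[of "4::real" k] by linarith
      qed
      then have "norm p < 2 ^ Suc k" by (rule power2_less_imp_less) simp
      then have ind: "indicator (ball 0 (2 ^ (Suc k))) p = (1::real)" by simp
      \<comment> \<open>128 = 4^2 * 2^2 * 2, from the bound of \<open>bump'\<close>, the inner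
        derivative 2 / 4^k and |p|^2 < 2 * 4^k.\<close>
      have "\<bar>bump' ((norm p)\<^sup>2 / 4 ^ k)\<bar>\<^sup>2 \<le> 4\<^sup>2" by (intro power_mono bump'_bound) auto
      then have "(c k)\<^sup>2 \<le> 16 * (2 / 4 ^ k)\<^sup>2"
        unfolding c_def power_mult_distrib by (intro mult_right_mono) auto
      then have "(c k)\<^sup>2 * (norm p)\<^sup>2 \<le> (16 * (2 / 4 ^ k)\<^sup>2) * (2 * 4 ^ k)"
        using p by (intro mult_mono) auto
      also have "\<dots> = 128 / 4 ^ k" by (simp add: power2_eq_square)
      finally show ?thesis using ind by simp
    qed simp
  qed simp
  finally show ?thesis .
qed

text \<open>With the exponent \<open>3\<close> the profile is \<open>C\<^sup>2\<close> and satisfies \<open>\<Delta>\<rho> \<ge> - C \<rho>\<close> up to the boundary of its support.\<close>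

definition rho :: "real \<Rightarrow> 'a::real_inner \<Rightarrow> real" where
  "rho r y = (max 0 (1 - (norm y)\<^sup>2 / r\<^sup>2)) ^ 3"

definition rho_grad :: "real \<Rightarrow> 'a::real_inner \<Rightarrow> 'a" where
  "rho_grad r y = (- 6 / r\<^sup>2 * (max 0 (1 - (norm y)\<^sup>2 / r\<^sup>2))\<^sup>2) *\<^sub>R y"

definition rho_second :: "real \<Rightarrow> 'a::real_inner \<Rightarrow> 'a \<Rightarrow> real" where
  "rho_second r b y = - 6 / r\<^sup>2 * (max 0 (1 - (norm y)\<^sup>2 / r\<^sup>2))\<^sup>2 * (b \<bullet> b)
    + 24 / r ^ 4 * max 0 (1 - (norm y)\<^sup>2 / r\<^sup>2) * (y \<bullet> b)\<^sup>2"

lemma DERIV_max_zero_power3: "((\<lambda>t::real. (max 0 t) ^ 3) has_real_derivative 3 * (max 0 t)\<^sup>2) (at t)"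
proof -
  have eq: "(max 0 t) ^ 3 = t * (max 0 t)\<^sup>2" for t :: real by (simp add: max_def power3_eq_cube power2_eq_square)
  have "((\<lambda>t::real. t * (max 0 t)\<^sup>2) has_real_derivative 1 * (max 0 t)\<^sup>2 + 2 * max 0 t * t) (at t)"
    by (rule DERIV_mult[OF DERIV_ident DERIV_max_zero_power2])
  moreover have "1 * (max 0 t)\<^sup>2 + 2 * max 0 t * t = 3 * (max 0 t)\<^sup>2" by (simp add: max_def power2_eq_square)
  ultimately show ?thesis unfolding eq by (rule DERIV_cong)
qed

lemma GDERIV_rho_arg: "GDERIV (\<lambda>y. 1 - (norm y)\<^sup>2 / r\<^sup>2) y :> (- 2 / r\<^sup>2) *\<^sub>R y"
proof -
  have "((\<lambda>t. 1 - t / r\<^sup>2) has_real_derivative - 1 / r\<^sup>2) (at ((norm y)\<^sup>2))"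
    by (intro DERIV_cong[OF DERIV_diff[OF DERIV_const DERIV_cdivide[OF DERIV_ident]]]) simp
  from GDERIV_DERIV_compose[OF GDERIV_norm_power2 this] show ?thesis by simp
qed

lemma GDERIV_rho: "GDERIV (rho r) y :> rho_grad r y"
  using GDERIV_DERIV_compose[OF GDERIV_rho_arg DERIV_max_zero_power3]
  unfolding rho_def[abs_def] rho_grad_def by (simp add: mult.commute)

lemma rho_grad_component_derivative:
  "((\<lambda>s. rho_grad r (y + s *\<^sub>R b) \<bullet> b) has_real_derivative rho_second r b y) (at 0)"
proof -
  let ?q = "\<lambda>y. 1 - (norm y)\<^sup>2 / r\<^sup>2"
  have line: "((\<lambda>s. y + s *\<^sub>R b) has_derivative (\<lambda>h. h *\<^sub>R b)) (at 0)"
    by (auto intro!: derivative_eq_intros)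
  have "GDERIV (\<lambda>y. (max 0 (?q y))\<^sup>2) y :> (2 * max 0 (?q y)) *\<^sub>R (- 2 / r\<^sup>2) *\<^sub>R y"
    by (rule GDERIV_DERIV_compose[OF GDERIV_rho_arg DERIV_max_zero_power2])
  then have "((\<lambda>y. (max 0 (?q y))\<^sup>2) has_derivative (\<lambda>h. h \<bullet> ((2 * max 0 (?q y)) *\<^sub>R (- 2 / r\<^sup>2) *\<^sub>R y))) (at (y + 0 *\<^sub>R b))"
    by (simp add: gderiv_def)
  from has_derivative_compose[OF line this]
  have 1: "((\<lambda>s. (max 0 (?q (y + s *\<^sub>R b)))\<^sup>2) has_real_derivative - 4 / r\<^sup>2 * max 0 (?q y) * (y \<bullet> b)) (at 0)"
    unfolding has_field_derivative_def
    by (rule has_derivative_eq_rhs) (simp add: fun_eq_iff inner_commute)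
  have 2: "((\<lambda>s. (y + s *\<^sub>R b) \<bullet> b) has_real_derivative b \<bullet> b) (at 0)"
    by (auto intro!: derivative_eq_intros simp: inner_add_left)
  have "((\<lambda>s. - 6 / r\<^sup>2 * ((max 0 (?q (y + s *\<^sub>R b)))\<^sup>2 * ((y + s *\<^sub>R b) \<bullet> b))) has_real_derivative
     - 6 / r\<^sup>2 * ((- 4 / r\<^sup>2 * max 0 (?q y) * (y \<bullet> b)) * ((y + 0 *\<^sub>R b) \<bullet> b) + b \<bullet> b * (max 0 (?q (y + 0 *\<^sub>R b)))\<^sup>2)) (at 0)"
    by (intro DERIV_cmult DERIV_mult 1 2)
  moreover have "- 6 / r\<^sup>2 * ((- 4 / r\<^sup>2 * max 0 (?q y) * (y \<bullet> b)) * ((y + 0 *\<^sub>R b) \<bullet> b) + b \<bullet> b * (max 0 (?q (y + 0 *\<^sub>R b)))\<^sup>2)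
      = rho_second r b y"
    unfolding rho_second_def by (simp add: algebra_simps power2_eq_square power4_eq_xxxx)
  ultimately show ?thesis unfolding rho_grad_def by (simp add: mult.assoc)
qed

lemma rho_zero:
  assumes "r > 0" "r \<le> norm y"
  shows "rho r y = 0" "rho_grad r y = 0" "rho_second r b y = 0"
proof -
  have "r\<^sup>2 \<le> (norm y)\<^sup>2" using assms by (intro power_mono) auto
  then have "max 0 (1 - (norm y)\<^sup>2 / r\<^sup>2) = 0" using assms(1) by (simp add: le_divide_eq)
  then show "rho r y = 0" "rho_grad r y = 0" "rho_second r b y = 0"
    by (auto simp: rho_def rho_grad_def rho_second_def)
qed

lemma rho_nonneg: "0 \<le> rho r y" by (simp add: rho_def)

lemma rho_pos: "r > 0 \<Longrightarrow> norm y < r \<Longrightarrow> 0 < rho r y"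
proof -
  assume "r > 0" "norm y < r"
  then have "(norm y)\<^sup>2 < r\<^sup>2" by (intro power_strict_mono) auto
  then show ?thesis using \<open>r > 0\<close> by (simp add: rho_def divide_less_eq)
qed

text \<open>With m = max 0 (1 - |y|^2 / r^2) and n the dimension, r^2 times the Laplacian is 24 m (1
  - m) - 6 n m^2. Adding K m^3 gives m (K m^2 - (24 + 6 n) m + 24), and K = (24 + 6 n)^2 / 96 is the
  least constant that makes the quadratic nonnegative for all m: it is then a perfect
  square.\<close>

lemma laplacian_rho_ge:
  fixes y :: "'a::euclidean_space"
  assumes r: "r > 0"
  shows "- ((24 + 6 * real DIM('a))\<^sup>2 / (96 * r\<^sup>2)) * rho r y \<le> (\<Sum>b\<in>Basis. rho_second r b y)"
proof -
  define q where "q = 1 - (norm y)\<^sup>2 / r\<^sup>2"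
  define n where "n = real DIM('a)"
  define m where "m = max 0 q"
  define t where "t = 1 / r\<^sup>2"
  have t: "0 < t" using r by (simp add: t_def)
  have "rho_second r b y = - 6 * t * m\<^sup>2 + (24 * t\<^sup>2 * m) * (y \<bullet> b)\<^sup>2" if "b \<in> Basis" for b
    using that by (simp add: rho_second_def m_def q_def t_def power2_eq_square power4_eq_xxxx)
  then have "(\<Sum>b\<in>Basis. rho_second r b y) = (\<Sum>b\<in>(Basis :: 'a set). - 6 * t * m\<^sup>2 + (24 * t\<^sup>2 * m) * (y \<bullet> b)\<^sup>2)"
    by (rule sum.cong[OF refl])
  also have "\<dots> = n * (- 6 * t * m\<^sup>2) + (24 * t\<^sup>2 * m) * (\<Sum>b\<in>Basis. (y \<bullet> b)\<^sup>2)"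
    unfolding n_def sum.distrib sum_distrib_left[symmetric] by simp
  also have "(\<Sum>b\<in>Basis. (y \<bullet> b)\<^sup>2) = (norm y)\<^sup>2"
    unfolding power2_norm_eq_inner by (subst euclidean_inner) (simp add: power2_eq_square)
  finally have lap: "(\<Sum>b\<in>Basis. rho_second r b y) = n * (- 6 * t * m\<^sup>2) + (24 * t\<^sup>2 * m) * (norm y)\<^sup>2" .
  have "- ((24 + 6 * n)\<^sup>2 / 96 * t) * m ^ 3 \<le> n * (- 6 * t * m\<^sup>2) + (24 * t\<^sup>2 * m) * (norm y)\<^sup>2"
  proof (cases "q \<le> 0")
    case True then show ?thesis by (simp add: m_def max_absorb1)
  next
    case False
    then have mq: "m = q" "0 < m" by (auto simp: m_def)
    have "t * (norm y)\<^sup>2 = 1 - m" by (simp add: mq q_def t_def)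
    then have "(24 * t\<^sup>2 * m) * (norm y)\<^sup>2 = 24 * t * m * (1 - m)"
      by (metis (no_types, opaque_lifting) mult.assoc mult.commute power2_eq_square)
    moreover have "m * t * (((24 + 6 * n) * m - 48)\<^sup>2 / 96)
        = n * (- 6 * t * m\<^sup>2) + 24 * t * m * (1 - m) + (24 + 6 * n)\<^sup>2 / 96 * t * m ^ 3"
      by (simp add: field_simps power2_eq_square power3_eq_cube)
    moreover have "0 \<le> m * t * (((24 + 6 * n) * m - 48)\<^sup>2 / 96)" using mq t by simp
    ultimately show ?thesis unfolding mult_minus_left by linarith
  qed
  then have "- ((24 + 6 * n)\<^sup>2 / 96 * t) * m ^ 3 \<le> (\<Sum>b\<in>Basis. rho_second r b y)" by (simp only: lap)
  moreover have "(24 + 6 * n)\<^sup>2 / 96 * t = (24 + 6 * n)\<^sup>2 / (96 * r\<^sup>2)" by (simp add: t_def)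
  moreover have "m ^ 3 = rho r y" by (simp add: m_def q_def rho_def)
  ultimately show ?thesis by (simp only: n_def)
qed

lemma continuous_on_rho:
  "continuous_on S (rho r)" "continuous_on S (rho_grad r)" "continuous_on S (rho_second r b)"
  unfolding rho_def[abs_def] rho_grad_def[abs_def] rho_second_def[abs_def]
  by (auto intro!: continuous_intros simp: divide_inverse)

section \<open>Integrals over the half-space and Lipschitz bounds\<close>

lemma borel_measurable_lebesgue_AE:
  fixes f g :: "'a::euclidean_space \<Rightarrow> 'b::topological_space"
  assumes f: "f \<in> borel_measurable lebesgue" and ae: "AE x in lebesgue. f x = g x"
  shows "g \<in> borel_measurable lebesgue"
proof (rule measurableI)
  fix A :: "'b set" assume A: "A \<in> sets borel"
  define D where "D = {x. f x \<noteq> g x}"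
  have D: "negligible D" using ae by (simp add: AE_lebesgue_iff_negligible D_def)
  have "f -` A \<in> sets lebesgue" using measurable_sets[OF f A] by simp
  moreover have "D \<in> sets lebesgue" "g -` A \<inter> D \<in> sets lebesgue"
    using D negligible_subset[OF D, of "g -` A \<inter> D"] by (auto intro: negligible_imp_sets)
  moreover have "g -` A = (f -` A - D) \<union> (g -` A \<inter> D)" by (auto simp: D_def)
  ultimately show "g -` A \<inter> space lebesgue \<in> sets lebesgue" by (metis Int_UNIV_right sets.Diff sets.Un space_completion space_lborel UNIV_I space_borel)
qed simp

text \<open>Completeness of \<open>lebesgue\<close> supplies the measurability of either function
  from that of the other, and two non-integrable functions both have integral 0.\<close>

lemma integrable_cong_AE_lebesgue:
  fixes f g :: "'a::euclidean_space \<Rightarrow> real"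
  assumes "AE x in lebesgue. f x = g x"
  shows "integrable lebesgue f \<longleftrightarrow> integrable lebesgue g"
    and "integral\<^sup>L lebesgue f = integral\<^sup>L lebesgue g"
proof -
  have sym: "AE x in lebesgue. g x = f x" using assms by eventually_elim simp
  show 1: "integrable lebesgue f \<longleftrightarrow> integrable lebesgue g"
    using integrable_cong_AE_imp[of lebesgue f g] integrable_cong_AE_imp[of lebesgue g f] assms sym
      borel_measurable_lebesgue_AE[OF _ assms] borel_measurable_lebesgue_AE[OF _ sym] by blast
  show "integral\<^sup>L lebesgue f = integral\<^sup>L lebesgue g"
  proof (cases "integrable lebesgue f")
    case True
    then show ?thesis using 1 assms by (intro integral_cong_AE) auto
  next
    case False
    then show ?thesis using 1 by (simp add: not_integrable_integral_eq)
  qed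
qed

abbreviation lebesgue_upper_half :: "((real ^ 'n) \<times> real) measure" where
  "lebesgue_upper_half \<equiv> lebesgue_on upper_half"

lemma upper_half_lebesgue [simp]: "upper_half \<in> sets lebesgue"
  by (intro sets_completionI_sets) (simp add: borel_open open_upper_half)

lemma AE_upper_half_iff: "(AE p in lebesgue_upper_half. P p) \<longleftrightarrow> (AE p in lebesgue. p \<in> upper_half \<longrightarrow> P p)"
  by (rule AE_restrict_space_iff) simp

text \<open>Passage from the set integrals of the definitions, over half-balls and with
  \<open>grad\<close>, to integrals over the whole half-space of an integrand chosen up to null
  sets.\<close>

lemma set_integral_eq_upper_half:
  fixes \<phi> \<psi> :: "(real ^ 'n) \<times> real \<Rightarrow> real"
  assumes S: "S \<subseteq> upper_half" and eq: "AE p in lebesgue_upper_half. \<phi> p = \<psi> p"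
    and zero: "\<And>p. p \<in> upper_half - S \<Longrightarrow> \<psi> p = 0"
  shows "set_integrable lebesgue S \<phi> \<longleftrightarrow> integrable lebesgue_upper_half \<psi>"
    and "(LINT p:S|lebesgue. \<phi> p) = (\<integral>p. \<psi> p \<partial>lebesgue_upper_half)"
proof -
  have "AE p in lebesgue. indicat_real S p *\<^sub>R \<phi> p = indicat_real upper_half p *\<^sub>R \<psi> p"
    using eq unfolding AE_upper_half_iff
    by eventually_elim (use S zero in \<open>auto simp: indicator_def\<close>)
  note * = integrable_cong_AE_lebesgue[OF this]
  show "set_integrable lebesgue S \<phi> \<longleftrightarrow> integrable lebesgue_upper_half \<psi>"
    unfolding set_integrable_def *(1) by (simp add: integrable_restrict_space)
  show "(LINT p:S|lebesgue. \<phi> p) = (\<integral>p. \<psi> p \<partial>lebesgue_upper_half)"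
    unfolding set_lebesgue_integral_def *(2) by (simp add: integral_restrict_space)
qed

lemma upper_half_translate:
  fixes f :: "(real ^ 'n) \<times> real \<Rightarrow> real"
  shows "integrable lebesgue_upper_half f \<Longrightarrow> integrable lebesgue_upper_half (\<lambda>p. f (p + (k, 0)))"
    and "integrable lebesgue_upper_half f \<Longrightarrow>
      (\<integral>p. f (p + (k, 0)) \<partial>lebesgue_upper_half) = (\<integral>p. f p \<partial>lebesgue_upper_half)"
proof -
  let ?g = "\<lambda>p. indicat_real upper_half p *\<^sub>R f p"
  have ind: "indicat_real upper_half p *\<^sub>R f (p + (k, 0)) = ?g ((k, 0) + p)" for p
    by (cases p) (simp add: indicator_def add.commute)
  assume "integrable lebesgue_upper_half f"
  then have g: "integrable lebesgue ?g" by (simp add: integrable_restrict_space)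
  then have "integrable (distr lebesgue lebesgue ((+) (k, 0))) ?g" by (simp add: distr_lebesgue_plus)
  then have "integrable lebesgue (\<lambda>p. ?g ((k, 0) + p))"
    by (subst (asm) integrable_distr_eq[OF measurable_plus_lebesgue]) (use g in auto)
  then show "integrable lebesgue_upper_half (\<lambda>p. f (p + (k, 0)))"
    by (simp only: integrable_restrict_space[OF _] ind[symmetric] upper_half_lebesgue) (simp add: integrable_restrict_space)
  have "(\<integral>p. ?g p \<partial>lebesgue) = (\<integral>p. ?g p \<partial>(distr lebesgue lebesgue ((+) (k, 0))))" by (simp add: distr_lebesgue_plus)
  also have "\<dots> = (\<integral>p. ?g ((k, 0) + p) \<partial>lebesgue)"
    by (rule integral_distr[OF measurable_plus_lebesgue]) (use g in auto)
  finally show "(\<integral>p. f (p + (k, 0)) \<partial>lebesgue_upper_half) = (\<integral>p. f p \<partial>lebesgue_upper_half)"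
    by (simp only: ind[symmetric]) (simp add: integral_restrict_space)
qed

lemma continuous_on_upper_half_measurable:
  "continuous_on upper_half f \<Longrightarrow> f \<in> borel_measurable lebesgue_upper_half"
  by (rule continuous_imp_measurable_on_sets_lebesgue) auto

text \<open>A superlevel set of a continuous function is open, hence empty as soon as it is
  null.\<close>

lemma AE_bounded_imp_bounded:
  fixes f :: "'a::euclidean_space \<Rightarrow> real"
  assumes S: "open S" and f: "continuous_on S f" and ae: "AE p in lebesgue_on S. f p \<le> C" and p: "p \<in> S"
  shows "f p \<le> C"
proof (rule ccontr)
  assume "\<not> f p \<le> C"
  then have pU: "p \<in> {p \<in> S. C < f p}" using p by auto
  have "open {p \<in> S. C < f p}"
    using continuous_open_preimage[OF f S open_greaterThan, of C] by (simp add: vimage_def Int_def conj_commute)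
  then have "\<not> negligible {p \<in> S. C < f p}" using pU open_not_negligible by blast
  moreover have "S \<in> sets lebesgue" using S by (simp add: borel_open sets_completionI_sets)
  then have "negligible {p \<in> S. C < f p}"
    using ae by (subst (asm) AE_restrict_space_iff) (auto simp: AE_lebesgue_iff_negligible not_le elim: negligible_subset)
  ultimately show False by simp
qed

text \<open>k is replaced by a Borel representative, for which the product measure theorem applies;
  the exceptional set of k lifts to a null set of the product.\<close>

lemma integrable_completion_product:
  fixes f :: "'a::euclidean_space \<Rightarrow> real" and k :: "'b::euclidean_space \<Rightarrow> real"
  assumes f: "integrable lborel f" and k: "integrable lebesgue k"
  shows "integrable lebesgue (\<lambda>p. f (fst p) * k (snd p))"
proof -
  have km: "k \<in> borel_measurable lebesgue" using k by auto
  obtain k' where k': "k' \<in> borel_measurable lborel" "AE x in lborel. k x = k' x"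
    using completion_ex_borel_measurable_real[OF km] by blast
  have ae: "AE x in lebesgue. k x = k' x" using k'(2) by (rule AE_completion)
  have "integrable lebesgue k'" using integrable_cong_AE_lebesgue(1)[OF ae] k by simp
  then have k'i: "integrable lborel k'" using k'(1) by (simp add: integrable_completion)
  have [measurable]: "f \<in> borel_measurable borel" "k' \<in> borel_measurable borel" using f k'(1) by auto
  have "integrable (lborel \<Otimes>\<^sub>M lborel) (\<lambda>(y, x). f y * k' x)"
  proof (rule lborel_pair.Fubini_integrable)
    show "(\<lambda>(y, x). f y * k' x) \<in> borel_measurable (lborel \<Otimes>\<^sub>M lborel)" by measurable
    have "integrable lborel (\<lambda>y. \<bar>f y\<bar> * (\<integral>x. \<bar>k' x\<bar> \<partial>lborel))" using f by simp
    then show "integrable lborel (\<lambda>y. \<integral>x. norm (case (y, x) of (y, x) \<Rightarrow> f y * k' x) \<partial>lborel)"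
      by (simp add: abs_mult)
    show "AE y in lborel. integrable lborel (\<lambda>x. case (y, x) of (y, x) \<Rightarrow> f y * k' x)" using k'i by simp
  qed
  then have "integrable lborel (\<lambda>p. f (fst p) * k' (snd p))" by (simp add: lborel_prod case_prod_unfold)
  then have "integrable lebesgue (\<lambda>p. f (fst p) * k' (snd p))"
    using integrable_completion borel_measurable_integrable by blast
  moreover have ae': "AE p in (lebesgue :: ('a \<times> 'b) measure). f (fst p) * k (snd p) = f (fst p) * k' (snd p)"
    using AE_lebesgue_snd[OF ae] by eventually_elim simp
  ultimately show ?thesis using integrable_cong_AE_lebesgue(1)[OF ae'] by simp
qed

text \<open>Compactness of the ball, taken from the theory of time-dependent locally Lipschitz maps
  with 0 as the only time.\<close>

lemma locally_lipschitz_imp_lipschitz_on_cball: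
  assumes "locally_lipschitz_on UNIV (f :: real \<Rightarrow> real)"
  shows "\<exists>L. L-lipschitz_on (cball 0 M) f"
proof -
  have "local_lipschitz {0::real} (cball 0 M) (\<lambda>_. f)"
    unfolding local_lipschitz_def
  proof (intro ballI)
    fix p t :: real
    obtain r L where r: "r > 0" "L-lipschitz_on (cball p r) f"
      using assms unfolding locally_lipschitz_on_def by (metis Int_UNIV_right UNIV_I)
    then have "\<forall>t\<in>cball t r \<inter> {0}. L-lipschitz_on (cball p r \<inter> cball 0 M) f"
      by (auto intro: lipschitz_on_subset)
    then show "\<exists>u>0. \<exists>L. \<forall>t\<in>cball t u \<inter> {0}. L-lipschitz_on (cball p u \<inter> cball 0 M) f"
      using r(1) by blast
  qed
  note ll = this
  obtain L where "\<And>t. t \<in> {0::real} \<Longrightarrow> L-lipschitz_on (cball 0 M) f"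
    by (rule local_lipschitz_compact_implies_lipschitz[OF ll _ _ continuous_on_const]) auto
  then show ?thesis by blast
qed

text \<open>The derivative is bounded wherever it exists, and it exists off a null set, so the
  second term of \<open>lipschitz_increment_le\<close> vanishes for that set. This turns the assumed
  bound on \<open>g\<^sub>u\<close> into a Lipschitz bound for \<open>g x\<close> that is uniform in
  x.\<close>

lemma lipschitz_bound_from_derivative_bound:
  fixes f f' :: "real \<Rightarrow> real"
  assumes lip: "locally_lipschitz_on UNIV f" and deriv: "AE t in lebesgue. (f has_real_derivative f' t) (at t)"
    and bound: "\<And>t D. \<bar>t\<bar> \<le> M \<Longrightarrow> (f has_real_derivative D) (at t) \<Longrightarrow> \<bar>D\<bar> \<le> C"
    and C: "0 \<le> C" and st: "\<bar>s\<bar> \<le> M" "\<bar>t\<bar> \<le> M"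
  shows "\<bar>f s - f t\<bar> \<le> C * \<bar>s - t\<bar>"
proof -
  define N where "N = {t. \<not> (f has_real_derivative f' t) (at t)}"
  have N: "negligible N" using deriv by (simp add: N_def AE_lebesgue_iff_negligible)
  then have N': "N \<in> lmeasurable" "measure lebesgue N = 0" by (auto simp: negligible_iff_measure)
  obtain L where L: "L-lipschitz_on (cball 0 M) f" using locally_lipschitz_imp_lipschitz_on_cball[OF lip] by blast
  have "\<bar>f b - f a\<bar> \<le> C * (b - a) + L * measure lebesgue N" if ab: "a \<le> b" "\<bar>a\<bar> \<le> M" "\<bar>b\<bar> \<le> M" for a b
  proof (rule lipschitz_increment_le[OF ab(1) lipschitz_on_nonneg[OF L] C _ N'(1)])
    fix s t assume "s \<in> {a..b}" "t \<in> {a..b}"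
    then have "dist (f s) (f t) \<le> L * dist s t" using ab by (intro lipschitz_onD[OF L]) auto
    then show "\<bar>f s - f t\<bar> \<le> L * \<bar>s - t\<bar>" by (simp add: dist_real_def)
  next
    fix t e :: real assume t: "t \<in> {a..b} - N" and e: "0 < e"
    then have D: "(f has_real_derivative f' t) (at t)" by (simp add: N_def)
    have D': "\<bar>f' t\<bar> \<le> C" using t ab by (intro bound[OF _ D]) auto
    obtain d where d: "d > 0" "\<And>s. \<bar>s - t\<bar> < d \<Longrightarrow> \<bar>f s - f t - f' t * (s - t)\<bar> \<le> e * \<bar>s - t\<bar>"
      using D e unfolding has_field_derivative_def has_derivative_at_alt real_norm_def by blast
    have "\<bar>f s - f t\<bar> \<le> (C + e) * \<bar>s - t\<bar>" if "\<bar>s - t\<bar> < d" for s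
    proof -
      have "\<bar>f' t * (s - t)\<bar> \<le> C * \<bar>s - t\<bar>" using D' by (simp add: abs_mult mult_right_mono)
      then show ?thesis using d(2)[OF that] by (simp add: algebra_simps)
    qed
    then show "\<exists>d>0. \<forall>s\<in>{a..b}. \<bar>s - t\<bar> < d \<longrightarrow> \<bar>f s - f t\<bar> \<le> (C + e) * \<bar>s - t\<bar>" using d(1) by blast
  qed
  then have *: "\<bar>f b - f a\<bar> \<le> C * (b - a)" if "a \<le> b" "\<bar>a\<bar> \<le> M" "\<bar>b\<bar> \<le> M" for a b
    using that N'(2) by simp
  show ?thesis
  proof (cases "t \<le> s")
    case True then show ?thesis using *[OF True st(2,1)] by simp
  next
    case False
    then have le: "s \<le> t" by simp
    show ?thesis using *[OF le st] False by (simp add: abs_minus_commute)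
  qed
qed

section \<open>Stable solutions\<close>

text \<open>\<open>D1\<close> and \<open>D2\<close> name the first and second derivatives of u in
  the interior, so that derivative rules replace the description operator behind
  \<open>grad\<close>.\<close>

locale stable_solution_setting =
  fixes \<mu> f f' :: "real \<Rightarrow> real"
    and g g\<^sub>u :: "real \<Rightarrow> real \<Rightarrow> real"
    and u :: "(real ^ 'n::finite) \<times> real \<Rightarrow> real"
    and C\<^sub>o :: real
    and D1 :: "(real ^ 'n) \<times> real \<Rightarrow> (real ^ 'n) \<times> real"
    and D2 :: "(real ^ 'n) \<times> real \<Rightarrow> ((real ^ 'n) \<times> real) \<Rightarrow>\<^sub>L ((real ^ 'n) \<times> real)"
  assumes structural: "structural TYPE('n) \<mu> g f"
    and deriv_g: "\<And>x. x > 0 \<Longrightarrow> AE t in lebesgue. (g x has_real_derivative g\<^sub>u x t) (at t)"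
    and deriv_f: "AE t in lebesgue. (f has_real_derivative f' t) (at t)"
    and grad_u: "\<And>p. p \<in> upper_half \<Longrightarrow> GDERIV u p :> D1 p"
    and deriv_D1: "\<And>p. p \<in> upper_half \<Longrightarrow> (D1 has_derivative blinfun_apply (D2 p)) (at p)"
    and cont_D2: "continuous_on upper_half D2"
    and bounded_u: "bounded (u ` upper_half)"
    and weak: "weak_solution \<mu> g f u"
    and stable: "stable_solution \<mu> g\<^sub>u f' u"
    and grad_y_Linfty: "\<And>r. r > 0 \<Longrightarrow> Linfty_on (half_ball r) (\<lambda>p. norm (grad_y u p))"
    and Co_ge_1: "C\<^sub>o \<ge> 1"
    and energy: "\<And>R. R \<ge> C\<^sub>o \<Longrightarrow>
      (LINT p:half_ball R|lebesgue. \<mu> (snd p) * (norm (grad u p))\<^sup>2) \<le> C\<^sub>o * R\<^sup>2"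
begin

abbreviation F where "F p \<equiv> fst (D1 p)"

lemma grad_u_eq: "p \<in> upper_half \<Longrightarrow> grad u p = D1 p"
  using grad_eq[OF grad_u] .

lemma cont_u: "continuous_on upper_half u"
proof (rule continuous_at_imp_continuous_on, rule ballI)
  fix p :: "(real ^ 'n) \<times> real" assume "p \<in> upper_half"
  from grad_u[OF this] show "isCont u p" unfolding gderiv_def by (rule has_derivative_continuous)
qed

lemma cont_D1: "continuous_on upper_half D1"
proof (rule continuous_at_imp_continuous_on, rule ballI)
  fix p :: "(real ^ 'n) \<times> real" assume "p \<in> upper_half"
  from deriv_D1[OF this] show "isCont D1 p" by (rule has_derivative_continuous)
qed

lemma mu_bounds:
  assumes "0 < a"
  obtains m1 m2 where "0 < m1" "\<And>x. a \<le> x \<Longrightarrow> x \<le> b \<Longrightarrow> m1 \<le> \<mu> x \<and> \<mu> x \<le> m2"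
proof -
  \<comment> \<open>\<open>\<mu>\<close> depends on x alone, so a single vertical segment extracts
    its bounds from the assumption on compact sets.\<close>
  let ?K = "{0} \<times> {a..b} :: ((real ^ 'n) \<times> real) set"
  have "closed ?K" by (intro closed_Times) auto
  then have "closure ?K = ?K" by simp
  moreover have "compact ?K" by (intro compact_Times) auto
  moreover have "?K \<subseteq> upper_half" using assms by auto
  moreover have "\<forall>K :: ((real ^ 'n) \<times> real) set. compact (closure K) \<and> closure K \<subseteq> upper_half \<longrightarrow>
      (\<exists>\<mu>1>0. \<exists>\<mu>2>0. \<forall>(y, x)\<in>K. \<mu>1 \<le> \<mu> x \<and> \<mu> x \<le> \<mu>2)"
    using structural unfolding structural_def by (elim conjE)
  then have "compact (closure ?K) \<and> closure ?K \<subseteq> upper_half \<longrightarrow>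
      (\<exists>\<mu>1>0. \<exists>\<mu>2>0. \<forall>(y, x)\<in>?K. \<mu>1 \<le> \<mu> x \<and> \<mu> x \<le> \<mu>2)" by (rule spec)
  ultimately have "\<exists>\<mu>1>0. \<exists>\<mu>2>0. \<forall>(y, x)\<in>?K. \<mu>1 \<le> \<mu> x \<and> \<mu> x \<le> \<mu>2" by simp
  then obtain \<mu>1 \<mu>2 where "\<mu>1 > 0" "\<forall>(y, x)\<in>?K. \<mu>1 \<le> \<mu> x \<and> \<mu> x \<le> \<mu>2" by blast
  then show ?thesis using that[of \<mu>1 \<mu>2] by auto
qed

lemma mu_pos:
  assumes "0 < x"
  shows "0 < \<mu> x"
proof (rule mu_bounds[OF assms, of x])
  fix m1 m2 assume "0 < m1" and b: "\<And>z. x \<le> z \<Longrightarrow> z \<le> x \<Longrightarrow> m1 \<le> \<mu> z \<and> \<mu> z \<le> m2"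
  show ?thesis using b[of x] \<open>0 < m1\<close> by simp
qed

lemma mu_integrable: "0 < r \<Longrightarrow> integrable lebesgue (\<lambda>x. indicator {0<..<r} x * \<mu> x)"
  using structural unfolding structural_def set_integrable_def by simp

lemma mu_measurable_pos: "(\<lambda>x. indicator {0<..} x * \<mu> x) \<in> borel_measurable lebesgue"
proof (rule borel_measurable_LIMSEQ_real)
  fix x :: real
  obtain N :: nat where N: "x < real N" using reals_Archimedean2 by blast
  have "indicator {0<..<real n + 1} x * \<mu> x = indicator {0<..} x * \<mu> x" if "n \<ge> N" for n
    using N that by (auto simp: indicator_def)
  then show "(\<lambda>n. indicator {0<..<real n + 1} x * \<mu> x) \<longlonglongrightarrow> indicator {0<..} x * \<mu> x"
    by (intro tendsto_eventually) (auto simp: eventually_sequentially)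
qed (use mu_integrable in auto)

lemma mu_measurable: "(\<lambda>p. \<mu> (snd p)) \<in> borel_measurable (lebesgue_upper_half :: ((real ^ 'n) \<times> real) measure)"
proof -
  have "(\<lambda>p :: (real ^ 'n) \<times> real. indicator {0<..} (snd p) * \<mu> (snd p)) \<in> borel_measurable lebesgue"
    using measurable_compose[OF measurable_snd_lebesgue mu_measurable_pos] .
  then have "(\<lambda>p :: (real ^ 'n) \<times> real. indicator {0<..} (snd p) * \<mu> (snd p)) \<in> borel_measurable lebesgue_upper_half"
    by (rule measurable_restrict_space1)
  moreover have "(\<lambda>p. indicator {0<..} (snd p) * \<mu> (snd p)) \<in> borel_measurable (lebesgue_upper_half :: ((real ^ 'n) \<times> real) measure)
      \<longleftrightarrow> (\<lambda>p. \<mu> (snd p)) \<in> borel_measurable (lebesgue_upper_half :: ((real ^ 'n) \<times> real) measure)"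
    by (rule measurable_cong) (auto simp: upper_half_def)
  ultimately show ?thesis by simp
qed

text \<open>The half-ball sits in a cylinder, on which the integral factorizes into a volume and the
  integral of \<open>\<mu>\<close> over (0, R).\<close>

lemma mu_ball_integrable: "integrable (lebesgue_upper_half :: ((real ^ 'n) \<times> real) measure) (\<lambda>p. \<mu> (snd p) * indicator (ball 0 R) p)"
proof (cases "0 < R")
  case True
  have "integrable lborel (indicator (cball 0 R) :: real ^ 'n \<Rightarrow> real)"
    using emeasure_bounded_finite[of "cball (0 :: real ^ 'n) R"] by (simp add: integrable_indicator_iff)
  from integrable_completion_product[OF this mu_integrable[OF True]]
  have int: "integrable lebesgue (\<lambda>p :: (real ^ 'n) \<times> real. indicator (cball 0 R) (fst p) * (indicator {0<..<R} (snd p) * \<mu> (snd p)))" .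
  have "integrable lebesgue_upper_half (\<lambda>p :: (real ^ 'n) \<times> real. indicator (cball 0 R) (fst p) * (indicator {0<..<R} (snd p) * \<mu> (snd p)))"
    using integrable_mult_indicator[OF upper_half_lebesgue int] by (simp add: integrable_restrict_space)
  then show ?thesis
  proof (rule Bochner_Integration.integrable_bound)
    show "(\<lambda>p. \<mu> (snd p) * indicator (ball 0 R) p) \<in> borel_measurable (lebesgue_upper_half :: ((real ^ 'n) \<times> real) measure)"
      by (intro borel_measurable_times mu_measurable measurable_restrict_space1 borel_measurable_indicator) auto
    show "AE p in (lebesgue_upper_half :: ((real ^ 'n) \<times> real) measure). norm (\<mu> (snd p) * indicator (ball 0 R) p)
        \<le> norm (indicat_real (cball 0 R) (fst p) * (indicat_real {0<..<R} (snd p) * \<mu> (snd p)))"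
    proof (rule AE_I2)
      fix p assume "p \<in> space (lebesgue_upper_half :: ((real ^ 'n) \<times> real) measure)"
      then have p: "0 < snd p" by (simp add: upper_half_def)
      show "norm (\<mu> (snd p) * indicat_real (ball 0 R) p)
        \<le> norm (indicat_real (cball 0 R) (fst p) * (indicat_real {0<..<R} (snd p) * \<mu> (snd p)))"
        using p norm_fst_le[of "fst p" "snd p"] norm_snd_le[of "snd p" "fst p"] mu_pos[OF p] by (auto simp: indicator_def)
    qed
  qed
next
  case False
  then have "R \<le> 0" by simp
  then show ?thesis by (simp only: ball_empty) simp
qed

lemma energy_integrable: "integrable lebesgue_upper_half (\<lambda>p. \<mu> (snd p) * (norm (D1 p))\<^sup>2 * indicator (ball 0 R) p)"
  and energy_le: "R \<ge> C\<^sub>o \<Longrightarrow>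
    (\<integral>p. \<mu> (snd p) * (norm (D1 p))\<^sup>2 * indicator (ball 0 R) p \<partial>lebesgue_upper_half) \<le> C\<^sub>o * R\<^sup>2"
proof -
  have eq: "AE p in lebesgue_upper_half. \<mu> (snd p) * (norm (grad u p))\<^sup>2 * indicator (ball 0 R) p
      = \<mu> (snd p) * (norm (D1 p))\<^sup>2 * indicator (ball 0 R) p" for R
    by (rule AE_I2) (simp add: grad_u_eq)
  have *: "set_integrable lebesgue (half_ball R) (\<lambda>p. \<mu> (snd p) * (norm (grad u p))\<^sup>2 * indicator (ball 0 R) p)
      \<longleftrightarrow> integrable lebesgue_upper_half (\<lambda>p. \<mu> (snd p) * (norm (D1 p))\<^sup>2 * indicator (ball 0 R) p)"
    "(LINT p:half_ball R|lebesgue. \<mu> (snd p) * (norm (grad u p))\<^sup>2 * indicator (ball 0 R) p)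
      = (\<integral>p. \<mu> (snd p) * (norm (D1 p))\<^sup>2 * indicator (ball 0 R) p \<partial>lebesgue_upper_half)" for R
    by (rule set_integral_eq_upper_half[OF _ eq]; auto simp: half_ball_def)+
  have ind: "indicat_real (half_ball R) p *\<^sub>R (\<mu> (snd p) * (norm (grad u p))\<^sup>2 * indicator (ball 0 R) p)
      = indicat_real (half_ball R) p *\<^sub>R (\<mu> (snd p) * (norm (grad u p))\<^sup>2)" for R p
    by (auto simp: indicator_def half_ball_def)
  have "set_integrable lebesgue (half_ball R) (\<lambda>p. \<mu> (snd p) * (norm (grad u p))\<^sup>2)" if "R > 0" for R
    using weak that by (simp add: weak_solution_def)
  then have pos: "integrable lebesgue_upper_half (\<lambda>p. \<mu> (snd p) * (norm (D1 p))\<^sup>2 * indicator (ball 0 R) p)" if "R > 0" for R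
    using that unfolding *(1)[symmetric] set_integrable_def ind by blast
  show "integrable lebesgue_upper_half (\<lambda>p. \<mu> (snd p) * (norm (D1 p))\<^sup>2 * indicator (ball 0 R) p)"
  proof (cases "0 < R")
    case False
    then have "R \<le> 0" by simp
    then show ?thesis by (simp only: ball_empty) simp
  qed (rule pos)
  show "(\<integral>p. \<mu> (snd p) * (norm (D1 p))\<^sup>2 * indicator (ball 0 R) p \<partial>lebesgue_upper_half) \<le> C\<^sub>o * R\<^sup>2"
    if "R \<ge> C\<^sub>o"
    using energy[OF that] unfolding *(2)[symmetric] set_lebesgue_integral_def ind .
qed

lemma u_bound: obtains B where "0 < B" "\<And>p. p \<in> upper_half \<Longrightarrow> \<bar>u p\<bar> \<le> B"
  using bounded_u by (auto simp: bounded_pos)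

text \<open>For the continuous F, essential boundedness is pointwise boundedness, and the bound
  holds uniformly as x tends to 0.\<close>

lemma F_bound: obtains B where "0 < B" "\<And>p. p \<in> half_ball r \<Longrightarrow> norm (F p) \<le> B"
proof (cases "0 < r")
  case True
  have op: "open (half_ball r :: ((real ^ 'n) \<times> real) set)"
    unfolding half_ball_def by (intro open_Int open_upper_half) auto
  obtain C where "AE p in lebesgue_on (half_ball r). \<bar>norm (grad_y u p)\<bar> \<le> C"
    using grad_y_Linfty[OF True] by (auto simp: Linfty_on_def)
  then have C: "AE p in lebesgue_on (half_ball r). norm (F p) \<le> C"
  proof (rule AE_mp[OF _ AE_I2], intro impI)
    fix p :: "(real ^ 'n) \<times> real" assume p: "p \<in> space (lebesgue_on (half_ball r))" and *: "\<bar>norm (grad_y u p)\<bar> \<le> C"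
    have "p \<in> upper_half" using p by (simp add: half_ball_def)
    then show "norm (F p) \<le> C" using * by (simp add: grad_y_def grad_u_eq)
  qed
  have "continuous_on (half_ball r) (\<lambda>p. norm (F p))"
    by (intro continuous_on_norm continuous_on_fst continuous_on_subset[OF cont_D1]) (simp add: half_ball_def)
  from AE_bounded_imp_bounded[OF op this C] have "norm (F p) \<le> max C 1" if "p \<in> half_ball r" for p
    using that by (simp add: le_max_iff_disj)
  then show ?thesis by (intro that[of "max C 1"]) auto
next
  case False
  then have "half_ball r = ({} :: ((real ^ 'n) \<times> real) set)" by (simp add: half_ball_def ball_empty)
  then show ?thesis using that[of 1] by simp
qed

lemma lipschitz_increment_y:
  assumes x: "0 < x" and B: "\<And>s. 0 \<le> s \<Longrightarrow> s \<le> 1 \<Longrightarrow> norm (F (y + s *\<^sub>R k, x)) \<le> B"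
  shows "\<bar>u (y + k, x) - u (y, x)\<bar> \<le> B * norm k"
proof -
  let ?\<gamma> = "\<lambda>s. (y + s *\<^sub>R k, x)"
  have d: "((\<lambda>s. u (?\<gamma> s)) has_real_derivative F (?\<gamma> s) \<bullet> k) (at s)" for s
  proof -
    have "(?\<gamma> has_derivative (\<lambda>h. (h *\<^sub>R k, 0))) (at s)" by (auto intro!: derivative_eq_intros)
    moreover have "(u has_derivative (\<lambda>h. h \<bullet> D1 (?\<gamma> s))) (at (?\<gamma> s))"
      using grad_u[of "?\<gamma> s"] x by (simp add: gderiv_def)
    ultimately have "((\<lambda>s. u (?\<gamma> s)) has_derivative (\<lambda>h. (h *\<^sub>R k, 0) \<bullet> D1 (?\<gamma> s))) (at s)"
      by (rule has_derivative_compose)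
    moreover have "(\<lambda>h. (h *\<^sub>R k, 0) \<bullet> D1 (?\<gamma> s)) = (*) (F (?\<gamma> s) \<bullet> k)"
      by (auto simp: inner_prod_def inner_commute fun_eq_iff)
    ultimately show ?thesis by (simp add: has_field_derivative_def)
  qed
  obtain z where z: "0 < z" "z < 1" "u (?\<gamma> 1) - u (?\<gamma> 0) = (1 - 0) * (F (?\<gamma> z) \<bullet> k)"
    using MVT2[of 0 1 "\<lambda>s. u (?\<gamma> s)", OF _ d] by auto
  have "\<bar>F (?\<gamma> z) \<bullet> k\<bar> \<le> B * norm k"
    using Cauchy_Schwarz_ineq2[of "F (?\<gamma> z)" k] mult_right_mono[OF B[of z], of "norm k"] z by simp
  then show ?thesis using z(3) by simp
qed

lemma segment_in_half_ball:
  assumes "0 < x" "norm y \<le> r" "norm (y + k) \<le> r" "0 \<le> s" "s \<le> 1"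
  shows "(y + s *\<^sub>R k, x) \<in> half_ball (r + x + 1)"
proof -
  have "y + s *\<^sub>R k = (1 - s) *\<^sub>R y + s *\<^sub>R (y + k)" by (simp add: algebra_simps)
  then have "norm (y + s *\<^sub>R k) \<le> (1 - s) * norm y + s * norm (y + k)"
    using assms(4,5) norm_triangle_ineq[of "(1 - s) *\<^sub>R y" "s *\<^sub>R (y + k)"] by simp
  also have "\<dots> \<le> (1 - s) * r + s * r" using assms by (intro add_mono mult_left_mono) auto
  finally have "norm (y + s *\<^sub>R k) \<le> r" by (simp add: algebra_simps)
  moreover have "norm (y + s *\<^sub>R k, x) \<le> norm (y + s *\<^sub>R k) + norm x"
    using sqrt_sum_squares_le_sum_abs[of "norm (y + s *\<^sub>R k)" x] by (simp add: norm_Pair)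
  ultimately show ?thesis using assms(1) by (simp add: half_ball_def)
qed

text \<open>The constant is uniform as x tends to 0, so that the estimate passes to the boundary
  values and bounds all difference quotients independently of h.\<close>

lemma u_lipschitz_y:
  obtains B where "0 < B" "\<And>x y y'. 0 < x \<Longrightarrow> x \<le> X \<Longrightarrow> norm y \<le> r \<Longrightarrow> norm y' \<le> r \<Longrightarrow>
    \<bar>u (y', x) - u (y, x)\<bar> \<le> B * norm (y' - y)"
proof -
  obtain B where B: "0 < B" "\<And>p. p \<in> half_ball (r + X + 1) \<Longrightarrow> norm (F p) \<le> B" using F_bound by blast
  have "\<bar>u (y', x) - u (y, x)\<bar> \<le> B * norm (y' - y)" if "0 < x" "x \<le> X" "norm y \<le> r" "norm y' \<le> r" for x y y'
  proof -
    have "norm (F (y + s *\<^sub>R (y' - y), x)) \<le> B" if s: "0 \<le> s" "s \<le> 1" for s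
    proof (rule B(2))
      have "(y + s *\<^sub>R (y' - y), x) \<in> half_ball (r + x + 1)"
        using \<open>0 < x\<close> \<open>norm y \<le> r\<close> \<open>norm y' \<le> r\<close> s by (intro segment_in_half_ball) auto
      then show "(y + s *\<^sub>R (y' - y), x) \<in> half_ball (r + X + 1)"
        using \<open>x \<le> X\<close> by (auto simp: half_ball_def)
    qed
    from lipschitz_increment_y[OF \<open>0 < x\<close> this] show ?thesis by simp
  qed
  then show ?thesis using B(1) that by blast
qed

lemma g_lipschitz:
  obtains C where "0 < C" "\<And>x s t. 0 < x \<Longrightarrow> x < R \<Longrightarrow> \<bar>s\<bar> \<le> B \<Longrightarrow> \<bar>t\<bar> \<le> B \<Longrightarrow> \<bar>g x s - g x t\<bar> \<le> C * \<bar>s - t\<bar>"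
    "\<And>x t D. 0 < x \<Longrightarrow> x < R \<Longrightarrow> \<bar>t\<bar> \<le> B \<Longrightarrow> (g x has_real_derivative D) (at t) \<Longrightarrow> \<bar>D\<bar> \<le> C"
proof -
  \<comment> \<open>The maxima make both parameters positive, and the added 1 turns |t| \<le> B into
    a strict inequality.\<close>
  have "\<exists>C>0. \<forall>x t D. 0 < x \<and> x < max R 1 \<and> \<bar>t\<bar> < max B 0 + 1 \<and> (g x has_real_derivative D) (at t) \<longrightarrow> \<bar>D\<bar> \<le> C"
  proof -
    have "\<forall>R>0. \<forall>M>0. \<exists>C>0. \<forall>x t D. 0 < x \<and> x < R \<and> \<bar>t\<bar> < M \<and>
      (g x has_real_derivative D) (at t) \<longrightarrow> \<bar>D\<bar> \<le> C"
      using structural unfolding structural_def by (elim conjE)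
    from this[rule_format, of "max R 1" "max B 0 + 1"] show ?thesis by simp
  qed
  then obtain C where C: "0 < C" "\<And>x t D. 0 < x \<Longrightarrow> x < max R 1 \<Longrightarrow> \<bar>t\<bar> < max B 0 + 1 \<Longrightarrow> (g x has_real_derivative D) (at t) \<Longrightarrow> \<bar>D\<bar> \<le> C"
    by blast
  have der: "\<bar>D\<bar> \<le> C" if "0 < x" "x < R" "\<bar>t\<bar> \<le> B" "(g x has_real_derivative D) (at t)" for x t D
    using that by (intro C(2)[of x t]) auto
  have "\<bar>g x s - g x t\<bar> \<le> C * \<bar>s - t\<bar>" if x: "0 < x" "x < R" and st: "\<bar>s\<bar> \<le> B" "\<bar>t\<bar> \<le> B" for x s t
  proof (rule lipschitz_bound_from_derivative_bound[OF _ deriv_g[OF x(1)] der[OF x] _ st])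
    show "locally_lipschitz_on UNIV (g x)" using structural x(1) by (simp add: structural_def)
  qed (use C(1) in auto)
  then show ?thesis using der C(1) that by blast
qed

end

section \<open>The trace of u on the boundary\<close>

context stable_solution_setting
begin

text \<open>The Muckenhoupt condition on (0, 1) bounds a product of two integrals. The first factor
  is nonzero because \<open>\<mu>\<close> is positive, so the second cannot be infinite; in
  \<open>ennreal\<close> a factor 0 would hide an infinite one.\<close>

lemma inverse_mu_integrable: "integrable lebesgue (\<lambda>x. indicator {0<..<1} x * (1 / \<mu> x))"
proof -
  have meas1: "(\<lambda>x. indicat_real {0<..<1} x * \<mu> x) \<in> borel_measurable lebesgue"
    using mu_integrable[of 1] by simp
  have "(\<lambda>x. indicat_real {0<..<1} x * (1 / (indicat_real {0<..<1} x * \<mu> x))) \<in> borel_measurable lebesgue"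
    by (intro borel_measurable_times borel_measurable_divide meas1 borel_measurable_indicator) auto
  moreover have "(\<lambda>x. indicat_real {0<..<1} x * (1 / (indicat_real {0<..<1} x * \<mu> x))) = (\<lambda>x. indicat_real {0<..<1} x * (1 / \<mu> x))"
    by (auto simp: indicator_def)
  ultimately have meas2: "(\<lambda>x. indicat_real {0<..<1} x * (1 / \<mu> x)) \<in> borel_measurable lebesgue" by simp
  have "\<exists>\<kappa>>0. \<forall>a b. 0 \<le> a \<and> a \<le> b \<longrightarrow>
      (\<integral>\<^sup>+x\<in>{a<..<b}. ennreal (\<mu> x) \<partial>lebesgue) * (\<integral>\<^sup>+x\<in>{a<..<b}. ennreal (1 / \<mu> x) \<partial>lebesgue)
        \<le> ennreal (\<kappa> * (b - a)\<^sup>2)"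
    using structural unfolding structural_def by (elim conjE)
  then obtain \<kappa> where "\<forall>a b. 0 \<le> a \<and> a \<le> b \<longrightarrow>
      (\<integral>\<^sup>+x\<in>{a<..<b}. ennreal (\<mu> x) \<partial>lebesgue) * (\<integral>\<^sup>+x\<in>{a<..<b}. ennreal (1 / \<mu> x) \<partial>lebesgue)
        \<le> ennreal (\<kappa> * (b - a)\<^sup>2)" by blast
  from this[rule_format, of 0 1]
  have A2: "(\<integral>\<^sup>+x\<in>{0<..<1}. ennreal (\<mu> x) \<partial>lebesgue) * (\<integral>\<^sup>+x\<in>{0<..<1}. ennreal (1 / \<mu> x) \<partial>lebesgue) \<le> ennreal \<kappa>"
    by simp
  have e1: "ennreal (\<mu> x) * indicator {0<..<1} x = ennreal (indicat_real {0<..<1} x * \<mu> x)" for x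
    by (auto simp: indicator_def)
  have e2: "ennreal (1 / \<mu> x) * indicator {0<..<1} x = ennreal (indicat_real {0<..<1} x * (1 / \<mu> x))" for x
    by (auto simp: indicator_def)
  have "(\<integral>\<^sup>+x\<in>{0<..<1}. ennreal (\<mu> x) \<partial>lebesgue) \<noteq> 0"
  proof
    assume "(\<integral>\<^sup>+x\<in>{0<..<1}. ennreal (\<mu> x) \<partial>lebesgue) = 0"
    then have "AE x in lebesgue. ennreal (indicat_real {0<..<1} x * \<mu> x) = 0"
      unfolding e1 using meas1 by (subst (asm) nn_integral_0_iff_AE) auto
    then have "negligible {x. \<not> ennreal (indicat_real {0<..<1} x * \<mu> x) = 0}"
      by (simp only: AE_lebesgue_iff_negligible)
    then have "negligible {0<..<1::real}"
      by (rule negligible_subset) (use mu_pos in \<open>auto simp: indicator_def ennreal_eq_0_iff not_le\<close>)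
    then show False using open_not_negligible[of "{0<..<1::real}"] by simp
  qed
  then have fin: "(\<integral>\<^sup>+x\<in>{0<..<1}. ennreal (1 / \<mu> x) \<partial>lebesgue) < \<infinity>"
    using A2 by (metis ennreal_mult_eq_top_iff ennreal_neq_top infinity_ennreal_def less_top top.extremum_uniqueI)
  show ?thesis
  proof (rule integrableI_bounded[OF meas2])
    have "(\<integral>\<^sup>+x. ennreal (norm (indicat_real {0<..<1} x * (1 / \<mu> x))) \<partial>lebesgue)
        = (\<integral>\<^sup>+x\<in>{0<..<1}. ennreal (1 / \<mu> x) \<partial>lebesgue)"
      unfolding e2 by (rule nn_integral_cong) (use mu_pos in \<open>auto simp: indicator_def less_imp_le\<close>)
    then show "(\<integral>\<^sup>+x. ennreal (norm (indicat_real {0<..<1} x * (1 / \<mu> x))) \<partial>lebesgue) < \<infinity>" using fin by simp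
  qed
qed

lemma x_derivative:
  assumes "0 < x"
  shows "((\<lambda>x. u (y, x)) has_real_derivative snd (D1 (y, x))) (at x within S)"
proof -
  have "((\<lambda>x. (y, x)) has_derivative (\<lambda>h. (0, h))) (at x within S)" by (auto intro!: derivative_eq_intros)
  moreover have "(u has_derivative (\<lambda>h. h \<bullet> D1 (y, x))) (at (y, x))"
    using grad_u[of "(y, x)"] assms by (simp add: gderiv_def)
  ultimately have "((\<lambda>x. u (y, x)) has_derivative (\<lambda>h. (0, h) \<bullet> D1 (y, x))) (at x within S)"
    by (rule has_derivative_compose)
  moreover have "(\<lambda>h. (0, h) \<bullet> D1 (y, x)) = (*) (snd (D1 (y, x)))"
    by (auto simp: inner_prod_def fun_eq_iff)
  ultimately show ?thesis by (simp add: has_field_derivative_def)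
qed

text \<open>The inequality |u_x| \<le> \<open>\<mu>\<close> u_x^2 + 1/\<open>\<mu>\<close> makes u_x
  integrable on a cylinder, hence on almost every vertical segment. There u is a constant plus an
  indefinite integral and has a limit at x = 0.\<close>

lemma AE_trace_exists: "AE y in lborel. norm y \<le> R \<longrightarrow> (\<exists>l. ((\<lambda>x. u (y, x)) \<longlongrightarrow> l) (at_right 0))"
proof -
  define A where "A = cball 0 R \<times> {0<..<1} \<inter> (upper_half :: ((real ^ 'n) \<times> real) set)"
  define d where "d p = indicator A p *\<^sub>R snd (D1 p)" for p
  have A: "A \<in> sets borel" unfolding A_def
    by (intro sets.Int borel_Times) (auto simp: open_upper_half)
  have dm: "d \<in> borel_measurable borel" unfolding d_def
    by (rule borel_measurable_continuous_on_indicator[OF A])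
      (intro continuous_on_snd continuous_on_subset[OF cont_D1], auto simp: A_def)
  have 1: "integrable lebesgue (\<lambda>p. indicat_real upper_half p *\<^sub>R (\<mu> (snd p) * (norm (D1 p))\<^sup>2 * indicator (ball 0 (R + 2)) p))"
    using energy_integrable[of "R + 2"] by (simp add: integrable_restrict_space)
  have "integrable lborel (indicator (cball 0 R) :: real ^ 'n \<Rightarrow> real)"
    using emeasure_bounded_finite[of "cball (0 :: real ^ 'n) R"] by (simp add: integrable_indicator_iff)
  from integrable_completion_product[OF this inverse_mu_integrable]
  have 2: "integrable lebesgue (\<lambda>p :: (real ^ 'n) \<times> real. indicator (cball 0 R) (fst p) * (indicator {0<..<1} (snd p) * (1 / \<mu> (snd p))))" .
  have "integrable lebesgue d"
  proof (rule Bochner_Integration.integrable_bound[OF Bochner_Integration.integrable_add[OF 1 2]])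
    show "d \<in> borel_measurable lebesgue" using dm by (intro measurable_completion) simp
    show "AE p in lebesgue. norm (d p) \<le> norm (indicat_real upper_half p *\<^sub>R (\<mu> (snd p) * (norm (D1 p))\<^sup>2 * indicator (ball 0 (R + 2)) p)
        + indicator (cball 0 R) (fst p) * (indicator {0<..<1} (snd p) * (1 / \<mu> (snd p))))"
    proof (rule AE_I2)
      fix p :: "(real ^ 'n) \<times> real"
      obtain y x where p: "p = (y, x)" by (cases p)
      show "norm (d p) \<le> norm (indicat_real upper_half p *\<^sub>R (\<mu> (snd p) * (norm (D1 p))\<^sup>2 * indicator (ball 0 (R + 2)) p)
        + indicator (cball 0 R) (fst p) * (indicator {0<..<1} (snd p) * (1 / \<mu> (snd p))))"
      proof (cases "p \<in> A")
        case True
        then have x: "norm y \<le> R" "0 < x" "x < 1" by (auto simp: A_def p)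
        have "norm p \<le> norm y + \<bar>x\<bar>"
          using sqrt_sum_squares_le_sum_abs[of "norm y" x] by (simp add: p norm_Pair)
        then have pb: "p \<in> ball 0 (R + 2)" using x by simp
        define q where "q = \<bar>snd (D1 p)\<bar>"
        have q: "0 \<le> q" "q \<le> norm (D1 p)"
          using norm_snd_le[of "snd (D1 p)" "fst (D1 p)"] by (auto simp: q_def)
        have m: "0 < \<mu> x" using mu_pos x by blast
        \<comment> \<open>Expanding the square gives 2 q \<le> \<open>\<mu>\<close> q^2 +
          1/\<open>\<mu>\<close>, the weighted arithmetic-geometric inequality.\<close>
        have "0 \<le> (q * \<mu> x - 1)\<^sup>2 / \<mu> x" using m by simp
        also have "\<dots> = \<mu> x * q\<^sup>2 - 2 * q + 1 / \<mu> x"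
          using m by (simp add: power2_eq_square field_simps)
        finally have "q \<le> \<mu> x * q\<^sup>2 + 1 / \<mu> x" using q by linarith
        also have "\<dots> \<le> \<mu> x * (norm (D1 p))\<^sup>2 + 1 / \<mu> x"
          using q m by (intro add_right_mono mult_left_mono power_mono) auto
        finally show ?thesis using True pb x m by (auto simp: d_def p q_def)
      qed (simp add: d_def)
    qed
  qed
  then have "integrable lborel d" using dm by (simp add: integrable_completion)
  then have "integrable (lborel \<Otimes>\<^sub>M lborel) d" by (simp only: lborel_prod)
  from lborel_pair.AE_integrable_fst'[OF this]
  have "AE y in lborel. integrable lborel (\<lambda>x. d (y, x))" .
  then show ?thesis
  proof eventually_elim
    case (elim y)
    show ?case
    proof
      assume y: "norm y \<le> R"
      define k where "k x = d (y, x)" for x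
      have k: "k x = snd (D1 (y, x))" if "0 < x" "x < 1" for x
        using y that by (simp add: k_def d_def A_def)
      have "k integrable_on UNIV"
        using has_integral_integral_lborel[OF elim] unfolding k_def by (rule has_integral_integrable)
      then have ki: "k integrable_on {a..b}" for a b
        by (metis integrable_on_subcbox box_real(2) subset_UNIV)
      define I where "I = integral {0..1/2} k"
      \<comment> \<open>The fundamental theorem is applied on [x, 1/2], away from 0. Continuity of
        the indefinite integral of k at 0 then provides the limit.\<close>
      have u_eq: "u (y, x) = u (y, 1/2) - I + integral {0..x} k" if x: "x \<in> {0<..1/2}" for x
      proof -
        have "((\<lambda>x. snd (D1 (y, x))) has_integral (u (y, 1/2) - u (y, x))) {x..1/2}"
        proof (rule fundamental_theorem_of_calculus)
          fix z assume "z \<in> {x..1/2}"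
          then show "((\<lambda>x. u (y, x)) has_vector_derivative snd (D1 (y, z))) (at z within {x..1/2})"
            using x_derivative[of z] x by (auto simp: has_real_derivative_iff_has_vector_derivative[symmetric])
        qed (use x in auto)
        then have "(k has_integral (u (y, 1/2) - u (y, x))) {x..1/2}"
          by (rule has_integral_eq[rotated]) (use x k in auto)
        then have "integral {x..1/2} k = u (y, 1/2) - u (y, x)" by (rule integral_unique)
        moreover have "integral {0..x} k + integral {x..1/2} k = I"
          unfolding I_def using x by (intro Henstock_Kurzweil_Integration.integral_combine ki) auto
        ultimately show ?thesis by simp
      qed
      have "continuous_on {0..1/2} (\<lambda>x. integral {0..x} k)"
        by (rule indefinite_integral_continuous_1[OF ki])
      then have "((\<lambda>x. integral {0..x} k) \<longlongrightarrow> integral {0..0} k) (at 0 within {0..1/2})"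
        unfolding continuous_on by (rule bspec) simp
      then have "((\<lambda>x. integral {0..x} k) \<longlongrightarrow> integral {0..0} k) (at_right 0)"
        using at_within_Icc_at_right[of "0::real" "1/2"] by simp
      then have "((\<lambda>x. u (y, 1/2) - I + integral {0..x} k) \<longlongrightarrow> u (y, 1/2) - I + integral {0..0} k) (at_right 0)"
        by (intro tendsto_intros)
      moreover have "\<forall>\<^sub>F x in at_right 0. u (y, 1/2) - I + integral {0..x} k = u (y, x)"
        unfolding eventually_at_right_field
      proof (intro exI[of _ "1/2"] conjI allI impI)
        fix x :: real assume "0 < x" "x < 1/2"
        then show "u (y, 1/2) - I + integral {0..x} k = u (y, x)" by (intro u_eq[symmetric]) auto
      qed simp
      ultimately show "\<exists>l. ((\<lambda>x. u (y, x)) \<longlongrightarrow> l) (at_right 0)"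
        using Lim_transform_eventually by (intro exI)
    qed
  qed
qed

text \<open>From almost every vertical line to every one: y is approximated by points z n at which
  the limit exists. The Lipschitz bound in y, uniform in x, makes these limits a Cauchy sequence and
  transfers the convergence to y.\<close>

lemma trace_exists: "\<exists>l. ((\<lambda>x. u (y, x)) \<longlongrightarrow> l) (at_right 0)"
proof -
  define r where "r = norm y + 1"
  obtain B where B: "0 < B" "\<And>x z z'. 0 < x \<Longrightarrow> x \<le> 1 \<Longrightarrow> norm z \<le> r \<Longrightarrow> norm z' \<le> r \<Longrightarrow>
      \<bar>u (z', x) - u (z, x)\<bar> \<le> B * norm (z' - z)"
    using u_lipschitz_y[of 1 r] by blast
  \<comment> \<open>A ball is not negligible, so it contains a good point; radius at most 1 keeps
    that point within r = |y| + 1.\<close>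
  have "\<exists>z. dist y z < e \<and> norm z \<le> r \<and> (\<exists>l. ((\<lambda>x. u (z, x)) \<longlongrightarrow> l) (at_right 0))" if e: "0 < e" for e
  proof -
    have "AE z in lebesgue. norm z \<le> r \<longrightarrow> (\<exists>l. ((\<lambda>x. u (z, x)) \<longlongrightarrow> l) (at_right 0))"
      by (rule AE_completion[OF AE_trace_exists])
    then have neg: "negligible {z. \<not> (norm z \<le> r \<longrightarrow> (\<exists>l. ((\<lambda>x. u (z, x)) \<longlongrightarrow> l) (at_right 0)))}"
      by (simp only: AE_lebesgue_iff_negligible)
    have "\<not> negligible (ball y (min e 1))"
      using open_not_negligible[of "ball y (min e 1)"] e by simp
    then have "\<not> ball y (min e 1) \<subseteq> {z. \<not> (norm z \<le> r \<longrightarrow> (\<exists>l. ((\<lambda>x. u (z, x)) \<longlongrightarrow> l) (at_right 0)))}"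
      using negligible_subset[OF neg] by blast
    then obtain z where z: "z \<in> ball y (min e 1)" "norm z \<le> r \<longrightarrow> (\<exists>l. ((\<lambda>x. u (z, x)) \<longlongrightarrow> l) (at_right 0))" by blast
    have "norm z \<le> norm y + dist y z" by (metis dist_commute dist_norm norm_triangle_sub)
    then have "norm z \<le> r" using z(1) by (simp add: r_def)
    then show ?thesis using z by auto
  qed
  then have "\<forall>n. \<exists>z. dist y z < inverse (real (Suc n)) \<and> norm z \<le> r \<and> (\<exists>l. ((\<lambda>x. u (z, x)) \<longlongrightarrow> l) (at_right 0))"
    by simp
  then obtain z where z: "\<And>n. dist y (z n) < inverse (real (Suc n))" "\<And>n. norm (z n) \<le> r"
      "\<And>n. \<exists>l. ((\<lambda>x. u (z n, x)) \<longlongrightarrow> l) (at_right 0)"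
    by metis
  then obtain l where l: "\<And>n. ((\<lambda>x. u (z n, x)) \<longlongrightarrow> l n) (at_right 0)" by metis
  have ev: "\<forall>\<^sub>F x in at_right (0::real). 0 < x \<and> x \<le> 1"
    unfolding eventually_at_right_field by (intro exI[of _ 1]) auto
  have close: "\<bar>l n - l m\<bar> \<le> B * norm (z n - z m)" for n m
  proof (rule tendsto_upperbound)
    show "((\<lambda>x. \<bar>u (z n, x) - u (z m, x)\<bar>) \<longlongrightarrow> \<bar>l n - l m\<bar>) (at_right 0)"
      by (intro tendsto_intros l)
    show "\<forall>\<^sub>F x in at_right 0. \<bar>u (z n, x) - u (z m, x)\<bar> \<le> B * norm (z n - z m)"
      using ev by eventually_elim (intro B(2) z; simp)
  qed simp
  have "z \<longlonglongrightarrow> y"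
  proof (rule metric_tendsto_imp_tendsto[of "\<lambda>n. inverse (real (Suc n))" 0])
    show "(\<lambda>n. inverse (real (Suc n))) \<longlonglongrightarrow> 0" by (rule LIMSEQ_inverse_real_of_nat)
    show "\<forall>\<^sub>F n in sequentially. dist (z n) y \<le> dist (inverse (real (Suc n))) 0"
      using z(1) by (intro always_eventually allI) (simp add: dist_commute less_imp_le del: of_nat_Suc)
  qed
  then have "Cauchy z" by (rule LIMSEQ_imp_Cauchy)
  have "Cauchy l"
  proof (rule CauchyI)
    fix e :: real assume e: "0 < e"
    obtain M where M: "\<And>m n. M \<le> m \<Longrightarrow> M \<le> n \<Longrightarrow> norm (z m - z n) < e / B"
      using CauchyD[OF \<open>Cauchy z\<close>, of "e / B"] e B(1) by auto
    show "\<exists>M. \<forall>m\<ge>M. \<forall>n\<ge>M. norm (l m - l n) < e"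
    proof (intro exI[of _ M] allI impI)
      fix m n assume "M \<le> m" "M \<le> n"
      from M[OF this] have "B * norm (z m - z n) < e" using B(1) by (simp add: pos_less_divide_eq mult.commute)
      then show "norm (l m - l n) < e" using close[of m n] by simp
    qed
  qed
  then obtain L where L: "l \<longlonglongrightarrow> L" using Cauchy_convergent_iff convergent_def by metis
  have "((\<lambda>x. u (y, x)) \<longlongrightarrow> L) (at_right 0)"
  proof (rule tendstoI)
    fix e :: real assume e: "0 < e"
    have "\<forall>\<^sub>F n in sequentially. dist (l n) L < e / 3" using L e by (intro tendstoD) auto
    moreover have "\<forall>\<^sub>F n in sequentially. dist (z n) y < e / (3 * B)"
      using \<open>z \<longlonglongrightarrow> y\<close> e B(1) by (intro tendstoD) auto
    ultimately have "\<forall>\<^sub>F n in sequentially. dist (l n) L < e / 3 \<and> dist (z n) y < e / (3 * B)" by (rule eventually_conj)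
    then obtain n where n: "dist (l n) L < e / 3" "dist (z n) y < e / (3 * B)"
      by (auto simp: eventually_sequentially)
    have Bz: "B * norm (y - z n) < e / 3"
      using n(2) B(1) by (simp add: dist_norm norm_minus_commute pos_less_divide_eq mult_ac)
    have "\<forall>\<^sub>F x in at_right 0. dist (u (z n, x)) (l n) < e / 3" using l[of n] e by (intro tendstoD) auto
    then show "\<forall>\<^sub>F x in at_right 0. dist (u (y, x)) L < e"
      using ev
    proof eventually_elim
      case (elim x)
      have "\<bar>u (y, x) - u (z n, x)\<bar> \<le> B * norm (y - z n)"
        by (rule B(2)) (use elim z(2) in \<open>auto simp: r_def\<close>)
      then show ?case using elim n(1) Bz unfolding dist_real_def by linarith
    qed
  qed
  then show ?thesis by blast
qed

definition a :: "real ^ 'n \<Rightarrow> real" where "a = bdry u"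

lemma trace_limit: "((\<lambda>x. u (y, x)) \<longlongrightarrow> a y) (at_right 0)"
proof -
  obtain l where l: "((\<lambda>x. u (y, x)) \<longlongrightarrow> l) (at_right 0)" using trace_exists by blast
  then have "a y = l" unfolding a_def bdry_def by (intro tendsto_Lim) auto
  then show ?thesis using l by simp
qed

lemma trace_bound:
  assumes "\<And>p. p \<in> upper_half \<Longrightarrow> \<bar>u p\<bar> \<le> B"
  shows "\<bar>a y\<bar> \<le> B"
proof (rule tendsto_upperbound)
  show "((\<lambda>x. \<bar>u (y, x)\<bar>) \<longlongrightarrow> \<bar>a y\<bar>) (at_right 0)" by (intro tendsto_intros trace_limit)
  show "\<forall>\<^sub>F x in at_right 0. \<bar>u (y, x)\<bar> \<le> B"
    unfolding eventually_at_right_field using assms by (intro exI[of _ 1]) auto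
qed simp

lemma trace_lipschitz:
  assumes B: "0 < B" "\<And>x z z'. 0 < x \<Longrightarrow> x \<le> 1 \<Longrightarrow> norm z \<le> r \<Longrightarrow> norm z' \<le> r \<Longrightarrow>
      \<bar>u (z', x) - u (z, x)\<bar> \<le> B * norm (z' - z)"
  shows "B-lipschitz_on (cball 0 r) a"
proof (rule lipschitz_onI)
  fix y z :: "real ^ 'n" assume yz: "y \<in> cball 0 r" "z \<in> cball 0 r"
  have "\<bar>a y - a z\<bar> \<le> B * norm (y - z)"
  proof (rule tendsto_upperbound)
    show "((\<lambda>x. \<bar>u (y, x) - u (z, x)\<bar>) \<longlongrightarrow> \<bar>a y - a z\<bar>) (at_right 0)" by (intro tendsto_intros trace_limit)
    show "\<forall>\<^sub>F x in at_right 0. \<bar>u (y, x) - u (z, x)\<bar> \<le> B * norm (y - z)"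
      unfolding eventually_at_right_field using B(2) yz by (intro exI[of _ 1]) auto
  qed simp
  then show "dist (a y) (a z) \<le> B * dist y z" by (simp add: dist_real_def dist_norm)
qed (use B in simp)

lemma trace_locally_lipschitz: "\<exists>L. L-lipschitz_on (cball 0 r) a"
  using u_lipschitz_y[of 1 r] trace_lipschitz by metis

end

section \<open>Difference quotients as test functions\<close>

lemma lebesgue_translate:
  fixes f :: "'a::euclidean_space \<Rightarrow> real"
  assumes f: "integrable lebesgue f"
  shows "integrable lebesgue (\<lambda>y. f (y + k))"
    and "(\<integral>y. f (y + k) \<partial>lebesgue) = (\<integral>y. f y \<partial>lebesgue)"
proof -
  have "integrable (distr lebesgue lebesgue ((+) k)) f" using f by (simp add: distr_lebesgue_plus)
  then have "integrable lebesgue (\<lambda>y. f (k + y))"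
    by (subst (asm) integrable_distr_eq[OF measurable_plus_lebesgue]) (use f in auto)
  then show "integrable lebesgue (\<lambda>y. f (y + k))" by (simp add: add.commute)
  have "(\<integral>y. f y \<partial>lebesgue) = (\<integral>y. f y \<partial>(distr lebesgue lebesgue ((+) k)))" by (simp add: distr_lebesgue_plus)
  also have "\<dots> = (\<integral>y. f (k + y) \<partial>lebesgue)"
    by (rule integral_distr[OF measurable_plus_lebesgue]) (use f in auto)
  finally show "(\<integral>y. f (y + k) \<partial>lebesgue) = (\<integral>y. f y \<partial>lebesgue)" by (simp add: add.commute)
qed

lemma AE_upper_half_translate:
  assumes "AE p in lebesgue_upper_half. P p"
  shows "AE p in lebesgue_upper_half. P (p + (k, 0))"
proof -
  have "negligible {p. \<not> (p \<in> upper_half \<longrightarrow> P p)}"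
    using assms by (simp only: AE_upper_half_iff AE_lebesgue_iff_negligible)
  then have "negligible ((+) (- (k, 0)) ` {p. \<not> (p \<in> upper_half \<longrightarrow> P p)})"
    by (rule negligible_translation)
  then have "negligible {p. \<not> (p \<in> upper_half \<longrightarrow> P (p + (k, 0)))}"
  proof (rule negligible_subset, intro subsetI)
    fix p assume "p \<in> {p. \<not> (p \<in> upper_half \<longrightarrow> P (p + (k, 0)))}"
    then have "p + (k, 0) \<in> {p. \<not> (p \<in> upper_half \<longrightarrow> P p)}" by (cases p) auto
    then show "p \<in> (+) (- (k, 0)) ` {p. \<not> (p \<in> upper_half \<longrightarrow> P p)}"
      by (rule image_eqI[rotated]) (simp add: zero_prod_def)
  qed
  then show ?thesis by (simp only: AE_upper_half_iff AE_lebesgue_iff_negligible)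
qed

lemma locally_lipschitz_on_translate:
  assumes lip: "locally_lipschitz_on S f" and S: "\<And>p. p \<in> S \<Longrightarrow> p + c \<in> S"
  shows "locally_lipschitz_on S (\<lambda>p. f (p + c :: 'a::real_normed_vector))"
  unfolding locally_lipschitz_on_def
proof
  fix p assume p: "p \<in> S"
  obtain r L where r: "r > 0" "L-lipschitz_on (cball (p + c) r \<inter> S) f"
    using lip S[OF p] unfolding locally_lipschitz_on_def by blast
  have "L-lipschitz_on (cball p r \<inter> S) (\<lambda>p. f (p + c))"
  proof (rule lipschitz_onI)
    fix x y assume "x \<in> cball p r \<inter> S" "y \<in> cball p r \<inter> S"
    then have "dist (f (x + c)) (f (y + c)) \<le> L * dist (x + c) (y + c)"
      using S by (intro lipschitz_onD[OF r(2)]) auto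
    then show "dist (f (x + c)) (f (y + c)) \<le> L * dist x y" by simp
  qed (rule lipschitz_on_nonneg[OF r(2)])
  then show "\<exists>r>0. \<exists>L. L-lipschitz_on (cball p r \<inter> S) (\<lambda>p. f (p + c))" using r(1) by blast
qed

lemma bdryI: "((\<lambda>x. v (y, x)) \<longlongrightarrow> l) (at_right 0) \<Longrightarrow> bdry v y = l"
  unfolding bdry_def by (intro tendsto_Lim) auto

lemma bdry_translate: "bdry (\<lambda>p. v (p + (k, 0))) y = bdry v (y + k)"
  by (simp add: bdry_def)

lemma norm_sum_scaleR_power2_le:
  fixes z :: "'i \<Rightarrow> 'a::real_normed_vector"
  shows "(norm (\<Sum>i\<in>I. c i *\<^sub>R z i))\<^sup>2 \<le> (\<Sum>i\<in>I. (c i)\<^sup>2) * (\<Sum>i\<in>I. (norm (z i))\<^sup>2)"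
proof -
  have "norm (\<Sum>i\<in>I. c i *\<^sub>R z i) \<le> (\<Sum>i\<in>I. norm (c i *\<^sub>R z i))" by (rule norm_sum)
  then have "norm (\<Sum>i\<in>I. c i *\<^sub>R z i) \<le> (\<Sum>i\<in>I. \<bar>c i\<bar> * norm (z i))" by simp
  then have "(norm (\<Sum>i\<in>I. c i *\<^sub>R z i))\<^sup>2 \<le> (\<Sum>i\<in>I. \<bar>c i\<bar> * norm (z i))\<^sup>2" by (intro power_mono) auto
  also have "\<dots> \<le> (\<Sum>i\<in>I. \<bar>c i\<bar>\<^sup>2) * (\<Sum>i\<in>I. (norm (z i))\<^sup>2)" by (rule Cauchy_Schwarz_ineq_sum)
  finally show ?thesis by simp
qed

lemma norm_add_power2_le: "(norm (x + y))\<^sup>2 \<le> 2 * (norm x)\<^sup>2 + 2 * (norm (y :: 'a::real_normed_vector))\<^sup>2"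
proof -
  have "(norm (x + y))\<^sup>2 \<le> (norm x + norm y)\<^sup>2" by (intro power_mono norm_triangle_ineq) auto
  also have "\<dots> \<le> 2 * (norm x)\<^sup>2 + 2 * (norm y)\<^sup>2"
    using sum_squares_bound[of "norm x" "norm y"] by (simp add: power2_sum)
  finally show ?thesis .
qed

context stable_solution_setting
begin

text \<open>A test function together with an explicit measurable gradient G, valid almost
  everywhere. Integrals are written with G instead of \<open>grad \<xi>\<close>, and G also vanishes
  beyond radius r, so that half-ball integrals extend to the half-space.\<close>

definition test :: "((real ^ 'n) \<times> real \<Rightarrow> real) \<Rightarrow> ((real ^ 'n) \<times> real \<Rightarrow> (real ^ 'n) \<times> real) \<Rightarrow> real \<Rightarrow> bool" where
  "test \<xi> G r \<longleftrightarrow> 0 < r \<and> locally_lipschitz_on upper_half \<xi> \<and> bounded (\<xi> ` upper_half) \<and>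
    (\<forall>p\<in>upper_half. r \<le> norm p \<longrightarrow> \<xi> p = 0 \<and> G p = 0) \<and>
    (AE p in lebesgue_upper_half. GDERIV \<xi> p :> G p) \<and>
    G \<in> borel_measurable lebesgue_upper_half \<and>
    integrable lebesgue_upper_half (\<lambda>p. \<mu> (snd p) * (norm (G p))\<^sup>2)"

lemma test_zero: "test \<xi> G r \<Longrightarrow> p \<in> upper_half \<Longrightarrow> r \<le> norm p \<Longrightarrow> \<xi> p = 0 \<and> G p = 0"
  unfolding test_def by blast

lemma test_AE_grad:
  assumes "test \<xi> G r"
  shows "AE p in lebesgue_upper_half. grad \<xi> p = G p"
proof -
  have "AE p in lebesgue_upper_half. GDERIV \<xi> p :> G p" using assms by (simp add: test_def)
  then show ?thesis by eventually_elim (rule grad_eq)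
qed

lemma test_dirichlet:
  assumes t: "test \<xi> G r"
  shows "set_integrable lebesgue (half_ball r) (\<lambda>p. \<mu> (snd p) * (norm (grad \<xi> p))\<^sup>2)"
    and "(LINT p:half_ball r|lebesgue. \<mu> (snd p) * (norm (grad \<xi> p))\<^sup>2)
      = (\<integral>p. \<mu> (snd p) * (norm (G p))\<^sup>2 \<partial>lebesgue_upper_half)"
proof -
  have ae: "AE p in lebesgue_upper_half. \<mu> (snd p) * (norm (grad \<xi> p))\<^sup>2 = \<mu> (snd p) * (norm (G p))\<^sup>2"
    using test_AE_grad[OF t] by eventually_elim simp
  have sub: "half_ball r \<subseteq> (upper_half :: ((real ^ 'n) \<times> real) set)" by (simp add: half_ball_def)
  have z: "\<mu> (snd p) * (norm (G p))\<^sup>2 = 0" if "p \<in> upper_half - half_ball r" for p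
    using test_zero[OF t, of p] that by (auto simp: half_ball_def)
  show "set_integrable lebesgue (half_ball r) (\<lambda>p. \<mu> (snd p) * (norm (grad \<xi> p))\<^sup>2)"
    using set_integral_eq_upper_half(1)[OF sub ae z] t by (simp add: test_def)
  show "(LINT p:half_ball r|lebesgue. \<mu> (snd p) * (norm (grad \<xi> p))\<^sup>2)
      = (\<integral>p. \<mu> (snd p) * (norm (G p))\<^sup>2 \<partial>lebesgue_upper_half)"
    by (rule set_integral_eq_upper_half(2)[OF sub ae z])
qed

lemma test_admissible:
  assumes t: "test \<xi> G r"
  shows "admissible \<mu> r \<xi>"
  using t test_dirichlet(1)[OF t] by (auto simp: admissible_def test_def)

lemma test_weak:
  assumes t: "test \<xi> G r"
  shows "integrable lebesgue_upper_half (\<lambda>p. \<mu> (snd p) * (D1 p \<bullet> G p))"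
    and "integrable lebesgue_upper_half (\<lambda>p. g (snd p) (u p) * \<xi> p)"
    and "integrable lebesgue (\<lambda>y. f (a y) * bdry \<xi> y)"
    and "(\<integral>p. \<mu> (snd p) * (D1 p \<bullet> G p) \<partial>lebesgue_upper_half) + (\<integral>p. g (snd p) (u p) * \<xi> p \<partial>lebesgue_upper_half)
      = (\<integral>y. f (a y) * bdry \<xi> y \<partial>lebesgue)"
proof -
  note adm = test_admissible[OF t]
  have w: "set_integrable lebesgue upper_half (\<lambda>p. \<mu> (snd p) * (grad u p \<bullet> grad \<xi> p))"
    "set_integrable lebesgue upper_half (\<lambda>p. g (snd p) (u p) * \<xi> p)"
    "set_integrable lebesgue UNIV (\<lambda>y. f (bdry u y) * bdry \<xi> y)"
    "(LINT p:upper_half|lebesgue. \<mu> (snd p) * (grad u p \<bullet> grad \<xi> p))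
        + (LINT p:upper_half|lebesgue. g (snd p) (u p) * \<xi> p)
        = (LINT y|lebesgue. f (bdry u y) * bdry \<xi> y)"
    using weak adm unfolding weak_solution_def by blast+
  have ae: "AE p in lebesgue_upper_half. \<mu> (snd p) * (grad u p \<bullet> grad \<xi> p) = \<mu> (snd p) * (D1 p \<bullet> G p)"
    using test_AE_grad[OF t] AE_space by eventually_elim (simp add: grad_u_eq)
  have ae2: "AE p in lebesgue_upper_half. g (snd p) (u p) * \<xi> p = g (snd p) (u p) * \<xi> p" by simp
  note 1 = set_integral_eq_upper_half[OF order_refl ae, simplified]
  note 2 = set_integral_eq_upper_half[OF order_refl ae2, simplified]
  show "integrable lebesgue_upper_half (\<lambda>p. \<mu> (snd p) * (D1 p \<bullet> G p))"
    "integrable lebesgue_upper_half (\<lambda>p. g (snd p) (u p) * \<xi> p)"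
    using w(1,2) 1(1) 2(1) by simp_all
  show "integrable lebesgue (\<lambda>y. f (a y) * bdry \<xi> y)" using w(3) by (simp add: set_integrable_def a_def)
  show "(\<integral>p. \<mu> (snd p) * (D1 p \<bullet> G p) \<partial>lebesgue_upper_half) + (\<integral>p. g (snd p) (u p) * \<xi> p \<partial>lebesgue_upper_half)
      = (\<integral>y. f (a y) * bdry \<xi> y \<partial>lebesgue)"
    using w(4) 1(2) 2(2) by (simp add: a_def)
qed

lemma test_stable:
  assumes t: "test \<xi> G r"
  shows "integrable lebesgue_upper_half (\<lambda>p. g\<^sub>u (snd p) (u p) * (\<xi> p)\<^sup>2)"
    and "integrable lebesgue (\<lambda>y. f' (a y) * (bdry \<xi> y)\<^sup>2)"
    and "0 \<le> (\<integral>p. \<mu> (snd p) * (norm (G p))\<^sup>2 \<partial>lebesgue_upper_half)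
      + (\<integral>p. g\<^sub>u (snd p) (u p) * (\<xi> p)\<^sup>2 \<partial>lebesgue_upper_half)
      - (\<integral>y. f' (a y) * (bdry \<xi> y)\<^sup>2 \<partial>lebesgue)"
proof -
  note adm = test_admissible[OF t]
  have s: "set_integrable lebesgue (half_ball r) (\<lambda>p. g\<^sub>u (snd p) (u p) * (\<xi> p)\<^sup>2)"
      "set_integrable lebesgue (ball 0 r) (\<lambda>y. f' (bdry u y) * (bdry \<xi> y)\<^sup>2)"
      "(LINT p:half_ball r|lebesgue. \<mu> (snd p) * (norm (grad \<xi> p))\<^sup>2)
        + (LINT p:half_ball r|lebesgue. g\<^sub>u (snd p) (u p) * (\<xi> p)\<^sup>2)
        - (LINT y:ball 0 r|lebesgue. f' (bdry u y) * (bdry \<xi> y)\<^sup>2) \<ge> 0"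
    using stable adm unfolding stable_solution_def by blast+
  have sub: "half_ball r \<subseteq> (upper_half :: ((real ^ 'n) \<times> real) set)" by (simp add: half_ball_def)
  have ae: "AE p in lebesgue_upper_half. g\<^sub>u (snd p) (u p) * (\<xi> p)\<^sup>2 = g\<^sub>u (snd p) (u p) * (\<xi> p)\<^sup>2" by simp
  have z: "g\<^sub>u (snd p) (u p) * (\<xi> p)\<^sup>2 = 0" if "p \<in> upper_half - half_ball r" for p
    using test_zero[OF t, of p] that by (auto simp: half_ball_def)
  note 1 = set_integral_eq_upper_half[OF sub ae z]
  show "integrable lebesgue_upper_half (\<lambda>p. g\<^sub>u (snd p) (u p) * (\<xi> p)\<^sup>2)" using s(1) 1(1) by simp
  have "bdry \<xi> y = 0" if "y \<notin> ball 0 r" for y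
  proof (rule bdryI, rule tendsto_eventually)
    show "\<forall>\<^sub>F x in at_right 0. \<xi> (y, x) = 0"
      unfolding eventually_at_right_field
    proof (intro exI[of _ 1] conjI allI impI)
      fix x :: real assume "0 < x"
      moreover have "r \<le> norm (y, x)" using that norm_fst_le[of y x] by simp
      ultimately show "\<xi> (y, x) = 0" using t by (simp add: test_def)
    qed simp
  qed
  then have ind: "indicat_real (ball 0 r) y *\<^sub>R (f' (bdry u y) * (bdry \<xi> y)\<^sup>2) = f' (a y) * (bdry \<xi> y)\<^sup>2" for y
    by (auto simp: indicator_def a_def)
  show "integrable lebesgue (\<lambda>y. f' (a y) * (bdry \<xi> y)\<^sup>2)" using s(2) unfolding set_integrable_def ind .
  show "0 \<le> (\<integral>p. \<mu> (snd p) * (norm (G p))\<^sup>2 \<partial>lebesgue_upper_half)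
      + (\<integral>p. g\<^sub>u (snd p) (u p) * (\<xi> p)\<^sup>2 \<partial>lebesgue_upper_half)
      - (\<integral>y. f' (a y) * (bdry \<xi> y)\<^sup>2 \<partial>lebesgue)"
  proof -
    have e: "(LINT p:half_ball r|lebesgue. g\<^sub>u (snd p) (u p) * (\<xi> p)\<^sup>2)
        = (\<integral>p. g\<^sub>u (snd p) (u p) * (\<xi> p)\<^sup>2 \<partial>lebesgue_upper_half)"
      by (rule set_integral_eq_upper_half(2)[OF sub ae z])
    have e': "(LINT y:ball 0 r|lebesgue. f' (bdry u y) * (bdry \<xi> y)\<^sup>2)
        = (\<integral>y. f' (a y) * (bdry \<xi> y)\<^sup>2 \<partial>lebesgue)"
      unfolding set_lebesgue_integral_def ind ..
    show ?thesis using s(3) unfolding e e' test_dirichlet(2)[OF t] .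
  qed
qed

text \<open>Horizontal translations preserve the half-space and the weight, which depends on x
  only.\<close>

lemma test_translate:
  assumes t: "test \<xi> G r"
  shows "test (\<lambda>p. \<xi> (p + (k, 0))) (\<lambda>p. G (p + (k, 0))) (r + norm k)"
proof -
  have H: "p + (k, 0) \<in> upper_half \<longleftrightarrow> p \<in> upper_half" for p :: "(real ^ 'n) \<times> real" by (cases p) simp
  have far: "r \<le> norm (p + (k, 0))" if "r + norm k \<le> norm p" for p :: "(real ^ 'n) \<times> real"
    using that norm_triangle_ineq4[of "p + (k, 0)" "(k, 0 :: real)"] by (simp add: norm_Pair)
  obtain B where "\<And>p. p \<in> upper_half \<Longrightarrow> norm (\<xi> p) \<le> B" using t by (auto simp: test_def bounded_iff)
  then have "bounded ((\<lambda>p. \<xi> (p + (k, 0))) ` upper_half)" unfolding bounded_iff by (intro exI[of _ B]) (use H in auto)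
  moreover have "AE p in lebesgue_upper_half. GDERIV (\<lambda>p. \<xi> (p + (k, 0))) p :> G (p + (k, 0))"
    unfolding GDERIV_translate using t by (intro AE_upper_half_translate) (simp add: test_def)
  moreover have "(\<lambda>p. G (p + (k, 0))) \<in> borel_measurable lebesgue_upper_half"
  proof -
    have "(+) (k, 0) \<in> lebesgue_upper_half \<rightarrow>\<^sub>M (lebesgue_upper_half :: ((real ^ 'n) \<times> real) measure)"
      by (rule measurable_restrict_space3[OF measurable_plus_lebesgue]) (use H in \<open>auto simp: add.commute\<close>)
    moreover have "G \<in> borel_measurable lebesgue_upper_half" using t by (simp add: test_def)
    ultimately have "(\<lambda>p. G ((k, 0) + p)) \<in> borel_measurable lebesgue_upper_half" by (rule measurable_compose)
    then show ?thesis by (simp add: add.commute)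
  qed
  moreover have "integrable lebesgue_upper_half (\<lambda>p. \<mu> (snd p) * (norm (G (p + (k, 0))))\<^sup>2)"
    using upper_half_translate(1)[of "\<lambda>p. \<mu> (snd p) * (norm (G p))\<^sup>2" k] t by (simp add: test_def)
  moreover have "locally_lipschitz_on upper_half (\<lambda>p. \<xi> (p + (k, 0)))"
    using t H by (intro locally_lipschitz_on_translate) (auto simp: test_def)
  moreover have "0 < r + norm k" using t by (simp add: test_def add_pos_nonneg)
  moreover have "\<forall>p\<in>upper_half. r + norm k \<le> norm p \<longrightarrow> \<xi> (p + (k, 0)) = 0 \<and> G (p + (k, 0)) = 0"
    using t far H by (simp add: test_def)
  ultimately show ?thesis unfolding test_def by blast
qed

definition v :: "real \<Rightarrow> real ^ 'n \<Rightarrow> (real ^ 'n) \<times> real \<Rightarrow> real" where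
  "v h b p = (u (p + (h *\<^sub>R b, 0)) - u p) / h"

definition dv :: "real \<Rightarrow> real ^ 'n \<Rightarrow> (real ^ 'n) \<times> real \<Rightarrow> (real ^ 'n) \<times> real" where
  "dv h b p = (1 / h) *\<^sub>R (D1 (p + (h *\<^sub>R b, 0)) - D1 p)"

definition dG :: "real \<Rightarrow> real ^ 'n \<Rightarrow> (real ^ 'n) \<times> real \<Rightarrow> real" where
  "dG h b p = (g (snd p) (u (p + (h *\<^sub>R b, 0))) - g (snd p) (u p)) / h"

definition da :: "real \<Rightarrow> real ^ 'n \<Rightarrow> real ^ 'n \<Rightarrow> real" where
  "da h b y = (a (y + h *\<^sub>R b) - a y) / h"

definition dF :: "real \<Rightarrow> real ^ 'n \<Rightarrow> real ^ 'n \<Rightarrow> real" where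
  "dF h b y = (f (a (y + h *\<^sub>R b)) - f (a y)) / h"

text \<open>The equation is tested with \<open>\<xi>\<close> and with \<open>\<xi>\<close> shifted
  by -h b. A change of variables moves the shift onto u and its trace, and the difference divided by
  h is an exact equation for the quotients, without derivatives of g or f.\<close>

lemma difference_equation:
  assumes t: "test \<xi> G r"
  shows "integrable lebesgue_upper_half (\<lambda>p. \<mu> (snd p) * (dv h b p \<bullet> G p))"
    and "integrable lebesgue_upper_half (\<lambda>p. dG h b p * \<xi> p)"
    and "integrable lebesgue (\<lambda>y. dF h b y * bdry \<xi> y)"
    and "(\<integral>p. \<mu> (snd p) * (dv h b p \<bullet> G p) \<partial>lebesgue_upper_half) + (\<integral>p. dG h b p * \<xi> p \<partial>lebesgue_upper_half)
      = (\<integral>y. dF h b y * bdry \<xi> y \<partial>lebesgue)"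
proof -
  define k where "k = h *\<^sub>R b"
  note w0 = test_weak[OF t]
  note w1 = test_weak[OF test_translate[OF t, of "- k"], unfolded bdry_translate]
  have c: "p + (k, 0) + (- k, 0) = p" for p :: "(real ^ 'n) \<times> real" by (cases p) simp
  note 1 = upper_half_translate[OF w1(1), of k, unfolded c]
  note 2 = upper_half_translate[OF w1(2), of k, unfolded c]
  note 3 = lebesgue_translate[OF w1(3), of k]
  have i1: "integrable lebesgue_upper_half (\<lambda>p. \<mu> (snd p) * (D1 (p + (k, 0)) \<bullet> G p))" using 1(1) by simp
  have i2: "integrable lebesgue_upper_half (\<lambda>p. g (snd p) (u (p + (k, 0))) * \<xi> p)" using 2(1) by simp
  have i3: "integrable lebesgue (\<lambda>y. f (a (y + k)) * bdry \<xi> y)" using 3(1) by simp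
  have eq: "(\<integral>p. \<mu> (snd p) * (D1 (p + (k, 0)) \<bullet> G p) \<partial>lebesgue_upper_half)
      + (\<integral>p. g (snd p) (u (p + (k, 0))) * \<xi> p \<partial>lebesgue_upper_half) = (\<integral>y. f (a (y + k)) * bdry \<xi> y \<partial>lebesgue)"
    using w1(4) 1(2) 2(2) 3(2) by simp
  have e1: "\<mu> (snd p) * (dv h b p \<bullet> G p) = (1 / h) * (\<mu> (snd p) * (D1 (p + (k, 0)) \<bullet> G p) - \<mu> (snd p) * (D1 p \<bullet> G p))" for p
    by (simp add: dv_def k_def inner_diff_left right_diff_distrib)
  have e2: "dG h b p * \<xi> p = (1 / h) * (g (snd p) (u (p + (k, 0))) * \<xi> p - g (snd p) (u p) * \<xi> p)" for p
    by (simp add: dG_def k_def left_diff_distrib)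
  have e3: "dF h b y * bdry \<xi> y = (1 / h) * (f (a (y + k)) * bdry \<xi> y - f (a y) * bdry \<xi> y)" for y
    by (simp add: dF_def k_def left_diff_distrib)
  show "integrable lebesgue_upper_half (\<lambda>p. \<mu> (snd p) * (dv h b p \<bullet> G p))"
    unfolding e1 by (intro integrable_mult_right Bochner_Integration.integrable_diff i1 w0)
  show "integrable lebesgue_upper_half (\<lambda>p. dG h b p * \<xi> p)"
    unfolding e2 by (intro integrable_mult_right Bochner_Integration.integrable_diff i2 w0)
  show "integrable lebesgue (\<lambda>y. dF h b y * bdry \<xi> y)"
    unfolding e3 by (intro integrable_mult_right Bochner_Integration.integrable_diff i3 w0)
  have "(\<integral>p. \<mu> (snd p) * (dv h b p \<bullet> G p) \<partial>lebesgue_upper_half)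
      = (1 / h) * ((\<integral>p. \<mu> (snd p) * (D1 (p + (k, 0)) \<bullet> G p) \<partial>lebesgue_upper_half) - (\<integral>p. \<mu> (snd p) * (D1 p \<bullet> G p) \<partial>lebesgue_upper_half))"
    unfolding e1 by (simp only: integral_mult_right_zero Bochner_Integration.integral_diff[OF i1 w0(1)])
  moreover have "(\<integral>p. dG h b p * \<xi> p \<partial>lebesgue_upper_half)
      = (1 / h) * ((\<integral>p. g (snd p) (u (p + (k, 0))) * \<xi> p \<partial>lebesgue_upper_half) - (\<integral>p. g (snd p) (u p) * \<xi> p \<partial>lebesgue_upper_half))"
    unfolding e2 by (simp only: integral_mult_right_zero Bochner_Integration.integral_diff[OF i2 w0(2)])
  moreover have "(\<integral>y. dF h b y * bdry \<xi> y \<partial>lebesgue)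
      = (1 / h) * ((\<integral>y. f (a (y + k)) * bdry \<xi> y \<partial>lebesgue) - (\<integral>y. f (a y) * bdry \<xi> y \<partial>lebesgue))"
    unfolding e3 by (simp only: integral_mult_right_zero Bochner_Integration.integral_diff[OF i3 w0(3)])
  ultimately show "(\<integral>p. \<mu> (snd p) * (dv h b p \<bullet> G p) \<partial>lebesgue_upper_half) + (\<integral>p. dG h b p * \<xi> p \<partial>lebesgue_upper_half)
      = (\<integral>y. dF h b y * bdry \<xi> y \<partial>lebesgue)"
    unfolding eq[symmetric] w0(4)[symmetric] by (simp only: distrib_left[symmetric]) (simp only: add_diff_add)
qed

text \<open>A common majorant for the squared gradients of the test functions built with step h: the
  summand 1 covers gradients of cutoffs, the others those of u and of its shifts. Times
  \<open>\<mu>\<close> it is integrable on half-balls, because the shifted energies are.\<close>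

definition E :: "real \<Rightarrow> (real ^ 'n) \<times> real \<Rightarrow> real" where
  "E h p = 1 + (norm (D1 p))\<^sup>2 + (\<Sum>b\<in>Basis. (norm (D1 (p + (h *\<^sub>R b, 0))))\<^sup>2)"

lemma cont_shift:
  assumes "continuous_on upper_half \<phi>"
  shows "continuous_on upper_half (\<lambda>p :: (real ^ 'n) \<times> real. \<phi> (p + (k, 0)))"
  by (rule continuous_on_compose2[OF assms]) (auto intro!: continuous_intros)

lemma ball_indicator_measurable: "(indicator (ball 0 r) :: (real ^ 'n) \<times> real \<Rightarrow> real) \<in> borel_measurable lebesgue_upper_half"
  by (intro measurable_restrict_space1 borel_measurable_indicator) auto

lemma E_integrable:
  assumes h: "0 < h"
  shows "integrable lebesgue_upper_half (\<lambda>p. \<mu> (snd p) * E h p * indicator (ball 0 r) p)"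
proof -
  have "integrable lebesgue_upper_half (\<lambda>p. \<mu> (snd p) * (norm (D1 (p + (h *\<^sub>R b, 0))))\<^sup>2 * indicator (ball 0 r) p)" if "b \<in> Basis" for b
  proof (rule Bochner_Integration.integrable_bound[OF upper_half_translate(1)[OF energy_integrable[of "r + h"], of "h *\<^sub>R b"]])
    show "(\<lambda>p. \<mu> (snd p) * (norm (D1 (p + (h *\<^sub>R b, 0))))\<^sup>2 * indicator (ball 0 r) p) \<in> borel_measurable lebesgue_upper_half"
    proof -
      have [measurable]: "(\<lambda>p. D1 (p + (h *\<^sub>R b, 0))) \<in> borel_measurable lebesgue_upper_half"
        by (intro continuous_on_upper_half_measurable cont_shift cont_D1)
      note [measurable] = mu_measurable ball_indicator_measurable
      show ?thesis by measurable
    qed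
    have "p + (h *\<^sub>R b, 0) \<in> ball 0 (r + h)" if "p \<in> ball 0 r" for p :: "(real ^ 'n) \<times> real"
      using that norm_triangle_ineq[of p "(h *\<^sub>R b, 0 :: real)"] \<open>b \<in> Basis\<close> h by (simp add: norm_Pair)
    then show "AE p in lebesgue_upper_half. norm (\<mu> (snd p) * (norm (D1 (p + (h *\<^sub>R b, 0))))\<^sup>2 * indicat_real (ball 0 r) p)
        \<le> norm (\<mu> (snd (p + (h *\<^sub>R b, 0))) * (norm (D1 (p + (h *\<^sub>R b, 0))))\<^sup>2 * indicat_real (ball 0 (r + h)) (p + (h *\<^sub>R b, 0)))"
      by (intro AE_I2) (auto simp: indicator_def)
  qed
  then have "integrable lebesgue_upper_half (\<lambda>p. \<mu> (snd p) * indicator (ball 0 r) p + \<mu> (snd p) * (norm (D1 p))\<^sup>2 * indicator (ball 0 r) p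
      + (\<Sum>b\<in>Basis. \<mu> (snd p) * (norm (D1 (p + (h *\<^sub>R b, 0))))\<^sup>2 * indicator (ball 0 r) p))"
    by (intro Bochner_Integration.integrable_add Bochner_Integration.integrable_sum mu_ball_integrable energy_integrable)
  moreover have "\<mu> (snd p) * indicator (ball 0 r) p + \<mu> (snd p) * (norm (D1 p))\<^sup>2 * indicator (ball 0 r) p
      + (\<Sum>b\<in>Basis. \<mu> (snd p) * (norm (D1 (p + (h *\<^sub>R b, 0))))\<^sup>2 * indicator (ball 0 r) p)
      = \<mu> (snd p) * E h p * indicator (ball 0 r) p" for p
    unfolding E_def by (simp add: distrib_left distrib_right sum_distrib_left sum_distrib_right)
  ultimately show ?thesis by simp
qed

lemma E_nonneg: "0 \<le> E h p" "1 \<le> E h p" "(norm (D1 p))\<^sup>2 \<le> E h p"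
  "b \<in> Basis \<Longrightarrow> (norm (D1 (p + (h *\<^sub>R b, 0))))\<^sup>2 \<le> E h p"
proof -
  have s: "0 \<le> (\<Sum>b\<in>Basis. (norm (D1 (p + (h *\<^sub>R b, 0))))\<^sup>2)" by (intro sum_nonneg) auto
  then show "0 \<le> E h p" "1 \<le> E h p" "(norm (D1 p))\<^sup>2 \<le> E h p" by (auto simp: E_def)
  assume "b \<in> Basis"
  then have "(norm (D1 (p + (h *\<^sub>R b, 0))))\<^sup>2 \<le> (\<Sum>b\<in>Basis. (norm (D1 (p + (h *\<^sub>R b, 0))))\<^sup>2)"
    by (intro member_le_sum) auto
  then show "(norm (D1 (p + (h *\<^sub>R b, 0))))\<^sup>2 \<le> E h p" by (simp add: E_def add_increasing)
qed

text \<open>Reduces the integrability condition for a C^1 function to one pointwise estimate, the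
  domination of |G|^2 by a multiple of \<open>E h\<close>. The multiple may depend on h.\<close>

lemma testI:
  assumes h: "0 < h" and r: "0 < r"
    and grad: "\<And>p. p \<in> upper_half \<Longrightarrow> GDERIV \<xi> p :> G p" and G: "continuous_on upper_half G"
    and bounded: "\<And>p. p \<in> upper_half \<Longrightarrow> \<bar>\<xi> p\<bar> \<le> B"
    and zero: "\<And>p. p \<in> upper_half \<Longrightarrow> r \<le> norm p \<Longrightarrow> \<xi> p = 0 \<and> G p = 0"
    and G_le: "\<And>p. p \<in> upper_half \<Longrightarrow> norm p < r \<Longrightarrow> (norm (G p))\<^sup>2 \<le> K * E h p"
  shows "test \<xi> G r"
proof -
  note Gm = continuous_on_upper_half_measurable[OF G]
  have "integrable lebesgue_upper_half (\<lambda>p. \<mu> (snd p) * (norm (G p))\<^sup>2)"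
  proof (rule Bochner_Integration.integrable_bound[OF integrable_mult_right[OF E_integrable[OF h, of r], of K]])
    show "(\<lambda>p. \<mu> (snd p) * (norm (G p))\<^sup>2) \<in> borel_measurable lebesgue_upper_half"
      using Gm mu_measurable by measurable
    show "AE p in lebesgue_upper_half. norm (\<mu> (snd p) * (norm (G p))\<^sup>2) \<le> norm (K * (\<mu> (snd p) * E h p * indicator (ball 0 r) p))"
    proof (rule AE_I2)
      fix p :: "(real ^ 'n) \<times> real" assume "p \<in> space lebesgue_upper_half"
      then have p: "p \<in> upper_half" by simp
      then have m: "0 < \<mu> (snd p)" using mu_pos by (simp add: upper_half_def)
      show "norm (\<mu> (snd p) * (norm (G p))\<^sup>2) \<le> norm (K * (\<mu> (snd p) * E h p * indicator (ball 0 r) p))"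
      proof (cases "norm p < r")
        case True
        have "\<mu> (snd p) * (norm (G p))\<^sup>2 \<le> \<mu> (snd p) * (K * E h p)" using G_le[OF p True] m by (intro mult_left_mono) auto
        moreover have "0 \<le> \<mu> (snd p) * (norm (G p))\<^sup>2" using m by simp
        ultimately show ?thesis using True by (simp only: real_norm_def abs_of_nonneg) (simp add: mult_ac)
      next
        case False then show ?thesis using zero[OF p] by simp
      qed
    qed
  qed
  moreover have "AE p in lebesgue_upper_half. GDERIV \<xi> p :> G p" using grad by (intro AE_I2) simp
  moreover have "bounded (\<xi> ` upper_half)" unfolding bounded_iff by (intro exI[of _ B]) (use bounded in auto)
  ultimately show ?thesis
    unfolding test_def using r zero Gm locally_lipschitz_on_C1[OF open_upper_half grad G] by simp
qed

end

context stable_solution_setting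
begin

abbreviation M :: "((real ^ 'n) \<times> real) measure" where "M \<equiv> lebesgue_upper_half"

lemma shift_in_upper_half [simp]: "p + (k, 0) \<in> upper_half \<longleftrightarrow> p \<in> upper_half"
  for p :: "(real ^ 'n) \<times> real"
  by (cases p) simp

lemma GDERIV_v: "p \<in> upper_half \<Longrightarrow> GDERIV (v h b) p :> dv h b p"
proof -
  assume p: "p \<in> upper_half"
  have "GDERIV (\<lambda>p. u (p + (h *\<^sub>R b, 0)) - u p) p :> D1 (p + (h *\<^sub>R b, 0)) - D1 p"
    by (intro GDERIV_diff grad_u p) (simp add: GDERIV_translate grad_u p)
  from GDERIV_DERIV_compose[OF this DERIV_cdivide[OF DERIV_ident]] show ?thesis
    unfolding v_def[abs_def] dv_def .
qed

lemma cont_v: "continuous_on upper_half (v h b)"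
  unfolding v_def[abs_def] divide_inverse
  by (intro continuous_on_mult continuous_on_diff continuous_on_const cont_shift cont_u)

lemma cont_dv: "continuous_on upper_half (dv h b)"
  unfolding dv_def[abs_def]
  by (intro continuous_on_scaleR continuous_on_diff continuous_on_const cont_shift cont_D1)

lemma dv_le:
  assumes b: "b \<in> Basis"
  shows "(norm (dv h b p))\<^sup>2 \<le> 4 / h\<^sup>2 * E h p"
proof -
  have "(norm (D1 (p + (h *\<^sub>R b, 0)) - D1 p))\<^sup>2 \<le> 2 * (norm (D1 (p + (h *\<^sub>R b, 0))))\<^sup>2 + 2 * (norm (D1 p))\<^sup>2"
    using norm_add_power2_le[of "D1 (p + (h *\<^sub>R b, 0))" "- D1 p"] by simp
  also have "\<dots> \<le> 4 * E h p" using E_nonneg(3)[of p h] E_nonneg(4)[OF b, of p h] by linarith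
  finally have "(1 / h\<^sup>2) * (norm (D1 (p + (h *\<^sub>R b, 0)) - D1 p))\<^sup>2 \<le> (1 / h\<^sup>2) * (4 * E h p)"
    by (intro mult_left_mono) auto
  then show ?thesis by (simp add: dv_def power_mult_distrib power_divide)
qed

text \<open>A differentiable substitute for the length of the vector of difference quotients. The
  step h serves as regularization parameter as well, so a single limit removes both
  approximations.\<close>

definition w :: "real \<Rightarrow> (real ^ 'n) \<times> real \<Rightarrow> real" where
  "w h p = sqrt ((\<Sum>b\<in>Basis. (v h b p)\<^sup>2) + h\<^sup>2)"

definition dw :: "real \<Rightarrow> (real ^ 'n) \<times> real \<Rightarrow> (real ^ 'n) \<times> real" where
  "dw h p = (1 / w h p) *\<^sub>R (\<Sum>b\<in>Basis. v h b p *\<^sub>R dv h b p)"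

text \<open>The defect between the gradients of the components and the gradient of the length. Its
  limit measures how far the derivative of F is from the rank-one form.\<close>

definition Q :: "real \<Rightarrow> (real ^ 'n) \<times> real \<Rightarrow> real" where
  "Q h p = (\<Sum>b\<in>Basis. (norm (dv h b p))\<^sup>2) - (norm (dw h p))\<^sup>2"

lemma w_power2: "(w h p)\<^sup>2 = (\<Sum>b\<in>Basis. (v h b p)\<^sup>2) + h\<^sup>2"
  unfolding w_def by (intro real_sqrt_pow2 add_nonneg_nonneg sum_nonneg) auto

lemma w_ge: "0 < h \<Longrightarrow> h \<le> w h p"
  unfolding w_def by (intro real_le_rsqrt) (simp add: sum_nonneg)

lemma w_pos: "0 < h \<Longrightarrow> 0 < w h p"
  using w_ge[of h p] by simp

lemma GDERIV_w:
  assumes h: "0 < h" and p: "p \<in> upper_half"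
  shows "GDERIV (w h) p :> dw h p"
proof -
  have sq: "((\<lambda>t::real. t\<^sup>2) has_real_derivative 2 * t) (at t)" for t
    by (auto intro!: derivative_eq_intros)
  have "GDERIV (\<lambda>p. (v h b p)\<^sup>2) p :> (2 * v h b p) *\<^sub>R dv h b p" for b
    by (rule GDERIV_DERIV_compose[OF GDERIV_v[OF p] sq])
  then have "GDERIV (\<lambda>p. (\<Sum>b\<in>Basis. (v h b p)\<^sup>2) + h\<^sup>2) p :> (\<Sum>b\<in>Basis. (2 * v h b p) *\<^sub>R dv h b p) + 0"
    by (intro GDERIV_add GDERIV_sum GDERIV_const)
  moreover have "0 < (\<Sum>b\<in>Basis. (v h b p)\<^sup>2) + h\<^sup>2"
    using h by (intro add_nonneg_pos sum_nonneg) auto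
  ultimately have "GDERIV (\<lambda>p. sqrt ((\<Sum>b\<in>Basis. (v h b p)\<^sup>2) + h\<^sup>2)) p :>
      (inverse (sqrt ((\<Sum>b\<in>Basis. (v h b p)\<^sup>2) + h\<^sup>2)) / 2) *\<^sub>R ((\<Sum>b\<in>Basis. (2 * v h b p) *\<^sub>R dv h b p) + 0)"
    by (intro GDERIV_DERIV_compose[of _ _ _ sqrt] DERIV_real_sqrt)
  moreover have "(inverse (sqrt ((\<Sum>b\<in>Basis. (v h b p)\<^sup>2) + h\<^sup>2)) / 2) *\<^sub>R ((\<Sum>b\<in>Basis. (2 * v h b p) *\<^sub>R dv h b p) + 0) = dw h p"
    unfolding dw_def w_def by (simp add: scaleR_sum_right inverse_eq_divide)
  ultimately show ?thesis unfolding w_def[abs_def] by simp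
qed

lemma cont_w: "continuous_on upper_half (w h)"
  unfolding w_def[abs_def]
  by (intro continuous_on_real_sqrt continuous_on_add continuous_on_sum continuous_on_power continuous_on_const cont_v)

lemma cont_dw:
  assumes "0 < h"
  shows "continuous_on upper_half (dw h)"
  unfolding dw_def[abs_def]
  by (intro continuous_on_scaleR continuous_on_divide continuous_on_sum continuous_on_const cont_v cont_w cont_dv)
    (use w_pos[OF assms] in \<open>auto simp: less_imp_neq[symmetric]\<close>)

lemma w_scaleR_dw: "0 < h \<Longrightarrow> w h p *\<^sub>R dw h p = (\<Sum>b\<in>Basis. v h b p *\<^sub>R dv h b p)"
  using w_pos[of h p] by (simp add: dw_def)

text \<open>Cauchy-Schwarz for w dw = sum of v_b dv_b, together with sum of v_b^2 \<le> w^2.\<close>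

lemma dw_le:
  assumes h: "0 < h"
  shows "(norm (dw h p))\<^sup>2 \<le> (\<Sum>b\<in>Basis. (norm (dv h b p))\<^sup>2)"
proof -
  have "(w h p)\<^sup>2 * (norm (dw h p))\<^sup>2 = (norm (w h p *\<^sub>R dw h p))\<^sup>2" by (simp add: power_mult_distrib)
  also have "\<dots> \<le> (\<Sum>b\<in>Basis. (v h b p)\<^sup>2) * (\<Sum>b\<in>Basis. (norm (dv h b p))\<^sup>2)"
    unfolding w_scaleR_dw[OF h] by (rule norm_sum_scaleR_power2_le)
  also have "\<dots> \<le> (w h p)\<^sup>2 * (\<Sum>b\<in>Basis. (norm (dv h b p))\<^sup>2)"
    unfolding w_power2 by (intro mult_right_mono sum_nonneg) auto
  finally show ?thesis using w_pos[OF h, of p] by simp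
qed

lemma Q_nonneg: "0 < h \<Longrightarrow> 0 \<le> Q h p"
  using dw_le[of h p] by (simp add: Q_def)

lemma sum_dv_le: "(\<Sum>b\<in>Basis. (norm (dv h b p))\<^sup>2) \<le> real DIM(real ^ 'n) * (4 / h\<^sup>2) * E h p"
  using sum_bounded_above[of "Basis :: (real ^ 'n) set" "\<lambda>b. (norm (dv h b p))\<^sup>2" "4 / h\<^sup>2 * E h p", OF dv_le]
  by (simp add: mult_ac)

text \<open>Cutoffs are defined on the full product space and not only for x > 0, so that the
  boundary value is simply \<open>\<phi> (y, 0)\<close>.\<close>

definition cut :: "((real ^ 'n) \<times> real \<Rightarrow> real) \<Rightarrow> ((real ^ 'n) \<times> real \<Rightarrow> (real ^ 'n) \<times> real) \<Rightarrow> real \<Rightarrow> bool" where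
  "cut \<phi> \<Phi> r \<longleftrightarrow> 0 < r \<and> (\<forall>p. GDERIV \<phi> p :> \<Phi> p) \<and> continuous_on UNIV \<Phi> \<and>
    (\<forall>p. r \<le> norm p \<longrightarrow> \<phi> p = 0 \<and> \<Phi> p = 0) \<and> (\<forall>p. 0 \<le> \<phi> p \<and> \<phi> p \<le> 1)"

lemma cutD:
  assumes "cut \<phi> \<Phi> r"
  shows "0 < r" "GDERIV \<phi> p :> \<Phi> p" "continuous_on S \<Phi>" "r \<le> norm p \<Longrightarrow> \<phi> p = 0"
    "r \<le> norm p \<Longrightarrow> \<Phi> p = 0" "0 \<le> \<phi> p" "\<phi> p \<le> 1"
  using assms continuous_on_subset[of UNIV \<Phi> S] unfolding cut_def by blast+

lemma cut_cont: "cut \<phi> \<Phi> r \<Longrightarrow> continuous_on S \<phi>"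
  by (rule has_derivative_continuous_on[OF has_derivative_at_withinI[OF cutD(2)[unfolded gderiv_def]]])

lemma cut_grad_bound:
  assumes "cut \<phi> \<Phi> r"
  obtains B where "0 \<le> B" "\<And>p. norm (\<Phi> p) \<le> B"
proof -
  have "bounded (\<Phi> ` cball 0 r)"
    by (intro compact_imp_bounded compact_continuous_image cutD(3)[OF assms]) auto
  then obtain B where B: "\<forall>q\<in>\<Phi> ` cball 0 r. norm q \<le> B" unfolding bounded_iff ..
  have "norm (\<Phi> p) \<le> max B 0" for p
  proof (cases "norm p \<le> r")
    case True
    then have "norm (\<Phi> p) \<le> B" using B by auto
    then show ?thesis by simp
  next
    case False then show ?thesis using cutD(5)[OF assms, of p] by simp
  qed
  then show ?thesis using that[of "max B 0"] by simp
qed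

lemma test_cut:
  assumes c: "cut \<phi> \<Phi> r"
  shows "test \<phi> \<Phi> r"
proof -
  obtain B where B: "0 \<le> B" "\<And>p. norm (\<Phi> p) \<le> B" using cut_grad_bound[OF c] by blast
  show ?thesis
  proof (rule testI[of 1 r _ _ 1 "B\<^sup>2"])
    fix p :: "(real ^ 'n) \<times> real"
    have "(norm (\<Phi> p))\<^sup>2 \<le> B\<^sup>2" using B by (intro power_mono) auto
    also have "\<dots> \<le> B\<^sup>2 * E 1 p" using mult_left_mono[OF E_nonneg(2)[of 1 p], of "B\<^sup>2"] by simp
    finally show "(norm (\<Phi> p))\<^sup>2 \<le> B\<^sup>2 * E 1 p" .
  qed (use cutD[OF c] in \<open>auto simp: abs_le_iff intro: order_trans[OF _ cutD(6)[OF c]]\<close>)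
qed

text \<open>A crude bound that blows up as h tends to 0. It suffices for admissibility at a fixed h;
  the limit relies on \<open>v_uniform_bound\<close>.\<close>

lemma v_bound_h:
  assumes B: "\<And>p. p \<in> upper_half \<Longrightarrow> \<bar>u p\<bar> \<le> B" and h: "0 < h" and p: "p \<in> upper_half"
  shows "\<bar>v h b p\<bar> \<le> 2 * B / h"
proof -
  have "\<bar>u (p + (h *\<^sub>R b, 0)) - u p\<bar> \<le> 2 * B" using B[OF p] B[of "p + (h *\<^sub>R b, 0)"] p by simp
  then show ?thesis using h by (simp add: v_def abs_divide divide_right_mono)
qed

text \<open>The square of the cutoff matches the square that stability produces from
  \<open>\<phi>\<close> times w.\<close>

lemma test_v_cut:
  assumes c: "cut \<phi> \<Phi> r" and h: "0 < h" and b: "b \<in> Basis"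
  shows "test (\<lambda>p. v h b p * (\<phi> p)\<^sup>2) (\<lambda>p. (\<phi> p)\<^sup>2 *\<^sub>R dv h b p + (2 * v h b p * \<phi> p) *\<^sub>R \<Phi> p) r"
proof -
  obtain B where B: "0 \<le> B" "\<And>p. norm (\<Phi> p) \<le> B" using cut_grad_bound[OF c] by blast
  obtain Bu where Bu: "0 < Bu" "\<And>p. p \<in> upper_half \<Longrightarrow> \<bar>u p\<bar> \<le> Bu" using u_bound by blast
  have \<phi>: "0 \<le> \<phi> p" "\<phi> p \<le> 1" for p using cutD(6,7)[OF c, of p] by auto
  have \<phi>2: "(\<phi> p)\<^sup>2 \<le> 1" for p using \<phi> by (simp add: power_le_one)
  have vb: "\<bar>v h b p\<bar> \<le> 2 * Bu / h" if "p \<in> upper_half" for p using v_bound_h[OF Bu(2) h that] .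
  show ?thesis
  proof (rule testI[OF h, of r _ _ "2 * Bu / h" "2 * (4 / h\<^sup>2) + 2 * (2 * (2 * Bu / h) * B)\<^sup>2"])
    fix p :: "(real ^ 'n) \<times> real" assume p: "p \<in> upper_half"
    have sq: "((\<lambda>t::real. t\<^sup>2) has_real_derivative 2 * t) (at t)" for t
      by (auto intro!: derivative_eq_intros)
    have "GDERIV \<phi> p :> \<Phi> p" by (rule cutD(2)[OF c])
    from GDERIV_mult[OF GDERIV_v[OF p] GDERIV_DERIV_compose[OF this sq]]
    show "GDERIV (\<lambda>p. v h b p * (\<phi> p)\<^sup>2) p :> (\<phi> p)\<^sup>2 *\<^sub>R dv h b p + (2 * v h b p * \<phi> p) *\<^sub>R \<Phi> p"
      by (rule GDERIV_subst) (simp add: mult_ac)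
    have "\<bar>v h b p\<bar> * (\<phi> p)\<^sup>2 \<le> 2 * Bu / h * 1"
      using vb[OF p] \<phi>2 by (intro mult_mono) auto
    then show "\<bar>v h b p * (\<phi> p)\<^sup>2\<bar> \<le> 2 * Bu / h" by (simp add: abs_mult)
    show "v h b p * (\<phi> p)\<^sup>2 = 0 \<and> (\<phi> p)\<^sup>2 *\<^sub>R dv h b p + (2 * v h b p * \<phi> p) *\<^sub>R \<Phi> p = 0" if "r \<le> norm p"
      using cutD(4,5)[OF c that] by simp
    have "(norm ((\<phi> p)\<^sup>2 *\<^sub>R dv h b p))\<^sup>2 \<le> 4 / h\<^sup>2 * E h p"
    proof -
      have "norm ((\<phi> p)\<^sup>2 *\<^sub>R dv h b p) \<le> 1 * norm (dv h b p)" using \<phi>2[of p] by (simp add: mult_left_le_one_le)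
      then have "(norm ((\<phi> p)\<^sup>2 *\<^sub>R dv h b p))\<^sup>2 \<le> (norm (dv h b p))\<^sup>2" by (intro power_mono) auto
      then show ?thesis using dv_le[OF b, of h p] by linarith
    qed
    moreover have "(norm ((2 * v h b p * \<phi> p) *\<^sub>R \<Phi> p))\<^sup>2 \<le> (2 * (2 * Bu / h) * B)\<^sup>2 * E h p"
    proof -
      have "norm ((2 * v h b p * \<phi> p) *\<^sub>R \<Phi> p) = (2 * \<bar>v h b p\<bar>) * \<phi> p * norm (\<Phi> p)"
        using \<phi>[of p] by (simp add: abs_mult)
      also have "\<dots> \<le> (2 * (2 * Bu / h)) * 1 * B"
        using vb[OF p] \<phi>[of p] B Bu h by (intro mult_mono) auto
      finally have "(norm ((2 * v h b p * \<phi> p) *\<^sub>R \<Phi> p))\<^sup>2 \<le> (2 * (2 * Bu / h) * B)\<^sup>2" by (intro power_mono) auto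
      also have "\<dots> \<le> (2 * (2 * Bu / h) * B)\<^sup>2 * E h p"
        using mult_left_mono[OF E_nonneg(2)[of h p], of "(2 * (2 * Bu / h) * B)\<^sup>2"] by simp
      finally show ?thesis .
    qed
    ultimately show "(norm ((\<phi> p)\<^sup>2 *\<^sub>R dv h b p + (2 * v h b p * \<phi> p) *\<^sub>R \<Phi> p))\<^sup>2
        \<le> (2 * (4 / h\<^sup>2) + 2 * (2 * (2 * Bu / h) * B)\<^sup>2) * E h p"
      using norm_add_power2_le[of "(\<phi> p)\<^sup>2 *\<^sub>R dv h b p" "(2 * v h b p * \<phi> p) *\<^sub>R \<Phi> p"]
      unfolding distrib_right mult.assoc by linarith
  next
    show "continuous_on upper_half (\<lambda>p. (\<phi> p)\<^sup>2 *\<^sub>R dv h b p + (2 * v h b p * \<phi> p) *\<^sub>R \<Phi> p)"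
      by (intro continuous_on_add continuous_on_scaleR continuous_on_mult continuous_on_power continuous_on_const
          cut_cont[OF c] cont_v cont_dv cutD(3)[OF c])
  qed (rule cutD(1)[OF c])
qed

lemma test_w_cut:
  assumes c: "cut \<phi> \<Phi> r" and h: "0 < h"
  shows "test (\<lambda>p. \<phi> p * w h p) (\<lambda>p. \<phi> p *\<^sub>R dw h p + w h p *\<^sub>R \<Phi> p) r"
proof -
  obtain B where B: "0 \<le> B" "\<And>p. norm (\<Phi> p) \<le> B" using cut_grad_bound[OF c] by blast
  obtain Bu where Bu: "0 < Bu" "\<And>p. p \<in> upper_half \<Longrightarrow> \<bar>u p\<bar> \<le> Bu" using u_bound by blast
  have \<phi>: "0 \<le> \<phi> p" "\<phi> p \<le> 1" for p using cutD(6,7)[OF c, of p] by auto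
  define W where "W = sqrt (real DIM(real ^ 'n) * (2 * Bu / h)\<^sup>2 + h\<^sup>2)"
  have W: "w h p \<le> W" "0 \<le> w h p" if p: "p \<in> upper_half" for p
  proof -
    have "(v h b p)\<^sup>2 \<le> (2 * Bu / h)\<^sup>2" for b
      using power_mono[OF v_bound_h[OF Bu(2) h p, of b], of 2] by simp
    then have "(\<Sum>b\<in>(Basis :: (real ^ 'n) set). (v h b p)\<^sup>2) \<le> of_nat (card (Basis :: (real ^ 'n) set)) * (2 * Bu / h)\<^sup>2"
      by (rule sum_bounded_above)
    then show "w h p \<le> W" unfolding w_def W_def by (intro real_sqrt_le_mono) simp
    show "0 \<le> w h p" using w_pos[OF h, of p] by simp
  qed
  have W0: "0 \<le> W" by (simp add: W_def)
  show ?thesis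
  proof (rule testI[OF h, of r _ _ W "2 * (real DIM(real ^ 'n) * (4 / h\<^sup>2)) + 2 * (W * B)\<^sup>2"])
    fix p :: "(real ^ 'n) \<times> real" assume p: "p \<in> upper_half"
    have "GDERIV \<phi> p :> \<Phi> p" by (rule cutD(2)[OF c])
    from GDERIV_mult[OF this GDERIV_w[OF h p]]
    show "GDERIV (\<lambda>p. \<phi> p * w h p) p :> \<phi> p *\<^sub>R dw h p + w h p *\<^sub>R \<Phi> p" .
    have "\<phi> p * w h p \<le> 1 * W" using \<phi>[of p] W[OF p] by (intro mult_mono) auto
    then show "\<bar>\<phi> p * w h p\<bar> \<le> W" using \<phi>[of p] W[OF p] by (simp add: abs_mult)
    show "\<phi> p * w h p = 0 \<and> \<phi> p *\<^sub>R dw h p + w h p *\<^sub>R \<Phi> p = 0" if "r \<le> norm p"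
      using cutD(4,5)[OF c that] by simp
    have "(norm (\<phi> p *\<^sub>R dw h p))\<^sup>2 \<le> real DIM(real ^ 'n) * (4 / h\<^sup>2) * E h p"
    proof -
      have "norm (\<phi> p *\<^sub>R dw h p) \<le> 1 * norm (dw h p)" using \<phi>[of p] by (simp add: mult_left_le_one_le)
      then have "(norm (\<phi> p *\<^sub>R dw h p))\<^sup>2 \<le> (norm (dw h p))\<^sup>2" by (intro power_mono) auto
      then show ?thesis using dw_le[OF h, of p] sum_dv_le[of h p] by linarith
    qed
    moreover have "(norm (w h p *\<^sub>R \<Phi> p))\<^sup>2 \<le> (W * B)\<^sup>2 * E h p"
    proof -
      have "norm (w h p *\<^sub>R \<Phi> p) \<le> W * B" using W[OF p] B W0 by (simp add: mult_mono)
      then have "(norm (w h p *\<^sub>R \<Phi> p))\<^sup>2 \<le> (W * B)\<^sup>2" by (intro power_mono) auto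
      also have "\<dots> \<le> (W * B)\<^sup>2 * E h p"
        using mult_left_mono[OF E_nonneg(2)[of h p], of "(W * B)\<^sup>2"] by simp
      finally show ?thesis .
    qed
    ultimately show "(norm (\<phi> p *\<^sub>R dw h p + w h p *\<^sub>R \<Phi> p))\<^sup>2
        \<le> (2 * (real DIM(real ^ 'n) * (4 / h\<^sup>2)) + 2 * (W * B)\<^sup>2) * E h p"
      using norm_add_power2_le[of "\<phi> p *\<^sub>R dw h p" "w h p *\<^sub>R \<Phi> p"]
      unfolding distrib_right mult.assoc by linarith
  next
    show "continuous_on upper_half (\<lambda>p. \<phi> p *\<^sub>R dw h p + w h p *\<^sub>R \<Phi> p)"
      by (intro continuous_on_add continuous_on_scaleR cut_cont[OF c] cont_w cont_dw h cutD(3)[OF c])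
  qed (rule cutD(1)[OF c])
qed

lemma test_add_scaled:
  assumes t1: "test \<xi> G r" and t2: "test \<psi> H r"
  shows "test (\<lambda>p. \<xi> p + \<tau> * \<psi> p) (\<lambda>p. G p + \<tau> *\<^sub>R H p) r"
proof -
  have ll: "locally_lipschitz_on upper_half (\<lambda>p. \<xi> p + \<tau> * \<psi> p)"
  proof (intro locally_lipschitz_on_add locally_lipschitz_on_mult)
    show "locally_lipschitz_on upper_half (\<lambda>p :: (real ^ 'n) \<times> real. \<tau>)"
      unfolding locally_lipschitz_on_def by (intro ballI exI[of _ 1] conjI exI[of _ 0]) (auto simp: lipschitz_on_def)
  qed (use t1 t2 in \<open>auto simp: test_def\<close>)
  obtain B1 B2 where B: "\<And>p. p \<in> upper_half \<Longrightarrow> \<bar>\<xi> p\<bar> \<le> B1" "\<And>p. p \<in> upper_half \<Longrightarrow> \<bar>\<psi> p\<bar> \<le> B2"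
  proof -
    have "bounded (\<xi> ` upper_half)" "bounded (\<psi> ` upper_half)" using t1 t2 by (auto simp: test_def)
    then obtain B1 B2 where "\<forall>z\<in>\<xi> ` upper_half. norm z \<le> B1" "\<forall>z\<in>\<psi> ` upper_half. norm z \<le> B2"
      unfolding bounded_iff by (elim exE)
    then show ?thesis by (intro that[of B1 B2]) auto
  qed
  have "\<bar>\<xi> p + \<tau> * \<psi> p\<bar> \<le> B1 + \<bar>\<tau>\<bar> * B2" if p: "p \<in> upper_half" for p
    using B(1)[OF p] mult_left_mono[OF B(2)[OF p], of "\<bar>\<tau>\<bar>"] abs_triangle_ineq[of "\<xi> p" "\<tau> * \<psi> p"] by (simp add: abs_mult)
  then have bd: "bounded ((\<lambda>p. \<xi> p + \<tau> * \<psi> p) ` upper_half)"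
    unfolding bounded_iff by (intro exI[of _ "B1 + \<bar>\<tau>\<bar> * B2"]) auto
  have gd: "AE p in M. GDERIV (\<lambda>p. \<xi> p + \<tau> * \<psi> p) p :> G p + \<tau> *\<^sub>R H p"
  proof -
    have "AE p in M. GDERIV \<xi> p :> G p" "AE p in M. GDERIV \<psi> p :> H p" using t1 t2 by (auto simp: test_def)
    then show ?thesis
    proof eventually_elim
      case (elim p)
      have "GDERIV (\<lambda>p. \<tau> * \<psi> p) p :> \<tau> *\<^sub>R H p"
        using GDERIV_mult[OF GDERIV_const elim(2), of \<tau>] by simp
      with elim(1) show ?case by (rule GDERIV_add)
    qed
  qed
  have Gm[measurable]: "G \<in> borel_measurable M" "H \<in> borel_measurable M" using t1 t2 by (auto simp: test_def)
  have m: "(\<lambda>p. G p + \<tau> *\<^sub>R H p) \<in> borel_measurable M" by measurable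
  have "integrable M (\<lambda>p. \<mu> (snd p) * (norm (G p + \<tau> *\<^sub>R H p))\<^sup>2)"
  proof (rule Bochner_Integration.integrable_bound)
    show "integrable M (\<lambda>p. 2 * (\<mu> (snd p) * (norm (G p))\<^sup>2) + 2 * \<tau>\<^sup>2 * (\<mu> (snd p) * (norm (H p))\<^sup>2))"
      using t1 t2 by (intro Bochner_Integration.integrable_add integrable_mult_right) (auto simp: test_def)
    show "(\<lambda>p. \<mu> (snd p) * (norm (G p + \<tau> *\<^sub>R H p))\<^sup>2) \<in> borel_measurable M"
      using m mu_measurable by measurable
    show "AE p in M. norm (\<mu> (snd p) * (norm (G p + \<tau> *\<^sub>R H p))\<^sup>2)
        \<le> norm (2 * (\<mu> (snd p) * (norm (G p))\<^sup>2) + 2 * \<tau>\<^sup>2 * (\<mu> (snd p) * (norm (H p))\<^sup>2))"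
    proof (rule AE_I2)
      fix p assume "p \<in> space M"
      then have m: "0 < \<mu> (snd p)" using mu_pos by (simp add: upper_half_def)
      have "(norm (G p + \<tau> *\<^sub>R H p))\<^sup>2 \<le> 2 * (norm (G p))\<^sup>2 + 2 * \<tau>\<^sup>2 * (norm (H p))\<^sup>2"
        using norm_add_power2_le[of "G p" "\<tau> *\<^sub>R H p"] by (simp add: power_mult_distrib)
      then have "\<mu> (snd p) * (norm (G p + \<tau> *\<^sub>R H p))\<^sup>2 \<le> \<mu> (snd p) * (2 * (norm (G p))\<^sup>2 + 2 * \<tau>\<^sup>2 * (norm (H p))\<^sup>2)"
        using m by (intro mult_left_mono) auto
      also have "\<dots> = 2 * (\<mu> (snd p) * (norm (G p))\<^sup>2) + 2 * \<tau>\<^sup>2 * (\<mu> (snd p) * (norm (H p))\<^sup>2)" by (simp add: algebra_simps)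
      finally show "norm (\<mu> (snd p) * (norm (G p + \<tau> *\<^sub>R H p))\<^sup>2)
        \<le> norm (2 * (\<mu> (snd p) * (norm (G p))\<^sup>2) + 2 * \<tau>\<^sup>2 * (\<mu> (snd p) * (norm (H p))\<^sup>2))"
        using m by simp
    qed
  qed
  then show ?thesis
    unfolding test_def
  proof (intro conjI ll bd gd m ballI impI)
    show "0 < r" using t1 by (simp add: test_def)
    fix p :: "(real ^ 'n) \<times> real" assume "p \<in> upper_half" "r \<le> norm p"
    then show "\<xi> p + \<tau> * \<psi> p = 0" "G p + \<tau> *\<^sub>R H p = 0"
      using test_zero[OF t1] test_zero[OF t2] by simp_all
  qed
qed

end

section \<open>Combining stability with the equation for the quotients\<close>

context stable_solution_setting
begin

lemma bdry_v_cut: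
  assumes c: "cut \<phi> \<Phi> r"
  shows "bdry (\<lambda>p. v h b p * (\<phi> p)\<^sup>2) y = da h b y * (\<phi> (y, 0))\<^sup>2"
    and "bdry \<phi> y = \<phi> (y, 0)"
    and "0 < x1 \<Longrightarrow> (\<And>x. 0 < x \<Longrightarrow> x < x1 \<Longrightarrow> \<psi> (y, x) = 0) \<Longrightarrow>
      bdry (\<lambda>p. \<phi> p * w h p + \<tau> * \<psi> p) y = \<phi> (y, 0) * sqrt ((\<Sum>b\<in>Basis. (da h b y)\<^sup>2) + h\<^sup>2)"
proof -
  have "isCont \<phi> (y, 0)" using cut_cont[OF c, of UNIV] by (simp add: continuous_on_eq_continuous_at)
  moreover have "((\<lambda>x. (y, x)) \<longlongrightarrow> (y, 0)) (at_right 0)" by (intro tendsto_intros)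
  ultimately have \<phi>: "((\<lambda>x. \<phi> (y, x)) \<longlongrightarrow> \<phi> (y, 0)) (at_right 0)"
    by (rule isCont_tendsto_compose)
  have v: "((\<lambda>x. v h b (y, x)) \<longlongrightarrow> da h b y) (at_right 0)" for b
    unfolding v_def da_def divide_inverse
    by (intro tendsto_mult tendsto_diff tendsto_const) (use trace_limit in \<open>simp_all\<close>)
  show "bdry (\<lambda>p. v h b p * (\<phi> p)\<^sup>2) y = da h b y * (\<phi> (y, 0))\<^sup>2"
    by (intro bdryI tendsto_mult tendsto_power v \<phi>)
  show "bdry \<phi> y = \<phi> (y, 0)" by (intro bdryI \<phi>)
  assume x1: "0 < x1" "\<And>x. 0 < x \<Longrightarrow> x < x1 \<Longrightarrow> \<psi> (y, x) = 0"
  have "((\<lambda>x. \<psi> (y, x)) \<longlongrightarrow> 0) (at_right 0)"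
    by (rule tendsto_eventually) (use x1 in \<open>auto simp: eventually_at_right_field\<close>)
  then have "((\<lambda>x. \<phi> (y, x) * w h (y, x) + \<tau> * \<psi> (y, x)) \<longlongrightarrow> \<phi> (y, 0) * sqrt ((\<Sum>b\<in>Basis. (da h b y)\<^sup>2) + h\<^sup>2) + \<tau> * 0) (at_right 0)"
    unfolding w_def by (intro tendsto_add tendsto_mult tendsto_real_sqrt tendsto_sum tendsto_power tendsto_const v \<phi>)
  then show "bdry (\<lambda>p. \<phi> p * w h p + \<tau> * \<psi> p) y = \<phi> (y, 0) * sqrt ((\<Sum>b\<in>Basis. (da h b y)\<^sup>2) + h\<^sup>2)"
    by (intro bdryI) simp
qed

text \<open>With \<open>\<phi>\<close> equal to 1 and flat wherever \<open>\<psi>\<close> or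
  \<open>\<Psi>\<close> is nonzero, the mixed terms of the perturbed test function contain no
  cutoff. Vanishing for x < x1 keeps \<open>\<psi>\<close> out of the boundary integral.\<close>

definition compatible where
  "compatible \<phi> \<Phi> \<psi> \<Psi> r x1 \<longleftrightarrow> cut \<phi> \<Phi> r \<and> test \<psi> \<Psi> r \<and> 0 < x1 \<and>
    (\<forall>y x. 0 < x \<longrightarrow> x < x1 \<longrightarrow> \<psi> (y, x) = 0) \<and>
    (\<forall>p\<in>upper_half. \<psi> p \<noteq> 0 \<or> \<Psi> p \<noteq> 0 \<longrightarrow> \<phi> p = 1 \<and> \<Phi> p = 0)"

text \<open>What remains of the zero-order terms in the interior when the difference equations are
  subtracted from the stability inequality. The part quadratic in the quotients cancels in the
  limit.\<close>

definition PI where "PI \<phi> \<psi> \<tau> h p =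
  g\<^sub>u (snd p) (u p) * (\<phi> p)\<^sup>2 * (w h p + \<tau> * \<psi> p)\<^sup>2 - (\<Sum>b\<in>Basis. dG h b p * (v h b p * (\<phi> p)\<^sup>2))"

text \<open>The boundary counterpart, without \<open>\<psi>\<close>. The quotients \<open>da\<close>
  are not shown to converge; only this combination is.\<close>

definition PB where "PB \<phi> h y =
  f' (a y) * (\<phi> (y, 0))\<^sup>2 * ((\<Sum>b\<in>Basis. (da h b y)\<^sup>2) + h\<^sup>2) - (\<Sum>b\<in>Basis. dF h b y * (da h b y * (\<phi> (y, 0))\<^sup>2))"

text \<open>Stability with \<open>\<phi> w + \<tau> \<psi>\<close> minus the difference quotients of the equation tested with \<open>v\<^sub>b \<phi>\<^sup>2\<close>.
  The gradient terms combine as in the geometric Poincare inequality.\<close>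

lemma stability_difference_quotients:
  assumes cp: "compatible \<phi> \<Phi> \<psi> \<Psi> r x1" and h: "0 < h"
  shows "integrable M (PI \<phi> \<psi> \<tau> h)" and "integrable lebesgue (PB \<phi> h)"
    and "integrable M (\<lambda>p. \<mu> (snd p) * (w h p)\<^sup>2 * (norm (\<Phi> p))\<^sup>2)"
    and "integrable M (\<lambda>p. \<mu> (snd p) * (dw h p \<bullet> \<Psi> p))"
    and "integrable M (\<lambda>p. \<mu> (snd p) * (\<phi> p)\<^sup>2 * Q h p)"
    and "(\<integral>p. \<mu> (snd p) * (\<phi> p)\<^sup>2 * Q h p \<partial>M) \<le> (\<integral>p. \<mu> (snd p) * (w h p)\<^sup>2 * (norm (\<Phi> p))\<^sup>2 \<partial>M)
      + 2 * \<tau> * (\<integral>p. \<mu> (snd p) * (dw h p \<bullet> \<Psi> p) \<partial>M) + \<tau>\<^sup>2 * (\<integral>p. \<mu> (snd p) * (norm (\<Psi> p))\<^sup>2 \<partial>M)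
      + (\<integral>p. PI \<phi> \<psi> \<tau> h p \<partial>M) - (\<integral>y. PB \<phi> h y \<partial>lebesgue)"
proof -
  have c: "cut \<phi> \<Phi> r" and t\<psi>: "test \<psi> \<Psi> r" and x1: "0 < x1" "\<And>y x. 0 < x \<Longrightarrow> x < x1 \<Longrightarrow> \<psi> (y, x) = 0"
    and one: "\<And>p. p \<in> upper_half \<Longrightarrow> \<psi> p \<noteq> 0 \<or> \<Psi> p \<noteq> 0 \<Longrightarrow> \<phi> p = 1 \<and> \<Phi> p = 0"
    using cp unfolding compatible_def by blast+
  define G where "G p = \<phi> p *\<^sub>R dw h p + w h p *\<^sub>R \<Phi> p + \<tau> *\<^sub>R \<Psi> p" for p
  define X where "X b p = (\<phi> p)\<^sup>2 *\<^sub>R dv h b p + (2 * v h b p * \<phi> p) *\<^sub>R \<Phi> p" for b p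
  have tw: "test (\<lambda>p. \<phi> p * w h p + \<tau> * \<psi> p) G r"
    unfolding G_def by (rule test_add_scaled[OF test_w_cut[OF c h] t\<psi>])
  note st = test_stable[OF tw]
  have tb: "test (\<lambda>p. v h b p * (\<phi> p)\<^sup>2) (X b) r" if "b \<in> Basis" for b
    unfolding X_def by (rule test_v_cut[OF c h that])
  note de = difference_equation[OF tb, where h=h]
  have sq_I: "g\<^sub>u (snd p) (u p) * (\<phi> p * w h p + \<tau> * \<psi> p)\<^sup>2 = g\<^sub>u (snd p) (u p) * (\<phi> p)\<^sup>2 * (w h p + \<tau> * \<psi> p)\<^sup>2"
    if "p \<in> upper_half" for p
  proof -
    \<comment> \<open>Since \<open>\<phi>\<close> is 1 where \<open>\<psi>\<close> is nonzero, it
      can be taken out of the whole sum before squaring.\<close>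
    have "\<phi> p * \<psi> p = \<psi> p" using one[OF that] by (cases "\<psi> p = 0") auto
    then have "\<phi> p * w h p + \<tau> * \<psi> p = \<phi> p * (w h p + \<tau> * \<psi> p)" by (simp add: distrib_left mult.left_commute)
    then show ?thesis by (simp add: power_mult_distrib)
  qed
  have i1: "integrable M (\<lambda>p. g\<^sub>u (snd p) (u p) * (\<phi> p)\<^sup>2 * (w h p + \<tau> * \<psi> p)\<^sup>2)"
    using st(1) by (rule Bochner_Integration.integrable_cong[THEN iffD1, rotated 2]) (auto simp: sq_I)
  have e1: "(\<integral>p. g\<^sub>u (snd p) (u p) * (\<phi> p * w h p + \<tau> * \<psi> p)\<^sup>2 \<partial>M) = (\<integral>p. g\<^sub>u (snd p) (u p) * (\<phi> p)\<^sup>2 * (w h p + \<tau> * \<psi> p)\<^sup>2 \<partial>M)"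
    by (rule Bochner_Integration.integral_cong) (auto simp: sq_I)
  have i2: "integrable M (\<lambda>p. \<Sum>b\<in>Basis. dG h b p * (v h b p * (\<phi> p)\<^sup>2))"
    by (intro Bochner_Integration.integrable_sum de(2))
  show PIi: "integrable M (PI \<phi> \<psi> \<tau> h)"
    unfolding PI_def[abs_def] by (rule Bochner_Integration.integrable_diff[OF i1 i2])
  have sq_B: "f' (a y) * (bdry (\<lambda>p. \<phi> p * w h p + \<tau> * \<psi> p) y)\<^sup>2 = f' (a y) * (\<phi> (y, 0))\<^sup>2 * ((\<Sum>b\<in>Basis. (da h b y)\<^sup>2) + h\<^sup>2)" for y
  proof -
    have "bdry (\<lambda>p. \<phi> p * w h p + \<tau> * \<psi> p) y = \<phi> (y, 0) * sqrt ((\<Sum>b\<in>Basis. (da h b y)\<^sup>2) + h\<^sup>2)"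
      by (rule bdry_v_cut(3)[OF c x1(1)]) (rule x1(2))
    then show ?thesis by (simp add: power_mult_distrib sum_nonneg)
  qed
  have i3: "integrable lebesgue (\<lambda>y. f' (a y) * (\<phi> (y, 0))\<^sup>2 * ((\<Sum>b\<in>Basis. (da h b y)\<^sup>2) + h\<^sup>2))"
    using st(2) unfolding sq_B .
  have i4: "integrable lebesgue (\<lambda>y. \<Sum>b\<in>Basis. dF h b y * (da h b y * (\<phi> (y, 0))\<^sup>2))"
    by (intro Bochner_Integration.integrable_sum de(3)[unfolded bdry_v_cut(1)[OF c]])
  show PBi: "integrable lebesgue (PB \<phi> h)"
    unfolding PB_def[abs_def] by (rule Bochner_Integration.integrable_diff[OF i3 i4])
  obtain B where B: "0 \<le> B" "\<And>p. norm (\<Phi> p) \<le> B" using cut_grad_bound[OF c] by blast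
  have \<mu>pos: "0 < \<mu> (snd p)" if "p \<in> space M" for p
    using that mu_pos by (simp add: upper_half_def)
  note [measurable] = mu_measurable continuous_on_upper_half_measurable[OF cont_w] continuous_on_upper_half_measurable[OF cont_dw[OF h]]
    continuous_on_upper_half_measurable[OF cutD(3)[OF c]]
  have \<Psi>m[measurable]: "\<Psi> \<in> borel_measurable M" using t\<psi> by (simp add: test_def)
  obtain Bu where Bu: "0 < Bu" "\<And>p. p \<in> upper_half \<Longrightarrow> \<bar>u p\<bar> \<le> Bu" using u_bound by blast
  have wW: "(w h p)\<^sup>2 \<le> real DIM(real ^ 'n) * (2 * Bu / h)\<^sup>2 + h\<^sup>2" if p: "p \<in> upper_half" for p
  proof -
    have "(v h b p)\<^sup>2 \<le> (2 * Bu / h)\<^sup>2" for b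
      using power_mono[OF v_bound_h[OF Bu(2) h p, of b], of 2] by simp
    then have "(\<Sum>b\<in>(Basis :: (real ^ 'n) set). (v h b p)\<^sup>2) \<le> of_nat (card (Basis :: (real ^ 'n) set)) * (2 * Bu / h)\<^sup>2"
      by (rule sum_bounded_above)
    then show ?thesis unfolding w_power2 by simp
  qed
  show iw: "integrable M (\<lambda>p. \<mu> (snd p) * (w h p)\<^sup>2 * (norm (\<Phi> p))\<^sup>2)"
  proof (rule Bochner_Integration.integrable_bound[OF integrable_mult_right[OF mu_ball_integrable[of r], of "(real DIM(real ^ 'n) * (2 * Bu / h)\<^sup>2 + h\<^sup>2) * B\<^sup>2"]])
    show "AE p in M. norm (\<mu> (snd p) * (w h p)\<^sup>2 * (norm (\<Phi> p))\<^sup>2)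
        \<le> norm ((real DIM(real ^ 'n) * (2 * Bu / h)\<^sup>2 + h\<^sup>2) * B\<^sup>2 * (\<mu> (snd p) * indicat_real (ball 0 r) p))"
    proof (rule AE_I2)
      fix p assume pM: "p \<in> space M"
      then have p: "p \<in> upper_half" by simp
      show "norm (\<mu> (snd p) * (w h p)\<^sup>2 * (norm (\<Phi> p))\<^sup>2)
        \<le> norm ((real DIM(real ^ 'n) * (2 * Bu / h)\<^sup>2 + h\<^sup>2) * B\<^sup>2 * (\<mu> (snd p) * indicat_real (ball 0 r) p))"
      proof (cases "norm p < r")
        case True
        have "(w h p)\<^sup>2 * (norm (\<Phi> p))\<^sup>2 \<le> (real DIM(real ^ 'n) * (2 * Bu / h)\<^sup>2 + h\<^sup>2) * B\<^sup>2"
          using wW[OF p] B by (intro mult_mono power_mono) auto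
        then have "\<mu> (snd p) * ((w h p)\<^sup>2 * (norm (\<Phi> p))\<^sup>2) \<le> \<mu> (snd p) * ((real DIM(real ^ 'n) * (2 * Bu / h)\<^sup>2 + h\<^sup>2) * B\<^sup>2)"
          using \<mu>pos[OF pM] by (intro mult_left_mono) auto
        moreover have "0 \<le> (real DIM(real ^ 'n) * (2 * Bu / h)\<^sup>2 + h\<^sup>2) * B\<^sup>2" by simp
        ultimately show ?thesis using True \<mu>pos[OF pM] by (simp add: abs_mult mult_ac)
      next
        case False then show ?thesis using cutD(5)[OF c, of p] by simp
      qed
    qed
  qed measurable
  have i\<Psi>: "integrable M (\<lambda>p. \<mu> (snd p) * (norm (\<Psi> p))\<^sup>2)" using t\<psi> by (simp add: test_def)
  have idw: "integrable M (\<lambda>p. \<mu> (snd p) * (norm (dw h p))\<^sup>2 * indicat_real (ball 0 r) p)"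
  proof (rule Bochner_Integration.integrable_bound[OF integrable_mult_right[OF E_integrable[OF h, of r], of "real DIM(real ^ 'n) * (4 / h\<^sup>2)"]])
    show "(\<lambda>p. \<mu> (snd p) * (norm (dw h p))\<^sup>2 * indicat_real (ball 0 r) p) \<in> borel_measurable M"
      using ball_indicator_measurable by measurable
    show "AE p in M. norm (\<mu> (snd p) * (norm (dw h p))\<^sup>2 * indicat_real (ball 0 r) p)
        \<le> norm (real DIM(real ^ 'n) * (4 / h\<^sup>2) * (\<mu> (snd p) * E h p * indicat_real (ball 0 r) p))"
    proof (rule AE_I2)
      fix p assume pM: "p \<in> space M"
      have "(norm (dw h p))\<^sup>2 \<le> real DIM(real ^ 'n) * (4 / h\<^sup>2) * E h p"
        using dw_le[OF h, of p] sum_dv_le[of h p] by linarith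
      then have "\<mu> (snd p) * (norm (dw h p))\<^sup>2 \<le> \<mu> (snd p) * (real DIM(real ^ 'n) * (4 / h\<^sup>2) * E h p)"
        using \<mu>pos[OF pM] by (intro mult_left_mono) auto
      then show "norm (\<mu> (snd p) * (norm (dw h p))\<^sup>2 * indicat_real (ball 0 r) p)
        \<le> norm (real DIM(real ^ 'n) * (4 / h\<^sup>2) * (\<mu> (snd p) * E h p * indicat_real (ball 0 r) p))"
        using \<mu>pos[OF pM] E_nonneg(1)[of h p] by (simp add: abs_mult mult_ac indicator_def)
    qed
  qed
  show ic: "integrable M (\<lambda>p. \<mu> (snd p) * (dw h p \<bullet> \<Psi> p))"
  proof (rule Bochner_Integration.integrable_bound[OF Bochner_Integration.integrable_add[OF idw i\<Psi>]])
    show "AE p in M. norm (\<mu> (snd p) * (dw h p \<bullet> \<Psi> p))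
        \<le> norm (\<mu> (snd p) * (norm (dw h p))\<^sup>2 * indicat_real (ball 0 r) p + \<mu> (snd p) * (norm (\<Psi> p))\<^sup>2)"
    proof (rule AE_I2)
      fix p assume pM: "p \<in> space M"
      show "norm (\<mu> (snd p) * (dw h p \<bullet> \<Psi> p))
        \<le> norm (\<mu> (snd p) * (norm (dw h p))\<^sup>2 * indicat_real (ball 0 r) p + \<mu> (snd p) * (norm (\<Psi> p))\<^sup>2)"
      proof (cases "norm p < r")
        case True
        have "\<bar>dw h p \<bullet> \<Psi> p\<bar> \<le> norm (dw h p) * norm (\<Psi> p)" by (rule Cauchy_Schwarz_ineq2)
        also have "\<dots> \<le> (norm (dw h p))\<^sup>2 + (norm (\<Psi> p))\<^sup>2"
          using sum_squares_bound[of "norm (dw h p)" "norm (\<Psi> p)"] zero_le_power2[of "norm (dw h p)"] zero_le_power2[of "norm (\<Psi> p)"]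
            mult_nonneg_nonneg[OF norm_ge_zero[of "dw h p"] norm_ge_zero[of "\<Psi> p"]] by linarith
        finally have "\<mu> (snd p) * \<bar>dw h p \<bullet> \<Psi> p\<bar> \<le> \<mu> (snd p) * ((norm (dw h p))\<^sup>2 + (norm (\<Psi> p))\<^sup>2)"
          using \<mu>pos[OF pM] by (intro mult_left_mono) auto
        moreover have "0 \<le> \<mu> (snd p) * (norm (dw h p))\<^sup>2 + \<mu> (snd p) * (norm (\<Psi> p))\<^sup>2" using \<mu>pos[OF pM] by simp
        ultimately show ?thesis using True \<mu>pos[OF pM] by (simp add: abs_mult distrib_left)
      next
        case False then show ?thesis using test_zero[OF t\<psi>, of p] pM by simp
      qed
    qed
  qed measurable
  have idiff: "integrable M (\<lambda>p. \<mu> (snd p) * (norm (G p))\<^sup>2 - (\<Sum>b\<in>Basis. \<mu> (snd p) * (dv h b p \<bullet> X b p)))"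
    using tw by (intro Bochner_Integration.integrable_diff Bochner_Integration.integrable_sum de(1)) (simp_all add: test_def)
  \<comment> \<open>The pointwise identity behind the inequality. By w dw = sum of v_b dv_b, the
    cross terms with \<open>\<Phi>\<close> in the squared gradient cancel those of the equations,
    which leaves w^2 |\<open>\<Phi>\<close>|^2 and the terms in \<open>\<tau>\<close>.\<close>
  have alg: "\<mu> (snd p) * (\<phi> p)\<^sup>2 * Q h p = \<mu> (snd p) * (w h p)\<^sup>2 * (norm (\<Phi> p))\<^sup>2 + 2 * \<tau> * (\<mu> (snd p) * (dw h p \<bullet> \<Psi> p))
      + \<tau>\<^sup>2 * (\<mu> (snd p) * (norm (\<Psi> p))\<^sup>2) - (\<mu> (snd p) * (norm (G p))\<^sup>2 - (\<Sum>b\<in>Basis. \<mu> (snd p) * (dv h b p \<bullet> X b p)))"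
    if p: "p \<in> upper_half" for p
  proof -
    define Y where "Y = \<phi> p *\<^sub>R dw h p + w h p *\<^sub>R \<Phi> p"
    have Y\<Psi>: "Y \<bullet> \<Psi> p = dw h p \<bullet> \<Psi> p"
      using one[OF p] by (cases "\<Psi> p = 0") (auto simp: Y_def)
    have "w h p * (dw h p \<bullet> \<Phi> p) = (w h p *\<^sub>R dw h p) \<bullet> \<Phi> p" by simp
    also have "\<dots> = (\<Sum>b\<in>Basis. v h b p * (dv h b p \<bullet> \<Phi> p))"
      unfolding w_scaleR_dw[OF h] by (simp add: inner_sum_left)
    finally have wd: "w h p * (dw h p \<bullet> \<Phi> p) = (\<Sum>b\<in>Basis. v h b p * (dv h b p \<bullet> \<Phi> p))" .
    have YY: "Y \<bullet> Y = (\<phi> p)\<^sup>2 * (dw h p \<bullet> dw h p) + 2 * \<phi> p * (w h p * (dw h p \<bullet> \<Phi> p)) + (w h p)\<^sup>2 * (\<Phi> p \<bullet> \<Phi> p)"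
      by (simp add: Y_def inner_add_left inner_add_right inner_commute power2_eq_square algebra_simps)
    have GG: "(norm (G p))\<^sup>2 = Y \<bullet> Y + 2 * \<tau> * (dw h p \<bullet> \<Psi> p) + \<tau>\<^sup>2 * (norm (\<Psi> p))\<^sup>2"
    proof -
      have "(norm (G p))\<^sup>2 = (Y + \<tau> *\<^sub>R \<Psi> p) \<bullet> (Y + \<tau> *\<^sub>R \<Psi> p)" by (simp add: G_def Y_def power2_norm_eq_inner)
      also have "\<dots> = Y \<bullet> Y + 2 * \<tau> * (Y \<bullet> \<Psi> p) + \<tau>\<^sup>2 * (\<Psi> p \<bullet> \<Psi> p)"
        by (simp add: inner_add_left inner_add_right inner_commute power2_eq_square algebra_simps)
      finally show ?thesis by (simp add: Y\<Psi> power2_norm_eq_inner)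
    qed
    have XX: "(\<Sum>b\<in>Basis. dv h b p \<bullet> X b p) = (\<phi> p)\<^sup>2 * (\<Sum>b\<in>Basis. (norm (dv h b p))\<^sup>2) + 2 * \<phi> p * (w h p * (dw h p \<bullet> \<Phi> p))"
      unfolding wd X_def sum_distrib_left sum.distrib[symmetric]
      by (intro sum.cong refl) (simp add: inner_add_right power2_norm_eq_inner mult_ac)
    have "(\<phi> p)\<^sup>2 * Q h p = (w h p)\<^sup>2 * (norm (\<Phi> p))\<^sup>2 + 2 * \<tau> * (dw h p \<bullet> \<Psi> p) + \<tau>\<^sup>2 * (norm (\<Psi> p))\<^sup>2
      - ((norm (G p))\<^sup>2 - (\<Sum>b\<in>Basis. dv h b p \<bullet> X b p))"
      unfolding GG XX YY Q_def by (simp add: power2_norm_eq_inner right_diff_distrib)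
    then have "\<mu> (snd p) * ((\<phi> p)\<^sup>2 * Q h p) = \<mu> (snd p) * ((w h p)\<^sup>2 * (norm (\<Phi> p))\<^sup>2 + 2 * \<tau> * (dw h p \<bullet> \<Psi> p) + \<tau>\<^sup>2 * (norm (\<Psi> p))\<^sup>2
      - ((norm (G p))\<^sup>2 - (\<Sum>b\<in>Basis. dv h b p \<bullet> X b p)))" by simp
    then show ?thesis by (simp add: right_diff_distrib distrib_left sum_distrib_left mult_ac)
  qed
  let ?R = "\<lambda>p. \<mu> (snd p) * (w h p)\<^sup>2 * (norm (\<Phi> p))\<^sup>2 + 2 * \<tau> * (\<mu> (snd p) * (dw h p \<bullet> \<Psi> p))
      + \<tau>\<^sup>2 * (\<mu> (snd p) * (norm (\<Psi> p))\<^sup>2) - (\<mu> (snd p) * (norm (G p))\<^sup>2 - (\<Sum>b\<in>Basis. \<mu> (snd p) * (dv h b p \<bullet> X b p)))"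
  have iR: "integrable M ?R"
    by (intro Bochner_Integration.integrable_diff[OF _ idiff] Bochner_Integration.integrable_add integrable_mult_right iw ic i\<Psi>)
  show "integrable M (\<lambda>p. \<mu> (snd p) * (\<phi> p)\<^sup>2 * Q h p)"
    using iR by (rule Bochner_Integration.integrable_cong[THEN iffD2, rotated 2]) (auto simp: alg)
  have "(\<integral>p. \<mu> (snd p) * (\<phi> p)\<^sup>2 * Q h p \<partial>M) = (\<integral>p. ?R p \<partial>M)"
    by (rule Bochner_Integration.integral_cong) (auto simp: alg)
  also have "\<dots> = (\<integral>p. \<mu> (snd p) * (w h p)\<^sup>2 * (norm (\<Phi> p))\<^sup>2 \<partial>M)
      + 2 * \<tau> * (\<integral>p. \<mu> (snd p) * (dw h p \<bullet> \<Psi> p) \<partial>M) + \<tau>\<^sup>2 * (\<integral>p. \<mu> (snd p) * (norm (\<Psi> p))\<^sup>2 \<partial>M)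
      - ((\<integral>p. \<mu> (snd p) * (norm (G p))\<^sup>2 \<partial>M) - (\<Sum>b\<in>Basis. \<integral>p. \<mu> (snd p) * (dv h b p \<bullet> X b p) \<partial>M))"
    using iw ic i\<Psi> idiff tw de(1)
    by (simp add: Bochner_Integration.integral_diff Bochner_Integration.integral_add Bochner_Integration.integral_sum
        Bochner_Integration.integrable_sum test_def)
  finally have main: "(\<integral>p. \<mu> (snd p) * (\<phi> p)\<^sup>2 * Q h p \<partial>M) = (\<integral>p. \<mu> (snd p) * (w h p)\<^sup>2 * (norm (\<Phi> p))\<^sup>2 \<partial>M)
      + 2 * \<tau> * (\<integral>p. \<mu> (snd p) * (dw h p \<bullet> \<Psi> p) \<partial>M) + \<tau>\<^sup>2 * (\<integral>p. \<mu> (snd p) * (norm (\<Psi> p))\<^sup>2 \<partial>M)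
      - ((\<integral>p. \<mu> (snd p) * (norm (G p))\<^sup>2 \<partial>M) - (\<Sum>b\<in>Basis. \<integral>p. \<mu> (snd p) * (dv h b p \<bullet> X b p) \<partial>M))" .
  have PIe: "(\<integral>p. PI \<phi> \<psi> \<tau> h p \<partial>M) = (\<integral>p. g\<^sub>u (snd p) (u p) * (\<phi> p)\<^sup>2 * (w h p + \<tau> * \<psi> p)\<^sup>2 \<partial>M)
      - (\<Sum>b\<in>Basis. \<integral>p. dG h b p * (v h b p * (\<phi> p)\<^sup>2) \<partial>M)"
    unfolding PI_def by (subst Bochner_Integration.integral_diff[OF i1 i2]) (simp add: Bochner_Integration.integral_sum de(2))
  have PBe: "(\<integral>y. PB \<phi> h y \<partial>lebesgue) = (\<integral>y. f' (a y) * (\<phi> (y, 0))\<^sup>2 * ((\<Sum>b\<in>Basis. (da h b y)\<^sup>2) + h\<^sup>2) \<partial>lebesgue)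
      - (\<Sum>b\<in>Basis. \<integral>y. dF h b y * (da h b y * (\<phi> (y, 0))\<^sup>2) \<partial>lebesgue)"
    unfolding PB_def
    by (subst Bochner_Integration.integral_diff[OF i3 i4])
      (simp add: Bochner_Integration.integral_sum de(3)[unfolded bdry_v_cut(1)[OF c]])
  have "(\<Sum>b\<in>Basis. \<integral>p. \<mu> (snd p) * (dv h b p \<bullet> X b p) \<partial>M) + (\<Sum>b\<in>Basis. \<integral>p. dG h b p * (v h b p * (\<phi> p)\<^sup>2) \<partial>M)
      = (\<Sum>b\<in>Basis. \<integral>y. dF h b y * (da h b y * (\<phi> (y, 0))\<^sup>2) \<partial>lebesgue)"
    unfolding sum.distrib[symmetric] by (intro sum.cong refl de(4)[unfolded bdry_v_cut(1)[OF c]])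
  moreover note st(3)[unfolded e1 sq_B]
  ultimately show "(\<integral>p. \<mu> (snd p) * (\<phi> p)\<^sup>2 * Q h p \<partial>M) \<le> (\<integral>p. \<mu> (snd p) * (w h p)\<^sup>2 * (norm (\<Phi> p))\<^sup>2 \<partial>M)
      + 2 * \<tau> * (\<integral>p. \<mu> (snd p) * (dw h p \<bullet> \<Psi> p) \<partial>M) + \<tau>\<^sup>2 * (\<integral>p. \<mu> (snd p) * (norm (\<Psi> p))\<^sup>2 \<partial>M)
      + (\<integral>p. PI \<phi> \<psi> \<tau> h p \<partial>M) - (\<integral>y. PB \<phi> h y \<partial>lebesgue)"
    unfolding main PIe PBe by linarith
qed

end

section \<open>The limit of the stability inequality\<close>

lemma difference_quotient_tendsto:
  fixes f :: "'a::real_normed_vector \<Rightarrow> 'b::real_normed_vector"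
  assumes D: "(f has_derivative f') (at p)" and h: "\<And>k. 0 < h k" "h \<longlonglongrightarrow> 0"
  shows "(\<lambda>k. (1 / h k) *\<^sub>R (f (p + h k *\<^sub>R c) - f p)) \<longlonglongrightarrow> f' c"
proof (rule LIMSEQ_I)
  interpret f': bounded_linear f' using D by (rule has_derivative_bounded_linear)
  fix e :: real assume e: "0 < e"
  define e' where "e' = e / (norm c + 1)"
  have nc: "0 < norm c + 1" by (simp add: add_nonneg_pos)
  have e': "0 < e'" using e nc by (simp add: e'_def)
  obtain d where d: "0 < d" "\<And>q. norm (q - p) < d \<Longrightarrow> norm (f q - f p - f' (q - p)) \<le> e' * norm (q - p)"
    using D e' unfolding has_derivative_at_alt by blast
  have "\<forall>\<^sub>F k in sequentially. h k < d / (norm c + 1)"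
    using order_tendstoD(2)[OF h(2), of "d / (norm c + 1)"] d(1) nc by simp
  then obtain n where n: "\<And>k. n \<le> k \<Longrightarrow> h k < d / (norm c + 1)" by (auto simp: eventually_sequentially)
  have "norm ((1 / h k) *\<^sub>R (f (p + h k *\<^sub>R c) - f p) - f' c) < e" if k: "n \<le> k" for k
  proof -
    have hk: "0 < h k" "h k * (norm c + 1) < d" using h(1) n[OF k] nc by (auto simp: pos_less_divide_eq)
    have "norm (h k *\<^sub>R c) = h k * norm c" using hk by simp
    also have "\<dots> < d" using hk by (simp add: distrib_left)
    finally have "norm (f (p + h k *\<^sub>R c) - f p - f' (h k *\<^sub>R c)) \<le> e' * (h k * norm c)"
      using d(2)[of "p + h k *\<^sub>R c"] hk by simp
    moreover have "(1 / h k) *\<^sub>R (f (p + h k *\<^sub>R c) - f p) - f' c = (1 / h k) *\<^sub>R (f (p + h k *\<^sub>R c) - f p - f' (h k *\<^sub>R c))"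
      using hk by (simp add: f'.scaleR scaleR_diff_right)
    moreover have "norm ((1 / h k) *\<^sub>R (f (p + h k *\<^sub>R c) - f p - f' (h k *\<^sub>R c))) = (1 / h k) * norm (f (p + h k *\<^sub>R c) - f p - f' (h k *\<^sub>R c))"
      using hk(1) by simp
    ultimately have "norm ((1 / h k) *\<^sub>R (f (p + h k *\<^sub>R c) - f p) - f' c) \<le> (1 / h k) * (e' * (h k * norm c))"
      using hk(1) mult_left_mono[of "norm (f (p + h k *\<^sub>R c) - f p - f' (h k *\<^sub>R c))" "e' * (h k * norm c)" "1 / h k"] by simp
    also have "\<dots> = e' * norm c" using hk(1) by simp
    also have "\<dots> < e' * (norm c + 1)" using e' by simp
    also have "\<dots> = e" using nc by (simp add: e'_def)
    finally show ?thesis .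
  qed
  then show "\<exists>n. \<forall>k\<ge>n. norm ((1 / h k) *\<^sub>R (f (p + h k *\<^sub>R c) - f p) - f' c) < e" by blast
qed

lemma sum_inner_Basis_power2: "(\<Sum>b\<in>Basis. (x \<bullet> b)\<^sup>2) = (norm (x :: 'a::euclidean_space))\<^sup>2"
  unfolding power2_norm_eq_inner by (subst euclidean_inner) (simp add: power2_eq_square)

context stable_solution_setting
begin

definition hk :: "nat \<Rightarrow> real" where "hk k = inverse (real (Suc k))"

lemma hk: "0 < hk k" "hk k \<le> 1" "hk \<longlonglongrightarrow> 0"
proof -
  show "0 < hk k" by (simp add: hk_def)
  show "hk k \<le> 1" unfolding hk_def by (rule inverse_le_1_iff[THEN iffD2]) simp
  show "hk \<longlonglongrightarrow> 0" unfolding hk_def[abs_def] by (rule LIMSEQ_inverse_real_of_nat)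
qed

definition N :: "(real ^ 'n) \<times> real \<Rightarrow> real" where "N p = norm (F p)"

definition D2b where "D2b b p = blinfun_apply (D2 p) (b, 0)"

text \<open>The limit of Q where F \<noteq> 0. At zeros of F the division by \<open>N p\<close>
  yields the default 0 and the formula has no geometric meaning; each use is restricted to F
  \<noteq> 0.\<close>

definition Q0 :: "(real ^ 'n) \<times> real \<Rightarrow> real" where
  "Q0 p = (\<Sum>b\<in>Basis. (norm (D2b b p))\<^sup>2) - (norm ((1 / N p) *\<^sub>R (\<Sum>b\<in>Basis. (F p \<bullet> b) *\<^sub>R D2b b p)))\<^sup>2"

lemma v_tendsto:
  assumes p: "p \<in> upper_half"
  shows "(\<lambda>k. v (hk k) b p) \<longlonglongrightarrow> F p \<bullet> b"
proof -
  have "(u has_derivative (\<lambda>h. h \<bullet> D1 p)) (at p)" using grad_u[OF p] by (simp add: gderiv_def)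
  from difference_quotient_tendsto[OF this hk(1,3), of "(b, 0)"]
  show ?thesis by (simp add: v_def inner_prod_def inner_commute)
qed

lemma dv_tendsto:
  assumes p: "p \<in> upper_half"
  shows "(\<lambda>k. dv (hk k) b p) \<longlonglongrightarrow> D2b b p"
  using difference_quotient_tendsto[OF deriv_D1[OF p] hk(1,3), of "(b, 0)"] by (simp add: dv_def D2b_def)

lemma w_tendsto:
  assumes p: "p \<in> upper_half"
  shows "(\<lambda>k. w (hk k) p) \<longlonglongrightarrow> N p"
proof -
  have "(\<lambda>k. sqrt ((\<Sum>b\<in>Basis. (v (hk k) b p)\<^sup>2) + (hk k)\<^sup>2)) \<longlonglongrightarrow> sqrt ((\<Sum>b\<in>Basis. (F p \<bullet> b)\<^sup>2) + 0\<^sup>2)"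
    by (intro tendsto_real_sqrt tendsto_add tendsto_sum tendsto_power v_tendsto p hk)
  then show ?thesis by (simp add: w_def sum_inner_Basis_power2 N_def)
qed

lemma Q_tendsto:
  assumes p: "p \<in> upper_half" and F: "F p \<noteq> 0"
  shows "(\<lambda>k. Q (hk k) p) \<longlonglongrightarrow> Q0 p"
  unfolding Q_def Q0_def dw_def
  by (intro tendsto_diff tendsto_sum tendsto_power tendsto_norm tendsto_scaleR tendsto_divide tendsto_const
      v_tendsto dv_tendsto w_tendsto p) (use F in \<open>simp add: N_def\<close>)

text \<open>Independent of h \<le> 1: the horizontal radius is enlarged by 1 to contain the shifted
  points, where u is Lipschitz in y.\<close>

lemma v_uniform_bound:
  obtains B where "0 < B" "\<And>h b p. 0 < h \<Longrightarrow> h \<le> 1 \<Longrightarrow> b \<in> Basis \<Longrightarrow> p \<in> upper_half \<Longrightarrow> norm p < r \<Longrightarrow> \<bar>v h b p\<bar> \<le> B"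
proof -
  obtain B where B: "0 < B" "\<And>x y y'. 0 < x \<Longrightarrow> x \<le> r \<Longrightarrow> norm y \<le> r + 1 \<Longrightarrow> norm y' \<le> r + 1 \<Longrightarrow>
    \<bar>u (y', x) - u (y, x)\<bar> \<le> B * norm (y' - y)"
    using u_lipschitz_y[of r "r + 1"] by blast
  have "\<bar>v h b p\<bar> \<le> B" if h: "0 < h" "h \<le> 1" and b: "b \<in> Basis" and p: "p \<in> upper_half" "norm p < r" for h b p
  proof -
    obtain y x where yx: "p = (y, x)" by (cases p)
    have x: "0 < x" "x \<le> r" "norm y \<le> r"
      using p norm_fst_le[of y x] norm_snd_le[of x y] by (auto simp: yx)
    have "norm (y + h *\<^sub>R b) \<le> norm y + norm (h *\<^sub>R b)" by (rule norm_triangle_ineq)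
    then have "norm (y + h *\<^sub>R b) \<le> r + 1" using x h b by simp
    then have "\<bar>u (y + h *\<^sub>R b, x) - u (y, x)\<bar> \<le> B * norm (y + h *\<^sub>R b - y)" using x by (intro B(2)) auto
    then have "\<bar>u (y + h *\<^sub>R b, x) - u (y, x)\<bar> \<le> B * h" using h b by simp
    then show ?thesis using h(1) by (simp add: v_def yx abs_divide pos_divide_le_eq)
  qed
  then show ?thesis using B(1) that by blast
qed

lemma da_uniform_bound:
  obtains B where "0 \<le> B" "\<And>h b y. 0 < h \<Longrightarrow> h \<le> 1 \<Longrightarrow> b \<in> Basis \<Longrightarrow> norm y < r \<Longrightarrow> \<bar>da h b y\<bar> \<le> B"
proof -
  obtain B where B: "B-lipschitz_on (cball 0 (r + 1)) a" using trace_locally_lipschitz by blast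
  have "\<bar>da h b y\<bar> \<le> B" if h: "0 < h" "h \<le> 1" and b: "b \<in> Basis" and y: "norm y < r" for h b y
  proof -
    have "norm (y + h *\<^sub>R b) \<le> norm y + norm (h *\<^sub>R b)" by (rule norm_triangle_ineq)
    then have "norm (y + h *\<^sub>R b) \<le> r + 1" using y h b by simp
    then have "dist (a (y + h *\<^sub>R b)) (a y) \<le> B * dist (y + h *\<^sub>R b) y" using y by (intro lipschitz_onD[OF B]) auto
    then have "\<bar>a (y + h *\<^sub>R b) - a y\<bar> \<le> B * h" using h b by (simp add: dist_real_def dist_norm)
    then show ?thesis using h(1) by (simp add: da_def abs_divide pos_divide_le_eq)
  qed
  then show ?thesis using lipschitz_on_nonneg[OF B] that by blast
qed

lemma slice_lipschitz: "0 < x \<Longrightarrow> \<exists>L. L-lipschitz_on (cball 0 r) (\<lambda>y. u (y, x))"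
proof -
  assume x: "0 < x"
  obtain B where B: "0 < B" "\<And>x' y y'. 0 < x' \<Longrightarrow> x' \<le> x \<Longrightarrow> norm y \<le> r \<Longrightarrow> norm y' \<le> r \<Longrightarrow>
    \<bar>u (y', x') - u (y, x')\<bar> \<le> B * norm (y' - y)" using u_lipschitz_y[of x r] by blast
  have "B-lipschitz_on (cball 0 r) (\<lambda>y. u (y, x))"
    by (rule lipschitz_onI) (use B(1) B(2)[OF x order_refl] in \<open>auto simp: dist_real_def dist_norm\<close>)
  then show ?thesis by blast
qed

lemma AE_M_I:
  assumes meas: "{p \<in> space M. \<not> P p} \<in> sets M"
    and slices: "\<And>x. 0 < x \<Longrightarrow> AE y in lebesgue. P (y, x)"
  shows "AE p in M. P p"
  unfolding AE_upper_half_iff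
proof (rule AE_lebesgue_prodI)
  have "{p. \<not> (p \<in> upper_half \<longrightarrow> P p)} = {p \<in> space M. \<not> P p}" by auto
  then show "{p. \<not> (p \<in> upper_half \<longrightarrow> P p)} \<in> sets lebesgue"
    using meas by (simp add: sets_restrict_space_iff)
  show "AE y in lebesgue. (y, x) \<in> upper_half \<longrightarrow> P (y, x)" for x
    using slices[of x] by (cases "0 < x") auto
qed

text \<open>Stability tested with the cutoff itself. Joint measurability and integrability of
  \<open>g\<^sub>u (snd p) (u p)\<close> come from here, as \<open>g\<^sub>u\<close> is chosen
  separately for each x.\<close>

lemma gu_cut_measurable:
  assumes c: "cut \<phi> \<Phi> r"
  shows "integrable M (\<lambda>p. g\<^sub>u (snd p) (u p) * (\<phi> p)\<^sup>2)"
  using test_stable(1)[OF test_cut[OF c]] .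

text \<open>Slice by slice, this is \<open>AE_chain_rule_difference_quotient\<close> for y \<mapsto>
  u (y, x). Measurability of the whole expression allows the slices to be assembled.\<close>

lemma AE_interior_chain:
  assumes c: "cut \<phi> \<Phi> r" and b: "b \<in> Basis"
  shows "AE p in M. (\<lambda>k. g\<^sub>u (snd p) (u p) * (\<phi> p)\<^sup>2 * (v (hk k) b p)\<^sup>2 - dG (hk k) b p * (v (hk k) b p * (\<phi> p)\<^sup>2)) \<longlonglongrightarrow> 0"
proof (rule AE_M_I)
  have [measurable]: "(\<lambda>p. g\<^sub>u (snd p) (u p) * (\<phi> p)\<^sup>2 * (v (hk k) b p)\<^sup>2 - dG (hk k) b p * (v (hk k) b p * (\<phi> p)\<^sup>2)) \<in> borel_measurable M" for k
  proof (intro borel_measurable_diff borel_measurable_times[of "\<lambda>p. g\<^sub>u (snd p) (u p) * (\<phi> p)\<^sup>2"] borel_measurable_power)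
    show "(\<lambda>p. g\<^sub>u (snd p) (u p) * (\<phi> p)\<^sup>2) \<in> borel_measurable M" using gu_cut_measurable[OF c] by simp
    show "v (hk k) b \<in> borel_measurable M" by (rule continuous_on_upper_half_measurable[OF cont_v])
    show "(\<lambda>p. dG (hk k) b p * (v (hk k) b p * (\<phi> p)\<^sup>2)) \<in> borel_measurable M"
      using difference_equation(2)[OF test_v_cut[OF c hk(1) b]] by (rule borel_measurable_integrable)
  qed
  show "{p \<in> space M. \<not> (\<lambda>k. g\<^sub>u (snd p) (u p) * (\<phi> p)\<^sup>2 * (v (hk k) b p)\<^sup>2 - dG (hk k) b p * (v (hk k) b p * (\<phi> p)\<^sup>2)) \<longlonglongrightarrow> 0} \<in> sets M"
    by measurable
  fix x :: real assume x: "0 < x"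
  have "locally_lipschitz_on UNIV (g x)" using structural x by (simp add: structural_def)
  from AE_chain_rule_difference_quotient[OF slice_lipschitz[OF x] locally_lipschitz_imp_lipschitz_on_cball[OF this] deriv_g[OF x] hk(1,3), of b]
  show "AE y in lebesgue. (\<lambda>k. g\<^sub>u (snd (y, x)) (u (y, x)) * (\<phi> (y, x))\<^sup>2 * (v (hk k) b (y, x))\<^sup>2
      - dG (hk k) b (y, x) * (v (hk k) b (y, x) * (\<phi> (y, x))\<^sup>2)) \<longlonglongrightarrow> 0"
  proof eventually_elim
    case (elim y)
    have eq: "A * P * V\<^sup>2 - D * (V * P) = P * (A * V\<^sup>2 - D * V)" for A P V D :: real
      by (simp add: right_diff_distrib mult_ac)
    from tendsto_mult_right_zero[OF elim, of "(\<phi> (y, x))\<^sup>2"] show ?case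
      unfolding eq v_def dG_def by (simp only: add_Pair snd_conv add_0_right)
  qed
qed

text \<open>The assumed bound concerns true derivatives of \<open>g x\<close> only. Where u takes a
  value at which \<open>g\<^sub>u\<close> is not the derivative, \<open>g\<^sub>u\<close> may be
  arbitrarily large, but there F = 0 almost everywhere on the slice. The factor \<open>N p\<close>
  on both sides absorbs this set.\<close>

lemma gu_bound:
  assumes c: "cut \<phi> \<Phi> r"
  obtains C where "0 < C" "AE p in M. \<bar>g\<^sub>u (snd p) (u p) * (\<phi> p)\<^sup>2\<bar> * N p \<le> C * (\<phi> p)\<^sup>2 * N p"
proof -
  obtain Bu where Bu: "0 < Bu" "\<And>p. p \<in> upper_half \<Longrightarrow> \<bar>u p\<bar> \<le> Bu" using u_bound by blast
  obtain C where C: "0 < C" "\<And>x t D. 0 < x \<Longrightarrow> x < r \<Longrightarrow> \<bar>t\<bar> \<le> Bu \<Longrightarrow> (g x has_real_derivative D) (at t) \<Longrightarrow> \<bar>D\<bar> \<le> C"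
  proof (rule g_lipschitz[of r Bu])
    fix C assume 1: "0 < C" and 3: "\<And>x t D. 0 < x \<Longrightarrow> x < r \<Longrightarrow> \<bar>t\<bar> \<le> Bu \<Longrightarrow> (g x has_real_derivative D) (at t) \<Longrightarrow> \<bar>D\<bar> \<le> C"
    show ?thesis by (rule that[OF 1 3])
  qed
  have "AE p in M. \<bar>g\<^sub>u (snd p) (u p) * (\<phi> p)\<^sup>2\<bar> * N p \<le> C * (\<phi> p)\<^sup>2 * N p"
  proof (rule AE_M_I)
    have [measurable]: "(\<lambda>p. g\<^sub>u (snd p) (u p) * (\<phi> p)\<^sup>2) \<in> borel_measurable M" using gu_cut_measurable[OF c] by simp
    have [measurable]: "\<phi> \<in> borel_measurable M" "N \<in> borel_measurable M"
      unfolding N_def[abs_def]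
      by (intro continuous_on_upper_half_measurable cut_cont[OF c] continuous_on_norm continuous_on_fst cont_D1)+
    show "{p \<in> space M. \<not> \<bar>g\<^sub>u (snd p) (u p) * (\<phi> p)\<^sup>2\<bar> * N p \<le> C * (\<phi> p)\<^sup>2 * N p} \<in> sets M"
      by measurable
    fix x :: real assume x: "0 < x"
    define Z where "Z = {t. \<not> (g x has_real_derivative g\<^sub>u x t) (at t)}"
    have Z: "negligible Z" using deriv_g[OF x] by (simp add: Z_def AE_lebesgue_iff_negligible)
    have "AE y in lebesgue. \<forall>b\<in>(Basis :: (real ^ 'n) set). u (y, x) \<in> Z \<longrightarrow> (\<lambda>k. (u (y + hk k *\<^sub>R b, x) - u (y, x)) / hk k) \<longlonglongrightarrow> 0"
      by (intro AE_finite_allI AE_difference_quotient_tendsto_zero_on_preimage[OF slice_lipschitz[OF x] Z hk(1,3)]) auto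
    then show "AE y in lebesgue. \<bar>g\<^sub>u (snd (y, x)) (u (y, x)) * (\<phi> (y, x))\<^sup>2\<bar> * N (y, x) \<le> C * (\<phi> (y, x))\<^sup>2 * N (y, x)"
    proof eventually_elim
      case (elim y)
      have N0: "0 \<le> N (y, x)" by (simp add: N_def)
      consider "r \<le> norm (y, x)" | "norm (y, x) < r" "u (y, x) \<in> Z" | "norm (y, x) < r" "u (y, x) \<notin> Z" by linarith
      then show ?case
      proof cases
        case 1 then show ?thesis using cutD(4)[OF c] by simp
      next
        case 2
        \<comment> \<open>The quotients tend to 0 because the value of u lies in Z, and to the
          component of F by differentiability.\<close>
        have "F (y, x) \<bullet> b = 0" if "b \<in> Basis" for b
        proof -
          have "(\<lambda>k. v (hk k) b (y, x)) \<longlonglongrightarrow> 0" using elim that 2(2) by (simp add: v_def)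
          then show ?thesis using LIMSEQ_unique v_tendsto[of "(y, x)" b] x by auto
        qed
        then have "F (y, x) = 0" by (metis euclidean_all_zero_iff)
        then show ?thesis by (simp add: N_def)
      next
        case 3
        then have "(g x has_real_derivative g\<^sub>u x (u (y, x))) (at (u (y, x)))" by (simp add: Z_def)
        moreover have "x < r" using 3(1) norm_snd_le[of x y] x by simp
        ultimately have "\<bar>g\<^sub>u x (u (y, x))\<bar> \<le> C" using x Bu(2)[of "(y, x)"] by (intro C(2)[of x "u (y, x)"]) auto
        then show ?thesis using N0 by (intro mult_right_mono) (auto simp: abs_mult intro!: mult_right_mono)
      qed
    qed
  qed
  then show ?thesis using C(1) that by blast
qed

text \<open>Dominated convergence. As \<open>g\<^sub>u (snd p) (u p)\<close> itself may be
  unbounded, the majorant contains its absolute value times \<open>\<phi>\<^sup>2\<close>,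
  integrable by stability; the difference terms are bounded by the Lipschitz constants of g and
  u.\<close>

lemma PI_tendsto:
  assumes cp: "compatible \<phi> \<Phi> \<psi> \<Psi> r x1"
  shows "(\<lambda>k. \<integral>p. PI \<phi> \<psi> \<tau> (hk k) p \<partial>M) \<longlonglongrightarrow> (\<integral>p. g\<^sub>u (snd p) (u p) * (\<phi> p)\<^sup>2 * (2 * \<tau> * N p * \<psi> p + \<tau>\<^sup>2 * (\<psi> p)\<^sup>2) \<partial>M)"
proof -
  have c: "cut \<phi> \<Phi> r" and t\<psi>: "test \<psi> \<Psi> r" using cp unfolding compatible_def by blast+
  obtain Bu where Bu: "0 < Bu" "\<And>p. p \<in> upper_half \<Longrightarrow> \<bar>u p\<bar> \<le> Bu" using u_bound by blast
  obtain C where C: "0 < C" "\<And>x s t. 0 < x \<Longrightarrow> x < r \<Longrightarrow> \<bar>s\<bar> \<le> Bu \<Longrightarrow> \<bar>t\<bar> \<le> Bu \<Longrightarrow> \<bar>g x s - g x t\<bar> \<le> C * \<bar>s - t\<bar>"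
  proof (rule g_lipschitz[of r Bu])
    fix C assume 1: "0 < C" and 2: "\<And>x s t. 0 < x \<Longrightarrow> x < r \<Longrightarrow> \<bar>s\<bar> \<le> Bu \<Longrightarrow> \<bar>t\<bar> \<le> Bu \<Longrightarrow> \<bar>g x s - g x t\<bar> \<le> C * \<bar>s - t\<bar>"
    show ?thesis by (rule that[OF 1 2])
  qed
  obtain Bv where Bv: "0 < Bv" "\<And>h b p. 0 < h \<Longrightarrow> h \<le> 1 \<Longrightarrow> b \<in> Basis \<Longrightarrow> p \<in> upper_half \<Longrightarrow> norm p < r \<Longrightarrow> \<bar>v h b p\<bar> \<le> Bv"
    using v_uniform_bound[of r] by blast
  obtain B\<psi> where B\<psi>: "\<And>p. p \<in> upper_half \<Longrightarrow> \<bar>\<psi> p\<bar> \<le> B\<psi>"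
  proof -
    have "bounded (\<psi> ` upper_half)" using t\<psi> by (simp add: test_def)
    then obtain B where "\<forall>z\<in>\<psi> ` upper_half. norm z \<le> B" unfolding bounded_iff ..
    then show ?thesis by (intro that[of B]) auto
  qed
  define d where "d = real DIM(real ^ 'n)"
  define W where "W = sqrt (d * Bv\<^sup>2 + 1)"
  have W: "0 \<le> w h p" "w h p \<le> W" if h: "0 < h" "h \<le> 1" and p: "p \<in> upper_half" "norm p < r" for h p
  proof -
    have "(v h b p)\<^sup>2 \<le> Bv\<^sup>2" if "b \<in> Basis" for b
      using power_mono[OF Bv(2)[OF h that p], of 2] by simp
    then have "(\<Sum>b\<in>(Basis :: (real ^ 'n) set). (v h b p)\<^sup>2) \<le> of_nat (card (Basis :: (real ^ 'n) set)) * Bv\<^sup>2"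
      by (rule sum_bounded_above)
    moreover have "h\<^sup>2 \<le> 1" using h by (simp add: power_le_one)
    ultimately show "w h p \<le> W" unfolding w_def W_def d_def by (intro real_sqrt_le_mono) simp
    show "0 \<le> w h p" using w_pos[OF h(1), of p] by simp
  qed
  define K where "K = (W + \<bar>\<tau>\<bar> * B\<psi>)\<^sup>2"
  define dom where "dom p = K * \<bar>g\<^sub>u (snd p) (u p) * (\<phi> p)\<^sup>2\<bar> + d * (C * Bv\<^sup>2) * indicat_real (ball 0 r) p" for p
  have ball_int: "integrable M (indicat_real (ball 0 r))"
  proof -
    have "integrable lebesgue (indicat_real (ball (0 :: (real ^ 'n) \<times> real) r))"
      using lmeasurable_ball[of "0 :: (real ^ 'n) \<times> real" r] unfolding fmeasurable_def by (intro integrable_real_indicator) blast+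
    from integrable_mult_indicator[OF upper_half_lebesgue this] show ?thesis by (simp add: integrable_restrict_space)
  qed
  show ?thesis
  proof (rule integral_dominated_convergence[where w=dom])
    show "(\<lambda>p. g\<^sub>u (snd p) (u p) * (\<phi> p)\<^sup>2 * (2 * \<tau> * N p * \<psi> p + \<tau>\<^sup>2 * (\<psi> p)\<^sup>2)) \<in> borel_measurable M"
    proof -
      have [measurable]: "(\<lambda>p. g\<^sub>u (snd p) (u p) * (\<phi> p)\<^sup>2) \<in> borel_measurable M" using gu_cut_measurable[OF c] by simp
      have [measurable]: "N \<in> borel_measurable M"
        unfolding N_def[abs_def] by (intro continuous_on_upper_half_measurable continuous_on_norm continuous_on_fst cont_D1)
      have [measurable]: "\<psi> \<in> borel_measurable M"
      proof (intro continuous_on_upper_half_measurable continuous_at_imp_continuous_on ballI)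
        fix p :: "(real ^ 'n) \<times> real" assume p: "p \<in> upper_half"
        obtain e L where e: "0 < e" "L-lipschitz_on (cball p e \<inter> upper_half) \<psi>"
          using t\<psi> p unfolding test_def locally_lipschitz_on_def by blast
        then have "continuous_on (cball p e \<inter> upper_half) \<psi>" using lipschitz_on_continuous_on by blast
        moreover have "p \<in> interior (cball p e \<inter> upper_half)"
          using e(1) p by (simp add: interior_Int interior_open open_upper_half)
        ultimately show "isCont \<psi> p" by (rule continuous_on_interior)
      qed
      show ?thesis by measurable
    qed
    show "PI \<phi> \<psi> \<tau> (hk k) \<in> borel_measurable M" for k
      using stability_difference_quotients(1)[OF cp hk(1)] by (rule borel_measurable_integrable)
    show "integrable M dom"
      unfolding dom_def using gu_cut_measurable[OF c] ball_int
      by (intro Bochner_Integration.integrable_add integrable_mult_right integrable_abs)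
    show "AE p in M. (\<lambda>k. PI \<phi> \<psi> \<tau> (hk k) p) \<longlonglongrightarrow> g\<^sub>u (snd p) (u p) * (\<phi> p)\<^sup>2 * (2 * \<tau> * N p * \<psi> p + \<tau>\<^sup>2 * (\<psi> p)\<^sup>2)"
    proof -
      have "AE p in M. \<forall>b\<in>Basis. (\<lambda>k. g\<^sub>u (snd p) (u p) * (\<phi> p)\<^sup>2 * (v (hk k) b p)\<^sup>2 - dG (hk k) b p * (v (hk k) b p * (\<phi> p)\<^sup>2)) \<longlonglongrightarrow> 0"
        by (intro AE_finite_allI AE_interior_chain[OF c]) auto
      then show ?thesis using AE_space
      proof eventually_elim
        case (elim p)
        have p: "p \<in> upper_half" using elim(2) by simp
        \<comment> \<open>Splits off the combinations that tend to 0. Of the rest only the terms in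
          \<open>\<tau>\<close> survive.\<close>
        have eq: "PI \<phi> \<psi> \<tau> h p = (\<Sum>b\<in>Basis. g\<^sub>u (snd p) (u p) * (\<phi> p)\<^sup>2 * (v h b p)\<^sup>2 - dG h b p * (v h b p * (\<phi> p)\<^sup>2))
            + g\<^sub>u (snd p) (u p) * (\<phi> p)\<^sup>2 * (h\<^sup>2 + 2 * \<tau> * w h p * \<psi> p + \<tau>\<^sup>2 * (\<psi> p)\<^sup>2)" for h
        proof -
          have "(w h p + \<tau> * \<psi> p)\<^sup>2 = (\<Sum>b\<in>Basis. (v h b p)\<^sup>2) + (h\<^sup>2 + 2 * \<tau> * w h p * \<psi> p + \<tau>\<^sup>2 * (\<psi> p)\<^sup>2)"
            by (simp add: power2_sum w_power2 power_mult_distrib)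
          then show ?thesis
            unfolding PI_def sum_subtractf sum_distrib_left[symmetric] by (simp add: distrib_left)
        qed
        have "(\<lambda>k. (\<Sum>b\<in>Basis. g\<^sub>u (snd p) (u p) * (\<phi> p)\<^sup>2 * (v (hk k) b p)\<^sup>2 - dG (hk k) b p * (v (hk k) b p * (\<phi> p)\<^sup>2))
            + g\<^sub>u (snd p) (u p) * (\<phi> p)\<^sup>2 * ((hk k)\<^sup>2 + 2 * \<tau> * w (hk k) p * \<psi> p + \<tau>\<^sup>2 * (\<psi> p)\<^sup>2))
            \<longlonglongrightarrow> (\<Sum>b\<in>(Basis :: (real ^ 'n) set). 0) + g\<^sub>u (snd p) (u p) * (\<phi> p)\<^sup>2 * (0\<^sup>2 + 2 * \<tau> * N p * \<psi> p + \<tau>\<^sup>2 * (\<psi> p)\<^sup>2)"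
          using elim(1) by (intro tendsto_add tendsto_sum tendsto_mult tendsto_power tendsto_const hk w_tendsto p) auto
        then show ?case unfolding eq by simp
      qed
    qed
    show "AE p in M. norm (PI \<phi> \<psi> \<tau> (hk k) p) \<le> dom p" for k
    proof (rule AE_I2)
      fix p assume "p \<in> space M"
      then have p: "p \<in> upper_half" by simp
      show "norm (PI \<phi> \<psi> \<tau> (hk k) p) \<le> dom p"
      proof (cases "norm p < r")
        case False
        then show ?thesis using cutD(4)[OF c, of p] by (simp add: PI_def dom_def)
      next
        case True
        note h = hk(1,2)[of k]
        note w = W[OF h p True]
        have "\<bar>w (hk k) p + \<tau> * \<psi> p\<bar> \<le> W + \<bar>\<tau>\<bar> * B\<psi>"
          using w mult_left_mono[OF B\<psi>[OF p], of "\<bar>\<tau>\<bar>"] abs_triangle_ineq[of "w (hk k) p" "\<tau> * \<psi> p"] by (simp add: abs_mult)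
        then have "(w (hk k) p + \<tau> * \<psi> p)\<^sup>2 \<le> K" unfolding K_def by (rule power_mono[of "\<bar>w (hk k) p + \<tau> * \<psi> p\<bar>" _ 2, simplified])
        then have 1: "\<bar>g\<^sub>u (snd p) (u p) * (\<phi> p)\<^sup>2 * (w (hk k) p + \<tau> * \<psi> p)\<^sup>2\<bar> \<le> K * \<bar>g\<^sub>u (snd p) (u p) * (\<phi> p)\<^sup>2\<bar>"
          using mult_left_mono[of "(w (hk k) p + \<tau> * \<psi> p)\<^sup>2" K "\<bar>g\<^sub>u (snd p) (u p) * (\<phi> p)\<^sup>2\<bar>"] by (simp add: abs_mult mult.commute)
        have "\<bar>dG (hk k) b p * (v (hk k) b p * (\<phi> p)\<^sup>2)\<bar> \<le> C * Bv\<^sup>2" if b: "b \<in> Basis" for b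
        proof -
          have xr: "0 < snd p" "snd p < r" using p True norm_snd_le[of "snd p" "fst p"] by (auto simp: upper_half_def)
          have "\<bar>g (snd p) (u (p + (hk k *\<^sub>R b, 0))) - g (snd p) (u p)\<bar> \<le> C * \<bar>u (p + (hk k *\<^sub>R b, 0)) - u p\<bar>"
            using xr p by (intro C(2) Bu(2)) auto
          then have "\<bar>dG (hk k) b p\<bar> \<le> C * \<bar>v (hk k) b p\<bar>"
            using h(1) by (simp add: dG_def v_def abs_divide divide_right_mono)
          also have "\<dots> \<le> C * Bv" using Bv(2)[OF h b p True] C(1) by simp
          finally have 1: "\<bar>dG (hk k) b p\<bar> \<le> C * Bv" .
          have "(\<phi> p)\<^sup>2 \<le> 1" using cutD(6,7)[OF c, of p] by (simp add: power_le_one)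
          then have "\<bar>v (hk k) b p\<bar> * (\<phi> p)\<^sup>2 \<le> Bv * 1" using Bv(2)[OF h b p True] Bv(1) by (intro mult_mono) auto
          then have "\<bar>dG (hk k) b p\<bar> * (\<bar>v (hk k) b p\<bar> * (\<phi> p)\<^sup>2) \<le> (C * Bv) * Bv"
            using 1 Bv(1) C(1) by (intro mult_mono) auto
          then show ?thesis by (simp add: abs_mult power2_eq_square mult.assoc)
        qed
        then have "(\<Sum>b\<in>(Basis :: (real ^ 'n) set). \<bar>dG (hk k) b p * (v (hk k) b p * (\<phi> p)\<^sup>2)\<bar>) \<le> of_nat (card (Basis :: (real ^ 'n) set)) * (C * Bv\<^sup>2)"
          by (rule sum_bounded_above)
        then have 2: "\<bar>\<Sum>b\<in>Basis. dG (hk k) b p * (v (hk k) b p * (\<phi> p)\<^sup>2)\<bar> \<le> d * (C * Bv\<^sup>2)"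
          by (intro order_trans[OF sum_abs]) (simp add: d_def)
        have ind: "indicat_real (ball 0 r) p = 1" using True by simp
        show ?thesis
          unfolding PI_def dom_def real_norm_def ind mult_1_right
          by (rule order_trans[OF abs_triangle_ineq4 add_mono[OF 1 2]])
      qed
    qed
  qed
qed

text \<open>What is left on the boundary is the chain rule defect along the trace and a term of
  order h^2. The perturbation \<open>\<psi>\<close> does not reach the boundary, so no term in
  \<open>\<tau>\<close> remains.\<close>

lemma PB_tendsto:
  assumes c: "cut \<phi> \<Phi> r"
    and int: "\<And>k. integrable lebesgue (PB \<phi> (hk k))"
  shows "(\<lambda>k. \<integral>y. PB \<phi> (hk k) y \<partial>lebesgue) \<longlonglongrightarrow> 0"
proof -
  obtain Bu where Bu: "0 < Bu" "\<And>p. p \<in> upper_half \<Longrightarrow> \<bar>u p\<bar> \<le> Bu" using u_bound by blast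
  have ab: "\<bar>a y\<bar> \<le> Bu" for y by (rule trace_bound[OF Bu(2)])
  have fl: "locally_lipschitz_on UNIV f" using structural by (simp add: structural_def)
  obtain L where L: "L-lipschitz_on (cball 0 Bu) f" using locally_lipschitz_imp_lipschitz_on_cball[OF fl] by blast
  obtain Ba where Ba: "0 \<le> Ba" "\<And>h b y. 0 < h \<Longrightarrow> h \<le> 1 \<Longrightarrow> b \<in> Basis \<Longrightarrow> norm y < r \<Longrightarrow> \<bar>da h b y\<bar> \<le> Ba"
    using da_uniform_bound[of r] by blast
  have L0: "0 \<le> L" by (rule lipschitz_on_nonneg[OF L])
  define d where "d = real DIM(real ^ 'n)"
  have i0: "integrable lebesgue (\<lambda>y. f' (a y) * (\<phi> (y, 0))\<^sup>2)"
    using test_stable(2)[OF test_cut[OF c]] unfolding bdry_v_cut(2)[OF c] .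
  have ball_int: "integrable lebesgue (indicat_real (ball (0 :: real ^ 'n) r))"
    using lmeasurable_ball[of "0 :: real ^ 'n" r] unfolding fmeasurable_def by (intro integrable_real_indicator) blast+
  define dom where "dom y = (d * Ba\<^sup>2 + 1) * \<bar>f' (a y) * (\<phi> (y, 0))\<^sup>2\<bar> + d * (L * Ba\<^sup>2) * indicat_real (ball 0 r) y" for y
  have out: "\<phi> (y, 0) = 0" if "\<not> norm y < r" for y
    using cutD(4)[OF c, of "(y, 0)"] that by (simp add: norm_Pair)
  have "(\<lambda>k. \<integral>y. PB \<phi> (hk k) y \<partial>lebesgue) \<longlonglongrightarrow> (\<integral>y. 0 \<partial>(lebesgue :: (real ^ 'n) measure))"
  proof (rule integral_dominated_convergence[where w=dom])
    show "PB \<phi> (hk k) \<in> borel_measurable lebesgue" for k using int by (rule borel_measurable_integrable)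
    show "integrable lebesgue dom"
      unfolding dom_def using i0 ball_int
      by (intro Bochner_Integration.integrable_add integrable_mult_right integrable_abs)
    have "AE y in lebesgue. \<forall>b\<in>(Basis :: (real ^ 'n) set). (\<lambda>k. f' (a y) * ((a (y + hk k *\<^sub>R b) - a y) / hk k)\<^sup>2
      - ((f (a (y + hk k *\<^sub>R b)) - f (a y)) / hk k) * ((a (y + hk k *\<^sub>R b) - a y) / hk k)) \<longlonglongrightarrow> 0"
      by (intro AE_finite_allI AE_chain_rule_difference_quotient trace_locally_lipschitz
          locally_lipschitz_imp_lipschitz_on_cball[OF fl] deriv_f hk) auto
    then show "AE y in lebesgue. (\<lambda>k. PB \<phi> (hk k) y) \<longlonglongrightarrow> 0"
    proof eventually_elim
      case (elim y)
      have eq: "PB \<phi> h y = (\<Sum>b\<in>Basis. (\<phi> (y, 0))\<^sup>2 * (f' (a y) * (da h b y)\<^sup>2 - dF h b y * da h b y)) + f' (a y) * (\<phi> (y, 0))\<^sup>2 * h\<^sup>2" for h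
      proof -
        have "(\<Sum>b\<in>Basis. (\<phi> (y, 0))\<^sup>2 * (f' (a y) * (da h b y)\<^sup>2 - dF h b y * da h b y))
          = f' (a y) * (\<phi> (y, 0))\<^sup>2 * (\<Sum>b\<in>Basis. (da h b y)\<^sup>2) - (\<Sum>b\<in>Basis. dF h b y * (da h b y * (\<phi> (y, 0))\<^sup>2))"
          unfolding sum_distrib_left sum_subtractf[symmetric] by (intro sum.cong refl) (simp add: right_diff_distrib mult_ac)
        then show ?thesis unfolding PB_def by (simp add: distrib_left)
      qed
      have "(\<lambda>k. (\<Sum>b\<in>Basis. (\<phi> (y, 0))\<^sup>2 * (f' (a y) * (da (hk k) b y)\<^sup>2 - dF (hk k) b y * da (hk k) b y)) + f' (a y) * (\<phi> (y, 0))\<^sup>2 * (hk k)\<^sup>2)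
        \<longlonglongrightarrow> (\<Sum>b\<in>(Basis :: (real ^ 'n) set). (\<phi> (y, 0))\<^sup>2 * 0) + f' (a y) * (\<phi> (y, 0))\<^sup>2 * 0\<^sup>2"
        using elim unfolding da_def dF_def
        by (intro tendsto_add tendsto_sum tendsto_mult[OF tendsto_const] tendsto_power hk) auto
      then show ?case unfolding eq by simp
    qed
    show "AE y in lebesgue. norm (PB \<phi> (hk k) y) \<le> dom y" for k
    proof (rule AE_I2)
      fix y :: "real ^ 'n"
      show "norm (PB \<phi> (hk k) y) \<le> dom y"
      proof (cases "norm y < r")
        case False
        then show ?thesis using out[of y] by (simp add: PB_def dom_def)
      next
        case True
        note h = hk(1,2)[of k]
        have "(da (hk k) b y)\<^sup>2 \<le> Ba\<^sup>2" if "b \<in> Basis" for b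
          using power_mono[OF Ba(2)[OF h that True], of 2] by simp
        then have "(\<Sum>b\<in>(Basis :: (real ^ 'n) set). (da (hk k) b y)\<^sup>2) \<le> of_nat (card (Basis :: (real ^ 'n) set)) * Ba\<^sup>2"
          by (rule sum_bounded_above)
        moreover have "(hk k)\<^sup>2 \<le> 1" using h by (simp add: power_le_one)
        ultimately have "(\<Sum>b\<in>Basis. (da (hk k) b y)\<^sup>2) + (hk k)\<^sup>2 \<le> d * Ba\<^sup>2 + 1" by (simp add: d_def)
        moreover have "0 \<le> (\<Sum>b\<in>Basis. (da (hk k) b y)\<^sup>2) + (hk k)\<^sup>2" by (intro add_nonneg_nonneg sum_nonneg) auto
        ultimately have 1: "\<bar>f' (a y) * (\<phi> (y, 0))\<^sup>2 * ((\<Sum>b\<in>Basis. (da (hk k) b y)\<^sup>2) + (hk k)\<^sup>2)\<bar> \<le> (d * Ba\<^sup>2 + 1) * \<bar>f' (a y) * (\<phi> (y, 0))\<^sup>2\<bar>"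
          using mult_left_mono[of "(\<Sum>b\<in>Basis. (da (hk k) b y)\<^sup>2) + (hk k)\<^sup>2" "d * Ba\<^sup>2 + 1" "\<bar>f' (a y) * (\<phi> (y, 0))\<^sup>2\<bar>"]
          unfolding abs_mult[of _ "(\<Sum>b\<in>Basis. (da (hk k) b y)\<^sup>2) + (hk k)\<^sup>2"] by (simp add: mult.commute)
        have "\<bar>dF (hk k) b y * (da (hk k) b y * (\<phi> (y, 0))\<^sup>2)\<bar> \<le> L * Ba\<^sup>2" if b: "b \<in> Basis" for b
        proof -
          have "dist (f (a (y + hk k *\<^sub>R b))) (f (a y)) \<le> L * dist (a (y + hk k *\<^sub>R b)) (a y)"
            using ab by (intro lipschitz_onD[OF L]) auto
          then have "\<bar>dF (hk k) b y\<bar> \<le> L * \<bar>da (hk k) b y\<bar>"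
            using h(1) by (simp add: dF_def da_def abs_divide divide_right_mono dist_real_def)
          also have "\<dots> \<le> L * Ba" using Ba(2)[OF h b True] L0 by (intro mult_left_mono)
          finally have 1: "\<bar>dF (hk k) b y\<bar> \<le> L * Ba" .
          have "(\<phi> (y, 0))\<^sup>2 \<le> 1" using cutD(6,7)[OF c, of "(y, 0)"] by (simp add: power_le_one)
          then have "\<bar>da (hk k) b y\<bar> * (\<phi> (y, 0))\<^sup>2 \<le> Ba * 1" using Ba(2)[OF h b True] Ba(1) by (intro mult_mono) auto
          then have "\<bar>dF (hk k) b y\<bar> * (\<bar>da (hk k) b y\<bar> * (\<phi> (y, 0))\<^sup>2) \<le> (L * Ba) * Ba"
            using 1 Ba(1) L0 by (intro mult_mono) auto
          then show ?thesis by (simp add: abs_mult power2_eq_square mult.assoc)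
        qed
        then have "(\<Sum>b\<in>(Basis :: (real ^ 'n) set). \<bar>dF (hk k) b y * (da (hk k) b y * (\<phi> (y, 0))\<^sup>2)\<bar>) \<le> of_nat (card (Basis :: (real ^ 'n) set)) * (L * Ba\<^sup>2)"
          by (rule sum_bounded_above)
        then have 2: "\<bar>\<Sum>b\<in>Basis. dF (hk k) b y * (da (hk k) b y * (\<phi> (y, 0))\<^sup>2)\<bar> \<le> d * (L * Ba\<^sup>2)"
          by (intro order_trans[OF sum_abs]) (simp add: d_def)
        have ind: "indicat_real (ball 0 r) y = 1" using True by simp
        show ?thesis
          unfolding PB_def dom_def real_norm_def ind mult_1_right
          by (rule order_trans[OF abs_triangle_ineq4 add_mono[OF 1 2]])
      qed
    qed
  qed simp
  then show ?thesis by simp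
qed

end

section \<open>The limit inequality and the rank-one structure\<close>

context stable_solution_setting
begin

lemma cont_N: "continuous_on upper_half N"
  unfolding N_def[abs_def] by (intro continuous_on_norm continuous_on_fst cont_D1)

lemma N_nonneg: "0 \<le> N p" by (simp add: N_def)

lemma w_uniform_bound:
  obtains W where "0 \<le> W" "\<And>h p. 0 < h \<Longrightarrow> h \<le> 1 \<Longrightarrow> p \<in> upper_half \<Longrightarrow> norm p < r \<Longrightarrow> \<bar>w h p\<bar> \<le> W"
proof -
  obtain Bv where Bv: "0 < Bv" "\<And>h b p. 0 < h \<Longrightarrow> h \<le> 1 \<Longrightarrow> b \<in> Basis \<Longrightarrow> p \<in> upper_half \<Longrightarrow> norm p < r \<Longrightarrow> \<bar>v h b p\<bar> \<le> Bv"
    using v_uniform_bound[of r] by blast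
  have "\<bar>w h p\<bar> \<le> sqrt (real DIM(real ^ 'n) * Bv\<^sup>2 + 1)" if h: "0 < h" "h \<le> 1" and p: "p \<in> upper_half" "norm p < r" for h p
  proof -
    have "(v h b p)\<^sup>2 \<le> Bv\<^sup>2" if "b \<in> Basis" for b
      using power_mono[OF Bv(2)[OF h that p], of 2] by simp
    then have "(\<Sum>b\<in>(Basis :: (real ^ 'n) set). (v h b p)\<^sup>2) \<le> of_nat (card (Basis :: (real ^ 'n) set)) * Bv\<^sup>2"
      by (rule sum_bounded_above)
    moreover have "h\<^sup>2 \<le> 1" using h by (simp add: power_le_one)
    ultimately have "w h p \<le> sqrt (real DIM(real ^ 'n) * Bv\<^sup>2 + 1)" unfolding w_def by (intro real_sqrt_le_mono) simp
    then show ?thesis using w_pos[OF h(1), of p] by simp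
  qed
  then show ?thesis using that[of "sqrt (real DIM(real ^ 'n) * Bv\<^sup>2 + 1)"] by simp
qed

lemma weighted_energy_tendsto:
  assumes cp: "compatible \<phi> \<Phi> \<psi> \<Psi> r x1"
  shows "(\<lambda>k. \<integral>p. \<mu> (snd p) * (w (hk k) p)\<^sup>2 * (norm (\<Phi> p))\<^sup>2 \<partial>M) \<longlonglongrightarrow> (\<integral>p. \<mu> (snd p) * (N p)\<^sup>2 * (norm (\<Phi> p))\<^sup>2 \<partial>M)"
    and "integrable M (\<lambda>p. \<mu> (snd p) * (N p)\<^sup>2 * (norm (\<Phi> p))\<^sup>2)"
proof -
  have c: "cut \<phi> \<Phi> r" using cp unfolding compatible_def by blast
  obtain B where B: "0 \<le> B" "\<And>p. norm (\<Phi> p) \<le> B" using cut_grad_bound[OF c] by blast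
  obtain W where W: "0 \<le> W" "\<And>h p. 0 < h \<Longrightarrow> h \<le> 1 \<Longrightarrow> p \<in> upper_half \<Longrightarrow> norm p < r \<Longrightarrow> \<bar>w h p\<bar> \<le> W"
    using w_uniform_bound[of r] by blast
  have [measurable]: "\<Phi> \<in> borel_measurable M" "N \<in> borel_measurable M" "(\<lambda>p. \<mu> (snd p)) \<in> borel_measurable M"
    by (intro continuous_on_upper_half_measurable cutD(3)[OF c] cont_N mu_measurable)+
  have m1: "(\<lambda>p. \<mu> (snd p) * (N p)\<^sup>2 * (norm (\<Phi> p))\<^sup>2) \<in> borel_measurable M" by measurable
  have m2: "(\<lambda>p. \<mu> (snd p) * (w (hk k) p)\<^sup>2 * (norm (\<Phi> p))\<^sup>2) \<in> borel_measurable M" for k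
    using stability_difference_quotients(3)[OF cp hk(1)] by (rule borel_measurable_integrable)
  have dom: "integrable M (\<lambda>p. (W\<^sup>2 * B\<^sup>2) * (\<mu> (snd p) * indicat_real (ball 0 r) p))"
    by (intro integrable_mult_right mu_ball_integrable)
  have lim: "AE p in M. (\<lambda>k. \<mu> (snd p) * (w (hk k) p)\<^sup>2 * (norm (\<Phi> p))\<^sup>2) \<longlonglongrightarrow> \<mu> (snd p) * (N p)\<^sup>2 * (norm (\<Phi> p))\<^sup>2"
    by (rule AE_I2) (auto intro!: tendsto_mult tendsto_power tendsto_const w_tendsto)
  have bound: "AE p in M. norm (\<mu> (snd p) * (w (hk k) p)\<^sup>2 * (norm (\<Phi> p))\<^sup>2) \<le> (W\<^sup>2 * B\<^sup>2) * (\<mu> (snd p) * indicat_real (ball 0 r) p)" for k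
  proof (rule AE_I2)
    fix p assume "p \<in> space M"
    then have p: "p \<in> upper_half" by simp
    then have m: "0 < \<mu> (snd p)" using mu_pos by (simp add: upper_half_def)
    show "norm (\<mu> (snd p) * (w (hk k) p)\<^sup>2 * (norm (\<Phi> p))\<^sup>2) \<le> (W\<^sup>2 * B\<^sup>2) * (\<mu> (snd p) * indicat_real (ball 0 r) p)"
    proof (cases "norm p < r")
      case True
      have "(w (hk k) p)\<^sup>2 \<le> W\<^sup>2" using power_mono[OF W(2)[OF hk(1)[of k] hk(2)[of k] p True], of 2] by simp
      then have "(w (hk k) p)\<^sup>2 * (norm (\<Phi> p))\<^sup>2 \<le> W\<^sup>2 * B\<^sup>2"
        using power_mono[OF B(2)[of p] norm_ge_zero, of 2] by (intro mult_mono) auto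
      then have "\<mu> (snd p) * ((w (hk k) p)\<^sup>2 * (norm (\<Phi> p))\<^sup>2) \<le> \<mu> (snd p) * (W\<^sup>2 * B\<^sup>2)"
        using m by (intro mult_left_mono) auto
      then show ?thesis using True m by (simp add: mult_ac)
    next
      case False then show ?thesis using cutD(5)[OF c, of p] by simp
    qed
  qed
  show "(\<lambda>k. \<integral>p. \<mu> (snd p) * (w (hk k) p)\<^sup>2 * (norm (\<Phi> p))\<^sup>2 \<partial>M) \<longlonglongrightarrow> (\<integral>p. \<mu> (snd p) * (N p)\<^sup>2 * (norm (\<Phi> p))\<^sup>2 \<partial>M)"
    by (rule integral_dominated_convergence[OF m1 m2 dom lim bound])
  show "integrable M (\<lambda>p. \<mu> (snd p) * (N p)\<^sup>2 * (norm (\<Phi> p))\<^sup>2)"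
    by (rule integrable_dominated_convergence[OF m1 m2 dom lim bound])
qed

text \<open>Fatou's lemma on the left and convergence on the right. The limit
  \<open>\<Lambda>\<close> of the pairing with \<open>\<Psi>\<close> is kept as a parameter, since
  writing it as an integral against the gradient of |F| would require that gradient; it is computed
  later by moving the derivatives onto the test function.\<close>

lemma limit_inequality:
  fixes \<tau> \<Lambda> :: real
  assumes cp: "compatible \<phi> \<Phi> \<psi> \<Psi> r x1"
    and \<Lambda>: "(\<lambda>k. \<integral>p. \<mu> (snd p) * (dw (hk k) p \<bullet> \<Psi> p) \<partial>M) \<longlonglongrightarrow> \<Lambda>"
  defines "I \<equiv> (\<integral>p. \<mu> (snd p) * (N p)\<^sup>2 * (norm (\<Phi> p))\<^sup>2 \<partial>M) + 2 * \<tau> * \<Lambda> + \<tau>\<^sup>2 * (\<integral>p. \<mu> (snd p) * (norm (\<Psi> p))\<^sup>2 \<partial>M)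
      + (\<integral>p. g\<^sub>u (snd p) (u p) * (\<phi> p)\<^sup>2 * (2 * \<tau> * N p * \<psi> p + \<tau>\<^sup>2 * (\<psi> p)\<^sup>2) \<partial>M)"
  shows "0 \<le> I"
    and "(\<integral>\<^sup>+p. ennreal (\<mu> (snd p) * (\<phi> p)\<^sup>2 * Q0 p) * indicator {p. F p \<noteq> 0} p \<partial>M) \<le> ennreal I"
proof -
  have c: "cut \<phi> \<Phi> r" using cp unfolding compatible_def by blast
  note st = stability_difference_quotients[OF cp hk(1)]
  define R where "R k = (\<integral>p. \<mu> (snd p) * (w (hk k) p)\<^sup>2 * (norm (\<Phi> p))\<^sup>2 \<partial>M)
      + 2 * \<tau> * (\<integral>p. \<mu> (snd p) * (dw (hk k) p \<bullet> \<Psi> p) \<partial>M) + \<tau>\<^sup>2 * (\<integral>p. \<mu> (snd p) * (norm (\<Psi> p))\<^sup>2 \<partial>M)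
      + (\<integral>p. PI \<phi> \<psi> \<tau> (hk k) p \<partial>M) - (\<integral>y. PB \<phi> (hk k) y \<partial>lebesgue)" for k
  have "R \<longlonglongrightarrow> (\<integral>p. \<mu> (snd p) * (N p)\<^sup>2 * (norm (\<Phi> p))\<^sup>2 \<partial>M) + 2 * \<tau> * \<Lambda> + \<tau>\<^sup>2 * (\<integral>p. \<mu> (snd p) * (norm (\<Psi> p))\<^sup>2 \<partial>M)
      + (\<integral>p. g\<^sub>u (snd p) (u p) * (\<phi> p)\<^sup>2 * (2 * \<tau> * N p * \<psi> p + \<tau>\<^sup>2 * (\<psi> p)\<^sup>2) \<partial>M) - 0"
    unfolding R_def[abs_def]
    by (intro tendsto_diff tendsto_add tendsto_mult tendsto_const \<Lambda> weighted_energy_tendsto(1)[OF cp] PI_tendsto[OF cp]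
        PB_tendsto[OF c st(2)])
  then have R: "R \<longlonglongrightarrow> I" by (simp add: I_def)
  have pos: "0 \<le> \<mu> (snd p) * (\<phi> p)\<^sup>2 * Q (hk k) p" if "p \<in> space M" for p k
    using that mu_pos[of "snd p"] Q_nonneg[OF hk(1)] by (simp add: upper_half_def)
  have L: "(\<integral>p. \<mu> (snd p) * (\<phi> p)\<^sup>2 * Q (hk k) p \<partial>M) \<le> R k" for k
    using st(6)[of k \<tau>] unfolding R_def .
  have "0 \<le> (\<integral>p. \<mu> (snd p) * (\<phi> p)\<^sup>2 * Q (hk k) p \<partial>M)" for k
    by (rule integral_nonneg_AE) (use pos in \<open>auto intro!: AE_I2\<close>)
  then have "0 \<le> R k" for k using L order_trans by blast
  then show "0 \<le> I" using R by (intro LIMSEQ_le_const[OF R]) auto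
  \<comment> \<open>At zeros of F the integrand on the left is 0, so convergence of Q is used only
    where F \<noteq> 0.\<close>
  have "(\<integral>\<^sup>+p. ennreal (\<mu> (snd p) * (\<phi> p)\<^sup>2 * Q0 p) * indicator {p. F p \<noteq> 0} p \<partial>M)
      \<le> (\<integral>\<^sup>+p. liminf (\<lambda>k. ennreal (\<mu> (snd p) * (\<phi> p)\<^sup>2 * Q (hk k) p)) \<partial>M)"
  proof (rule nn_integral_mono)
    fix p assume "p \<in> space M"
    then have p: "p \<in> upper_half" by simp
    show "ennreal (\<mu> (snd p) * (\<phi> p)\<^sup>2 * Q0 p) * indicator {p. F p \<noteq> 0} p \<le> liminf (\<lambda>k. ennreal (\<mu> (snd p) * (\<phi> p)\<^sup>2 * Q (hk k) p))"
    proof (cases "F p = 0")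
      case False
      have "(\<lambda>k. ennreal (\<mu> (snd p) * (\<phi> p)\<^sup>2 * Q (hk k) p)) \<longlonglongrightarrow> ennreal (\<mu> (snd p) * (\<phi> p)\<^sup>2 * Q0 p)"
        by (intro tendsto_ennrealI tendsto_mult tendsto_const Q_tendsto p False)
      then have "liminf (\<lambda>k. ennreal (\<mu> (snd p) * (\<phi> p)\<^sup>2 * Q (hk k) p)) = ennreal (\<mu> (snd p) * (\<phi> p)\<^sup>2 * Q0 p)"
        by (intro lim_imp_Liminf) auto
      then show ?thesis using False by simp
    qed simp
  qed
  also have "\<dots> \<le> liminf (\<lambda>k. \<integral>\<^sup>+p. ennreal (\<mu> (snd p) * (\<phi> p)\<^sup>2 * Q (hk k) p) \<partial>M)"
    by (rule nn_integral_liminf) (use st(5) in auto)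
  also have "\<dots> \<le> liminf (\<lambda>k. ennreal (R k))"
  proof (rule Liminf_mono, rule always_eventually, rule allI)
    fix k
    have "(\<integral>\<^sup>+p. ennreal (\<mu> (snd p) * (\<phi> p)\<^sup>2 * Q (hk k) p) \<partial>M) = ennreal (\<integral>p. \<mu> (snd p) * (\<phi> p)\<^sup>2 * Q (hk k) p \<partial>M)"
      by (rule nn_integral_eq_integral[OF st(5)]) (use pos in \<open>auto intro!: AE_I2\<close>)
    also have "\<dots> \<le> ennreal (R k)" by (rule ennreal_leI[OF L])
    finally show "(\<integral>\<^sup>+p. ennreal (\<mu> (snd p) * (\<phi> p)\<^sup>2 * Q (hk k) p) \<partial>M) \<le> ennreal (R k)" .
  qed
  also have "\<dots> = ennreal I" by (intro lim_imp_Liminf tendsto_ennrealI R) auto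
  finally show "(\<integral>\<^sup>+p. ennreal (\<mu> (snd p) * (\<phi> p)\<^sup>2 * Q0 p) * indicator {p. F p \<noteq> 0} p \<partial>M) \<le> ennreal I" .
qed

lemma cut_cutoff: "0 < n \<Longrightarrow> cut (cutoff n) (cutoff_grad n) (2 ^ (2 * n))"
  unfolding cut_def
  using GDERIV_cutoff continuous_on_cutoff_grad cutoff_large cutoff_nonneg cutoff_le_1 by (auto simp del: split_paired_All)

text \<open>On the ball of radius 2^(k+1) the energy is at most 4 \<open>C\<^sub>o\<close> 4^k,
  which the factor 128 / 4^k turns into 512 \<open>C\<^sub>o\<close>. There are n such terms,
  divided by n^2.\<close>

lemma cutoff_energy:
  assumes n: "0 < n" and Cn: "C\<^sub>o \<le> 2 ^ n"
  shows "(\<integral>p. \<mu> (snd p) * (N p)\<^sup>2 * (norm (cutoff_grad n p))\<^sup>2 \<partial>M) \<le> 512 * C\<^sub>o / real n"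
proof -
  define e where "e k = (\<lambda>p. \<mu> (snd p) * (norm (D1 p))\<^sup>2 * indicat_real (ball 0 (2 ^ Suc k)) p)" for k
  have ei: "integrable M (e k)" for k unfolding e_def by (rule energy_integrable)
  have "(\<integral>p. \<mu> (snd p) * (N p)\<^sup>2 * (norm (cutoff_grad n p))\<^sup>2 \<partial>M)
      \<le> (\<integral>p. (\<Sum>k\<in>{n..<2 * n}. 128 / 4 ^ k * e k p) / (real n)\<^sup>2 \<partial>M)"
  proof (rule integral_mono_AE')
    show "integrable M (\<lambda>p. (\<Sum>k\<in>{n..<2 * n}. 128 / 4 ^ k * e k p) / (real n)\<^sup>2)"
      by (intro Bochner_Integration.integrable_divide Bochner_Integration.integrable_sum integrable_mult_right ei)
    have m: "0 < \<mu> (snd p)" if "p \<in> space M" for p using that mu_pos by (simp add: upper_half_def)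
    show "AE p in M. \<mu> (snd p) * (N p)\<^sup>2 * (norm (cutoff_grad n p))\<^sup>2 \<le> (\<Sum>k\<in>{n..<2 * n}. 128 / 4 ^ k * e k p) / (real n)\<^sup>2"
    proof (rule AE_I2)
      fix p assume p: "p \<in> space M"
      have "N p \<le> norm (D1 p)" using norm_fst_le[of "fst (D1 p)" "snd (D1 p)"] by (simp add: N_def)
      then have "(N p)\<^sup>2 \<le> (norm (D1 p))\<^sup>2" by (intro power_mono N_nonneg)
      then have "\<mu> (snd p) * (N p)\<^sup>2 * (norm (cutoff_grad n p))\<^sup>2
        \<le> \<mu> (snd p) * (norm (D1 p))\<^sup>2 * ((\<Sum>k\<in>{n..<2 * n}. 128 / 4 ^ k * indicator (ball 0 (2 ^ (Suc k))) p) / (real n)\<^sup>2)"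
        using m[OF p] by (intro mult_mono norm_cutoff_grad) auto
      also have "\<dots> = (\<Sum>k\<in>{n..<2 * n}. 128 / 4 ^ k * e k p) / (real n)\<^sup>2"
        by (simp add: e_def sum_distrib_left sum_divide_distrib mult_ac)
      finally show "\<mu> (snd p) * (N p)\<^sup>2 * (norm (cutoff_grad n p))\<^sup>2 \<le> (\<Sum>k\<in>{n..<2 * n}. 128 / 4 ^ k * e k p) / (real n)\<^sup>2" .
    qed
    show "AE p in M. 0 \<le> (\<Sum>k\<in>{n..<2 * n}. 128 / 4 ^ k * e k p) / (real n)\<^sup>2"
      by (rule AE_I2) (use m in \<open>auto intro!: divide_nonneg_nonneg sum_nonneg simp: e_def less_imp_le\<close>)
  qed
  also have "\<dots> = (\<Sum>k\<in>{n..<2 * n}. 128 / 4 ^ k * (\<integral>p. e k p \<partial>M)) / (real n)\<^sup>2"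
    using ei by (simp add: Bochner_Integration.integral_sum)
  also have "\<dots> \<le> (\<Sum>k\<in>{n..<2 * n}. 512 * C\<^sub>o) / (real n)\<^sup>2"
  proof (intro divide_right_mono sum_mono)
    fix k assume k: "k \<in> {n..<2 * n}"
    have "C\<^sub>o \<le> 2 ^ Suc k" using k power_increasing[of n "Suc k" "2::real"] by (intro order_trans[OF Cn]) auto
    from energy_le[OF this] have "(\<integral>p. e k p \<partial>M) \<le> C\<^sub>o * (2 ^ Suc k)\<^sup>2" by (simp add: e_def)
    then have "128 / 4 ^ k * (\<integral>p. e k p \<partial>M) \<le> 128 / 4 ^ k * (C\<^sub>o * (2 ^ Suc k)\<^sup>2)" by (intro mult_left_mono) auto
    also have "((2::real) ^ Suc k)\<^sup>2 = 4 * 4 ^ k" by (simp add: power2_eq_square power_mult_distrib[symmetric])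
    finally show "128 / 4 ^ k * (\<integral>p. e k p \<partial>M) \<le> 512 * C\<^sub>o" by simp
  qed simp
  also have "\<dots> = 512 * C\<^sub>o / real n" using n by (simp add: power2_eq_square)
  finally show ?thesis .
qed

lemma compatible_zero: "cut \<phi> \<Phi> r \<Longrightarrow> compatible \<phi> \<Phi> (\<lambda>_. 0) (\<lambda>_. 0) r 1"
proof -
  assume c: "cut \<phi> \<Phi> r"
  have "test (\<lambda>_. 0) (\<lambda>_. 0) r"
    by (rule testI[of 1 r _ _ 0 0]) (use cutD(1)[OF c] in \<open>auto simp: GDERIV_const\<close>)
  then show ?thesis using c by (simp add: compatible_def)
qed

lemma cont_D2b: "continuous_on upper_half (D2b b)"
  unfolding D2b_def[abs_def] by (intro bounded_bilinear.continuous_on[OF bounded_bilinear_blinfun_apply] cont_D2 continuous_on_const)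

text \<open>The equality case of Cauchy-Schwarz made explicit. By symmetry \<open>D2b b p\<close> is
  the gradient of the component F_b, and G is the gradient of log |F|, the vector for which the
  multiples F_b G approximate these gradients best in the least squares sense. \<open>Q0\<close> is
  the remaining squared error.\<close>

lemma Q0_eq:
  assumes F: "F p \<noteq> 0"
  defines "G \<equiv> (1 / (N p)\<^sup>2) *\<^sub>R (\<Sum>b\<in>Basis. (F p \<bullet> b) *\<^sub>R D2b b p)"
  shows "Q0 p = (\<Sum>b\<in>Basis. (norm (D2b b p - (F p \<bullet> b) *\<^sub>R G))\<^sup>2)"
proof -
  have N: "0 < N p" using F by (simp add: N_def)
  define S where "S = (\<Sum>b\<in>Basis. (F p \<bullet> b) *\<^sub>R D2b b p)"
  have S: "S = (N p)\<^sup>2 *\<^sub>R G" using N by (simp add: G_def S_def)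
  have NN: "(N p)\<^sup>2 = (\<Sum>b\<in>Basis. (F p \<bullet> b)\<^sup>2)" by (simp add: N_def sum_inner_Basis_power2)
  have "(\<Sum>b\<in>Basis. (norm (D2b b p - (F p \<bullet> b) *\<^sub>R G))\<^sup>2)
      = (\<Sum>b\<in>Basis. (norm (D2b b p))\<^sup>2 - 2 * (((F p \<bullet> b) *\<^sub>R D2b b p) \<bullet> G) + (F p \<bullet> b)\<^sup>2 * (norm G)\<^sup>2)"
    unfolding power2_norm_eq_inner
    by (intro sum.cong refl) (simp add: inner_diff_left inner_diff_right inner_commute power2_eq_square algebra_simps)
  also have "\<dots> = (\<Sum>b\<in>Basis. (norm (D2b b p))\<^sup>2) - 2 * (S \<bullet> G) + (N p)\<^sup>2 * (norm G)\<^sup>2"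
    unfolding S_def NN inner_sum_left by (simp only: sum.distrib sum_subtractf sum_distrib_left sum_distrib_right)
  also have "\<dots> = (\<Sum>b\<in>Basis. (norm (D2b b p))\<^sup>2) - (norm ((1 / N p) *\<^sub>R S))\<^sup>2"
    using N by (simp add: S power2_norm_eq_inner[symmetric] power_mult_distrib power_divide) (simp add: power2_eq_square power4_eq_xxxx mult_ac)
  finally show ?thesis by (simp add: Q0_def S_def)
qed

text \<open>With \<open>\<psi> = 0\<close> and cutoffs that are 1 on ever larger balls, the weighted
  integral of \<open>Q0\<close> over a fixed ball is at most 512 \<open>C\<^sub>o\<close> / k for
  all large k, hence 0. Continuity of \<open>Q0\<close> where F \<noteq> 0 then excludes a point of
  positivity.\<close>

lemma Q0_zero:
  assumes p0: "p0 \<in> upper_half" and F0: "F p0 \<noteq> 0"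
  shows "Q0 p0 = 0"
proof (rule ccontr)
  assume nz: "Q0 p0 \<noteq> 0"
  have Q0_nonneg: "0 \<le> Q0 p" if "F p \<noteq> 0" for p unfolding Q0_eq[OF that] by (intro sum_nonneg) auto
  define U where "U = {p \<in> upper_half. F p \<noteq> 0}"
  have contF: "continuous_on upper_half F" by (intro continuous_on_fst cont_D1)
  have U: "open U"
  proof -
    have "U = {p \<in> upper_half. F p \<in> - {0}}" by (auto simp: U_def)
    then show ?thesis using continuous_open_preimage[OF contF open_upper_half open_Compl[OF closed_singleton], of 0] by (simp add: vimage_def Int_def)
  qed
  have contQ: "continuous_on U Q0"
    unfolding Q0_def[abs_def]
    by (intro continuous_on_diff continuous_on_sum continuous_on_power continuous_on_norm continuous_on_scaleR continuous_on_divide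
        continuous_on_const continuous_on_inner continuous_on_subset[OF cont_D2b] continuous_on_subset[OF contF] continuous_on_subset[OF cont_N])
      (auto simp: U_def N_def)
  define V where "V = {p \<in> U. 0 < Q0 p}"
  have "open V"
    using continuous_open_preimage[OF contQ U open_greaterThan, of 0] by (simp add: V_def vimage_def Int_def)
  moreover have "p0 \<in> V" using nz Q0_nonneg[OF F0] p0 F0 by (simp add: V_def U_def)
  ultimately have Vn: "\<not> negligible V" using open_not_negligible by blast
  obtain n0 where n0: "norm p0 + C\<^sub>o < 2 ^ n0" using real_arch_pow[of 2 "norm p0 + C\<^sub>o"] by auto
  have "AE p in M. \<not> (p \<in> V \<and> norm p < 2 ^ n)" if n: "0 < n" for n :: nat
  proof -
    define f where "f p = ennreal (\<mu> (snd p) * Q0 p) * indicator {p. p \<in> U \<and> norm p < 2 ^ n} p" for p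
    have le: "(\<integral>\<^sup>+p. f p \<partial>M) \<le> ennreal (512 * C\<^sub>o / real k)" if k: "n \<le> k" "n0 \<le> k" "0 < k" for k
    proof -
      note cp = compatible_zero[OF cut_cutoff[OF k(3)]]
      have "(\<integral>\<^sup>+p. f p \<partial>M) \<le> (\<integral>\<^sup>+p. ennreal (\<mu> (snd p) * (cutoff k p)\<^sup>2 * Q0 p) * indicator {p. F p \<noteq> 0} p \<partial>M)"
      proof (rule nn_integral_mono)
        fix p assume "p \<in> space M"
        show "f p \<le> ennreal (\<mu> (snd p) * (cutoff k p)\<^sup>2 * Q0 p) * indicator {p. F p \<noteq> 0} p"
        proof (cases "p \<in> U \<and> norm p < 2 ^ n")
          case True
          then have "norm p \<le> 2 ^ k" using order_trans[OF less_imp_le power_increasing[OF k(1), of "2::real"]] by simp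
          then have "cutoff k p = 1" using k by (intro cutoff_eq_1)
          then show ?thesis using True by (simp add: f_def U_def)
        qed (simp add: f_def)
      qed
      also have "\<dots> \<le> ennreal (\<integral>p. \<mu> (snd p) * (N p)\<^sup>2 * (norm (cutoff_grad k p))\<^sup>2 \<partial>M)"
        using limit_inequality(2)[OF cp, of 0 0] by simp
      also have "\<dots> \<le> ennreal (512 * C\<^sub>o / real k)"
      proof (intro ennreal_leI cutoff_energy k(3))
        have "C\<^sub>o \<le> 2 ^ n0" using n0 norm_ge_zero[of p0] by linarith
        also have "\<dots> \<le> 2 ^ k" using k by (intro power_increasing) auto
        finally show "C\<^sub>o \<le> 2 ^ k" .
      qed
      finally show ?thesis .
    qed
    have "(\<lambda>k. ennreal (512 * C\<^sub>o / real k)) \<longlonglongrightarrow> ennreal 0"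
      by (intro tendsto_ennrealI real_tendsto_divide_at_top[OF tendsto_const] filterlim_real_sequentially)
    then have "(\<integral>\<^sup>+p. f p \<partial>M) \<le> ennreal 0"
    proof (rule tendsto_lowerbound)
      show "\<forall>\<^sub>F k in sequentially. (\<integral>\<^sup>+p. f p \<partial>M) \<le> ennreal (512 * C\<^sub>o / real k)"
        unfolding eventually_sequentially by (intro exI[of _ "max (max n n0) 1"]) (auto intro!: le)
    qed simp
    then have z: "(\<integral>\<^sup>+p. f p \<partial>M) = 0" by simp
    have fm: "f \<in> borel_measurable M"
    proof -
      have A: "{p. p \<in> U \<and> norm p < 2 ^ n} = U \<inter> ball 0 (2 ^ n)" by auto
      have "continuous_on (U \<inter> ball 0 (2 ^ n)) Q0" by (rule continuous_on_subset[OF contQ]) auto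
      then have "(\<lambda>p. indicator (U \<inter> ball 0 (2 ^ n)) p *\<^sub>R Q0 p) \<in> borel_measurable borel"
        by (rule borel_measurable_continuous_on_indicator[rotated]) (use U in auto)
      then have "(\<lambda>p. indicator (U \<inter> ball 0 (2 ^ n)) p *\<^sub>R Q0 p) \<in> borel_measurable M"
        by (intro measurable_restrict_space1 measurable_completion) simp
      then have "(\<lambda>p. ennreal (\<mu> (snd p) * (indicator (U \<inter> ball 0 (2 ^ n)) p *\<^sub>R Q0 p))) \<in> borel_measurable M"
        using mu_measurable by measurable
      moreover have "f = (\<lambda>p. ennreal (\<mu> (snd p) * (indicator (U \<inter> ball 0 (2 ^ n)) p *\<^sub>R Q0 p)))"
        unfolding f_def A by (auto simp: indicator_def)
      ultimately show ?thesis by simp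
    qed
    have "AE p in M. f p = 0" using z fm by (simp add: nn_integral_0_iff_AE)
    then show ?thesis
    proof (rule AE_mp[OF _ AE_I2], intro impI notI)
      fix p assume pM: "p \<in> space M" and f0: "f p = 0" and pV: "p \<in> V \<and> norm p < 2 ^ n"
      then have "0 < \<mu> (snd p) * Q0 p" using mu_pos by (auto simp: V_def upper_half_def)
      then show False using f0 pV by (simp add: f_def V_def ennreal_eq_0_iff)
    qed
  qed
  note * = this
  have "AE p in M. \<not> (p \<in> V \<and> norm p < 2 ^ Suc n)" for n by (rule *) simp
  then have "AE p in M. \<forall>n. \<not> (p \<in> V \<and> norm p < 2 ^ Suc n)" by (simp only: AE_all_countable) blast
  then have "AE p in M. p \<notin> V"
  proof eventually_elim
    case (elim p)
    obtain m where "norm p < 2 ^ m" using real_arch_pow[of 2 "norm p"] by auto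
    also have "(2::real) ^ m \<le> 2 ^ Suc m" by simp
    finally show ?case using elim by blast
  qed
  then have "negligible {p. \<not> (p \<in> upper_half \<longrightarrow> p \<notin> V)}" by (simp only: AE_upper_half_iff AE_lebesgue_iff_negligible)
  moreover have "{p. \<not> (p \<in> upper_half \<longrightarrow> p \<notin> V)} = V" by (auto simp: V_def U_def)
  ultimately show False using Vn by simp
qed

text \<open>Vanishing of \<open>Q0\<close> makes the gradient of each component F_b equal to F_b G.
  Symmetry of the second derivative converts derivatives in the directions (b, 0) into components of
  derivatives in arbitrary directions.\<close>

lemma rank_one_D2:
  assumes p: "p \<in> upper_half" and F: "F p \<noteq> 0"
  shows "\<exists>G. \<forall>v. fst (blinfun_apply (D2 p) v) = (G \<bullet> v) *\<^sub>R F p"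
proof -
  define G where "G = (1 / (N p)\<^sup>2) *\<^sub>R (\<Sum>b\<in>Basis. (F p \<bullet> b) *\<^sub>R D2b b p)"
  have "(\<Sum>b\<in>Basis. (norm (D2b b p - (F p \<bullet> b) *\<^sub>R G))\<^sup>2) = 0"
    using Q0_eq[OF F] Q0_zero[OF p F] by (simp add: G_def)
  then have "\<forall>b\<in>Basis. (norm (D2b b p - (F p \<bullet> b) *\<^sub>R G))\<^sup>2 = 0"
    by (subst (asm) sum_nonneg_eq_0_iff) auto
  then have D: "D2b b p = (F p \<bullet> b) *\<^sub>R G" if "b \<in> Basis" for b using that by auto
  have "fst (blinfun_apply (D2 p) v) = (G \<bullet> v) *\<^sub>R F p" for v
  proof (rule euclidean_eqI)
    fix b :: "real ^ 'n" assume b: "b \<in> Basis"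
    have "fst (blinfun_apply (D2 p) v) \<bullet> b = blinfun_apply (D2 p) v \<bullet> (b, 0)" by (simp add: inner_prod_def)
    also have "\<dots> = blinfun_apply (D2 p) (b, 0) \<bullet> v"
      by (rule gradient_derivative_symmetric[OF open_upper_half p grad_u deriv_D1[OF p]])
    also have "\<dots> = (F p \<bullet> b) * (G \<bullet> v)" using D[OF b] by (simp add: D2b_def)
    finally show "fst (blinfun_apply (D2 p) v) \<bullet> b = ((G \<bullet> v) *\<^sub>R F p) \<bullet> b" by simp
  qed
  then show ?thesis by blast
qed

end

section \<open>A maximum principle on slices\<close>

text \<open>The gauge integral is chosen for its rule of differentiation under the integral sign on
  boxes; the integrands to which it is applied have compact support in y.\<close>

definition slice_integral :: "((real ^ 'n) \<times> real \<Rightarrow> real) \<Rightarrow> real \<Rightarrow> real" where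
  "slice_integral c x = integral UNIV (\<lambda>y. c (y, x))"

lemma integral_UNIV_eq_cbox:
  fixes f :: "'a::euclidean_space \<Rightarrow> real"
  assumes box: "ball 0 r \<subseteq> cbox a b" and zero: "\<And>y. r \<le> norm y \<Longrightarrow> f y = 0"
  shows "integral UNIV f = integral (cbox a b) f"
proof (rule integral_spike_set[symmetric])
  have "f y = 0" if "y \<notin> cbox a b" for y
    using that box by (intro zero) (auto simp: subset_iff not_less[symmetric])
  then have "{x \<in> UNIV - cbox a b. f x \<noteq> 0} = {}" "{x \<in> cbox a b - UNIV. f x \<noteq> 0} = {}" by auto
  then show "negligible {x \<in> UNIV - cbox a b. f x \<noteq> 0}" "negligible {x \<in> cbox a b - UNIV. f x \<noteq> 0}"
    by (simp_all only: negligible_empty)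
qed

lemma ball_subset_cbox:
  obtains a b :: "'a::euclidean_space" where "ball 0 r \<subseteq> cbox a b"
proof -
  obtain a where "ball (0::'a) r \<subseteq> cbox (- a) a" using bounded_subset_cbox_symmetric[OF bounded_ball] .
  then show thesis by (rule that)
qed

lemma integrable_on_UNIV_compact_support:
  fixes f :: "'a::euclidean_space \<Rightarrow> real"
  assumes f: "continuous_on UNIV f" and zero: "\<And>y. r \<le> norm y \<Longrightarrow> f y = 0"
  shows "f integrable_on UNIV"
proof -
  obtain a b :: 'a where box: "ball 0 r \<subseteq> cbox a b" by (rule ball_subset_cbox)
  show ?thesis
  proof (rule integrable_on_superset)
    show "f integrable_on cbox a b" by (intro integrable_continuous continuous_on_subset[OF f]) simp
    show "f y = 0" if "y \<notin> cbox a b" for y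
      using that box by (intro zero) (auto simp: subset_iff not_less[symmetric])
  qed simp
qed

lemma GDERIV_imp_partial:
  fixes f :: "(real ^ 'n) \<times> real \<Rightarrow> real"
  assumes "GDERIV f (y, x) :> G"
  shows "((\<lambda>x. f (y, x)) has_real_derivative snd G) (at x)"
    and "((\<lambda>s. f (y + s *\<^sub>R b, x)) has_real_derivative fst G \<bullet> b) (at 0)"
proof -
  have f: "(f has_derivative (\<lambda>h. h \<bullet> G)) (at (y, x))" using assms by (simp add: gderiv_def)
  have "((\<lambda>x. (y, x)) has_derivative (\<lambda>h. (0, h))) (at x)" by (auto intro!: derivative_eq_intros)
  from has_derivative_compose[OF this f] show "((\<lambda>x. f (y, x)) has_real_derivative snd G) (at x)"
    by (rule has_derivative_imp_has_field_derivative) (simp add: inner_prod_def mult.commute)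
  have l: "((\<lambda>s. (y + s *\<^sub>R b, x)) has_derivative (\<lambda>h. (h *\<^sub>R b, 0))) (at 0)" by (auto intro!: derivative_eq_intros)
  have "(f has_derivative (\<lambda>h. h \<bullet> G)) (at (y + 0 *\<^sub>R b, x))" using f by simp
  from has_derivative_compose[OF l this] show "((\<lambda>s. f (y + s *\<^sub>R b, x)) has_real_derivative fst G \<bullet> b) (at 0)"
    by (rule has_derivative_imp_has_field_derivative) (simp add: inner_prod_def inner_commute mult.commute)
qed

lemma continuous_on_swap_upper_half:
  assumes "continuous_on upper_half (c :: (real ^ 'n) \<times> real \<Rightarrow> real)"
  shows "continuous_on ({0<..} \<times> S) (\<lambda>(x, y). c (y, x))"
proof -
  have "continuous_on ({0<..} \<times> S) (\<lambda>q. c (snd q, fst q))"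
    by (rule continuous_on_compose2[OF assms]) (auto intro!: continuous_intros simp: upper_half_def)
  then show ?thesis by (simp add: case_prod_unfold)
qed

lemma continuous_on_slice:
  assumes "continuous_on upper_half (c :: (real ^ 'n) \<times> real \<Rightarrow> real)" "0 < x"
  shows "continuous_on S (\<lambda>y. c (y, x))"
  by (rule continuous_on_compose2[OF assms(1)]) (use assms(2) in \<open>auto intro!: continuous_intros simp: upper_half_def\<close>)

lemma continuous_on_slice_integral:
  fixes c :: "(real ^ 'n) \<times> real \<Rightarrow> real"
  assumes c: "continuous_on upper_half c" and zero: "\<And>y x. r \<le> norm y \<Longrightarrow> c (y, x) = 0"
  shows "continuous_on {0<..} (slice_integral c)"
proof -
  obtain a b :: "real ^ 'n" where box: "ball 0 r \<subseteq> cbox a b" by (rule ball_subset_cbox)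
  have "slice_integral c = (\<lambda>x. integral (cbox a b) (\<lambda>y. c (y, x)))"
    unfolding slice_integral_def[abs_def] by (rule ext, rule integral_UNIV_eq_cbox[OF box zero])
  then show ?thesis
    using integral_continuous_on_param[OF continuous_on_swap_upper_half[OF c, of "cbox a b"]] by simp
qed

lemma DERIV_slice_integral:
  fixes c c' :: "(real ^ 'n) \<times> real \<Rightarrow> real"
  assumes c: "continuous_on upper_half c" and zero: "\<And>y x. r \<le> norm y \<Longrightarrow> c (y, x) = 0"
    and c': "continuous_on upper_half c'" and zero': "\<And>y x. r \<le> norm y \<Longrightarrow> c' (y, x) = 0"
    and d: "\<And>y x. 0 < x \<Longrightarrow> ((\<lambda>x. c (y, x)) has_real_derivative c' (y, x)) (at x)"
    and x: "0 < x"
  shows "(slice_integral c has_real_derivative slice_integral c' x) (at x)"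
proof -
  obtain a b :: "real ^ 'n" where box: "ball 0 r \<subseteq> cbox a b" by (rule ball_subset_cbox)
  have eq: "slice_integral c = (\<lambda>x. integral (cbox a b) (\<lambda>y. c (y, x)))"
      "slice_integral c' = (\<lambda>x. integral (cbox a b) (\<lambda>y. c' (y, x)))"
    unfolding slice_integral_def[abs_def]
    by (rule ext, rule integral_UNIV_eq_cbox[OF box zero], assumption)
      (rule ext, rule integral_UNIV_eq_cbox[OF box zero'])
  have "((\<lambda>x. integral (cbox a b) (\<lambda>y. c (y, x))) has_real_derivative integral (cbox a b) (\<lambda>y. c' (y, x))) (at x within {0<..})"
  proof (rule leibniz_rule_field_derivative[where f = "\<lambda>x y. c (y, x)" and fx = "\<lambda>x y. c' (y, x)" and U = "{0<..}"])
    show "((\<lambda>x. c (y, x)) has_real_derivative c' (y, x)) (at x within {0<..})" if "x \<in> {0<..}" for x y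
      by (rule has_field_derivative_at_within, rule d) (use that in simp)
    show "(\<lambda>y. c (y, x)) integrable_on cbox a b" if "x \<in> {0<..}" for x
      using that by (intro integrable_continuous continuous_on_slice[OF c]) auto
    show "continuous_on ({0<..} \<times> cbox a b) (\<lambda>(x, y). c' (y, x))" by (rule continuous_on_swap_upper_half[OF c'])
  qed (use x in auto)
  then show ?thesis unfolding eq using x by (simp add: at_within_open[OF _ open_greaterThan])
qed

text \<open>Translation invariance in place of the divergence theorem: the integral of k(y + s b)
  over y does not depend on s, and its derivative at s = 0 is the integral of kb.\<close>

lemma integral_directional_derivative_zero:
  fixes k kb :: "'a::euclidean_space \<Rightarrow> real"
  assumes k: "continuous_on UNIV k" and zero: "\<And>y. r \<le> norm y \<Longrightarrow> k y = 0"
    and kb: "continuous_on UNIV kb" and zero': "\<And>y. r \<le> norm y \<Longrightarrow> kb y = 0"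
    and b: "norm b \<le> 1"
    and d: "\<And>y. ((\<lambda>s. k (y + s *\<^sub>R b)) has_real_derivative kb y) (at 0)"
  shows "integral UNIV kb = 0"
proof -
  \<comment> \<open>The margin 1 makes the box contain the supports of all shifts with |s| < 1, as
    |b| \<le> 1.\<close>
  obtain l m :: 'a where box: "ball 0 (r + 1) \<subseteq> cbox l m" by (rule ball_subset_cbox)
  let ?U = "{-1<..<1::real}"
  have d': "((\<lambda>s. k (y + s *\<^sub>R b)) has_real_derivative kb (y + s *\<^sub>R b)) (at s)" for y s
    using DERIV_shift[of "\<lambda>s. k (y + s *\<^sub>R b)" _ 0 s] d[of "y + s *\<^sub>R b"] by (simp add: scaleR_left.add add_ac)
  have kc: "continuous_on S (\<lambda>p. k (g p))" "continuous_on S (\<lambda>p. kb (g p))" if "continuous_on S g" for S :: "'b::topological_space set" and g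
    using that by (auto intro: continuous_on_compose2[OF k] continuous_on_compose2[OF kb])
  have "((\<lambda>s. integral (cbox l m) (\<lambda>y. k (y + s *\<^sub>R b))) has_real_derivative integral (cbox l m) (\<lambda>y. kb (y + 0 *\<^sub>R b))) (at 0 within ?U)"
  proof (rule leibniz_rule_field_derivative[where f = "\<lambda>s y. k (y + s *\<^sub>R b)" and fx = "\<lambda>s y. kb (y + s *\<^sub>R b)" and U = ?U])
    show "((\<lambda>s. k (y + s *\<^sub>R b)) has_real_derivative kb (y + s *\<^sub>R b)) (at s within ?U)" for s y
      using d' by (rule has_field_derivative_at_within)
    show "(\<lambda>y. k (y + s *\<^sub>R b)) integrable_on cbox l m" for s
      by (intro integrable_continuous kc continuous_intros)
    show "continuous_on (?U \<times> cbox l m) (\<lambda>(s, y). kb (y + s *\<^sub>R b))"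
      unfolding case_prod_unfold by (intro kc continuous_intros)
  qed auto
  then have 1: "((\<lambda>s. integral (cbox l m) (\<lambda>y. k (y + s *\<^sub>R b))) has_real_derivative integral (cbox l m) kb) (at 0)"
    by (simp add: at_within_open[OF _ open_greaterThanLessThan])
  have const: "integral (cbox l m) (\<lambda>y. k (y + s *\<^sub>R b)) = integral UNIV k" if "s \<in> ?U" for s
  proof -
    have "k (y + s *\<^sub>R b) = 0" if y: "r + 1 \<le> norm y" for y
    proof (rule zero)
      have "norm (s *\<^sub>R b) \<le> 1 * 1" unfolding norm_scaleR by (intro mult_mono) (use \<open>s \<in> ?U\<close> b in auto)
      moreover have "norm y \<le> norm (y + s *\<^sub>R b) + norm (s *\<^sub>R b)" using norm_triangle_ineq4[of "y + s *\<^sub>R b" "s *\<^sub>R b"] by simp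
      ultimately show "r \<le> norm (y + s *\<^sub>R b)" using y by linarith
    qed
    then have "integral (cbox l m) (\<lambda>y. k (y + s *\<^sub>R b)) = integral UNIV (\<lambda>y. k (y + s *\<^sub>R b))"
      using integral_UNIV_eq_cbox[OF box] by metis
    also have "\<dots> = integral UNIV k"
    proof -
      have 0: "k y = 0" if "y \<notin> cbox l m" for y
        using that box by (intro zero) (auto simp: subset_iff not_less[symmetric])
      have "k (y + s *\<^sub>R b) = 0" if "y \<notin> cbox (l - s *\<^sub>R b) (m - s *\<^sub>R b)" for y
        using that by (intro 0) (auto simp: mem_box inner_diff_left inner_add_left algebra_simps)
      then have "integral UNIV (\<lambda>y. k (y + s *\<^sub>R b)) = integral (cbox (l - s *\<^sub>R b) (m - s *\<^sub>R b)) (\<lambda>y. k (y + s *\<^sub>R b))"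
        by (intro integral_spike_set) (auto intro: negligible_subset[OF negligible_empty])
      also have "\<dots> = integral (cbox l m) k" by (rule integral_shift_cbox)
      also have "\<dots> = integral UNIV k"
        using 0 by (intro integral_spike_set) (auto intro: negligible_subset[OF negligible_empty])
      finally show ?thesis .
    qed
    finally show ?thesis .
  qed
  have "((\<lambda>s. integral UNIV k) has_real_derivative 0) (at 0)" by (rule DERIV_const)
  then have "((\<lambda>s. integral (cbox l m) (\<lambda>y. k (y + s *\<^sub>R b))) has_real_derivative 0) (at 0)"
    by (rule has_field_derivative_transform_within_open[of _ _ _ ?U]) (use const in auto)
  from DERIV_unique[OF 1 this] have "integral (cbox l m) kb = 0" .
  moreover have "integral UNIV kb = integral (cbox l m) kb"
    by (rule integral_UNIV_eq_cbox[OF box]) (use zero' in auto)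
  ultimately show ?thesis by simp
qed

text \<open>m is only Lebesgue measurable, and c is continuous for x > 0 only. A bounded Borel
  representative of m supported in [lo, hi], and the restriction of c to a compact subset of the
  half-space, give a Borel integrand to which Fubini applies.\<close>

lemma upper_half_fubini:
  fixes c :: "(real ^ 'n) \<times> real \<Rightarrow> real" and m :: "real \<Rightarrow> real"
  assumes c: "continuous_on upper_half c" and zero: "\<And>y x. r \<le> norm y \<Longrightarrow> c (y, x) = 0"
    and m: "m \<in> borel_measurable lebesgue" and mK: "\<And>x. \<bar>m x\<bar> \<le> K"
    and m0: "\<And>x. x \<notin> {lo..hi} \<Longrightarrow> m x = 0" and lo: "0 < lo"
  shows "integrable lebesgue_upper_half (\<lambda>p. m (snd p) * c p)"
    and "(\<integral>p. m (snd p) * c p \<partial>lebesgue_upper_half) = (\<integral>x. m x * slice_integral c x \<partial>lebesgue)"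
proof -
  define S where "S = cball (0 :: real ^ 'n) r \<times> {lo..hi}"
  define cc where "cc p = indicat_real S p * c p" for p
  have S: "compact S" "S \<subseteq> upper_half" unfolding S_def using lo by (auto intro!: compact_Times simp: upper_half_def)
  have cS: "continuous_on S c" by (rule continuous_on_subset[OF c S(2)])
  have "bounded (c ` S)" by (intro compact_imp_bounded compact_continuous_image cS S)
  then obtain B where B: "0 < B" "\<forall>q\<in>c ` S. norm q \<le> B" unfolding bounded_pos by auto
  have ccB: "\<bar>cc p\<bar> \<le> B" for p using B by (cases "p \<in> S") (auto simp: cc_def)
  have ccm [measurable]: "cc \<in> borel_measurable borel"
    using borel_measurable_continuous_on_indicator[OF _ cS] compact_imp_closed[OF S(1)] by (simp add: cc_def[abs_def])
  obtain m' where m': "m' \<in> borel_measurable lborel" "AE x in lborel. m x = m' x"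
    using completion_ex_borel_measurable_real[OF m] by blast
  \<comment> \<open>Truncation at K restores, for every x, the bound that the Borel representative
    satisfies only almost everywhere.\<close>
  define mm where "mm x = indicat_real {lo..hi} x * max (- K) (min K (m' x))" for x
  have mm [measurable]: "mm \<in> borel_measurable borel" using m'(1) unfolding mm_def[abs_def] by measurable
  have K: "0 \<le> K" using mK[of 0] by linarith
  have mmK: "\<bar>mm x\<bar> \<le> K * indicat_real {lo..hi} x" for x using K by (auto simp: mm_def indicator_def)
  have ae0: "AE x in lborel. m x = mm x"
    using m'(2)
  proof eventually_elim
    case (elim x)
    show ?case using mK[of x] m0[of x] elim by (cases "x \<in> {lo..hi}") (auto simp: mm_def)
  qed
  then have ae: "AE x in lebesgue. m x = mm x" by (rule AE_completion)
  have int: "integrable (lborel \<Otimes>\<^sub>M lborel) (\<lambda>(y, x). mm x * cc (y, x))"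
  proof (rule Bochner_Integration.integrable_bound)
    have "integrable lborel (indicator S :: (real ^ 'n) \<times> real \<Rightarrow> real)"
      using emeasure_bounded_finite[OF compact_imp_bounded[OF S(1)]] compact_imp_closed[OF S(1)]
      by (simp add: integrable_indicator_iff)
    then show "integrable (lborel \<Otimes>\<^sub>M lborel) (\<lambda>p. (K * B) * indicat_real S p)" by (simp add: lborel_prod)
    show "AE p in lborel \<Otimes>\<^sub>M lborel. norm (case p of (y, x) \<Rightarrow> mm x * cc (y, x)) \<le> norm ((K * B) * indicat_real S p)"
    proof (rule AE_I2)
      fix p :: "(real ^ 'n) \<times> real"
      obtain y x where p: "p = (y, x)" by (cases p)
      have "\<bar>mm x * cc (y, x)\<bar> \<le> K * B * indicat_real S (y, x)"
      proof (cases "(y, x) \<in> S")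
        case True
        have "\<bar>mm x\<bar> \<le> K" using mmK[of x] K by (cases "x \<in> {lo..hi}") auto
        then have "\<bar>mm x\<bar> * \<bar>cc (y, x)\<bar> \<le> K * B" using ccB[of "(y, x)"] K by (intro mult_mono) auto
        then show ?thesis using True by (simp add: abs_mult)
      qed (simp add: cc_def)
      then show "norm (case p of (y, x) \<Rightarrow> mm x * cc (y, x)) \<le> norm ((K * B) * indicat_real S p)"
        using K B(1) by (simp add: p abs_mult)
    qed
    have "(\<lambda>p :: (real ^ 'n) \<times> real. mm (snd p)) \<in> borel_measurable borel"
      by (rule measurable_compose[OF borel_measurable_continuous_onI mm]) (intro continuous_intros)
    from borel_measurable_times[OF this ccm] have "(\<lambda>p. mm (snd p) * cc p) \<in> borel_measurable borel" .
    then show "(\<lambda>(y, x). mm x * cc (y, x)) \<in> borel_measurable (lborel \<Otimes>\<^sub>M lborel)"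
      by (simp add: lborel_prod case_prod_unfold)
  qed
  have slice: "mm x * (\<integral>y. cc (y, x) \<partial>lborel) = mm x * slice_integral c x" for x
  proof (cases "x \<in> {lo..hi}")
    case True
    then have x: "0 < x" using lo by simp
    have cy: "cc (y, x) = indicat_real (cball 0 r) y * c (y, x)" for y using True by (simp add: cc_def S_def indicator_def)
    have "continuous_on (cball 0 r) (\<lambda>y. c (y, x))" by (rule continuous_on_slice[OF c x])
    then have "integrable lborel (\<lambda>y. indicat_real (cball 0 r) y *\<^sub>R c (y, x))"
      by (intro borel_integrable_compact) auto
    then have i: "integrable lborel (\<lambda>y. cc (y, x))" by (simp add: cy)
    have "(\<integral>y. cc (y, x) \<partial>lborel) = integral UNIV (\<lambda>y. cc (y, x))" using integral_lborel[OF i] by simp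
    moreover have "(\<lambda>y. cc (y, x)) = (\<lambda>y. c (y, x))"
    proof
      fix y show "cc (y, x) = c (y, x)" using zero[of y x] by (cases "norm y \<le> r") (simp_all add: cy)
    qed
    ultimately show ?thesis by (simp add: slice_integral_def)
  qed (simp add: mm_def)
  have pair: "indicat_real upper_half p *\<^sub>R (mm (snd p) * c p) = mm (snd p) * cc p" for p
  proof (cases "p \<in> S")
    case True then show ?thesis using S(2) by (auto simp: cc_def)
  next
    case False
    obtain y x where p: "p = (y, x)" by (cases p)
    show ?thesis using False zero[of y x] by (cases "x \<in> {lo..hi}") (auto simp: p S_def mm_def cc_def)
  qed
  have ae2: "AE p in lebesgue. indicat_real upper_half p *\<^sub>R (m (snd p) * c p) = mm (snd p) * cc p"
    using AE_lebesgue_snd[OF ae] by eventually_elim (simp only: pair)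
  have intl: "integrable lborel (\<lambda>p. mm (snd p) * cc p)" using int by (simp add: lborel_prod case_prod_unfold)
  then have "integrable lebesgue (\<lambda>p. mm (snd p) * cc p)"
    using integrable_completion borel_measurable_integrable by blast
  then show "integrable lebesgue_upper_half (\<lambda>p. m (snd p) * c p)"
    using integrable_cong_AE_lebesgue(1)[OF ae2] by (simp add: integrable_restrict_space)
  have "(\<integral>p. m (snd p) * c p \<partial>lebesgue_upper_half) = (\<integral>p. mm (snd p) * cc p \<partial>lebesgue)"
    using integrable_cong_AE_lebesgue(2)[OF ae2] by (simp add: integral_restrict_space)
  also have "\<dots> = (\<integral>p. mm (snd p) * cc p \<partial>lborel)" by (rule integral_completion) (use intl in auto)
  also have "\<dots> = (\<integral>p. (case p of (y, x) \<Rightarrow> mm x * cc (y, x)) \<partial>(lborel \<Otimes>\<^sub>M lborel))"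
    by (simp add: lborel_prod case_prod_unfold)
  also have "\<dots> = (\<integral>x. (\<integral>y. mm x * cc (y, x) \<partial>lborel) \<partial>lborel)"
    using lborel_pair.integral_snd[OF int] by simp
  also have "\<dots> = (\<integral>x. mm x * (\<integral>y. cc (y, x) \<partial>lborel) \<partial>lborel)" by simp
  also have "\<dots> = (\<integral>x. mm x * (\<integral>y. cc (y, x) \<partial>lborel) \<partial>lebesgue)"
    by (rule integral_completion[symmetric]) measurable
  also have "\<dots> = (\<integral>x. m x * slice_integral c x \<partial>lebesgue)"
    unfolding slice
  proof (rule integrable_cong_AE_lebesgue(2))
    show "AE x in lebesgue. mm x * slice_integral c x = m x * slice_integral c x" using ae by eventually_elim simp
  qed
  finally show "(\<integral>p. m (snd p) * c p \<partial>lebesgue_upper_half) = (\<integral>x. m x * slice_integral c x \<partial>lebesgue)" .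
qed

text \<open>Fubini, differentiation under the integral sign and the fundamental theorem of calculus
  in x: the integral of an x-derivative over a layer leaves the averages on its two faces.\<close>

lemma upper_half_integral_x_derivative:
  fixes c c' :: "(real ^ 'n) \<times> real \<Rightarrow> real"
  assumes c: "continuous_on upper_half c" and zero: "\<And>y x. r \<le> norm y \<Longrightarrow> c (y, x) = 0"
    and c': "continuous_on upper_half c'" and zero': "\<And>y x. r \<le> norm y \<Longrightarrow> c' (y, x) = 0"
    and d: "\<And>y x. 0 < x \<Longrightarrow> ((\<lambda>x. c (y, x)) has_real_derivative c' (y, x)) (at x)"
    and \<alpha>: "0 < \<alpha>" "\<alpha> \<le> \<beta>"
  shows "integrable lebesgue_upper_half (\<lambda>p. indicat_real {\<alpha>..\<beta>} (snd p) * c' p)"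
    and "(\<integral>p. indicat_real {\<alpha>..\<beta>} (snd p) * c' p \<partial>lebesgue_upper_half) = slice_integral c \<beta> - slice_integral c \<alpha>"
proof -
  have ind: "indicat_real {\<alpha>..\<beta>} \<in> borel_measurable lebesgue" by (rule borel_measurable_indicator) simp
  note fub = upper_half_fubini[OF c' zero' ind, where K = 1 and lo = \<alpha> and hi = \<beta>]
  show "integrable lebesgue_upper_half (\<lambda>p. indicat_real {\<alpha>..\<beta>} (snd p) * c' p)" by (rule fub(1)) (use \<alpha> in auto)
  have "(\<integral>p. indicat_real {\<alpha>..\<beta>} (snd p) * c' p \<partial>lebesgue_upper_half) = (\<integral>x. indicat_real {\<alpha>..\<beta>} x * slice_integral c' x \<partial>lebesgue)"
    by (rule fub(2)) (use \<alpha> in auto)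
  also have "\<dots> = integral {\<alpha>..\<beta>} (slice_integral c')"
  proof -
    have "continuous_on {\<alpha>..\<beta>} (slice_integral c')"
      by (rule continuous_on_subset[OF continuous_on_slice_integral[OF c' zero']]) (use \<alpha> in auto)
    then have "slice_integral c' absolutely_integrable_on {\<alpha>..\<beta>}"
      using absolutely_integrable_continuous[of \<alpha> \<beta>] by simp
    from set_lebesgue_integral_eq_integral(2)[OF this] show ?thesis by (simp add: set_lebesgue_integral_def)
  qed
  also have "\<dots> = slice_integral c \<beta> - slice_integral c \<alpha>"
  proof (rule integral_unique, rule fundamental_theorem_of_calculus[OF \<alpha>(2)])
    fix x assume x: "x \<in> {\<alpha>..\<beta>}"
    then have "0 < x" using \<alpha> by simp
    from DERIV_slice_integral[OF c zero c' zero' d this]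
    show "(slice_integral c has_vector_derivative slice_integral c' x) (at x within {\<alpha>..\<beta>})"
      by (rule has_vector_derivative_at_within[OF has_real_derivative_iff_has_vector_derivative[THEN iffD1]])
  qed
  finally show "(\<integral>p. indicat_real {\<alpha>..\<beta>} (snd p) * c' p \<partial>lebesgue_upper_half) = slice_integral c \<beta> - slice_integral c \<alpha>" .
qed

lemma continuous_on_rho_fst:
  "continuous_on S (\<lambda>p. rho r (fst p))" "continuous_on S (\<lambda>p. rho_grad r (fst p))" "continuous_on S (\<lambda>p. rho_second r b (fst p))"
  by (rule continuous_on_compose2[OF continuous_on_rho(1)[of UNIV]] continuous_on_compose2[OF continuous_on_rho(2)[of UNIV]]
      continuous_on_compose2[OF continuous_on_rho(3)[of UNIV]]; simp add: continuous_on_fst continuous_on_id)+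

definition rho_laplacian :: "real \<Rightarrow> real ^ 'n \<Rightarrow> real" where
  "rho_laplacian r y = (\<Sum>b\<in>Basis. rho_second r b y)"

context stable_solution_setting
begin

definition "J r = slice_integral (\<lambda>p. rho r (fst p) * N p)"

text \<open>Integration by parts in y, one coordinate at a time, for w times a component of
  \<open>rho_grad\<close>. The derivative is moved onto \<open>rho\<close> while w is still
  differentiable, so that only w itself has to pass to the limit.\<close>

lemma slice_divergence:
  assumes h: "0 < h" and r: "0 < r" and x: "0 < x"
  shows "slice_integral (\<lambda>p. fst (dw h p) \<bullet> rho_grad r (fst p)) x = - slice_integral (\<lambda>p. w h p * rho_laplacian r (fst p)) x"
proof -
  define k where "k b y = (fst (dw h (y, x)) \<bullet> b) * (rho_grad r y \<bullet> b) + w h (y, x) * rho_second r b y" for b y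
  have wc: "continuous_on UNIV (\<lambda>y. w h (y, x))" by (rule continuous_on_slice[OF cont_w x])
  have dwc: "continuous_on UNIV (\<lambda>y. fst (dw h (y, x)) \<bullet> b)" for b
    by (rule continuous_on_slice[OF _ x]) (intro continuous_on_inner continuous_on_fst cont_dw h continuous_on_const)
  have kc: "continuous_on UNIV (k b)" for b
    unfolding k_def[abs_def] by (intro continuous_on_add continuous_on_mult continuous_on_inner dwc wc continuous_on_rho continuous_on_const)
  have k0: "k b y = 0" if "r \<le> norm y" for b y using rho_zero[OF r that] by (simp add: k_def)
  have ki: "k b integrable_on UNIV" for b by (rule integrable_on_UNIV_compact_support[OF kc k0])
  have "integral UNIV (k b) = 0" if b: "b \<in> Basis" for b
  proof (rule integral_directional_derivative_zero)
    show "continuous_on UNIV (\<lambda>y. w h (y, x) * (rho_grad r y \<bullet> b))"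
      by (intro continuous_on_mult continuous_on_inner wc continuous_on_rho continuous_on_const)
    show "w h (y, x) * (rho_grad r y \<bullet> b) = 0" if "r \<le> norm y" for y using rho_zero[OF r that] by simp
    show "norm b \<le> 1" using b by simp
    show "((\<lambda>s. w h (y + s *\<^sub>R b, x) * (rho_grad r (y + s *\<^sub>R b) \<bullet> b)) has_real_derivative k b y) (at 0)" for y
      by (rule DERIV_cong[OF DERIV_mult[OF GDERIV_imp_partial(2)[OF GDERIV_w[OF h]] rho_grad_component_derivative]])
        (use x in \<open>simp_all add: k_def upper_half_def mult.commute\<close>)
  qed (use kc k0 in auto)
  then have "0 = (\<Sum>b\<in>Basis. integral UNIV (k b))" by simp
  also have "\<dots> = integral UNIV (\<lambda>y. \<Sum>b\<in>Basis. k b y)" by (rule integral_sum[symmetric]) (auto intro: ki)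
  also have "(\<lambda>y. \<Sum>b\<in>Basis. k b y) = (\<lambda>y. fst (dw h (y, x)) \<bullet> rho_grad r y + w h (y, x) * rho_laplacian r y)"
    by (simp add: k_def rho_laplacian_def sum.distrib sum_distrib_left euclidean_inner[of _ "rho_grad r _"])
  also have "integral UNIV \<dots> = integral UNIV (\<lambda>y. fst (dw h (y, x)) \<bullet> rho_grad r y) + integral UNIV (\<lambda>y. w h (y, x) * rho_laplacian r y)"
  proof (rule integral_add)
    show "(\<lambda>y. fst (dw h (y, x)) \<bullet> rho_grad r y) integrable_on UNIV"
    proof (rule integrable_on_UNIV_compact_support[where r = r])
      show "continuous_on UNIV (\<lambda>y. fst (dw h (y, x)) \<bullet> rho_grad r y)"
      proof -
        have "continuous_on upper_half (\<lambda>p. fst (dw h p) \<bullet> rho_grad r (fst p))"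
          by (intro continuous_on_inner continuous_on_fst cont_dw h continuous_on_rho_fst)
        from continuous_on_slice[OF this x] show ?thesis by simp
      qed
    qed (simp add: rho_zero[OF r])
    show "(\<lambda>y. w h (y, x) * rho_laplacian r y) integrable_on UNIV"
    proof (rule integrable_on_UNIV_compact_support[where r = r])
      show "continuous_on UNIV (\<lambda>y. w h (y, x) * rho_laplacian r y)"
        unfolding rho_laplacian_def by (intro continuous_on_mult wc continuous_on_sum continuous_on_rho)
    qed (simp add: rho_zero[OF r] rho_laplacian_def)
  qed
  finally show ?thesis by (simp add: slice_integral_def)
qed

lemma slice_integral_w_tendsto:
  assumes r: "0 < r" and x: "0 < x"
  shows "(\<lambda>k. slice_integral (\<lambda>p. rho r (fst p) * w (hk k) p) x) \<longlonglongrightarrow> J r x"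
proof -
  obtain W where W: "0 \<le> W" "\<And>h p. 0 < h \<Longrightarrow> h \<le> 1 \<Longrightarrow> p \<in> upper_half \<Longrightarrow> norm p < r + x + 1 \<Longrightarrow> \<bar>w h p\<bar> \<le> W"
    using w_uniform_bound[of "r + x + 1"] by blast
  show ?thesis
    unfolding slice_integral_def J_def fst_conv
  proof (rule dominated_convergence(2))
    show "(\<lambda>y. rho r y * w (hk k) (y, x)) integrable_on UNIV" for k
      by (rule integrable_on_UNIV_compact_support[where r = r])
        (auto intro!: continuous_on_mult continuous_on_rho continuous_on_slice[OF cont_w x] simp: rho_zero[OF r])
    show "(\<lambda>y :: real ^ 'n. W * rho r y) integrable_on UNIV"
      by (rule integrable_on_UNIV_compact_support[where r = r])
        (auto intro!: continuous_on_mult continuous_on_rho continuous_on_const simp: rho_zero[OF r])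
    show "norm (rho r y * w (hk k) (y, x)) \<le> W * rho r y" for k and y :: "real ^ 'n"
    proof (cases "r \<le> norm y")
      case False
      then have "norm (y, x) < r + x + 1" using norm_Pair_le[of y x] x by simp
      then have "\<bar>w (hk k) (y, x)\<bar> \<le> W" using x by (intro W(2) hk) (auto simp: upper_half_def)
      from mult_left_mono[OF this rho_nonneg[of r y]] show ?thesis
        by (simp add: abs_mult rho_nonneg mult.commute[of W])
    qed (simp add: rho_zero[OF r])
    show "(\<lambda>k. rho r y * w (hk k) (y, x)) \<longlonglongrightarrow> rho r y * N (y, x)" for y :: "real ^ 'n"
      using x by (intro tendsto_mult tendsto_const w_tendsto) (auto simp: upper_half_def)
  qed
qed

section \<open>A tent function adapted to the weight\<close>

context
  fixes lo mid hi :: real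
  assumes order: "0 < lo" "lo < mid" "mid < hi"
begin

text \<open>Solutions of the one-dimensional equation with weight \<open>\<mu>\<close> are affine
  functions of this integral, because their flux, \<open>\<mu>\<close> times the derivative, is
  constant.\<close>

definition "resistance s t = integral {s..t} (\<lambda>x. 1 / \<mu> x)"

text \<open>\<open>\<mu>\<close> times the derivative of the tent, prescribed first: constant on two
  layers, so that no regularity of \<open>\<mu>\<close> enters the integration by parts in x. The
  constants make the tent rise from 0 to 1 and return to 0. Both indicators count at mid, a null
  set.\<close>

definition "flux x = indicat_real {lo..mid} x / resistance lo mid - indicat_real {mid..hi} x / resistance mid hi"

definition "slope x = flux x / \<mu> x"

definition "tent x = integral {0..x} slope"

lemma inverse_mu_measurable: "(\<lambda>x. 1 / (indicator {0<..} x * \<mu> x)) \<in> borel_measurable lebesgue"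
  using mu_measurable_pos by measurable

lemma inverse_mu_integrable_Icc:
  assumes "0 < s"
  shows "(\<lambda>x. 1 / \<mu> x) integrable_on {s..t}"
proof (rule mu_bounds[OF assms])
  fix m1 m2 assume m: "0 < m1" "\<And>x. s \<le> x \<Longrightarrow> x \<le> t \<Longrightarrow> m1 \<le> \<mu> x \<and> \<mu> x \<le> m2"
  have "(\<lambda>x. 1 / (indicator {0<..} x * \<mu> x)) integrable_on {s..t}"
  proof (rule measurable_bounded_by_integrable_imp_integrable)
    show "(\<lambda>x. 1 / (indicator {0<..} x * \<mu> x)) \<in> borel_measurable (lebesgue_on {s..t})"
      using inverse_mu_measurable by (rule measurable_restrict_space1)
    show "(\<lambda>_. 1 / m1) integrable_on {s..t}" by (rule integrable_const_ivl)
    show "norm (1 / (indicator {0<..} x * \<mu> x)) \<le> 1 / m1" if "x \<in> {s..t}" for x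
    proof -
      have "0 < x" "m1 \<le> \<mu> x" using m(2)[of x] that assms by auto
      then show ?thesis using m(1) by (simp add: frac_le)
    qed
  qed simp
  then show ?thesis
    by (rule integrable_eq) (use assms in auto)
qed

lemma resistance_bounds:
  assumes "0 < m1" and m: "\<And>x. s \<le> x \<Longrightarrow> x \<le> t \<Longrightarrow> m1 \<le> \<mu> x \<and> \<mu> x \<le> m2" and ab: "0 < s" "s < t"
  shows "0 < resistance s t" "resistance s t \<le> (t - s) / m1"
proof -
  have m2: "0 < m2" using m[of s] assms(1) ab by linarith
  have "integral {s..t} (\<lambda>_. 1 / m2) \<le> resistance s t"
    unfolding resistance_def
  proof (intro integral_le inverse_mu_integrable_Icc ab integrable_const_ivl)
    fix x assume "x \<in> {s..t}"
    then have "m1 \<le> \<mu> x" "\<mu> x \<le> m2" using m[of x] by auto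
    then show "1 / m2 \<le> 1 / \<mu> x" using assms(1) by (intro frac_le) auto
  qed
  moreover have "0 < (t - s) * (1 / m2)" using ab m2 by simp
  ultimately show "0 < resistance s t" using ab by simp
  have "resistance s t \<le> integral {s..t} (\<lambda>_. 1 / m1)"
    unfolding resistance_def
  proof (intro integral_le inverse_mu_integrable_Icc ab integrable_const_ivl)
    fix x assume "x \<in> {s..t}"
    then have "m1 \<le> \<mu> x" using m[of x] by auto
    then show "1 / \<mu> x \<le> 1 / m1" using assms(1) by (intro frac_le) auto
  qed
  then show "resistance s t \<le> (t - s) / m1" using ab by simp
qed

lemma resistance_pos: "0 < resistance lo mid" "0 < resistance mid hi"
proof -
  have p: "0 < resistance s t" if ab: "0 < s" "s < t" for s t
  proof (rule mu_bounds[OF ab(1)])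
    fix m1 m2 assume m: "0 < m1" "\<And>x. s \<le> x \<Longrightarrow> x \<le> t \<Longrightarrow> m1 \<le> \<mu> x \<and> \<mu> x \<le> m2"
    show ?thesis by (rule resistance_bounds(1)[OF m ab])
  qed
  show "0 < resistance lo mid" "0 < resistance mid hi" by (rule p; use order in simp)+
qed

lemma flux_zero: "x \<notin> {lo..hi} \<Longrightarrow> flux x = 0"
  using order by (auto simp: flux_def indicator_def)

lemma slope_zero: "x \<notin> {lo..hi} \<Longrightarrow> slope x = 0"
  by (simp add: slope_def flux_zero)

lemma slope_bound: obtains K where "0 < K" "\<And>x. \<bar>slope x\<bar> \<le> K"
proof (rule mu_bounds[OF order(1), of hi])
  fix m1 m2 assume m: "0 < m1" "\<And>x. lo \<le> x \<Longrightarrow> x \<le> hi \<Longrightarrow> m1 \<le> \<mu> x \<and> \<mu> x \<le> m2"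
  let ?K = "1 / resistance lo mid + 1 / resistance mid hi"
  have K: "0 < ?K" using resistance_pos by (intro add_pos_pos) auto
  have f: "\<bar>flux x\<bar> \<le> ?K" for x
  proof -
    have "\<bar>flux x\<bar> \<le> \<bar>indicat_real {lo..mid} x / resistance lo mid\<bar> + \<bar>indicat_real {mid..hi} x / resistance mid hi\<bar>"
      unfolding flux_def by linarith
    also have "\<dots> \<le> ?K"
      using resistance_pos by (intro add_mono) (auto simp: indicator_def)
    finally show ?thesis .
  qed
  have "\<bar>slope x\<bar> \<le> ?K / m1" for x
  proof (cases "x \<in> {lo..hi}")
    case True
    then have "m1 \<le> \<mu> x" using m(2)[of x] by simp
    then have "\<bar>flux x\<bar> / \<bar>\<mu> x\<bar> \<le> ?K / m1" using f[of x] m(1) K by (intro frac_le) auto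
    then show ?thesis by (simp add: slope_def)
  next
    case False
    then show ?thesis using slope_zero[of x] K m(1) by simp
  qed
  moreover have "0 < ?K / m1" using K m(1) by simp
  ultimately show thesis by (rule that[rotated])
qed

lemma flux_measurable: "flux \<in> borel_measurable lebesgue"
proof -
  have "flux \<in> borel_measurable borel" unfolding flux_def[abs_def] by measurable
  then show ?thesis by (intro measurable_completion) simp
qed

lemma slope_measurable: "slope \<in> borel_measurable lebesgue"
proof -
  have "slope = (\<lambda>x. flux x * (1 / (indicator {0<..} x * \<mu> x)))"
  proof
    fix x show "slope x = flux x * (1 / (indicator {0<..} x * \<mu> x))"
      using flux_zero[of x] order(1) by (cases "x \<in> {lo..hi}") (auto simp: slope_def)
  qed
  then show ?thesis using borel_measurable_times[OF flux_measurable inverse_mu_measurable] by simp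
qed

lemma slope_integrable: "slope integrable_on {s..t}"
proof (rule slope_bound)
  fix K assume K: "0 < K" "\<And>x. \<bar>slope x\<bar> \<le> K"
  show ?thesis
  proof (rule measurable_bounded_by_integrable_imp_integrable)
    show "slope \<in> borel_measurable (lebesgue_on {s..t})" using slope_measurable by (rule measurable_restrict_space1)
    show "(\<lambda>_. K) integrable_on {s..t}" by (rule integrable_const_ivl)
  qed (use K(2) in auto)
qed

lemma tent_diff:
  assumes "0 \<le> x" "x \<le> z"
  shows "tent z - tent x = integral {x..z} slope"
  using Henstock_Kurzweil_Integration.integral_combine[OF assms slope_integrable] by (simp add: tent_def)

lemma tent_lipschitz: obtains K where "0 < K" "\<And>x z. \<bar>tent x - tent z\<bar> \<le> K * \<bar>x - z\<bar>"
proof (rule slope_bound)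
  fix K assume K: "0 < K" "\<And>x. \<bar>slope x\<bar> \<le> K"
  have pos: "\<bar>tent z - tent x\<bar> \<le> K * (z - x)" if xz: "0 \<le> x" "x \<le> z" for x z
  proof -
    have "norm (integral {x..z} slope) \<le> K * measure lborel {x..z}"
      by (rule has_integral_bound_real[OF _ finite.emptyI integrable_integral[OF slope_integrable]]) (use K in auto)
    then show ?thesis using xz by (simp add: tent_diff)
  qed
  have neg: "tent x = tent (max x 0)" for x by (cases x "0 :: real" rule: linorder_cases) (auto simp: tent_def max_def)
  have le: "\<bar>tent z - tent x\<bar> \<le> K * \<bar>z - x\<bar>" if xz: "x \<le> z" for x z
  proof -
    have "\<bar>tent (max z 0) - tent (max x 0)\<bar> \<le> K * (max z 0 - max x 0)" using xz by (intro pos) auto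
    also have "\<dots> \<le> K * \<bar>z - x\<bar>" using K(1) xz by (intro mult_left_mono) auto
    finally show ?thesis by (simp only: neg[symmetric])
  qed
  have "\<bar>tent x - tent z\<bar> \<le> K * \<bar>x - z\<bar>" for x z
    using le[of x z] le[of z x] by (cases "x \<le> z") (simp_all add: abs_minus_commute)
  then show thesis by (rule that[OF K(1)])
qed

lemma tent_left: "x \<le> lo \<Longrightarrow> tent x = 0"
proof -
  assume x: "x \<le> lo"
  have "tent x = integral {0..x} (\<lambda>_. 0)"
    unfolding tent_def by (rule integral_spike[of "{lo}"]) (use x order in \<open>auto simp: slope_zero\<close>)
  then show ?thesis by simp
qed

lemma tent_rising: "lo \<le> x \<Longrightarrow> x \<le> mid \<Longrightarrow> tent x = resistance lo x / resistance lo mid"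
proof -
  assume x: "lo \<le> x" "x \<le> mid"
  have "tent x = integral {lo..x} slope" using tent_diff[of lo x] tent_left[of lo] x order by simp
  also have "\<dots> = integral {lo..x} (\<lambda>x. (1 / resistance lo mid) * (1 / \<mu> x))"
    by (rule integral_spike[of "{mid}"]) (use x in \<open>auto simp: slope_def flux_def\<close>)
  finally show ?thesis by (simp only: integral_mult_right resistance_def) simp
qed

lemma tent_mid: "tent mid = 1"
  using tent_rising[of mid] order resistance_pos by simp

lemma tent_falling: "mid \<le> x \<Longrightarrow> x \<le> hi \<Longrightarrow> tent x = 1 - resistance mid x / resistance mid hi"
proof -
  assume x: "mid \<le> x" "x \<le> hi"
  have "tent x - 1 = integral {mid..x} slope" using tent_diff[of mid x] tent_mid x order by simp
  also have "\<dots> = integral {mid..x} (\<lambda>x. (- 1 / resistance mid hi) * (1 / \<mu> x))"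
    by (rule integral_spike[of "{mid}"]) (use x in \<open>auto simp: slope_def flux_def\<close>)
  finally show ?thesis by (simp only: integral_mult_right resistance_def) simp
qed

lemma tent_right: "hi \<le> x \<Longrightarrow> tent x = 0"
proof -
  assume x: "hi \<le> x"
  have "tent x - tent hi = integral {hi..x} slope" using tent_diff[of hi x] x order by simp
  also have "\<dots> = integral {hi..x} (\<lambda>_. 0)"
    by (rule integral_spike[of "{hi}"]) (use x order in \<open>auto simp: slope_zero\<close>)
  finally show ?thesis using tent_falling[of hi] order resistance_pos by simp
qed

lemma tent_outside: "x \<notin> {lo..hi} \<Longrightarrow> tent x = 0"
  using tent_left[of x] tent_right[of x] by (cases "x \<le> lo") auto

lemma resistance_mono:
  assumes "0 < s" "s \<le> x" "x \<le> t"
  shows "0 \<le> resistance s x" "resistance s x \<le> resistance s t"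
proof -
  have nn: "0 \<le> 1 / \<mu> z" if "s \<le> z" for z using mu_pos[of z] that assms by simp
  show "0 \<le> resistance s x"
    unfolding resistance_def by (rule integral_nonneg[OF inverse_mu_integrable_Icc[OF assms(1)]]) (use nn in auto)
  show "resistance s x \<le> resistance s t"
    unfolding resistance_def
    by (rule integral_subset_le[OF _ inverse_mu_integrable_Icc[OF assms(1)] inverse_mu_integrable_Icc[OF assms(1)]]) (use assms nn in auto)
qed

lemma tent_range: "0 \<le> tent x" "tent x \<le> 1"
proof -
  have "0 \<le> tent x \<and> tent x \<le> 1"
  proof (cases "x \<in> {lo..hi}")
    case True
    show ?thesis
    proof (cases "x \<le> mid")
      case le: True
      then show ?thesis
        using True tent_rising[of x] resistance_mono[of lo x mid] resistance_pos order by simp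
    next
      case False
      then show ?thesis
        using True tent_falling[of x] resistance_mono[of mid x hi] resistance_pos order by simp
    qed
  qed (simp add: tent_outside)
  then show "0 \<le> tent x" "tent x \<le> 1" by auto
qed

lemma tent_continuous: "continuous_on S tent"
proof (rule tent_lipschitz)
  fix K assume K: "0 < K" "\<And>x z. \<bar>tent x - tent z\<bar> \<le> K * \<bar>x - z\<bar>"
  have "K-lipschitz_on S tent" using K by (intro lipschitz_onI) (auto simp: dist_real_def)
  then show ?thesis by (rule lipschitz_on_continuous_on)
qed

lemma tent_measurable: "tent \<in> borel_measurable lebesgue"
  using borel_measurable_continuous_onI[OF tent_continuous] by (intro measurable_completion) simp

text \<open>Lebesgue differentiation of the integral of the slope, which need not be continuous. An
  almost everywhere gradient is all that \<open>test\<close> asks for.\<close>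

lemma tent_derivative: "AE x in lebesgue. 0 < x \<longrightarrow> (tent has_real_derivative slope x) (at x)"
proof -
  have "AE x in lebesgue. 0 < x \<and> x < real n \<longrightarrow> (tent has_real_derivative slope x) (at x)" for n :: nat
    using AE_has_real_derivative_integral[OF slope_integrable[of 0 "real n"]] by (simp only: tent_def[abs_def])
  then have "AE x in lebesgue. \<forall>n::nat. 0 < x \<and> x < real n \<longrightarrow> (tent has_real_derivative slope x) (at x)"
    by (simp only: AE_all_countable) simp
  then show ?thesis
  proof eventually_elim
    case (elim x)
    show ?case using reals_Archimedean2[of x] elim by blast
  qed
qed

definition bump_test :: "real \<Rightarrow> (real ^ 'n) \<times> real \<Rightarrow> real" where "bump_test r p = rho r (fst p) * tent (snd p)"

definition bump_test_grad :: "real \<Rightarrow> (real ^ 'n) \<times> real \<Rightarrow> (real ^ 'n) \<times> real" where "bump_test_grad r p = (tent (snd p) *\<^sub>R rho_grad r (fst p), rho r (fst p) * slope (snd p))"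

lemma rho_le_1: "0 < r \<Longrightarrow> rho r y \<le> 1"
  unfolding rho_def by (intro power_le_one) auto

lemma bump_test_zero:
  assumes r: "0 < r" and p: "p \<in> upper_half" "r + hi \<le> norm p"
  shows "bump_test r p = 0" "bump_test_grad r p = 0"
proof -
  obtain y x where yx: "p = (y, x)" by (cases p)
  have x: "0 < x" using p(1) by (simp add: yx)
  have "norm p \<le> norm y + x" using norm_Pair_le[of y x] x by (simp add: yx)
  then have "r \<le> norm y \<or> hi \<le> x" using p(2) by linarith
  moreover have "bump_test r p = 0 \<and> bump_test_grad r p = 0" if "r \<le> norm y"
    using rho_zero[OF r that] by (simp add: yx bump_test_def bump_test_grad_def zero_prod_def)
  moreover have "bump_test r p = 0 \<and> bump_test_grad r p = 0" if "hi < x \<or> r \<le> norm y"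
    using rho_zero[OF r, of y] tent_right[of x] slope_zero[of x] that by (auto simp: yx bump_test_def bump_test_grad_def zero_prod_def)
  moreover have "hi < x \<or> r \<le> norm y"
  proof (rule ccontr)
    assume n: "\<not> (hi < x \<or> r \<le> norm y)"
    then have "norm y + x < r + hi" by linarith
    then show False using \<open>norm p \<le> norm y + x\<close> p(2) by linarith
  qed
  ultimately show "bump_test r p = 0" "bump_test_grad r p = 0" by auto
qed

lemma GDERIV_rho_fst: "GDERIV (\<lambda>p. rho r (fst p)) p :> (rho_grad r (fst p), 0)"
proof -
  have "(rho r has_derivative (\<lambda>h. h \<bullet> rho_grad r (fst p))) (at (fst p))" using GDERIV_rho by (simp add: gderiv_def)
  from has_derivative_compose[OF has_derivative_fst[OF has_derivative_ident] this]
  show ?thesis by (simp add: gderiv_def inner_prod_def)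
qed

lemma test_bump:
  assumes r: "0 < r" and R: "r + hi \<le> R"
  shows "test (bump_test r) (bump_test_grad r) R"
  unfolding test_def
proof (intro conjI ballI impI)
  obtain K where K: "0 < K" "\<And>x. \<bar>slope x\<bar> \<le> K" by (rule slope_bound, rule that)
  obtain L where L: "0 < L" "\<And>x z. \<bar>tent x - tent z\<bar> \<le> L * \<bar>x - z\<bar>" by (rule tent_lipschitz, rule that)
  show "0 < R" using r R order by linarith
  have l1: "locally_lipschitz_on upper_half (\<lambda>p :: (real ^ 'n) \<times> real. rho r (fst p))"
    by (rule locally_lipschitz_on_C1[OF open_upper_half GDERIV_rho_fst])
      (intro continuous_on_Pair continuous_on_const continuous_on_compose2[OF continuous_on_rho(2)[of UNIV]] continuous_on_fst continuous_on_id subset_UNIV)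
  have l2: "locally_lipschitz_on upper_half (\<lambda>p :: (real ^ 'n) \<times> real. tent (snd p))"
    unfolding locally_lipschitz_on_def
  proof (intro ballI exI conjI)
    show "L-lipschitz_on (cball p 1 \<inter> upper_half) (\<lambda>p. tent (snd p))" for p :: "(real ^ 'n) \<times> real"
    proof (rule lipschitz_onI)
      show "dist (tent (snd s)) (tent (snd t)) \<le> L * dist s t" for s t :: "(real ^ 'n) \<times> real"
      proof -
        have "\<bar>snd s - snd t\<bar> \<le> dist s t" using dist_snd_le[of s t] by (simp add: dist_real_def)
        from order_trans[OF L(2)[of "snd s" "snd t"] mult_left_mono[OF this, of L]] L(1)
        show ?thesis by (simp only: dist_real_def)
      qed
    qed (use L in simp)
  qed simp
  show "locally_lipschitz_on upper_half (bump_test r)"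
    unfolding bump_test_def[abs_def] by (rule locally_lipschitz_on_mult[OF l1 l2])
  have "\<bar>bump_test r p\<bar> \<le> 1 * 1" for p
    unfolding bump_test_def abs_mult using rho_nonneg[of r "fst p"] rho_le_1[OF r, of "fst p"] tent_range[of "snd p"]
    by (intro mult_mono) auto
  then show "bounded (bump_test r ` upper_half)" by (auto simp: bounded_iff intro!: exI[of _ 1])
  show "bump_test r p = 0" "bump_test_grad r p = 0" if "p \<in> upper_half" "R \<le> norm p" for p
    using bump_test_zero[OF r that(1)] that R by auto
  show "AE p in M. GDERIV (bump_test r) p :> bump_test_grad r p"
    unfolding AE_upper_half_iff using AE_lebesgue_snd[OF tent_derivative]
  proof eventually_elim
    case (elim p)
    show ?case
    proof
      assume "p \<in> upper_half"
      then have "(tent has_derivative (\<lambda>h. slope (snd p) * h)) (at (snd p))"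
        using elim by (simp add: upper_half_def has_field_derivative_def)
      from has_derivative_compose[OF has_derivative_snd[OF has_derivative_ident] this]
      have "GDERIV (\<lambda>p. tent (snd p)) p :> (0, slope (snd p))"
        by (simp add: gderiv_def inner_prod_def mult.commute)
      from GDERIV_mult[OF GDERIV_rho_fst this, of r]
      show "GDERIV (bump_test r) p :> bump_test_grad r p"
        by (simp add: bump_test_def[abs_def] bump_test_grad_def add.commute)
    qed
  qed
  have sm: "(\<lambda>p. slope (snd p)) \<in> borel_measurable M"
    by (rule measurable_restrict_space1[OF measurable_compose[OF measurable_snd_lebesgue slope_measurable]])
  have tm: "(\<lambda>p. tent (snd p)) \<in> borel_measurable M"
    by (intro continuous_on_upper_half_measurable continuous_on_compose2[OF tent_continuous[of UNIV]] continuous_on_snd continuous_on_id subset_UNIV)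
  have rm: "(\<lambda>p. rho r (fst p)) \<in> borel_measurable M" "(\<lambda>p. rho_grad r (fst p)) \<in> borel_measurable M"
    by (intro continuous_on_upper_half_measurable continuous_on_compose2[OF continuous_on_rho(1)[of UNIV]]
      continuous_on_compose2[OF continuous_on_rho(2)[of UNIV]] continuous_on_fst continuous_on_id subset_UNIV)+
  show Gm: "bump_test_grad r \<in> borel_measurable M"
    unfolding bump_test_grad_def[abs_def]
    by (intro borel_measurable_Pair borel_measurable_scaleR borel_measurable_times sm tm rm)
  obtain B where B: "\<And>y. norm (rho_grad r (y :: real ^ 'n)) \<le> B"
  proof -
    have "bounded (rho_grad r ` cball (0 :: real ^ 'n) r)"
      by (intro compact_imp_bounded compact_continuous_image continuous_on_rho) simp
    then obtain B where B: "\<forall>q\<in>rho_grad r ` cball (0 :: real ^ 'n) r. norm q \<le> B" unfolding bounded_iff ..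
    have "norm (rho_grad r y) \<le> max B 0" for y :: "real ^ 'n"
      using B rho_zero(2)[OF r, of y] by (cases "norm y \<le> r") (auto simp: le_max_iff_disj)
    then show thesis by (rule that)
  qed
  show "integrable M (\<lambda>p. \<mu> (snd p) * (norm (bump_test_grad r p))\<^sup>2)"
  proof (rule Bochner_Integration.integrable_bound[OF integrable_mult_right[OF mu_ball_integrable[of R], of "B\<^sup>2 + K\<^sup>2"]])
    show "(\<lambda>p. \<mu> (snd p) * (norm (bump_test_grad r p))\<^sup>2) \<in> borel_measurable M" using mu_measurable Gm by measurable
    show "AE p in M. norm (\<mu> (snd p) * (norm (bump_test_grad r p))\<^sup>2) \<le> norm ((B\<^sup>2 + K\<^sup>2) * (\<mu> (snd p) * indicat_real (ball 0 R) p))"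
    proof (rule AE_I2)
      fix p assume "p \<in> space M"
      then have p: "p \<in> upper_half" by simp
      then have m: "0 < \<mu> (snd p)" using mu_pos by (simp add: upper_half_def)
      show "norm (\<mu> (snd p) * (norm (bump_test_grad r p))\<^sup>2) \<le> norm ((B\<^sup>2 + K\<^sup>2) * (\<mu> (snd p) * indicat_real (ball 0 R) p))"
      proof (cases "norm p < R")
        case True
        have "norm (tent (snd p) *\<^sub>R rho_grad r (fst p)) \<le> 1 * B"
          unfolding norm_scaleR using tent_range[of "snd p"] B[of "fst p"] by (intro mult_mono) auto
        moreover have "norm (rho r (fst p) * slope (snd p)) \<le> 1 * K"
          unfolding norm_mult using rho_nonneg[of r "fst p"] rho_le_1[OF r, of "fst p"] K(2)[of "snd p"] by (intro mult_mono) auto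
        ultimately have "(norm (tent (snd p) *\<^sub>R rho_grad r (fst p)))\<^sup>2 + (norm (rho r (fst p) * slope (snd p)))\<^sup>2 \<le> B\<^sup>2 + K\<^sup>2"
          by (intro add_mono power_mono) auto
        then have "(norm (bump_test_grad r p))\<^sup>2 \<le> B\<^sup>2 + K\<^sup>2"
          unfolding bump_test_grad_def norm_Pair by (simp add: sum_power2_ge_zero)
        then have "\<mu> (snd p) * (norm (bump_test_grad r p))\<^sup>2 \<le> \<mu> (snd p) * (B\<^sup>2 + K\<^sup>2)" using m by (intro mult_left_mono) auto
        then show ?thesis using True m by (simp add: mult_ac)
      next
        case False
        then show ?thesis using bump_test_zero(2)[OF r p] R by simp
      qed
    qed
  qed
qed

lemma compatible_bump:
  assumes r: "0 < r" and n: "0 < n" "r + hi \<le> 2 ^ n"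
  shows "compatible (cutoff n) (cutoff_grad n) (bump_test r) (bump_test_grad r) (2 ^ (2 * n)) lo"
  unfolding compatible_def
proof (intro conjI allI impI ballI)
  show "cut (cutoff n) (cutoff_grad n) (2 ^ (2 * n))" by (rule cut_cutoff[OF n(1)])
  have "(2::real) ^ n \<le> 2 ^ (2 * n)" by (intro power_increasing) auto
  then show "test (bump_test r) (bump_test_grad r) (2 ^ (2 * n))" using n by (intro test_bump[OF r]) linarith
  show "0 < lo" by (rule order(1))
  show "bump_test r (y, x) = 0" if "x < lo" for y x using tent_left[of x] that by (simp add: bump_test_def)
  fix p :: "(real ^ 'n) \<times> real" assume p: "p \<in> upper_half" "bump_test r p \<noteq> 0 \<or> bump_test_grad r p \<noteq> 0"
  then have "\<not> r + hi \<le> norm p" using bump_test_zero[OF r p(1)] by auto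
  then have lt: "norm p < 2 ^ n" using n(2) by linarith
  show "cutoff n p = 1" using lt n(1) by (intro cutoff_eq_1) auto
  \<comment> \<open>By the strict inequality p is interior to the ball where the cutoff is 1, so
    uniqueness of the gradient gives \<open>cutoff_grad n p = 0\<close>.\<close>
  have "GDERIV (\<lambda>_. 1) p :> 0" by (rule GDERIV_const)
  then have "((\<lambda>_. 1::real) has_derivative (\<lambda>h. h \<bullet> 0)) (at p)" by (simp add: gderiv_def)
  note d = this
  have pb: "p \<in> ball 0 (2 ^ n)" using lt by simp
  have eq: "1 = cutoff n q" if "q \<in> ball 0 (2 ^ n)" for q :: "(real ^ 'n) \<times> real"
    using that n(1) by (intro cutoff_eq_1[symmetric]) (simp_all del: split_paired_All)
  have "(cutoff n has_derivative (\<lambda>h. h \<bullet> 0)) (at p)"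
    by (rule has_derivative_transform_within_open[OF d open_ball pb eq])
  then have "GDERIV (cutoff n) p :> 0" by (simp add: gderiv_def)
  from grad_eq[OF this] grad_eq[OF GDERIV_cutoff[of n p]] show "cutoff_grad n p = 0" by simp
qed

text \<open>Bounded, because the tent is supported away from x = 0, where \<open>\<mu>\<close> may
  be singular or degenerate.\<close>

definition "weight x = \<mu> x * tent x"

lemma weight_measurable: "weight \<in> borel_measurable lebesgue"
proof -
  have "weight = (\<lambda>x. (indicator {0<..} x * \<mu> x) * tent x)"
  proof
    fix x show "weight x = (indicator {0<..} x * \<mu> x) * tent x"
      using tent_outside[of x] order(1) by (cases "0 < x") (auto simp: weight_def)
  qed
  then show ?thesis using borel_measurable_times[OF mu_measurable_pos tent_measurable] by simp
qed

lemma weight_nonneg: "0 \<le> weight x"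
  using tent_range[of x] tent_left[of x] order(1) mu_pos[of x] by (cases "0 < x") (auto simp: weight_def)

lemma weight_le:
  assumes "\<And>x. lo \<le> x \<Longrightarrow> x \<le> hi \<Longrightarrow> \<mu> x \<le> m2"
  shows "weight x \<le> m2 * tent x"
proof (cases "x \<in> {lo..hi}")
  case True
  then show ?thesis using assms[of x] tent_range[of x] by (simp add: weight_def mult_right_mono)
qed (simp add: weight_def tent_outside)

lemma weight_bound: obtains K where "\<And>x. \<bar>weight x\<bar> \<le> K"
proof (rule mu_bounds[OF order(1), of hi])
  fix m1 m2 assume m: "0 < m1" "\<And>x. lo \<le> x \<Longrightarrow> x \<le> hi \<Longrightarrow> m1 \<le> \<mu> x \<and> \<mu> x \<le> m2"
  have m2: "0 < m2" using m(1) m(2)[of lo] order by linarith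
  have "\<bar>weight x\<bar> \<le> m2" for x
  proof -
    have "\<bar>weight x\<bar> \<le> m2 * tent x" using weight_le[of m2 x] m(2) weight_nonneg[of x] by simp
    also have "\<dots> \<le> m2 * 1" using tent_range[of x] m2 by (intro mult_left_mono) auto
    finally show ?thesis by simp
  qed
  then show thesis by (rule that)
qed

lemma weight_fubini:
  fixes c :: "(real ^ 'n) \<times> real \<Rightarrow> real"
  assumes c: "continuous_on upper_half c" and zero: "\<And>y x. r \<le> norm y \<Longrightarrow> c (y, x) = 0"
  shows "integrable M (\<lambda>p. weight (snd p) * c p)"
    and "(\<integral>p. weight (snd p) * c p \<partial>M) = (\<integral>x. weight x * slice_integral c x \<partial>lebesgue)"
    and "integrable M (\<lambda>p. tent (snd p) * c p)"
    and "(\<integral>p. tent (snd p) * c p \<partial>M) = (\<integral>x. tent x * slice_integral c x \<partial>lebesgue)"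
proof -
  obtain K where K: "\<And>x. \<bar>weight x\<bar> \<le> K" by (rule weight_bound, rule that)
  have w0: "weight x = 0" if "x \<notin> {lo..hi}" for x using tent_outside[OF that] by (simp add: weight_def)
  note * = upper_half_fubini[OF c zero weight_measurable K w0 order(1)]
  show "integrable M (\<lambda>p. weight (snd p) * c p)" by (rule *(1)) 
  show "(\<integral>p. weight (snd p) * c p \<partial>M) = (\<integral>x. weight x * slice_integral c x \<partial>lebesgue)" by (rule *(2))
  have K1: "\<bar>tent x\<bar> \<le> 1" for x using tent_range[of x] by simp
  note ** = upper_half_fubini[OF c zero tent_measurable K1 tent_outside order(1)]
  show "integrable M (\<lambda>p. tent (snd p) * c p)" by (rule **(1))
  show "(\<integral>p. tent (snd p) * c p \<partial>M) = (\<integral>x. tent x * slice_integral c x \<partial>lebesgue)" by (rule **(2))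
qed

text \<open>The horizontal part is integrated by parts on each slice and produces the Laplacian of
  \<open>rho\<close>. In the vertical part \<open>\<mu>\<close> times the slope is the flux,
  constant on each of the two layers, so only the averages at lo, mid and hi remain. No derivative
  of w is left.\<close>

lemma gradient_pairing:
  assumes h: "0 < h" and r: "0 < r"
  defines "S \<equiv> slice_integral (\<lambda>p. rho r (fst p) * w h p)"
  shows "(\<integral>p. \<mu> (snd p) * (dw h p \<bullet> bump_test_grad r p) \<partial>M)
    = - (\<integral>p. weight (snd p) * (w h p * rho_laplacian r (fst p)) \<partial>M)
      + (S mid - S lo) / resistance lo mid - (S hi - S mid) / resistance mid hi"
proof -
  let ?c = "\<lambda>p. fst (dw h p) \<bullet> rho_grad r (fst p)"
  let ?d = "\<lambda>p. rho r (fst p) * w h p"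
  let ?d' = "\<lambda>p. rho r (fst p) * snd (dw h p)"
  have cc: "continuous_on upper_half ?c" by (intro continuous_on_inner continuous_on_fst cont_dw h continuous_on_rho_fst)
  have c0: "?c (y, x) = 0" if "r \<le> norm y" for y x using rho_zero[OF r that] by simp
  have lc: "continuous_on upper_half (\<lambda>p. w h p * rho_laplacian r (fst p))"
    unfolding rho_laplacian_def by (intro continuous_on_mult cont_w continuous_on_sum continuous_on_rho_fst)
  have l0: "w h (y, x) * rho_laplacian r (fst (y, x)) = 0" if "r \<le> norm y" for y x
    using rho_zero[OF r that] by (simp add: rho_laplacian_def)
  have dc: "continuous_on upper_half ?d" by (intro continuous_on_mult cont_w continuous_on_rho_fst)
  have d0: "?d (y, x) = 0" if "r \<le> norm y" for y x using rho_zero[OF r that] by simp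
  have d'c: "continuous_on upper_half ?d'" by (intro continuous_on_mult continuous_on_snd cont_dw h continuous_on_rho_fst)
  have d'0: "?d' (y, x) = 0" if "r \<le> norm y" for y x using rho_zero[OF r that] by simp
  have dd: "((\<lambda>x. ?d (y, x)) has_real_derivative ?d' (y, x)) (at x)" if x: "0 < x" for y x
  proof -
    have "((\<lambda>x. w h (y, x)) has_real_derivative snd (dw h (y, x))) (at x)"
      by (rule GDERIV_imp_partial(1)[OF GDERIV_w[OF h]]) (use x in \<open>simp add: upper_half_def\<close>)
    from DERIV_cmult[OF this, of "rho r y"] show ?thesis by simp
  qed
  note c = weight_fubini[OF cc c0]
  note Y1 = upper_half_integral_x_derivative[OF dc d0 d'c d'0 dd order(1) less_imp_le[OF order(2)]]
  have "0 < mid" using order by simp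
  note Y2 = upper_half_integral_x_derivative[OF dc d0 d'c d'0 dd this less_imp_le[OF order(3)]]
  have c2: "(\<integral>p. weight (snd p) * ?c p \<partial>M) = (\<integral>x. weight x * slice_integral ?c x \<partial>lebesgue)"
    by (rule c(2))
  have Y12: "(\<integral>p. indicat_real {lo..mid} (snd p) * ?d' p \<partial>M) = S mid - S lo" unfolding S_def by (rule Y1(2))
  have Y22: "(\<integral>p. indicat_real {mid..hi} (snd p) * ?d' p \<partial>M) = S hi - S mid" unfolding S_def by (rule Y2(2))
  have "(\<integral>p. \<mu> (snd p) * (dw h p \<bullet> bump_test_grad r p) \<partial>M) =
      (\<integral>p. weight (snd p) * ?c p + ((indicat_real {lo..mid} (snd p) * ?d' p) / resistance lo mid
        - (indicat_real {mid..hi} (snd p) * ?d' p) / resistance mid hi) \<partial>M)"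
  proof (rule Bochner_Integration.integral_cong[OF refl])
    fix p :: "(real ^ 'n) \<times> real" assume "p \<in> space M"
    then have m: "\<mu> (snd p) \<noteq> 0" using mu_pos[of "snd p"] by (simp add: upper_half_def)
    have "\<mu> (snd p) * (dw h p \<bullet> bump_test_grad r p) = weight (snd p) * ?c p + (\<mu> (snd p) * slope (snd p)) * ?d' p"
      by (simp add: bump_test_grad_def inner_prod_def weight_def algebra_simps)
    also have "\<mu> (snd p) * slope (snd p) = flux (snd p)" using m by (simp add: slope_def)
    finally show "\<mu> (snd p) * (dw h p \<bullet> bump_test_grad r p) = weight (snd p) * ?c p + ((indicat_real {lo..mid} (snd p) * ?d' p) / resistance lo mid
        - (indicat_real {mid..hi} (snd p) * ?d' p) / resistance mid hi)"
      by (simp only: flux_def left_diff_distrib times_divide_eq_left)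
  qed
  also have "\<dots> = (\<integral>p. weight (snd p) * ?c p \<partial>M) + ((\<integral>p. indicat_real {lo..mid} (snd p) * ?d' p \<partial>M) / resistance lo mid
        - (\<integral>p. indicat_real {mid..hi} (snd p) * ?d' p \<partial>M) / resistance mid hi)"
    by (simp only: Bochner_Integration.integral_add Bochner_Integration.integral_diff Bochner_Integration.integrable_diff
        integrable_divide integral_divide_zero c(1) Y1(1) Y2(1))
  also have "(\<integral>p. weight (snd p) * ?c p \<partial>M) = (\<integral>x. - (weight x * slice_integral (\<lambda>p. w h p * rho_laplacian r (fst p)) x) \<partial>lebesgue)"
  proof -
    have "weight x * slice_integral ?c x = - (weight x * slice_integral (\<lambda>p. w h p * rho_laplacian r (fst p)) x)" for x
    proof (cases "x \<in> {lo..hi}")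
      case True
      then show ?thesis using slice_divergence[OF h r, of x] order(1) by simp
    qed (simp add: weight_def tent_outside)
    then show ?thesis unfolding c2 by simp
  qed
  also have "\<dots> = - (\<integral>p. weight (snd p) * (w h p * rho_laplacian r (fst p)) \<partial>M)"
    using weight_fubini(2)[OF lc l0] by simp
  finally show ?thesis using Y12 Y22 by simp
qed

text \<open>In the integrated form the limit concerns w alone, which converges to |F| and is bounded
  uniformly in h. This supplies the parameter \<open>\<Lambda>\<close> of
  \<open>limit_inequality\<close>.\<close>

lemma gradient_pairing_tendsto:
  assumes r: "0 < r"
  shows "(\<lambda>k. \<integral>p. \<mu> (snd p) * (dw (hk k) p \<bullet> bump_test_grad r p) \<partial>M) \<longlonglongrightarrow>
    - (\<integral>p. weight (snd p) * (N p * rho_laplacian r (fst p)) \<partial>M)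
      + (J r mid - J r lo) / resistance lo mid - (J r hi - J r mid) / resistance mid hi"
proof -
  obtain W where W: "0 \<le> W" "\<And>h p. 0 < h \<Longrightarrow> h \<le> 1 \<Longrightarrow> p \<in> upper_half \<Longrightarrow> norm p < r + hi + 1 \<Longrightarrow> \<bar>w h p\<bar> \<le> W"
    using w_uniform_bound[of "r + hi + 1"] by blast
  have lc: "continuous_on upper_half (\<lambda>p. rho_laplacian r (fst p))"
    unfolding rho_laplacian_def by (intro continuous_on_sum continuous_on_rho_fst)
  have l0: "rho_laplacian r (fst (y, x)) = 0" if "r \<le> norm y" for y :: "real ^ 'n" and x :: real
    using rho_zero[OF r that] by (simp add: rho_laplacian_def)
  have wl: "integrable M (\<lambda>p. weight (snd p) * (w (hk k) p * rho_laplacian r (fst p)))" for k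
    by (rule weight_fubini(1)[where r = r]) (use l0 in \<open>auto intro!: continuous_on_mult lc cont_w\<close>)
  have nl: "integrable M (\<lambda>p. weight (snd p) * (N p * rho_laplacian r (fst p)))"
    by (rule weight_fubini(1)[where r = r]) (use l0 in \<open>auto intro!: continuous_on_mult lc cont_N\<close>)
  have dom: "integrable M (\<lambda>p. weight (snd p) * (W * \<bar>rho_laplacian r (fst p)\<bar>))"
    by (rule weight_fubini(1)[where r = r]) (use l0 in \<open>auto intro!: continuous_on_mult continuous_on_rabs lc continuous_on_const\<close>)
  have "(\<lambda>k. \<integral>p. weight (snd p) * (w (hk k) p * rho_laplacian r (fst p)) \<partial>M) \<longlonglongrightarrow> (\<integral>p. weight (snd p) * (N p * rho_laplacian r (fst p)) \<partial>M)"
  proof (rule integral_dominated_convergence[OF borel_measurable_integrable[OF nl] borel_measurable_integrable[OF wl] dom])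
    show "AE p in M. (\<lambda>k. weight (snd p) * (w (hk k) p * rho_laplacian r (fst p))) \<longlonglongrightarrow> weight (snd p) * (N p * rho_laplacian r (fst p))"
      by (rule AE_I2) (auto intro!: tendsto_mult tendsto_const w_tendsto)
    show "AE p in M. norm (weight (snd p) * (w (hk k) p * rho_laplacian r (fst p))) \<le> weight (snd p) * (W * \<bar>rho_laplacian r (fst p)\<bar>)" for k
    proof (rule AE_I2)
      fix p :: "(real ^ 'n) \<times> real" assume "p \<in> space M"
      then have p: "p \<in> upper_half" by simp
      show "norm (weight (snd p) * (w (hk k) p * rho_laplacian r (fst p))) \<le> weight (snd p) * (W * \<bar>rho_laplacian r (fst p)\<bar>)"
      proof (cases "norm p < r + hi + 1")
        case True
        have "\<bar>w (hk k) p\<bar> * \<bar>rho_laplacian r (fst p)\<bar> \<le> W * \<bar>rho_laplacian r (fst p)\<bar>"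
          by (intro mult_right_mono W(2) hk p True) simp
        then have "weight (snd p) * (\<bar>w (hk k) p\<bar> * \<bar>rho_laplacian r (fst p)\<bar>) \<le> weight (snd p) * (W * \<bar>rho_laplacian r (fst p)\<bar>)"
          using weight_nonneg[of "snd p"] by (rule mult_left_mono)
        then show ?thesis using weight_nonneg[of "snd p"] by (simp add: abs_mult)
      next
        case False
        obtain y x where yx: "p = (y, x)" by (cases p)
        have x: "0 < x" using p by (simp add: yx upper_half_def)
        have "r \<le> norm y \<or> hi \<le> x" using False norm_Pair_le[of y x] x by (auto simp: yx)
        then show ?thesis using l0[of y x] tent_right[of x] by (auto simp: yx weight_def)
      qed
    qed
  qed
  moreover have "0 < mid" "0 < hi" using order by auto
  ultimately show ?thesis
    unfolding gradient_pairing[OF hk(1) r]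
    using order resistance_pos
    by (intro tendsto_add tendsto_diff tendsto_minus tendsto_divide tendsto_const slice_integral_w_tendsto r) auto
qed

end

end

text \<open>For small \<open>\<tau>\<close> > 0 the linear term dominates; the witness makes
  \<open>\<tau>\<close> A at most -L.\<close>

lemma nonneg_of_quadratic:
  fixes L A :: real
  assumes "\<And>\<tau>. 0 \<le> 2 * \<tau> * L + \<tau>\<^sup>2 * A"
  shows "0 \<le> L"
proof (rule ccontr)
  assume "\<not> 0 \<le> L"
  then have L: "L < 0" by simp
  define \<tau> where "\<tau> = - L / (\<bar>A\<bar> + 1)"
  have \<tau>: "0 < \<tau>" using L divide_neg_pos[of L "\<bar>A\<bar> + 1"] by (simp add: \<tau>_def)
  have "\<tau> * A \<le> \<tau> * (\<bar>A\<bar> + 1)" using \<tau> by (intro mult_left_mono) auto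
  also have "\<dots> = - L" by (simp add: \<tau>_def)
  finally have "2 * L + \<tau> * A < 0" using L by linarith
  then have "\<tau> * (2 * L + \<tau> * A) < 0" using \<tau> by (rule mult_pos_neg[rotated])
  then show False using assms[of \<tau>] by (simp add: power2_eq_square algebra_simps)
qed

section \<open>Propagation of zeros of the slice averages\<close>

context stable_solution_setting
begin

lemma rho_N_slice:
  assumes r: "0 < r"
  shows "continuous_on upper_half (\<lambda>p. rho r (fst p) * N p)"
    and "r \<le> norm y \<Longrightarrow> rho r (fst (y, x)) * N (y, x) = 0"
  using rho_zero[OF r] by (auto intro!: continuous_on_mult continuous_on_rho_fst cont_N)

lemma cont_J: "0 < r \<Longrightarrow> continuous_on {0<..} (J r)"
  unfolding J_def by (rule continuous_on_slice_integral[OF rho_N_slice])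

lemma J_nonneg:
  assumes "0 < r" "0 < x"
  shows "0 \<le> J r x"
  unfolding J_def slice_integral_def
proof (rule integral_nonneg)
  show "(\<lambda>y. rho r (fst (y, x)) * N (y, x)) integrable_on UNIV"
    by (rule integrable_on_UNIV_compact_support[OF continuous_on_slice[OF rho_N_slice(1) assms(2)] rho_N_slice(2)]) (use assms in auto)
qed (simp add: rho_nonneg N_nonneg)

text \<open>A continuous nonnegative integrand with integral 0 vanishes, and \<open>rho\<close> is
  positive inside its ball.\<close>

lemma J_eq_0_imp_N:
  assumes r: "0 < r" and x: "0 < x" and J: "J r x = 0" and y: "norm y < r"
  shows "N (y, x) = 0"
proof -
  let ?f = "\<lambda>y. rho r (fst (y, x)) * N (y, x)"
  obtain l m :: "real ^ 'n" where box: "ball 0 r \<subseteq> cbox l m" by (rule ball_subset_cbox)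
  have fc: "continuous_on S ?f" for S by (rule continuous_on_slice[OF rho_N_slice(1)[OF r] x])
  have "integral (cbox l m) ?f = 0"
    using integral_UNIV_eq_cbox[OF box rho_N_slice(2)[OF r]] J by (simp only: J_def slice_integral_def)
  then have i: "(?f has_integral 0) (cbox l m)"
    using integrable_integral[OF integrable_continuous[OF fc, of l m]] by (simp only:)
  have yb: "y \<in> ball 0 r" using y by simp
  have "ball 0 r \<subseteq> box l m" using interior_maximal[OF box open_ball] by simp
  then have "box l m \<noteq> {}" using yb by blast
  have "?f y = 0"
    by (rule has_integral_0_cbox_imp_0[OF fc _ i \<open>box l m \<noteq> {}\<close>]) (use yb box in \<open>auto simp: rho_nonneg N_nonneg\<close>)
  then show ?thesis using rho_pos[OF r y] by simp
qed

text \<open>The linear term in \<open>\<tau>\<close> of the limit inequality, with the cutoff energy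
  sent to 0. Because \<open>J r mid = 0\<close>, its flux terms are minus the averages at lo and hi
  divided by the resistances, while the Laplacian of \<open>rho\<close> and the zero-order term are
  controlled by multiples of the average itself. So the ends of the layer are compared with its
  interior.\<close>

lemma J_inequality:
  assumes order: "0 < lo" "lo < mid" "mid < hi" and r: "0 < r" and n0: "0 < n0" "r + hi \<le> 2 ^ n0"
    and C: "0 < C" "AE p in M. \<bar>g\<^sub>u (snd p) (u p) * (cutoff n0 p)\<^sup>2\<bar> * N p \<le> C * (cutoff n0 p)\<^sup>2 * N p"
    and m2: "\<And>x. lo \<le> x \<Longrightarrow> x \<le> hi \<Longrightarrow> \<mu> x \<le> m2"
    and J0: "J r mid = 0"
  shows "J r lo / resistance lo mid + J r hi / resistance mid hi
    \<le> (m2 * ((24 + 6 * real DIM(real ^ 'n))\<^sup>2 / (96 * r\<^sup>2)) + C) * integral {lo..hi} (J r)"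
proof -
  define K where "K = (24 + 6 * real DIM(real ^ 'n))\<^sup>2 / (96 * r\<^sup>2)"
  let ?\<psi> = "bump_test lo mid hi r" and ?\<Psi> = "bump_test_grad lo mid hi r"
  let ?t = "tent lo mid hi" and ?wt = "weight lo mid hi"
  \<comment> \<open>Frozen with the cutoff n0: on the support of the bump all later cutoffs equal 1
    too, so the coefficients do not change as n grows.\<close>
  define G where "G p = g\<^sub>u (snd p) (u p) * (cutoff n0 p)\<^sup>2" for p
  define \<Lambda> where "\<Lambda> = - (\<integral>p. ?wt (snd p) * (N p * rho_laplacian r (fst p)) \<partial>M)
      + (J r mid - J r lo) / resistance lo mid - (J r hi - J r mid) / resistance mid hi"
  have \<Lambda>: "(\<lambda>k. \<integral>p. \<mu> (snd p) * (dw (hk k) p \<bullet> ?\<Psi> p) \<partial>M) \<longlonglongrightarrow> \<Lambda>"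
    unfolding \<Lambda>_def by (rule gradient_pairing_tendsto[OF order r])
  have cp: "compatible (cutoff n) (cutoff_grad n) ?\<psi> ?\<Psi> (2 ^ (2 * n)) lo" if "n0 \<le> n" for n
  proof (rule compatible_bump[OF order r])
    show "0 < n" using that n0 by simp
    show "r + hi \<le> 2 ^ n" using order_trans[OF n0(2) power_increasing[OF that, of "2::real"]] by simp
  qed
  have one: "cutoff n p = 1" if "n0 \<le> n" "p \<in> upper_half" "?\<psi> p \<noteq> 0" for n p
    using cp[OF that(1)] that(2,3) unfolding compatible_def by blast
  have G: "integrable M G" unfolding G_def[abs_def] by (rule gu_cut_measurable[OF cut_cutoff[OF n0(1)]])
  have \<psi>: "0 \<le> ?\<psi> p" "?\<psi> p \<le> 1" for p
    unfolding bump_test_def[OF order] using rho_nonneg[of r "fst p"] rho_le_1[OF order r, of "fst p"] tent_range[OF order, of "snd p"]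
    by (auto intro: mult_le_one)
  have \<psi>c: "continuous_on upper_half ?\<psi>"
    unfolding bump_test_def[OF order, abs_def]
    by (intro continuous_on_mult continuous_on_rho_fst continuous_on_compose2[OF tent_continuous[OF order, of UNIV]] continuous_on_snd continuous_on_id subset_UNIV)
  obtain B where B: "0 < B" "\<And>p. p \<in> half_ball (r + hi) \<Longrightarrow> norm (F p) \<le> B" using F_bound by blast
  have N\<psi>: "\<bar>N p * ?\<psi> p\<bar> \<le> B" if p: "p \<in> upper_half" for p
  proof (cases "norm p < r + hi")
    case True
    then have "N p \<le> B" using B(2)[of p] p by (simp add: half_ball_def N_def)
    then have "N p * ?\<psi> p \<le> B * 1" using \<psi>[of p] N_nonneg[of p] B(1) by (intro mult_mono) auto
    then show ?thesis using \<psi>[of p] N_nonneg[of p] by simp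
  next
    case False
    then show ?thesis using bump_test_zero(1)[OF order r p] B(1) by simp
  qed
  have G1: "integrable M (\<lambda>p. G p * (N p * ?\<psi> p))"
  proof (rule Bochner_Integration.integrable_bound[OF integrable_mult_right[OF G, of B]])
    show "(\<lambda>p. G p * (N p * ?\<psi> p)) \<in> borel_measurable M"
      by (intro borel_measurable_times borel_measurable_integrable[OF G] continuous_on_upper_half_measurable cont_N \<psi>c)
    show "AE p in M. norm (G p * (N p * ?\<psi> p)) \<le> norm (B * G p)"
    proof (rule AE_I2)
      fix p :: "(real ^ 'n) \<times> real" assume "p \<in> space M"
      then have "\<bar>N p * ?\<psi> p\<bar> \<le> B" by (intro N\<psi>) simp
      from mult_left_mono[OF this abs_ge_zero[of "G p"]] show "norm (G p * (N p * ?\<psi> p)) \<le> norm (B * G p)"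
        using B(1) by (simp add: abs_mult mult.commute[of _ B])
    qed
  qed
  have G2: "integrable M (\<lambda>p. G p * (?\<psi> p)\<^sup>2)"
  proof (rule Bochner_Integration.integrable_bound[OF G])
    show "(\<lambda>p. G p * (?\<psi> p)\<^sup>2) \<in> borel_measurable M"
      by (intro borel_measurable_times borel_measurable_power borel_measurable_integrable[OF G] continuous_on_upper_half_measurable \<psi>c)
    show "AE p in M. norm (G p * (?\<psi> p)\<^sup>2) \<le> norm (G p)"
    proof (rule AE_I2)
      fix p :: "(real ^ 'n) \<times> real"
      have "(?\<psi> p)\<^sup>2 \<le> 1" using \<psi>[of p] by (intro power_le_one)
      from mult_left_mono[OF this abs_ge_zero[of "G p"]] show "norm (G p * (?\<psi> p)\<^sup>2) \<le> norm (G p)" by (simp add: abs_mult)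
    qed
  qed
  define A1 where "A1 = (\<integral>p. G p * (N p * ?\<psi> p) \<partial>M)"
  define A where "A = (\<integral>p. \<mu> (snd p) * (norm (?\<Psi> p))\<^sup>2 \<partial>M) + (\<integral>p. G p * (?\<psi> p)\<^sup>2 \<partial>M)"
  \<comment> \<open>For each \<open>\<tau>\<close> the term 512 \<open>C\<^sub>o\<close> / n is
    removed by letting n tend to infinity; the polynomial in \<open>\<tau>\<close> does not depend
    on n.\<close>
  have "0 \<le> 2 * \<tau> * (\<Lambda> + A1) + \<tau>\<^sup>2 * A" for \<tau>
  proof -
    obtain n1 where n1: "C\<^sub>o < 2 ^ n1" using real_arch_pow[of 2 "C\<^sub>o"] by auto
    have le: "0 \<le> 512 * C\<^sub>o / real n + (2 * \<tau> * (\<Lambda> + A1) + \<tau>\<^sup>2 * A)" if n: "max n0 n1 \<le> n" for n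
    proof -
      have n': "n0 \<le> n" "0 < n" using n n0 by auto
      have Cn: "C\<^sub>o \<le> 2 ^ n" using order_trans[OF less_imp_le[OF n1] power_increasing[of n1 n "2::real"]] n by simp
      have "(\<integral>p. g\<^sub>u (snd p) (u p) * (cutoff n p)\<^sup>2 * (2 * \<tau> * N p * ?\<psi> p + \<tau>\<^sup>2 * (?\<psi> p)\<^sup>2) \<partial>M)
          = (\<integral>p. 2 * \<tau> * (G p * (N p * ?\<psi> p)) + \<tau>\<^sup>2 * (G p * (?\<psi> p)\<^sup>2) \<partial>M)"
      proof (rule Bochner_Integration.integral_cong[OF refl])
        fix p :: "(real ^ 'n) \<times> real" assume "p \<in> space M"
        then have p: "p \<in> upper_half" by simp
        show "g\<^sub>u (snd p) (u p) * (cutoff n p)\<^sup>2 * (2 * \<tau> * N p * ?\<psi> p + \<tau>\<^sup>2 * (?\<psi> p)\<^sup>2)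
            = 2 * \<tau> * (G p * (N p * ?\<psi> p)) + \<tau>\<^sup>2 * (G p * (?\<psi> p)\<^sup>2)"
        proof (cases "?\<psi> p = 0")
          case False
          then show ?thesis using one[OF n'(1) p] one[OF order.refl p] by (simp add: G_def algebra_simps)
        qed simp
      qed
      also have "\<dots> = 2 * \<tau> * A1 + \<tau>\<^sup>2 * (\<integral>p. G p * (?\<psi> p)\<^sup>2 \<partial>M)" using G1 G2 by (simp add: A1_def)
      finally show ?thesis
        using limit_inequality(1)[OF cp[OF n'(1)] \<Lambda>, of \<tau>] cutoff_energy[OF n'(2) Cn] by (simp add: A_def algebra_simps)
    qed
    have "(\<lambda>n. 512 * C\<^sub>o / real n + (2 * \<tau> * (\<Lambda> + A1) + \<tau>\<^sup>2 * A)) \<longlonglongrightarrow> 0 + (2 * \<tau> * (\<Lambda> + A1) + \<tau>\<^sup>2 * A)"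
      by (intro tendsto_add tendsto_const real_tendsto_divide_at_top[OF tendsto_const] filterlim_real_sequentially)
    from LIMSEQ_le_const[OF this] le have "0 \<le> 0 + (2 * \<tau> * (\<Lambda> + A1) + \<tau>\<^sup>2 * A)" by blast
    then show ?thesis by simp
  qed
  then have L: "0 \<le> \<Lambda> + A1" by (rule nonneg_of_quadratic)
  let ?I = "\<integral>p. ?t (snd p) * (rho r (fst p) * N p) \<partial>M"
  have m2': "0 \<le> m2" using m2[of mid] mu_pos[of mid] order by simp
  have K0: "0 \<le> K" unfolding K_def by simp
  note tf = weight_fubini[OF order rho_N_slice[OF r]]
  have "A1 \<le> (\<integral>p. C * (?t (snd p) * (rho r (fst p) * N p)) \<partial>M)"
    unfolding A1_def
  proof (rule integral_mono_AE[OF G1 integrable_mult_right[OF tf(3)]])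
    show "AE p in M. G p * (N p * ?\<psi> p) \<le> C * (?t (snd p) * (rho r (fst p) * N p))"
      using C(2)
    proof eventually_elim
      case (elim p)
      have "(cutoff n0 p)\<^sup>2 \<le> 1" using cutoff_nonneg cutoff_le_1 by (rule power_le_one)
      then have "(cutoff n0 p)\<^sup>2 * (C * N p) \<le> 1 * (C * N p)" using C(1) N_nonneg[of p] by (intro mult_right_mono) auto
      then have "C * (cutoff n0 p)\<^sup>2 * N p \<le> C * N p" by (simp add: mult_ac)
      moreover have "G p * N p \<le> \<bar>G p\<bar> * N p" using N_nonneg[of p] by (intro mult_right_mono) auto
      moreover have "\<bar>G p\<bar> * N p \<le> C * (cutoff n0 p)\<^sup>2 * N p" using elim by (simp only: G_def)
      ultimately have "G p * N p \<le> C * N p" by linarith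
      then have "G p * N p * ?\<psi> p \<le> C * N p * ?\<psi> p" using \<psi>(1) by (rule mult_right_mono)
      then show ?case by (simp add: bump_test_def[OF order] mult_ac)
    qed
  qed
  then have A1: "A1 \<le> C * ?I" by simp
  have "(\<integral>p. - (?wt (snd p) * (N p * rho_laplacian r (fst p))) \<partial>M) \<le> (\<integral>p. (m2 * K) * (?t (snd p) * (rho r (fst p) * N p)) \<partial>M)"
  proof (rule integral_mono_AE[OF _ integrable_mult_right[OF tf(3)]])
    have lc: "continuous_on upper_half (\<lambda>p. N p * rho_laplacian r (fst p))"
      unfolding rho_laplacian_def by (intro continuous_on_mult cont_N continuous_on_sum continuous_on_rho_fst)
    have l0: "N (y, x) * rho_laplacian r (fst (y, x)) = 0" if "r \<le> norm y" for y x
      using rho_zero[OF r that] by (simp add: rho_laplacian_def)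
    show "integrable M (\<lambda>p. - (?wt (snd p) * (N p * rho_laplacian r (fst p))))"
      by (intro Bochner_Integration.integrable_minus weight_fubini(1)[OF order lc l0])
    show "AE p in M. - (?wt (snd p) * (N p * rho_laplacian r (fst p))) \<le> (m2 * K) * (?t (snd p) * (rho r (fst p) * N p))"
    proof (rule AE_I2)
      fix p :: "(real ^ 'n) \<times> real"
      have "- rho_laplacian r (fst p) \<le> K * rho r (fst p)"
        using laplacian_rho_ge[OF r, of "fst p"] by (simp add: K_def rho_laplacian_def)
      then have "?wt (snd p) * N p * - rho_laplacian r (fst p) \<le> ?wt (snd p) * N p * (K * rho r (fst p))"
        using weight_nonneg[OF order, of "snd p"] N_nonneg[of p] by (intro mult_left_mono) auto
      also have "\<dots> = ?wt (snd p) * (N p * (K * rho r (fst p)))" by simp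
      also have "\<dots> \<le> (m2 * ?t (snd p)) * (N p * (K * rho r (fst p)))"
        using weight_le[OF order m2, of "snd p"] N_nonneg[of p] K0 rho_nonneg[of r "fst p"] by (intro mult_right_mono mult_nonneg_nonneg) auto
      finally show "- (?wt (snd p) * (N p * rho_laplacian r (fst p))) \<le> (m2 * K) * (?t (snd p) * (rho r (fst p) * N p))"
        by (simp add: mult_ac)
    qed
  qed
  then have A2: "- (\<integral>p. ?wt (snd p) * (N p * rho_laplacian r (fst p)) \<partial>M) \<le> m2 * K * ?I" by simp
  have "?I = (\<integral>x. ?t x * J r x \<partial>lebesgue)" unfolding J_def by (rule tf(4))
  also have "\<dots> \<le> (\<integral>x. indicat_real {lo..hi} x * J r x \<partial>lebesgue)"
  proof (rule integral_mono')
    have "continuous_on {lo..hi} (J r)" by (rule continuous_on_subset[OF cont_J[OF r]]) (use order in auto)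
    then have ai: "J r absolutely_integrable_on {lo..hi}" using absolutely_integrable_continuous[of lo hi "J r"] by simp
    then show "integrable lebesgue (\<lambda>x. indicat_real {lo..hi} x * J r x)" by (simp add: set_integrable_def)
    show "?t x * J r x \<le> indicat_real {lo..hi} x * J r x" for x
    proof (cases "x \<in> {lo..hi}")
      case True
      then show ?thesis using J_nonneg[OF r, of x] tent_range[OF order, of x] order(1) by (simp add: mult_left_le_one_le)
    qed (simp add: tent_outside[OF order])
    show "0 \<le> indicat_real {lo..hi} x * J r x" for x
      using J_nonneg[OF r, of x] order(1) by (cases "x \<in> {lo..hi}") auto
  qed
  also have "\<dots> = integral {lo..hi} (J r)"
  proof -
    have "continuous_on {lo..hi} (J r)" by (rule continuous_on_subset[OF cont_J[OF r]]) (use order in auto)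
    then have "J r absolutely_integrable_on {lo..hi}" using absolutely_integrable_continuous[of lo hi "J r"] by simp
    from set_lebesgue_integral_eq_integral(2)[OF this] show ?thesis by (simp add: set_lebesgue_integral_def)
  qed
  finally have "(m2 * K + C) * ?I \<le> (m2 * K + C) * integral {lo..hi} (J r)"
    using m2' K0 C(1) by (intro mult_left_mono) auto
  moreover have "J r lo / resistance lo mid + J r hi / resistance mid hi \<le> (m2 * K + C) * ?I"
    using L A1 A2 J0 unfolding \<Lambda>_def by (simp add: algebra_simps)
  ultimately show ?thesis by (simp add: K_def)
qed

text \<open>A strong maximum principle by scaling. Let z maximize J near mid and place the ends of
  the layer at distance t = |z - mid|, so that z is one of them. The flux terms are at least J(z) m1
  / t, the right side is at most 2 t D J(z), hence J(z) \<le> (2 D t^2 / m1) J(z), which forces J(z)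
  = 0 when t is small.\<close>

lemma J_zero_nearby:
  assumes r: "0 < r" and mid: "0 < mid" and J0: "J r mid = 0"
  obtains \<delta> where "0 < \<delta>" "\<And>x. \<bar>x - mid\<bar> \<le> \<delta> \<Longrightarrow> J r x = 0"
proof -
  obtain m1 m2 where m: "0 < m1" "\<And>x. mid / 2 \<le> x \<Longrightarrow> x \<le> 2 * mid \<Longrightarrow> m1 \<le> \<mu> x \<and> \<mu> x \<le> m2"
    by (rule mu_bounds[of "mid / 2" "2 * mid"]) (use mid that in auto)
  obtain n where n: "r + 2 * mid < 2 ^ n" using real_arch_pow[of 2 "r + 2 * mid"] by auto
  \<comment> \<open>One cutoff index for all layers inside [mid / 2, 2 mid], so that C and D do not
    depend on t. The successor makes it positive.\<close>
  define n0 where "n0 = Suc n"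
  have n0: "0 < n0" "r + 2 * mid \<le> 2 ^ n0" using n r mid by (auto simp: n0_def)
  obtain C where C: "0 < C" "AE p in M. \<bar>g\<^sub>u (snd p) (u p) * (cutoff n0 p)\<^sup>2\<bar> * N p \<le> C * (cutoff n0 p)\<^sup>2 * N p"
    using gu_bound[OF cut_cutoff[OF n0(1)]] by blast
  define D where "D = m2 * ((24 + 6 * real DIM(real ^ 'n))\<^sup>2 / (96 * r\<^sup>2)) + C"
  have "0 < m2" using m(1) m(2)[of mid] mid by linarith
  then have D: "0 < D" using C(1) unfolding D_def by (intro add_nonneg_pos) auto
  \<comment> \<open>mid / 2 keeps the layer where \<open>\<mu>\<close> lies between m1 and m2; the
    other two bounds give t^2 \<le> m1 / (4 D), hence a factor 2 D t^2 / m1 of at most 1/2.\<close>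
  define \<delta> where "\<delta> = min (mid / 2) (min 1 (m1 / (4 * D)))"
  have \<delta>: "0 < \<delta>" "\<delta> \<le> mid / 2" "\<delta> \<le> 1" "\<delta> \<le> m1 / (4 * D)" using mid m(1) D by (auto simp: \<delta>_def)
  have Jc: "continuous_on {mid - \<delta>..mid + \<delta>} (J r)"
    by (rule continuous_on_subset[OF cont_J[OF r]]) (use \<delta> mid in auto)
  obtain z where z: "z \<in> {mid - \<delta>..mid + \<delta>}" "\<And>x. x \<in> {mid - \<delta>..mid + \<delta>} \<Longrightarrow> J r x \<le> J r z"
    using continuous_attains_sup[OF compact_Icc _ Jc] \<delta>(1) by auto
  define t where "t = \<bar>z - mid\<bar>"
  have t\<delta>: "t \<le> \<delta>" using z(1) by (auto simp: t_def abs_le_iff)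
  have "J r z \<le> 0"
  proof (cases "t = 0")
    case True
    then show ?thesis using J0 by (simp add: t_def)
  next
    case False
    then have t: "0 < t" by (simp add: t_def)
    have order: "0 < mid - t" "mid - t < mid" "mid < mid + t" using t t\<delta> \<delta> mid by auto
    have in': "mid / 2 \<le> x \<and> x \<le> 2 * mid" if "mid - t \<le> x" "x \<le> mid + t" for x using that t\<delta> \<delta> mid by auto
    have m': "m1 \<le> \<mu> x \<and> \<mu> x \<le> m2" if "mid - t \<le> x" "x \<le> mid + t" for x using in'[OF that] by (intro m(2)) auto
    have n0': "r + (mid + t) \<le> 2 ^ n0" using n0(2) t\<delta> \<delta>(2) mid by linarith
    have "J r (mid - t) / resistance (mid - t) mid + J r (mid + t) / resistance mid (mid + t) \<le> D * integral {mid - t..mid + t} (J r)"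
      unfolding D_def by (rule J_inequality[OF order r n0(1) n0' C _ J0]) (use m' in blast)
    also have "integral {mid - t..mid + t} (J r) \<le> integral {mid - t..mid + t} (\<lambda>_. J r z)"
    proof (rule integral_le)
      show "J r integrable_on {mid - t..mid + t}"
        by (rule integrable_continuous_interval, rule continuous_on_subset[OF Jc]) (use t\<delta> in auto)
      show "J r x \<le> J r z" if "x \<in> {mid - t..mid + t}" for x using that t\<delta> by (intro z(2)) auto
    qed (rule integrable_const_ivl)
    also have "\<dots> = 2 * t * J r z" using t by simp
    finally have le: "J r (mid - t) / resistance (mid - t) mid + J r (mid + t) / resistance mid (mid + t) \<le> D * (2 * t * J r z)"
      using D by (simp add: mult_left_mono)
    have R1: "0 < resistance (mid - t) mid" "resistance (mid - t) mid \<le> t / m1"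
      using resistance_bounds[OF order m(1), of "mid - t" mid m2] m' order t by auto
    have R2: "0 < resistance mid (mid + t)" "resistance mid (mid + t) \<le> t / m1"
      using resistance_bounds[OF order m(1), of mid "mid + t" m2] m' order t mid by auto
    have Jn: "0 \<le> J r (mid - t)" "0 \<le> J r (mid + t)" using order mid t by (auto intro!: J_nonneg r)
    have J1: "J r (mid - t) / (t / m1) \<le> J r (mid - t) / resistance (mid - t) mid"
      using R1 Jn by (intro divide_left_mono mult_pos_pos) (use t m(1) in auto)
    have J2: "J r (mid + t) / (t / m1) \<le> J r (mid + t) / resistance mid (mid + t)"
      using R2 Jn by (intro divide_left_mono mult_pos_pos) (use t m(1) in auto)
    have p: "0 \<le> J r (mid - t) / (t / m1)" "0 \<le> J r (mid + t) / (t / m1)" using Jn t m(1) by auto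
    have "z = mid - t \<or> z = mid + t" by (auto simp: t_def abs_if)
    then have "J r z / (t / m1) \<le> D * (2 * t * J r z)" using le J1 J2 p by auto
    then have "J r z / (t / m1) * (t / m1) \<le> D * (2 * t * J r z) * (t / m1)" using t m(1) by (intro mult_right_mono) auto
    then have le2: "J r z \<le> (2 * D * t * t / m1) * J r z" using t m(1) by (simp add: mult_ac)
    have "t * t \<le> \<delta> * 1" using t t\<delta> \<delta> by (intro mult_mono) auto
    then have "t * t \<le> m1 / (4 * D)" using \<delta>(4) by simp
    then have "2 * D / m1 * (t * t) \<le> 2 * D / m1 * (m1 / (4 * D))" using D m(1) by (intro mult_left_mono) auto
    then have half: "2 * D * t * t / m1 \<le> 1 / 2" using D m(1) by simp
    have "0 \<le> J r z" using z(1) \<delta> mid by (intro J_nonneg r) auto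
    from mult_right_mono[OF half this] le2 show ?thesis by linarith
  qed
  then have "J r x = 0" if "\<bar>x - mid\<bar> \<le> \<delta>" for x
  proof -
    assume z0: "J r z \<le> 0"
    have "x \<in> {mid - \<delta>..mid + \<delta>}" using that by (auto simp: abs_le_iff)
    then have "J r x \<le> 0" "0 < x" using z(2)[of x] z0 \<delta> mid by auto
    then show ?thesis using J_nonneg[OF r, of x] by simp
  qed
  then show thesis by (rule that[OF \<delta>(1)])
qed

text \<open>The heights at which J vanishes form a set that is closed by continuity and open by the
  previous lemma, and the half-line is connected. The radius places the given point inside the
  support of \<open>rho\<close>.\<close>

lemma gradient_dichotomy:
  assumes x0: "0 < x0" and zero: "\<And>y. F (y, x0) = 0" and p: "p \<in> upper_half"
  shows "F p = 0"
proof -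
  obtain y x where yx: "p = (y, x)" by (cases p)
  have x: "0 < x" using p by (simp add: yx upper_half_def)
  define r where "r = norm y + 1"
  have r: "0 < r" unfolding r_def by (intro add_nonneg_pos) auto
  define Z where "Z = {x \<in> {0<..}. J r x = 0}"
  have "openin (top_of_set {0<..}) Z"
    unfolding openin_contains_ball
  proof (intro conjI ballI)
    show "Z \<subseteq> {0<..}" by (auto simp: Z_def)
    fix c assume c: "c \<in> Z"
    then have c': "0 < c" "J r c = 0" by (auto simp: Z_def)
    obtain \<delta> where \<delta>: "0 < \<delta>" "\<And>x. \<bar>x - c\<bar> \<le> \<delta> \<Longrightarrow> J r x = 0"
      by (rule J_zero_nearby[OF r c'], rule that)
    have "ball c \<delta> \<inter> {0<..} \<subseteq> Z"
      by (auto simp: Z_def dist_real_def abs_minus_commute intro!: \<delta>(2))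
    then show "\<exists>e>0. ball c e \<inter> {0<..} \<subseteq> Z" using \<delta>(1) by blast
  qed
  moreover have "closedin (top_of_set {0<..}) Z"
    unfolding Z_def using continuous_closedin_preimage_constant[OF cont_J[OF r], of 0] by simp
  moreover have "connected {0::real<..}" by (intro convex_connected convex_real_interval)
  ultimately have "Z = {} \<or> Z = {0<..}" by (simp add: connected_clopen)
  moreover have "J r x0 = 0" by (simp add: J_def slice_integral_def N_def zero)
  then have "x0 \<in> Z" using x0 by (simp add: Z_def)
  ultimately have "x \<in> Z" using x by auto
  then have "J r x = 0" by (simp add: Z_def)
  from J_eq_0_imp_N[OF r x this, of y] show ?thesis by (simp add: r_def N_def yx)
qed

lemma rank_one: "rank_one_gradient u D1 D2"
  by unfold_locales (rule grad_u deriv_D1 rank_one_D2; assumption)+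

end

theorem theorem11:
  fixes \<mu> f f' :: "real \<Rightarrow> real"
    and g g\<^sub>u :: "real \<Rightarrow> real \<Rightarrow> real"
    and u :: "(real ^ 'n::finite) \<times> real \<Rightarrow> real"
    and C\<^sub>o :: real
  assumes "structural TYPE('n) \<mu> g f"
    and "\<And>x. x > 0 \<Longrightarrow> AE t in lebesgue. (g x has_real_derivative g\<^sub>u x t) (at t)"
    and "AE t in lebesgue. (f has_real_derivative f' t) (at t)"
    and "C2_on upper_half u"
    and "bounded (u ` upper_half)"
    and "weak_solution \<mu> g f u"
    and "stable_solution \<mu> g\<^sub>u f' u"
    and "\<And>r. r > 0 \<Longrightarrow> Linfty_on (half_ball r) (\<lambda>p. norm (grad_y u p))"
    and "C\<^sub>o \<ge> 1"
    and "\<And>R. R \<ge> C\<^sub>o \<Longrightarrow>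
      (LINT p:half_ball R|lebesgue. \<mu> (snd p) * (norm (grad u p))\<^sup>2) \<le> C\<^sub>o * R\<^sup>2"
  shows "\<exists>\<omega>::real ^ 'n. \<omega> \<in> sphere 0 1 \<and>
    (\<exists>u\<^sub>o :: real \<Rightarrow> real \<Rightarrow> real. \<forall>y x. x > 0 \<longrightarrow> u (y, x) = u\<^sub>o (\<omega> \<bullet> y) x)"
proof -
  obtain D1 D2 where D: "\<And>p. p \<in> upper_half \<Longrightarrow> GDERIV u p :> D1 p"
      "\<And>p. p \<in> upper_half \<Longrightarrow> (D1 has_derivative blinfun_apply (D2 p)) (at p)" "continuous_on upper_half D2"
    using assms(4) unfolding C2_on_def by fast
  interpret stable_solution_setting \<mu> f f' g g\<^sub>u u C\<^sub>o D1 D2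
    by (unfold_locales; rule assms D; assumption)
  show ?thesis
    by (rule rank_one_gradient.one_dimensional[OF rank_one]) (intro ballI, rule gradient_dichotomy)
qed

end
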